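(* Let $\mathcal{P}$ be a filtered poset and $R$ be a unital commutative ring. (1) Given a functor $F\colon \mathcal{P}^{\mathrm{op}}\to R\text{-Mod}$, we have $$H^*(\mathcal{P};F)=H^*\big(\lim_{\mathcal{P}}\mathbf{R}F\big),$$ where $\mathbf{R}F\colon \mathcal{P}^{\mathrm{op}}\to \mathrm{Ch}(R)$ is a fibrant replacement of $F$ in $\mathrm{Fun}(\mathcal{P}^{\mathrm{op}},\mathrm{Ch}(R))$. (2) Given a functor $F\colon \mathcal{P}\to R\text{-Mod}$, we have $$H_*(\mathcal{P};F)=H_*\big(\mathrm{colim}_{\mathcal{P}}\,\mathbf{Q}F\big),$$ where $\mathbf{Q}F\colon \mathcal{P}\to \mathrm{Ch}(R)$ is a cofibrant replacement of $F$ in $\mathrm{Fun}(\mathcal{P},\mathrm{Ch}(R))$.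
   Context: A poset $\mathcal{P}$ is viewed as a category with a unique arrow $p\to q$ iff $p\le q$. It is filtered if there is a strictly order-preserving map $d\colon\mathcal{P}\to\mathbb{N}$. Write $\mathcal{P}_{<p}=\{q\in\mathcal{P}\mid q<p\}$. $\mathrm{Ch}(R)$ is the category of unbounded cochain complexes of $R$-modules, with the convention $C_k=C^{-k}$. Functors to $R\text{-Mod}$ are regarded as functors to $\mathrm{Ch}(R)$ concentrated in degree $0$. For $F\colon\mathcal{P}^{\mathrm{op}}\to R\text{-Mod}$, $H^k(\mathcal{P};F)=\mathrm{R}^k\lim(F)$ is the $k$-th right derived functor of $\lim\colon\mathrm{Fun}(\mathcal{P}^{\mathrm{op}},R\text{-Mod})\to R\text{-Mod}$. For $F\colon\mathcal{P}\to R\text{-Mod}$, $H_k(\mathcal{P};F)=\mathrm{L}_k\mathrm{colim}(F)$ is the $k$-th left derived functor of $\mathrm{colim}\colon\mathrm{Fun}(\mathcal{P},R\text{-Mod})\to R\text{-Mod}$. $\mathrm{Fun}(\mathcal{P}^{\mathrm{op}},\mathrm{Ch}(R))$ carries the model structure in which $\eta\colon F\Rightarrow G$ is a weak equivalence iff every $\eta_p$ is a quasi-isomorphism, and a fibration iff for every $p$ the map $F(p)\to G(p)\times_{\lim_{\mathcal{P}_{<p}}G}\lim_{\mathcal{P}_{<p}}F$ is an epimorphism. Thus $F$ is fibrant iff $F(p)\to\lim_{\mathcal{P}_{<p}}F$ is an epimorphism for every $p$. A fibrant replacement of $F$ is a weak equivalence $F\Rightarrow\mathbf{R}F$ with $\mathbf{R}F$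 fibrant. $\mathrm{Fun}(\mathcal{P},\mathrm{Ch}(R))$ carries the model structure in which $\eta\colon F\Rightarrow G$ is a weak equivalence iff every $\eta_p$ is a quasi-isomorphism, and a cofibration iff for every $p$ the map $F(p)\sqcup_{\mathrm{colim}_{\mathcal{P}_{<p}}F}\mathrm{colim}_{\mathcal{P}_{<p}}G\to G(p)$ is a monomorphism. Thus $F$ is cofibrant iff $\mathrm{colim}_{\mathcal{P}_{<p}}F\to F(p)$ is a monomorphism for every $p$. A cofibrant replacement of $F$ is a weak equivalence $\mathbf{Q}F\Rightarrow F$ with $\mathbf{Q}F$ cofibrant. *)

theory Defs
  imports "HOL-Algebra.Module" "HOL-Algebra.AbelCoset" "HOL-Library.Equipollence"
begin

section \<open>Modules\<close>

definition module_hom ::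
  "('r, 'x) ring_scheme \<Rightarrow> ('r, 'a) module \<Rightarrow> ('r, 'b) module \<Rightarrow> ('a \<Rightarrow> 'b) set" where
  "module_hom R M N = {f \<in> carrier M \<rightarrow> carrier N.
     (\<forall>x\<in>carrier M. \<forall>y\<in>carrier M. f (x \<oplus>\<^bsub>M\<^esub> y) = f x \<oplus>\<^bsub>N\<^esub> f y) \<and>
     (\<forall>a\<in>carrier R. \<forall>x\<in>carrier M. f (a \<odot>\<^bsub>M\<^esub> x) = a \<odot>\<^bsub>N\<^esub> f x)}"

definition isomorphic_modules ::
  "('r, 'x) ring_scheme \<Rightarrow> ('r, 'a) module \<Rightarrow> ('r, 'b) module \<Rightarrow> bool" where
  "isomorphic_modules R M N \<longleftrightarrow>
     (\<exists>f\<in>module_hom R M N. bij_betw f (carrier M) (carrier N))"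

text \<open>The record type of modules extends that of rings, but the locale \<^locale>\<open>module\<close>
  ignores the fields \<^const>\<open>mult\<close> and \<^const>\<open>one\<close> of the module; they are left
  undefined in all constructions below.\<close>

definition quotient_module :: "('r, 'a) module \<Rightarrow> 'a set \<Rightarrow> ('r, 'a set) module" where
  "quotient_module M N =
     \<lparr>carrier = a_rcosets\<^bsub>M\<^esub> N, mult = undefined, one = undefined,
      zero = N, add = set_add M,
      smult = (\<lambda>a X. \<Union>x\<in>X. N +>\<^bsub>M\<^esub> (a \<odot>\<^bsub>M\<^esub> x))\<rparr>"


section \<open>Unbounded cochain complexes\<close>

record ('r, 'a) cochain_complex =
  obj :: "int \<Rightarrow> ('r, 'a) module"
  diff :: "int \<Rightarrow> 'a \<Rightarrow> 'a"

definition is_complex :: "('r, 'x) ring_scheme \<Rightarrow> ('r, 'a) cochain_complex \<Rightarrow> bool" where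
  "is_complex R C \<longleftrightarrow>
     (\<forall>n. module R (obj C n)) \<and>
     (\<forall>n. diff C n \<in> module_hom R (obj C n) (obj C (n + 1))) \<and>
     (\<forall>n. \<forall>x\<in>carrier (obj C n). diff C (n + 1) (diff C n x) = \<zero>\<^bsub>obj C (n + 2)\<^esub>)"

definition chain_map ::
  "('r, 'x) ring_scheme \<Rightarrow> ('r, 'a) cochain_complex \<Rightarrow> ('r, 'b) cochain_complex \<Rightarrow>
   (int \<Rightarrow> 'a \<Rightarrow> 'b) \<Rightarrow> bool" where
  "chain_map R C D f \<longleftrightarrow>
     (\<forall>n. f n \<in> module_hom R (obj C n) (obj D n)) \<and>
     (\<forall>n. \<forall>x\<in>carrier (obj C n). f (n + 1) (diff C n x) = diff D n (f n x))"

definition cocycles :: "('r, 'a) cochain_complex \<Rightarrow> int \<Rightarrow> 'a set" where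
  "cocycles C n = {x \<in> carrier (obj C n). diff C n x = \<zero>\<^bsub>obj C (n + 1)\<^esub>}"

definition coboundaries :: "('r, 'a) cochain_complex \<Rightarrow> int \<Rightarrow> 'a set" where
  "coboundaries C n = diff C (n - 1) ` carrier (obj C (n - 1))"

definition cohomology :: "('r, 'a) cochain_complex \<Rightarrow> int \<Rightarrow> ('r, 'a set) module" where
  "cohomology C n = quotient_module ((obj C n)\<lparr>carrier := cocycles C n\<rparr>) (coboundaries C n)"

text \<open>Convention \<open>C\<^sub>k = C\<^sup>-\<^sup>k\<close>.\<close>

definition homology :: "('r, 'a) cochain_complex \<Rightarrow> int \<Rightarrow> ('r, 'a set) module" where
  "homology C k = cohomology C (- k)"

text \<open>The map induced on cohomology by a chain map \<open>f\<close> into \<open>D\<close>: the class of \<open>x\<close> is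
  sent to the class of \<open>f n x\<close>.\<close>

definition cohomology_map ::
  "('r, 'b) cochain_complex \<Rightarrow> (int \<Rightarrow> 'a \<Rightarrow> 'b) \<Rightarrow> int \<Rightarrow> 'a set \<Rightarrow> 'b set" where
  "cohomology_map D f n X = (\<Union>x\<in>X. coboundaries D n +>\<^bsub>obj D n\<^esub> f n x)"

definition quasi_iso ::
  "('r, 'x) ring_scheme \<Rightarrow> ('r, 'a) cochain_complex \<Rightarrow> ('r, 'b) cochain_complex \<Rightarrow>
   (int \<Rightarrow> 'a \<Rightarrow> 'b) \<Rightarrow> bool" where
  "quasi_iso R C D f \<longleftrightarrow> chain_map R C D f \<and>
     (\<forall>n. bij_betw (cohomology_map D f n) (carrier (cohomology C n)) (carrier (cohomology D n)))"


section \<open>Functors on a poset\<close>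

text \<open>A poset is given by a set \<open>S\<close> and an order relation \<open>leq\<close>, with one arrow from \<open>p\<close>
  to \<open>q\<close> iff \<open>leq p q\<close>. The functors below are covariant on \<open>(S, leq)\<close>; for a subset \<open>P\<close> of
  a type of class \<^class>\<open>order\<close>, functors on \<open>P\<close> are those on \<open>(P, (\<le>))\<close> and functors on
  the opposite of \<open>P\<close> are those on \<open>(P, (\<ge>))\<close>. In both cases \<open>Mar F p q\<close> and
  \<open>Car G p q\<close> are maps from the value at \<open>p\<close> to the value at \<open>q\<close>.\<close>

record ('r, 'p, 'a) mod_functor =
  Mob :: "'p \<Rightarrow> ('r, 'a) module"
  Mar :: "'p \<Rightarrow> 'p \<Rightarrow> 'a \<Rightarrow> 'a"

record ('r, 'p, 'a) cx_functor =
  Cob :: "'p \<Rightarrow> ('r, 'a) cochain_complex"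
  Car :: "'p \<Rightarrow> 'p \<Rightarrow> int \<Rightarrow> 'a \<Rightarrow> 'a"

definition is_mod_functor ::
  "('r, 'x) ring_scheme \<Rightarrow> 'p set \<Rightarrow> ('p \<Rightarrow> 'p \<Rightarrow> bool) \<Rightarrow> ('r, 'p, 'a) mod_functor \<Rightarrow> bool" where
  "is_mod_functor R S leq F \<longleftrightarrow>
     (\<forall>p\<in>S. module R (Mob F p)) \<and>
     (\<forall>p\<in>S. \<forall>q\<in>S. leq p q \<longrightarrow> Mar F p q \<in> module_hom R (Mob F p) (Mob F q)) \<and>
     (\<forall>p\<in>S. \<forall>x\<in>carrier (Mob F p). Mar F p p x = x) \<and>
     (\<forall>p\<in>S. \<forall>q\<in>S. \<forall>s\<in>S. leq p q \<longrightarrow> leq q s \<longrightarrow>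
        (\<forall>x\<in>carrier (Mob F p). Mar F q s (Mar F p q x) = Mar F p s x))"

definition mod_nat ::
  "('r, 'x) ring_scheme \<Rightarrow> 'p set \<Rightarrow> ('p \<Rightarrow> 'p \<Rightarrow> bool) \<Rightarrow>
   ('r, 'p, 'a) mod_functor \<Rightarrow> ('r, 'p, 'b) mod_functor \<Rightarrow> ('p \<Rightarrow> 'a \<Rightarrow> 'b) \<Rightarrow> bool" where
  "mod_nat R S leq F G \<eta> \<longleftrightarrow>
     (\<forall>p\<in>S. \<eta> p \<in> module_hom R (Mob F p) (Mob G p)) \<and>
     (\<forall>p\<in>S. \<forall>q\<in>S. leq p q \<longrightarrow>
        (\<forall>x\<in>carrier (Mob F p). \<eta> q (Mar F p q x) = Mar G p q (\<eta> p x)))"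

definition degree_part :: "('r, 'p, 'a) cx_functor \<Rightarrow> int \<Rightarrow> ('r, 'p, 'a) mod_functor" where
  "degree_part G n = \<lparr>Mob = (\<lambda>p. obj (Cob G p) n), Mar = (\<lambda>p q. Car G p q n)\<rparr>"

definition is_cx_functor ::
  "('r, 'x) ring_scheme \<Rightarrow> 'p set \<Rightarrow> ('p \<Rightarrow> 'p \<Rightarrow> bool) \<Rightarrow> ('r, 'p, 'a) cx_functor \<Rightarrow> bool" where
  "is_cx_functor R S leq G \<longleftrightarrow>
     (\<forall>p\<in>S. is_complex R (Cob G p)) \<and>
     (\<forall>p\<in>S. \<forall>q\<in>S. leq p q \<longrightarrow> chain_map R (Cob G p) (Cob G q) (Car G p q)) \<and>
     (\<forall>n. is_mod_functor R S leq (degree_part G n))"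

definition cx_nat ::
  "('r, 'x) ring_scheme \<Rightarrow> 'p set \<Rightarrow> ('p \<Rightarrow> 'p \<Rightarrow> bool) \<Rightarrow>
   ('r, 'p, 'a) cx_functor \<Rightarrow> ('r, 'p, 'b) cx_functor \<Rightarrow> ('p \<Rightarrow> int \<Rightarrow> 'a \<Rightarrow> 'b) \<Rightarrow> bool" where
  "cx_nat R S leq F G \<eta> \<longleftrightarrow>
     (\<forall>p\<in>S. chain_map R (Cob F p) (Cob G p) (\<eta> p)) \<and>
     (\<forall>n. mod_nat R S leq (degree_part F n) (degree_part G n) (\<lambda>p. \<eta> p n))"

text \<open>A functor to modules, regarded as a functor to complexes concentrated in degree 0.\<close>

definition concentrated :: "('r, 'p, 'a) mod_functor \<Rightarrow> ('r, 'p, 'a) cx_functor" where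
  "concentrated F =
     \<lparr>Cob = (\<lambda>p. \<lparr>obj = (\<lambda>n. if n = 0 then Mob F p
                              else (Mob F p)\<lparr>carrier := {\<zero>\<^bsub>Mob F p\<^esub>}\<rparr>),
                   diff = (\<lambda>n x. \<zero>\<^bsub>Mob F p\<^esub>)\<rparr>),
      Car = (\<lambda>p q n. Mar F p q)\<rparr>"


section \<open>Limits and colimits\<close>

text \<open>The limit is the module of compatible families in the product.\<close>

definition lim_mod ::
  "'p set \<Rightarrow> ('p \<Rightarrow> 'p \<Rightarrow> bool) \<Rightarrow> ('r, 'p, 'a) mod_functor \<Rightarrow> ('r, 'p \<Rightarrow> 'a) module" where
  "lim_mod S leq F =
     \<lparr>carrier = {x \<in> (\<Pi>\<^sub>E p\<in>S. carrier (Mob F p)).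
                   \<forall>p\<in>S. \<forall>q\<in>S. leq p q \<longrightarrow> Mar F p q (x p) = x q},
      mult = undefined, one = undefined,
      zero = (\<lambda>p\<in>S. \<zero>\<^bsub>Mob F p\<^esub>),
      add = (\<lambda>x y. \<lambda>p\<in>S. x p \<oplus>\<^bsub>Mob F p\<^esub> y p),
      smult = (\<lambda>a x. \<lambda>p\<in>S. a \<odot>\<^bsub>Mob F p\<^esub> x p)\<rparr>"

definition lim_cx ::
  "'p set \<Rightarrow> ('p \<Rightarrow> 'p \<Rightarrow> bool) \<Rightarrow> ('r, 'p, 'a) cx_functor \<Rightarrow> ('r, 'p \<Rightarrow> 'a) cochain_complex"
  where
  "lim_cx S leq G =
     \<lparr>obj = (\<lambda>n. lim_mod S leq (degree_part G n)),
      diff = (\<lambda>n x. \<lambda>p\<in>S. diff (Cob G p) n (x p))\<rparr>"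

text \<open>The colimit is the quotient of the direct sum by the submodule generated by the
  elements \<open>\<iota>\<^sub>p x - \<iota>\<^sub>q (F(p \<rightarrow> q) x)\<close>.\<close>

definition direct_sum :: "'p set \<Rightarrow> ('r, 'p, 'a) mod_functor \<Rightarrow> ('r, 'p \<Rightarrow> 'a) module" where
  "direct_sum S F =
     \<lparr>carrier = {x \<in> (\<Pi>\<^sub>E p\<in>S. carrier (Mob F p)). finite {p\<in>S. x p \<noteq> \<zero>\<^bsub>Mob F p\<^esub>}},
      mult = undefined, one = undefined,
      zero = (\<lambda>p\<in>S. \<zero>\<^bsub>Mob F p\<^esub>),
      add = (\<lambda>x y. \<lambda>p\<in>S. x p \<oplus>\<^bsub>Mob F p\<^esub> y p),
      smult = (\<lambda>a x. \<lambda>p\<in>S. a \<odot>\<^bsub>Mob F p\<^esub> x p)\<rparr>"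

definition sum_incl :: "'p set \<Rightarrow> ('r, 'p, 'a) mod_functor \<Rightarrow> 'p \<Rightarrow> 'a \<Rightarrow> 'p \<Rightarrow> 'a" where
  "sum_incl S F p x = (\<lambda>q\<in>S. if q = p then x else \<zero>\<^bsub>Mob F q\<^esub>)"

definition colim_relations ::
  "('r, 'x) ring_scheme \<Rightarrow> 'p set \<Rightarrow> ('p \<Rightarrow> 'p \<Rightarrow> bool) \<Rightarrow> ('r, 'p, 'a) mod_functor \<Rightarrow>
   ('p \<Rightarrow> 'a) set" where
  "colim_relations R S leq F =
     \<Inter>{N. submodule N R (direct_sum S F) \<and>
          (\<forall>p\<in>S. \<forall>q\<in>S. leq p q \<longrightarrow> (\<forall>x\<in>carrier (Mob F p).
             sum_incl S F p x \<ominus>\<^bsub>direct_sum S F\<^esub> sum_incl S F q (Mar F p q x) \<in> N))}"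

definition colim_mod ::
  "('r, 'x) ring_scheme \<Rightarrow> 'p set \<Rightarrow> ('p \<Rightarrow> 'p \<Rightarrow> bool) \<Rightarrow> ('r, 'p, 'a) mod_functor \<Rightarrow>
   ('r, ('p \<Rightarrow> 'a) set) module" where
  "colim_mod R S leq F = quotient_module (direct_sum S F) (colim_relations R S leq F)"

definition colim_cx ::
  "('r, 'x) ring_scheme \<Rightarrow> 'p set \<Rightarrow> ('p \<Rightarrow> 'p \<Rightarrow> bool) \<Rightarrow> ('r, 'p, 'a) cx_functor \<Rightarrow>
   ('r, ('p \<Rightarrow> 'a) set) cochain_complex" where
  "colim_cx R S leq G =
     \<lparr>obj = (\<lambda>n. colim_mod R S leq (degree_part G n)),
      diff = (\<lambda>n X. \<Union>x\<in>X. colim_relations R S leq (degree_part G (n + 1))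
                +>\<^bsub>direct_sum S (degree_part G (n + 1))\<^esub> (\<lambda>p\<in>S. diff (Cob G p) n (x p)))\<rparr>"


section \<open>Derived functors of the limit and the colimit\<close>

text \<open>Injectivity and projectivity can only be tested against functors with values in modules
  carried by subsets of one fixed type, the universe. If this type is large in the following
  sense, then nothing is lost. The representable functors and their subfunctors are available
  as test objects, so by Baer's criterion an object that is injective in the universe is
  injective with respect to all functors; and every functor in the universe is a quotient, in
  the universe, of a direct sum of corepresentable functors, so an object that is projective
  in the universe is a retract of such a sum. Projective resolutions exist in every large
  universe containing the values of the functor; injective resolutions exist, by a cardinality
  bound on injective hulls, for instance in \<open>('r + 'p + nat + 'a) set\<close> for functors with
  values in \<open>'a\<close>.\<close>

definition large_universe :: "('r, 'x) ring_scheme \<Rightarrow> 'p set \<Rightarrow> 'u itself \<Rightarrow> bool" where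
  "large_universe R S (_ :: 'u itself) \<longleftrightarrow>
     infinite (UNIV :: 'u set) \<and> carrier R \<lesssim> (UNIV :: 'u set) \<and> S \<lesssim> (UNIV :: 'u set)"

definition injective_functor ::
  "('r, 'x) ring_scheme \<Rightarrow> 'p set \<Rightarrow> ('p \<Rightarrow> 'p \<Rightarrow> bool) \<Rightarrow> ('r, 'p, 'u) mod_functor \<Rightarrow> bool" where
  "injective_functor R S leq J \<longleftrightarrow>
     large_universe R S TYPE('u) \<and> is_mod_functor R S leq J \<and>
     (\<forall>(A :: ('r, 'p, 'u) mod_functor) (B :: ('r, 'p, 'u) mod_functor) \<iota> \<phi>.
        is_mod_functor R S leq A \<and> is_mod_functor R S leq B \<and>
        mod_nat R S leq A B \<iota> \<and> (\<forall>p\<in>S. inj_on (\<iota> p) (carrier (Mob A p))) \<and>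
        mod_nat R S leq A J \<phi> \<longrightarrow>
        (\<exists>\<psi>. mod_nat R S leq B J \<psi> \<and> (\<forall>p\<in>S. \<forall>x\<in>carrier (Mob A p). \<psi> p (\<iota> p x) = \<phi> p x)))"

definition projective_functor ::
  "('r, 'x) ring_scheme \<Rightarrow> 'p set \<Rightarrow> ('p \<Rightarrow> 'p \<Rightarrow> bool) \<Rightarrow> ('r, 'p, 'u) mod_functor \<Rightarrow> bool" where
  "projective_functor R S leq Q \<longleftrightarrow>
     large_universe R S TYPE('u) \<and> is_mod_functor R S leq Q \<and>
     (\<forall>(A :: ('r, 'p, 'u) mod_functor) (B :: ('r, 'p, 'u) mod_functor) \<pi> \<phi>.
        is_mod_functor R S leq A \<and> is_mod_functor R S leq B \<and>
        mod_nat R S leq A B \<pi> \<and> (\<forall>p\<in>S. \<pi> p ` carrier (Mob A p) = carrier (Mob B p)) \<and>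
        mod_nat R S leq Q B \<phi> \<longrightarrow>
        (\<exists>\<psi>. mod_nat R S leq Q A \<psi> \<and> (\<forall>p\<in>S. \<forall>x\<in>carrier (Mob Q p). \<pi> p (\<psi> p x) = \<phi> p x)))"

definition weak_equivalence ::
  "('r, 'x) ring_scheme \<Rightarrow> 'p set \<Rightarrow> ('p \<Rightarrow> 'p \<Rightarrow> bool) \<Rightarrow>
   ('r, 'p, 'a) cx_functor \<Rightarrow> ('r, 'p, 'b) cx_functor \<Rightarrow> ('p \<Rightarrow> int \<Rightarrow> 'a \<Rightarrow> 'b) \<Rightarrow> bool" where
  "weak_equivalence R S leq F G \<eta> \<longleftrightarrow>
     cx_nat R S leq F G \<eta> \<and> (\<forall>p\<in>S. quasi_iso R (Cob F p) (Cob G p) (\<eta> p))"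

text \<open>Resolutions are complexes in the functor category, that is, functors to complexes; an
  augmented complex \<open>F \<rightarrow> I\<^sup>0 \<rightarrow> I\<^sup>1 \<rightarrow> \<dots>\<close> is exact iff the augmentation is a
  quasi-isomorphism at every object. A projective resolution lives in cohomological degrees
  \<open>\<le> 0\<close>.\<close>

definition injective_resolution ::
  "('r, 'x) ring_scheme \<Rightarrow> 'p set \<Rightarrow> ('p \<Rightarrow> 'p \<Rightarrow> bool) \<Rightarrow>
   ('r, 'p, 'a) mod_functor \<Rightarrow> ('r, 'p, 'u) cx_functor \<Rightarrow> ('p \<Rightarrow> int \<Rightarrow> 'a \<Rightarrow> 'u) \<Rightarrow> bool" where
  "injective_resolution R S leq F I \<epsilon> \<longleftrightarrow>
     is_cx_functor R S leq I \<and>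
     (\<forall>n. injective_functor R S leq (degree_part I n)) \<and>
     (\<forall>n<0. \<forall>p\<in>S. carrier (obj (Cob I p) n) = {\<zero>\<^bsub>obj (Cob I p) n\<^esub>}) \<and>
     weak_equivalence R S leq (concentrated F) I \<epsilon>"

definition projective_resolution ::
  "('r, 'x) ring_scheme \<Rightarrow> 'p set \<Rightarrow> ('p \<Rightarrow> 'p \<Rightarrow> bool) \<Rightarrow>
   ('r, 'p, 'a) mod_functor \<Rightarrow> ('r, 'p, 'u) cx_functor \<Rightarrow> ('p \<Rightarrow> int \<Rightarrow> 'u \<Rightarrow> 'a) \<Rightarrow> bool" where
  "projective_resolution R S leq F Q \<epsilon> \<longleftrightarrow>
     is_cx_functor R S leq Q \<and>
     (\<forall>n. projective_functor R S leq (degree_part Q n)) \<and>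
     (\<forall>n>0. \<forall>p\<in>S. carrier (obj (Cob Q p) n) = {\<zero>\<^bsub>obj (Cob Q p) n\<^esub>}) \<and>
     weak_equivalence R S leq Q (concentrated F) \<epsilon>"

text \<open>The derived functors are determined up to isomorphism: \<open>H\<close> is a value of the \<open>k\<close>-th
  derived functor at \<open>F\<close> if it is computed by some resolution. The type of \<open>H\<close> records the
  universe the resolution lives in. In negative degrees \<open>H\<close> is the zero module.\<close>

definition is_right_derived_lim ::
  "('r, 'x) ring_scheme \<Rightarrow> 'p set \<Rightarrow> ('p \<Rightarrow> 'p \<Rightarrow> bool) \<Rightarrow>
   ('r, 'p, 'a) mod_functor \<Rightarrow> int \<Rightarrow> ('r, ('p \<Rightarrow> 'u) set) module \<Rightarrow> bool" where
  "is_right_derived_lim R S leq F k H \<longleftrightarrow>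
     (\<exists>I \<epsilon>. injective_resolution R S leq F I \<epsilon> \<and> H = cohomology (lim_cx S leq I) k)"

definition is_left_derived_colim ::
  "('r, 'x) ring_scheme \<Rightarrow> 'p set \<Rightarrow> ('p \<Rightarrow> 'p \<Rightarrow> bool) \<Rightarrow>
   ('r, 'p, 'a) mod_functor \<Rightarrow> int \<Rightarrow> ('r, ('p \<Rightarrow> 'u) set set) module \<Rightarrow> bool" where
  "is_left_derived_colim R S leq F k H \<longleftrightarrow>
     (\<exists>Q \<epsilon>. projective_resolution R S leq F Q \<epsilon> \<and> H = homology (colim_cx R S leq Q) k)"


section \<open>Filtered posets, fibrant and cofibrant replacements\<close>

definition filtered_poset :: "'p::order set \<Rightarrow> bool" where
  "filtered_poset P \<longleftrightarrow> (\<exists>d :: 'p \<Rightarrow> nat. strict_mono_on P d)"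

definition below :: "'p::order set \<Rightarrow> 'p \<Rightarrow> 'p set" where
  "below P p = {q \<in> P. q < p}"

definition matching_map ::
  "'p::order set \<Rightarrow> ('r, 'p, 'a) cx_functor \<Rightarrow> 'p \<Rightarrow> int \<Rightarrow> 'a \<Rightarrow> 'p \<Rightarrow> 'a" where
  "matching_map P G p n x = (\<lambda>q\<in>below P p. Car G p q n x)"

definition fibrant :: "('r, 'x) ring_scheme \<Rightarrow> 'p::order set \<Rightarrow> ('r, 'p, 'a) cx_functor \<Rightarrow> bool"
  where
  "fibrant R P G \<longleftrightarrow> is_cx_functor R P (\<ge>) G \<and>
     (\<forall>p\<in>P. \<forall>n. matching_map P G p n ` carrier (obj (Cob G p) n) =
                  carrier (obj (lim_cx (below P p) (\<ge>) G) n))"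

definition fibrant_replacement ::
  "('r, 'x) ring_scheme \<Rightarrow> 'p::order set \<Rightarrow> ('r, 'p, 'a) mod_functor \<Rightarrow>
   ('r, 'p, 'b) cx_functor \<Rightarrow> ('p \<Rightarrow> int \<Rightarrow> 'a \<Rightarrow> 'b) \<Rightarrow> bool" where
  "fibrant_replacement R P F RF \<eta> \<longleftrightarrow>
     fibrant R P RF \<and> weak_equivalence R P (\<ge>) (concentrated F) RF \<eta>"

text \<open>The canonical map from the colimit over \<open>P\<^sub><\<^sub>p\<close> to \<open>G(p)\<close>: the class of a finitely
  supported family \<open>x\<close> is sent to the sum of the images of the \<open>x q\<close>, which does not depend
  on the representative. The sum is restricted to the support because \<^const>\<open>finsum\<close> over
  an infinite index set is a default value.\<close>

definition latching_map ::
  "'p::order set \<Rightarrow> ('r, 'p, 'a) cx_functor \<Rightarrow> 'p \<Rightarrow> int \<Rightarrow> ('p \<Rightarrow> 'a) set \<Rightarrow> 'a" where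
  "latching_map P G p n X = the_elem
     ((\<lambda>x. \<Oplus>\<^bsub>obj (Cob G p) n\<^esub>q\<in>{q \<in> below P p. x q \<noteq> \<zero>\<^bsub>obj (Cob G q) n\<^esub>}.
              Car G q p n (x q)) ` X)"

definition cofibrant :: "('r, 'x) ring_scheme \<Rightarrow> 'p::order set \<Rightarrow> ('r, 'p, 'a) cx_functor \<Rightarrow> bool"
  where
  "cofibrant R P G \<longleftrightarrow> is_cx_functor R P (\<le>) G \<and>
     (\<forall>p\<in>P. \<forall>n. inj_on (latching_map P G p n)
                  (carrier (obj (colim_cx R (below P p) (\<le>) G) n)))"

definition cofibrant_replacement ::
  "('r, 'x) ring_scheme \<Rightarrow> 'p::order set \<Rightarrow> ('r, 'p, 'a) mod_functor \<Rightarrow>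
   ('r, 'p, 'b) cx_functor \<Rightarrow> ('p \<Rightarrow> int \<Rightarrow> 'b \<Rightarrow> 'a) \<Rightarrow> bool" where
  "cofibrant_replacement R P F QF \<eta> \<longleftrightarrow>
     cofibrant R P QF \<and> weak_equivalence R P (\<le>) QF (concentrated F) \<eta>"

end

theory Submission
  imports Complex_Main Defs
begin

text \<open>
  Each half compares the given replacement of \<open>F\<close> with a resolution by one natural chain map, and shows
  that the limit, respectively the colimit, turns this map into a quasi-isomorphism.

  \<^bold>\<open>Limits.\<close> Let \<open>RF\<close> be a fibrant replacement and \<open>I\<close> an injective resolution of \<open>F\<close>. Since the terms of
  \<open>I\<close> are injective, the identity of \<open>F\<close> extends degree by degree to a natural chain map \<open>RF \<rightarrow> I\<close>, which
  is a quasi-isomorphism at every object (\<open>map_into_injective_complex\<close>). Moreover \<open>I\<close> is fibrant: lifting a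
  compatible family below \<open>p\<close> to \<open>p\<close> is an extension problem for a subfunctor of the functor represented
  by \<open>p\<close> (\<open>baer_fibrant\<close>). It remains to see that \<open>lim\<close> respects weak equivalences between fibrant
  functors. The cone of such a map is again fibrant, and acyclic at every object, so this amounts to the
  acyclicity of the limit of such a functor (\<open>lim_fibrant_acyclic\<close>). There a primitive of a compatible
  family of cocycles is chosen by recursion along the order, which is well-founded because \<open>\<P>\<close> is
  filtered: fibrancy extends the primitives below \<open>p\<close> to \<open>p\<close>, and the error lies in the kernel of the
  matching map, which is acyclic by induction.

  \<^bold>\<open>Colimits.\<close> A projective resolution \<open>Q\<close> of \<open>F\<close> maps to a cofibrant replacement \<open>QF\<close> in the same way
  (\<open>map_from_projective_complex\<close>). The acyclicity of the colimit of the cone is not proved by a second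
  recursion but reduced to the case of limits by duality. Characters, here homomorphisms to the
  multiplicative group of \<open>\<complex>\<close>, extend from subgroups and separate points because that group is divisible
  and contains roots of unity. Hence duality preserves acyclicity. It turns colimits into limits, and it
  takes cofibrant functors and functors with projective terms to fibrant functors on the opposite poset
  (\<open>cofibrant_characters_extend\<close>, \<open>projective_characters_extend\<close>). So the dual of the cone has an acyclic
  limit, and a cocycle of the colimit that is not a coboundary would be detected by a character that
  contradicts this (\<open>colim_primitive\<close>).

  \<^bold>\<open>Universes.\<close> Injectivity and projectivity are only given with respect to functors with values in one
  type, while \<open>RF\<close> and \<open>QF\<close> have values in other types. For injective functors it suffices to extend from
  subfunctors of representable functors, which fit into the universe; the general case follows with Zorn's
  lemma (\<open>injective_baer\<close>, \<open>baer_extension\<close>). A lifting problem for a projective functor is first cut down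
  to a subfunctor that is small enough for the universe (\<open>projective_lifting\<close>).
\<close>

section \<open>Modules, submodules and quotients\<close>

text \<open>The locale of commutative rings with names for its type parameters, which the definitions below refer
  to.\<close>

locale cring_base = cring R for R :: "('r, 'x) ring_scheme" (structure)
begin

lemma module_abelian_group: "module R M \<Longrightarrow> abelian_group M"
  by (rule module.axioms)

text \<open>Most modules below come in families, as values of functors. They are treated by conditional rewriting
  with the hypothesis \<open>module R M\<close>, which applies to all members of a family at once.\<close>

lemma module_simps [simp]:
  assumes "module R M"
  shows "x \<in> carrier M \<Longrightarrow> y \<in> carrier M \<Longrightarrow> x \<oplus>\<^bsub>M\<^esub> y \<in> carrier M"
    "\<zero>\<^bsub>M\<^esub> \<in> carrier M"
    "x \<in> carrier M \<Longrightarrow> \<ominus>\<^bsub>M\<^esub> x \<in> carrier M"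
    "x \<in> carrier M \<Longrightarrow> y \<in> carrier M \<Longrightarrow> x \<ominus>\<^bsub>M\<^esub> y \<in> carrier M"
    "a \<in> carrier R \<Longrightarrow> x \<in> carrier M \<Longrightarrow> a \<odot>\<^bsub>M\<^esub> x \<in> carrier M"
    "x \<in> carrier M \<Longrightarrow> \<zero>\<^bsub>M\<^esub> \<oplus>\<^bsub>M\<^esub> x = x"
    "x \<in> carrier M \<Longrightarrow> x \<oplus>\<^bsub>M\<^esub> \<zero>\<^bsub>M\<^esub> = x"
    "x \<in> carrier M \<Longrightarrow> \<ominus>\<^bsub>M\<^esub> x \<oplus>\<^bsub>M\<^esub> x = \<zero>\<^bsub>M\<^esub>"
    "x \<in> carrier M \<Longrightarrow> x \<oplus>\<^bsub>M\<^esub> \<ominus>\<^bsub>M\<^esub> x = \<zero>\<^bsub>M\<^esub>"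
    "x \<in> carrier M \<Longrightarrow> \<ominus>\<^bsub>M\<^esub> (\<ominus>\<^bsub>M\<^esub> x) = x"
    "\<ominus>\<^bsub>M\<^esub> \<zero>\<^bsub>M\<^esub> = \<zero>\<^bsub>M\<^esub>"
    "x \<in> carrier M \<Longrightarrow> \<zero> \<odot>\<^bsub>M\<^esub> x = \<zero>\<^bsub>M\<^esub>"
    "a \<in> carrier R \<Longrightarrow> a \<odot>\<^bsub>M\<^esub> \<zero>\<^bsub>M\<^esub> = \<zero>\<^bsub>M\<^esub>"
    "x \<in> carrier M \<Longrightarrow> \<one> \<odot>\<^bsub>M\<^esub> x = x"
proof -
  interpret M: module R M by fact
  note M.l_neg [simp] M.r_neg [simp]
  show "\<ominus>\<^bsub>M\<^esub> \<zero>\<^bsub>M\<^esub> = \<zero>\<^bsub>M\<^esub>" by (simp add: a_inv_def)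
  show "x \<in> carrier M \<Longrightarrow> y \<in> carrier M \<Longrightarrow> x \<oplus>\<^bsub>M\<^esub> y \<in> carrier M"
    "\<zero>\<^bsub>M\<^esub> \<in> carrier M" "x \<in> carrier M \<Longrightarrow> \<zero>\<^bsub>M\<^esub> \<oplus>\<^bsub>M\<^esub> x = x"
    "x \<in> carrier M \<Longrightarrow> x \<oplus>\<^bsub>M\<^esub> \<zero>\<^bsub>M\<^esub> = x" by simp_all
qed (use assms in \<open>auto simp: module.smult_closed module.smult_l_null module.smult_r_null
    module.smult_one abelian_group.l_neg abelian_group.r_neg abelian_group.a_inv_closed
    abelian_group.minus_minus abelian_group.minus_closed dest!: module.axioms(2)\<close>)

lemma module_ac:
  assumes "module R M"
  shows "x \<in> carrier M \<Longrightarrow> y \<in> carrier M \<Longrightarrow> z \<in> carrier M \<Longrightarrow>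
      (x \<oplus>\<^bsub>M\<^esub> y) \<oplus>\<^bsub>M\<^esub> z = x \<oplus>\<^bsub>M\<^esub> (y \<oplus>\<^bsub>M\<^esub> z)"
    "x \<in> carrier M \<Longrightarrow> y \<in> carrier M \<Longrightarrow> x \<oplus>\<^bsub>M\<^esub> y = y \<oplus>\<^bsub>M\<^esub> x"
    "x \<in> carrier M \<Longrightarrow> y \<in> carrier M \<Longrightarrow> z \<in> carrier M \<Longrightarrow>
      x \<oplus>\<^bsub>M\<^esub> (y \<oplus>\<^bsub>M\<^esub> z) = y \<oplus>\<^bsub>M\<^esub> (x \<oplus>\<^bsub>M\<^esub> z)"
    "x \<in> carrier M \<Longrightarrow> y \<in> carrier M \<Longrightarrow> \<ominus>\<^bsub>M\<^esub> (x \<oplus>\<^bsub>M\<^esub> y) = \<ominus>\<^bsub>M\<^esub> x \<oplus>\<^bsub>M\<^esub> \<ominus>\<^bsub>M\<^esub> y"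
    "x \<in> carrier M \<Longrightarrow> y \<in> carrier M \<Longrightarrow> x \<oplus>\<^bsub>M\<^esub> (\<ominus>\<^bsub>M\<^esub> x \<oplus>\<^bsub>M\<^esub> y) = y"
    "x \<in> carrier M \<Longrightarrow> y \<in> carrier M \<Longrightarrow> \<ominus>\<^bsub>M\<^esub> x \<oplus>\<^bsub>M\<^esub> (x \<oplus>\<^bsub>M\<^esub> y) = y"
    "x \<in> carrier M \<Longrightarrow> y \<in> carrier M \<Longrightarrow> x \<oplus>\<^bsub>M\<^esub> (y \<oplus>\<^bsub>M\<^esub> \<ominus>\<^bsub>M\<^esub> x) = y"
    "x \<in> carrier M \<Longrightarrow> y \<in> carrier M \<Longrightarrow> \<ominus>\<^bsub>M\<^esub> x \<oplus>\<^bsub>M\<^esub> (y \<oplus>\<^bsub>M\<^esub> x) = y"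
    "x \<ominus>\<^bsub>M\<^esub> y = x \<oplus>\<^bsub>M\<^esub> \<ominus>\<^bsub>M\<^esub> y"
proof -
  interpret M: module R M by fact
  show "x \<in> carrier M \<Longrightarrow> y \<in> carrier M \<Longrightarrow> z \<in> carrier M \<Longrightarrow>
      (x \<oplus>\<^bsub>M\<^esub> y) \<oplus>\<^bsub>M\<^esub> z = x \<oplus>\<^bsub>M\<^esub> (y \<oplus>\<^bsub>M\<^esub> z)"
    "x \<in> carrier M \<Longrightarrow> y \<in> carrier M \<Longrightarrow> x \<oplus>\<^bsub>M\<^esub> y = y \<oplus>\<^bsub>M\<^esub> x"
    "x \<in> carrier M \<Longrightarrow> y \<in> carrier M \<Longrightarrow> z \<in> carrier M \<Longrightarrow>
      x \<oplus>\<^bsub>M\<^esub> (y \<oplus>\<^bsub>M\<^esub> z) = y \<oplus>\<^bsub>M\<^esub> (x \<oplus>\<^bsub>M\<^esub> z)" by (simp_all add: M.a_ac)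
  show "x \<in> carrier M \<Longrightarrow> y \<in> carrier M \<Longrightarrow> \<ominus>\<^bsub>M\<^esub> (x \<oplus>\<^bsub>M\<^esub> y) = \<ominus>\<^bsub>M\<^esub> x \<oplus>\<^bsub>M\<^esub> \<ominus>\<^bsub>M\<^esub> y"
    by (rule M.minus_add)
  show "x \<in> carrier M \<Longrightarrow> y \<in> carrier M \<Longrightarrow> x \<oplus>\<^bsub>M\<^esub> (\<ominus>\<^bsub>M\<^esub> x \<oplus>\<^bsub>M\<^esub> y) = y" by (rule M.r_neg2)
  show "x \<in> carrier M \<Longrightarrow> y \<in> carrier M \<Longrightarrow> \<ominus>\<^bsub>M\<^esub> x \<oplus>\<^bsub>M\<^esub> (x \<oplus>\<^bsub>M\<^esub> y) = y" by (rule M.r_neg1)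
  show "x \<in> carrier M \<Longrightarrow> y \<in> carrier M \<Longrightarrow> x \<oplus>\<^bsub>M\<^esub> (y \<oplus>\<^bsub>M\<^esub> \<ominus>\<^bsub>M\<^esub> x) = y"
    by (metis M.a_comm M.a_inv_closed M.r_neg2)
  show "x \<in> carrier M \<Longrightarrow> y \<in> carrier M \<Longrightarrow> \<ominus>\<^bsub>M\<^esub> x \<oplus>\<^bsub>M\<^esub> (y \<oplus>\<^bsub>M\<^esub> x) = y"
    by (metis M.a_comm M.r_neg1)
  show "x \<ominus>\<^bsub>M\<^esub> y = x \<oplus>\<^bsub>M\<^esub> \<ominus>\<^bsub>M\<^esub> y" by (rule M.minus_eq)
qed

lemma module_smult:
  assumes "module R M"
  shows "a \<in> carrier R \<Longrightarrow> x \<in> carrier M \<Longrightarrow> y \<in> carrier M \<Longrightarrow>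
      a \<odot>\<^bsub>M\<^esub> (x \<oplus>\<^bsub>M\<^esub> y) = a \<odot>\<^bsub>M\<^esub> x \<oplus>\<^bsub>M\<^esub> a \<odot>\<^bsub>M\<^esub> y"
    "a \<in> carrier R \<Longrightarrow> b \<in> carrier R \<Longrightarrow> x \<in> carrier M \<Longrightarrow>
      (a \<oplus> b) \<odot>\<^bsub>M\<^esub> x = a \<odot>\<^bsub>M\<^esub> x \<oplus>\<^bsub>M\<^esub> b \<odot>\<^bsub>M\<^esub> x"
    "a \<in> carrier R \<Longrightarrow> b \<in> carrier R \<Longrightarrow> x \<in> carrier M \<Longrightarrow>
      (a \<otimes> b) \<odot>\<^bsub>M\<^esub> x = a \<odot>\<^bsub>M\<^esub> (b \<odot>\<^bsub>M\<^esub> x)"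
    "a \<in> carrier R \<Longrightarrow> x \<in> carrier M \<Longrightarrow> a \<odot>\<^bsub>M\<^esub> (\<ominus>\<^bsub>M\<^esub> x) = \<ominus>\<^bsub>M\<^esub> (a \<odot>\<^bsub>M\<^esub> x)"
    "a \<in> carrier R \<Longrightarrow> x \<in> carrier M \<Longrightarrow> (\<ominus> a) \<odot>\<^bsub>M\<^esub> x = \<ominus>\<^bsub>M\<^esub> (a \<odot>\<^bsub>M\<^esub> x)"
  by (simp_all add: module.smult_r_distr[OF assms] module.smult_l_distr[OF assms]
      module.smult_assoc1[OF assms] module.smult_r_minus[OF assms] module.smult_l_minus[OF assms])

lemma module_eq_iff:
  assumes "module R M" "x \<in> carrier M" "y \<in> carrier M"
  shows "x \<oplus>\<^bsub>M\<^esub> \<ominus>\<^bsub>M\<^esub> y = \<zero>\<^bsub>M\<^esub> \<longleftrightarrow> x = y"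
proof
  assume "x \<oplus>\<^bsub>M\<^esub> \<ominus>\<^bsub>M\<^esub> y = \<zero>\<^bsub>M\<^esub>"
  then have "(x \<oplus>\<^bsub>M\<^esub> \<ominus>\<^bsub>M\<^esub> y) \<oplus>\<^bsub>M\<^esub> y = \<zero>\<^bsub>M\<^esub> \<oplus>\<^bsub>M\<^esub> y" by simp
  with assms show "x = y" by (simp add: module_ac)
qed (use assms in simp)

lemma module_minus_unique:
  assumes "module R M" "x \<in> carrier M" "y \<in> carrier M" "x \<oplus>\<^bsub>M\<^esub> y = \<zero>\<^bsub>M\<^esub>"
  shows "y = \<ominus>\<^bsub>M\<^esub> x"
  using module_eq_iff[of M y "\<ominus>\<^bsub>M\<^esub> x"] assms by (simp add: module_ac)

lemma module_homD:
  assumes "f \<in> module_hom R M N" "module R M" "module R N"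
  shows "x \<in> carrier M \<Longrightarrow> f x \<in> carrier N"
    "x \<in> carrier M \<Longrightarrow> y \<in> carrier M \<Longrightarrow> f (x \<oplus>\<^bsub>M\<^esub> y) = f x \<oplus>\<^bsub>N\<^esub> f y"
    "a \<in> carrier R \<Longrightarrow> x \<in> carrier M \<Longrightarrow> f (a \<odot>\<^bsub>M\<^esub> x) = a \<odot>\<^bsub>N\<^esub> f x"
    "f \<zero>\<^bsub>M\<^esub> = \<zero>\<^bsub>N\<^esub>"
    "x \<in> carrier M \<Longrightarrow> f (\<ominus>\<^bsub>M\<^esub> x) = \<ominus>\<^bsub>N\<^esub> f x"
proof -
  show c: "f x \<in> carrier N" if "x \<in> carrier M" for x using assms(1) that by (auto simp: module_hom_def)
  show a: "f (x \<oplus>\<^bsub>M\<^esub> y) = f x \<oplus>\<^bsub>N\<^esub> f y" if "x \<in> carrier M" "y \<in> carrier M" for x y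
    using assms(1) that by (auto simp: module_hom_def)
  show s: "f (a \<odot>\<^bsub>M\<^esub> x) = a \<odot>\<^bsub>N\<^esub> f x" if "a \<in> carrier R" "x \<in> carrier M" for a x
    using assms(1) that by (auto simp: module_hom_def)
  show z: "f \<zero>\<^bsub>M\<^esub> = \<zero>\<^bsub>N\<^esub>"
    using s[of \<zero> "\<zero>\<^bsub>M\<^esub>"] assms c by simp
  show "f (\<ominus>\<^bsub>M\<^esub> x) = \<ominus>\<^bsub>N\<^esub> f x" if "x \<in> carrier M" for x
    using a[of x "\<ominus>\<^bsub>M\<^esub> x"] that z assms c by (intro module_minus_unique) auto
qed

lemma module_homI:
  assumes "\<And>x. x \<in> carrier M \<Longrightarrow> f x \<in> carrier N"
    "\<And>x y. x \<in> carrier M \<Longrightarrow> y \<in> carrier M \<Longrightarrow> f (x \<oplus>\<^bsub>M\<^esub> y) = f x \<oplus>\<^bsub>N\<^esub> f y"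
    "\<And>a x. a \<in> carrier R \<Longrightarrow> x \<in> carrier M \<Longrightarrow> f (a \<odot>\<^bsub>M\<^esub> x) = a \<odot>\<^bsub>N\<^esub> f x"
  shows "f \<in> module_hom R M N"
  using assms by (auto simp: module_hom_def)

lemma smult_hom:
  assumes M: "module R M" and a: "a \<in> carrier R"
  shows "(\<lambda>x. a \<odot>\<^bsub>M\<^esub> x) \<in> module_hom R M M"
proof (rule module_homI)
  fix b x assume "b \<in> carrier R" "x \<in> carrier M"
  with a M show "a \<odot>\<^bsub>M\<^esub> (b \<odot>\<^bsub>M\<^esub> x) = b \<odot>\<^bsub>M\<^esub> (a \<odot>\<^bsub>M\<^esub> x)"
    by (metis module_smult(3) m_comm)
qed (use M a in \<open>auto simp: module_smult\<close>)

lemma isomorphic_modules_sym: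
  assumes "isomorphic_modules R M N" and M: "module R M"
  shows "isomorphic_modules R N M"
proof -
  from assms obtain f where f: "f \<in> module_hom R M N" "bij_betw f (carrier M) (carrier N)"
    by (auto simp: isomorphic_modules_def)
  let ?g = "inv_into (carrier M) f"
  have g: "?g y \<in> carrier M" "f (?g y) = y" if "y \<in> carrier N" for y
    using f(2) that by (auto simp: bij_betw_def intro: inv_into_into f_inv_into_f)
  have gf: "?g (f x) = x" if "x \<in> carrier M" for x
    using f(2) that by (auto simp: bij_betw_def)
  have "?g \<in> module_hom R N M"
  proof (rule module_homI)
    fix x y assume "x \<in> carrier N" "y \<in> carrier N"
    with g have "f (?g x \<oplus>\<^bsub>M\<^esub> ?g y) = x \<oplus>\<^bsub>N\<^esub> y" using f(1) by (simp add: module_hom_def)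
    with gf[of "?g x \<oplus>\<^bsub>M\<^esub> ?g y"] g \<open>x \<in> _\<close> \<open>y \<in> _\<close> M show "?g (x \<oplus>\<^bsub>N\<^esub> y) = ?g x \<oplus>\<^bsub>M\<^esub> ?g y" by simp
  next
    fix a x assume "a \<in> carrier R" "x \<in> carrier N"
    with g have "f (a \<odot>\<^bsub>M\<^esub> ?g x) = a \<odot>\<^bsub>N\<^esub> x" using f(1) by (simp add: module_hom_def)
    with gf[of "a \<odot>\<^bsub>M\<^esub> ?g x"] g \<open>x \<in> _\<close> \<open>a \<in> _\<close> M show "?g (a \<odot>\<^bsub>N\<^esub> x) = a \<odot>\<^bsub>M\<^esub> ?g x" by simp
  qed (use g in auto)
  moreover have "bij_betw ?g (carrier N) (carrier M)" by (rule bij_betw_inv_into[OF f(2)])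
  ultimately show ?thesis by (auto simp: isomorphic_modules_def)
qed

text \<open>Closure under negation is multiplication by \<open>-1\<close>.\<close>

lemma submodule_criterion:
  assumes "module R M" "H \<subseteq> carrier M" "\<zero>\<^bsub>M\<^esub> \<in> H"
    "\<And>x y. x \<in> H \<Longrightarrow> y \<in> H \<Longrightarrow> x \<oplus>\<^bsub>M\<^esub> y \<in> H"
    "\<And>a x. a \<in> carrier R \<Longrightarrow> x \<in> H \<Longrightarrow> a \<odot>\<^bsub>M\<^esub> x \<in> H"
  shows "submodule H R M"
proof (rule module.submoduleI[OF assms(1-3)])
  fix x assume "x \<in> H"
  moreover from this have "\<ominus>\<^bsub>M\<^esub> x = (\<ominus> \<one>) \<odot>\<^bsub>M\<^esub> x"
    using assms by (auto simp: module_smult[OF assms(1)])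
  ultimately show "\<ominus>\<^bsub>M\<^esub> x \<in> H" using assms by auto
qed (use assms in auto)

lemma submoduleD:
  assumes "submodule H R M" "module R M"
  shows "x \<in> H \<Longrightarrow> x \<in> carrier M" "\<zero>\<^bsub>M\<^esub> \<in> H" "x \<in> H \<Longrightarrow> y \<in> H \<Longrightarrow> x \<oplus>\<^bsub>M\<^esub> y \<in> H"
    "x \<in> H \<Longrightarrow> \<ominus>\<^bsub>M\<^esub> x \<in> H" "a \<in> carrier R \<Longrightarrow> x \<in> H \<Longrightarrow> a \<odot>\<^bsub>M\<^esub> x \<in> H"
  using module.submoduleE[OF assms(2,1)]
    subgroup.one_closed[OF submodule.axioms(1)[OF assms(1)]] by auto

lemma submodule_module: "submodule N R M \<Longrightarrow> module R M \<Longrightarrow> module R (M\<lparr>carrier := N\<rparr>)"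
  by (rule submodule.submodule_is_module)

lemma a_r_coset_restrict [simp]: "N +>\<^bsub>M\<lparr>carrier := Z\<rparr>\<^esub> x = N +>\<^bsub>M\<^esub> x"
  by (simp add: a_r_coset_def r_coset_def)

lemma coset_mem_iff:
  "y \<in> N +>\<^bsub>M\<^esub> x \<longleftrightarrow> (\<exists>n\<in>N. y = n \<oplus>\<^bsub>M\<^esub> x)"
  by (auto simp: a_r_coset_def r_coset_def)

lemma coset_eq_iff:
  assumes M: "module R M" and N: "submodule N R M" and x: "x \<in> carrier M" and y: "y \<in> carrier M"
  shows "N +>\<^bsub>M\<^esub> x = N +>\<^bsub>M\<^esub> y \<longleftrightarrow> (\<exists>n\<in>N. x = y \<oplus>\<^bsub>M\<^esub> n)"
proof
  note N' = submoduleD[OF N M]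
  assume "N +>\<^bsub>M\<^esub> x = N +>\<^bsub>M\<^esub> y"
  moreover have "x \<in> N +>\<^bsub>M\<^esub> x" unfolding coset_mem_iff using N'(2) M x by force
  ultimately show "\<exists>n\<in>N. x = y \<oplus>\<^bsub>M\<^esub> n"
    unfolding coset_mem_iff using N'(1) M y by (auto simp: coset_mem_iff module_ac)
next
  note N' = submoduleD[OF N M]
  assume "\<exists>n\<in>N. x = y \<oplus>\<^bsub>M\<^esub> n"
  then obtain n where n: "n \<in> N" "x = y \<oplus>\<^bsub>M\<^esub> n" by auto
  show "N +>\<^bsub>M\<^esub> x = N +>\<^bsub>M\<^esub> y"
  proof (intro Set.set_eqI iffI)
    fix z assume "z \<in> N +>\<^bsub>M\<^esub> x"
    then obtain m where m: "m \<in> N" "z = m \<oplus>\<^bsub>M\<^esub> x" by (auto simp: coset_mem_iff)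
    then have "z = (m \<oplus>\<^bsub>M\<^esub> n) \<oplus>\<^bsub>M\<^esub> y" using n y M N'(1) by (simp add: module_ac)
    with m n N' show "z \<in> N +>\<^bsub>M\<^esub> y" unfolding coset_mem_iff by blast
  next
    fix z assume "z \<in> N +>\<^bsub>M\<^esub> y"
    then obtain m where m: "m \<in> N" "z = m \<oplus>\<^bsub>M\<^esub> y" by (auto simp: coset_mem_iff)
    then have "z = (m \<oplus>\<^bsub>M\<^esub> \<ominus>\<^bsub>M\<^esub> n) \<oplus>\<^bsub>M\<^esub> x" using n y M N'(1) by (simp add: module_ac)
    with m n N' show "z \<in> N +>\<^bsub>M\<^esub> x" unfolding coset_mem_iff by blast
  qed
qed

text \<open>Maps on quotients are defined by unions over a coset; such a union may be evaluated at any representative.\<close>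

lemma coset_UN:
  assumes M: "module R M" and N: "submodule N R M" and M': "module R M'" and N': "submodule N' R M'"
    and g: "g \<in> module_hom R M M'" and gN: "\<And>x. x \<in> N \<Longrightarrow> g x \<in> N'" and x: "x \<in> carrier M"
  shows "(\<Union>y\<in>N +>\<^bsub>M\<^esub> x. N' +>\<^bsub>M'\<^esub> g y) = N' +>\<^bsub>M'\<^esub> g x"
proof -
  note g = module_homD[OF g M M']
  note N = submoduleD[OF N M]
  have "N' +>\<^bsub>M'\<^esub> g y = N' +>\<^bsub>M'\<^esub> g x" if "y \<in> N +>\<^bsub>M\<^esub> x" for y
  proof -
    from that obtain n where "n \<in> N" "y = n \<oplus>\<^bsub>M\<^esub> x" by (auto simp: coset_mem_iff)
    with N x M M' gN show ?thesis
      by (subst coset_eq_iff[OF M' N']) (auto simp: g intro!: bexI[of _ "g n"] simp: module_ac)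
  qed
  moreover have "x \<in> N +>\<^bsub>M\<^esub> x" unfolding coset_mem_iff using N M x by force
  ultimately show ?thesis by blast
qed

lemma quotient_simps:
  assumes M: "module R M" and N: "submodule N R M"
  shows "carrier (quotient_module M N) = (\<lambda>x. N +>\<^bsub>M\<^esub> x) ` carrier M"
    and "\<zero>\<^bsub>quotient_module M N\<^esub> = N +>\<^bsub>M\<^esub> \<zero>\<^bsub>M\<^esub>"
    and "x \<in> carrier M \<Longrightarrow> y \<in> carrier M \<Longrightarrow>
      (N +>\<^bsub>M\<^esub> x) \<oplus>\<^bsub>quotient_module M N\<^esub> (N +>\<^bsub>M\<^esub> y) = N +>\<^bsub>M\<^esub> (x \<oplus>\<^bsub>M\<^esub> y)"
    and "a \<in> carrier R \<Longrightarrow> x \<in> carrier M \<Longrightarrow>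
      a \<odot>\<^bsub>quotient_module M N\<^esub> (N +>\<^bsub>M\<^esub> x) = N +>\<^bsub>M\<^esub> (a \<odot>\<^bsub>M\<^esub> x)"
proof -
  interpret M: module R M by fact
  interpret N: abelian_subgroup N M
    using N by (intro abelian_subgroupI3 additive_subgroup.intro submodule.axioms(1)[OF N]
        M.abelian_group_axioms)
  show "carrier (quotient_module M N) = (\<lambda>x. N +>\<^bsub>M\<^esub> x) ` carrier M"
    by (auto simp: quotient_module_def A_RCOSETS_def' a_r_coset_def')
  show "\<zero>\<^bsub>quotient_module M N\<^esub> = N +>\<^bsub>M\<^esub> \<zero>\<^bsub>M\<^esub>"
    using N.a_subset by (simp add: quotient_module_def)
  show "x \<in> carrier M \<Longrightarrow> y \<in> carrier M \<Longrightarrow>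
      (N +>\<^bsub>M\<^esub> x) \<oplus>\<^bsub>quotient_module M N\<^esub> (N +>\<^bsub>M\<^esub> y) = N +>\<^bsub>M\<^esub> (x \<oplus>\<^bsub>M\<^esub> y)"
    by (simp add: quotient_module_def N.a_rcos_sum)
  show "a \<in> carrier R \<Longrightarrow> x \<in> carrier M \<Longrightarrow>
      a \<odot>\<^bsub>quotient_module M N\<^esub> (N +>\<^bsub>M\<^esub> x) = N +>\<^bsub>M\<^esub> (a \<odot>\<^bsub>M\<^esub> x)"
    unfolding quotient_module_def
    by (simp, rule coset_UN[OF M N M N smult_hom[OF M]]) (auto simp: submoduleD[OF N M])
qed

lemma quotient_is_module:
  assumes M: "module R M" and N: "submodule N R M"
  shows "module R (quotient_module M N)"
proof (intro moduleI abelian_groupI is_cring)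
  note q = quotient_simps[OF M N]
  show "\<exists>y\<in>carrier (quotient_module M N). y \<oplus>\<^bsub>quotient_module M N\<^esub> x = \<zero>\<^bsub>quotient_module M N\<^esub>"
    if "x \<in> carrier (quotient_module M N)" for x
  proof -
    from that obtain u where "u \<in> carrier M" "x = N +>\<^bsub>M\<^esub> u" by (auto simp: q)
    then show ?thesis
      using M by (intro bexI[of _ "N +>\<^bsub>M\<^esub> (\<ominus>\<^bsub>M\<^esub> u)"]) (auto simp: q)
  qed
qed (auto simp: quotient_simps[OF M N] M module_smult module_ac[OF M])

text \<open>A homomorphism that respects submodules induces a homomorphism of the quotients; that this
  is bijective can be expressed without cosets.\<close>

lemma induced_quotient_hom:
  assumes M: "module R M" and N: "submodule N R M" and M': "module R M'" and N': "submodule N' R M'"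
    and g: "g \<in> module_hom R M M'" and gN: "\<And>x. x \<in> N \<Longrightarrow> g x \<in> N'"
  defines "\<Phi> \<equiv> \<lambda>X. \<Union>y\<in>X. N' +>\<^bsub>M'\<^esub> g y"
  shows "\<Phi> \<in> module_hom R (quotient_module M N) (quotient_module M' N')"
    and "bij_betw \<Phi> (carrier (quotient_module M N)) (carrier (quotient_module M' N')) \<longleftrightarrow>
      (\<forall>x\<in>carrier M. g x \<in> N' \<longrightarrow> x \<in> N) \<and>
      (\<forall>y\<in>carrier M'. \<exists>x\<in>carrier M. \<exists>n\<in>N'. y = g x \<oplus>\<^bsub>M'\<^esub> n)" (is "?bij \<longleftrightarrow> ?i \<and> ?s")
proof -
  note q = quotient_simps[OF M N] and q' = quotient_simps[OF M' N']
  note gh = module_homD[OF g M M']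
  note Nd = submoduleD[OF N M] and Nd' = submoduleD[OF N' M']
  have \<Phi>: "\<Phi> (N +>\<^bsub>M\<^esub> x) = N' +>\<^bsub>M'\<^esub> g x" if "x \<in> carrier M" for x
    unfolding \<Phi>_def by (rule coset_UN[OF M N M' N' g gN that])
  show "\<Phi> \<in> module_hom R (quotient_module M N) (quotient_module M' N')"
    by (intro module_homI) (auto simp: q q' \<Phi> gh M)
  show "?bij \<longleftrightarrow> ?i \<and> ?s"
  proof
    assume b: ?bij
    show "?i \<and> ?s"
    proof (intro conjI ballI impI)
      fix x assume x: "x \<in> carrier M" "g x \<in> N'"
      then have "\<Phi> (N +>\<^bsub>M\<^esub> x) = \<Phi> (N +>\<^bsub>M\<^esub> \<zero>\<^bsub>M\<^esub>)"
        using M M' N' by (simp add: \<Phi>)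
          (subst coset_eq_iff, auto simp: gh intro!: bexI[of _ "g x"])
      then have "N +>\<^bsub>M\<^esub> x = N +>\<^bsub>M\<^esub> \<zero>\<^bsub>M\<^esub>"
        using b x M by (auto simp: bij_betw_def inj_on_def q)
      then show "x \<in> N" using x M by (subst (asm) coset_eq_iff[OF M N]) (auto simp: Nd)
    next
      fix y assume y: "y \<in> carrier M'"
      then have "N' +>\<^bsub>M'\<^esub> y \<in> \<Phi> ` carrier (quotient_module M N)" using b by (auto simp: bij_betw_def q')
      then obtain x where "x \<in> carrier M" "N' +>\<^bsub>M'\<^esub> y = N' +>\<^bsub>M'\<^esub> g x" by (auto simp: q \<Phi>)
      with y show "\<exists>x\<in>carrier M. \<exists>n\<in>N'. y = g x \<oplus>\<^bsub>M'\<^esub> n"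
        using coset_eq_iff[OF M' N'] gh by blast
    qed
  next
    assume i_s: "?i \<and> ?s"
    show ?bij
      unfolding bij_betw_def
    proof (rule conjI[OF inj_onI subset_antisym[OF _ subsetI]])
      fix X Y assume X: "X \<in> carrier (quotient_module M N)" and Y: "Y \<in> carrier (quotient_module M N)"
        and eq: "\<Phi> X = \<Phi> Y"
      from X Y obtain x y where x: "x \<in> carrier M" "X = N +>\<^bsub>M\<^esub> x" and y: "y \<in> carrier M" "Y = N +>\<^bsub>M\<^esub> y"
        by (auto simp: q)
      from eq x y obtain n where n: "n \<in> N'" "g x = g y \<oplus>\<^bsub>M'\<^esub> n"
        using coset_eq_iff[OF M' N'] gh by (auto simp: \<Phi>)
      have "g (\<ominus>\<^bsub>M\<^esub> y \<oplus>\<^bsub>M\<^esub> x) = n" using x y n M M' Nd' by (simp add: gh module_ac)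
      with i_s n x y M have "\<ominus>\<^bsub>M\<^esub> y \<oplus>\<^bsub>M\<^esub> x \<in> N" by simp
      with x y M show "X = Y"
        by (simp, subst coset_eq_iff[OF M N]) (auto intro!: bexI[of _ "\<ominus>\<^bsub>M\<^esub> y \<oplus>\<^bsub>M\<^esub> x"] simp: module_ac)
    next
      fix Y assume "Y \<in> carrier (quotient_module M' N')"
      then obtain y where y: "y \<in> carrier M'" "Y = N' +>\<^bsub>M'\<^esub> y" by (auto simp: q')
      with i_s obtain x n where "x \<in> carrier M" "n \<in> N'" "y = g x \<oplus>\<^bsub>M'\<^esub> n" by blast
      with y have "Y = \<Phi> (N +>\<^bsub>M\<^esub> x)" using coset_eq_iff[OF M' N'] gh by (simp add: \<Phi>) blast
      with \<open>x \<in> carrier M\<close> show "Y \<in> \<Phi> ` carrier (quotient_module M N)" by (auto simp: q)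
    qed (auto simp: q q' \<Phi> gh)
  qed
qed

section \<open>Cohomology in terms of elements\<close>

lemma complexD:
  assumes "is_complex R C"
  shows "module R (obj C n)" "diff C n \<in> module_hom R (obj C n) (obj C (n + 1))"
    "x \<in> carrier (obj C n) \<Longrightarrow> diff C (n + 1) (diff C n x) = \<zero>\<^bsub>obj C (n + 2)\<^esub>"
  using assms by (auto simp: is_complex_def)

lemma diffD:
  assumes "is_complex R C"
  shows "x \<in> carrier (obj C n) \<Longrightarrow> diff C n x \<in> carrier (obj C (n + 1))"
    "x \<in> carrier (obj C n) \<Longrightarrow> y \<in> carrier (obj C n) \<Longrightarrow>
      diff C n (x \<oplus>\<^bsub>obj C n\<^esub> y) = diff C n x \<oplus>\<^bsub>obj C (n + 1)\<^esub> diff C n y"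
    "a \<in> carrier R \<Longrightarrow> x \<in> carrier (obj C n) \<Longrightarrow>
      diff C n (a \<odot>\<^bsub>obj C n\<^esub> x) = a \<odot>\<^bsub>obj C (n + 1)\<^esub> diff C n x"
    "diff C n \<zero>\<^bsub>obj C n\<^esub> = \<zero>\<^bsub>obj C (n + 1)\<^esub>"
    "x \<in> carrier (obj C n) \<Longrightarrow> diff C n (\<ominus>\<^bsub>obj C n\<^esub> x) = \<ominus>\<^bsub>obj C (n + 1)\<^esub> diff C n x"
  using module_homD[OF complexD(2,1,1)[OF assms]] by auto

lemma diff_diff:
  assumes "is_complex R C" "x \<in> carrier (obj C (n - 1))"
  shows "diff C n (diff C (n - 1) x) = \<zero>\<^bsub>obj C (n + 1)\<^esub>"
proof -
  have "n - 1 + 1 = n" "n - 1 + 2 = n + 1" by simp_all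
  with complexD(3)[OF assms(1), of x "n - 1"] assms(2) show ?thesis by metis
qed

text \<open>The same for the differential that arrives in degree \<open>n\<close>, where the rules above would speak of degree
  \<open>n - 1 + 1\<close>.\<close>

lemma diff_intoD:
  assumes "is_complex R C"
  shows "x \<in> carrier (obj C (n - 1)) \<Longrightarrow> diff C (n - 1) x \<in> carrier (obj C n)"
    "x \<in> carrier (obj C (n - 1)) \<Longrightarrow> y \<in> carrier (obj C (n - 1)) \<Longrightarrow>
      diff C (n - 1) (x \<oplus>\<^bsub>obj C (n - 1)\<^esub> y) = diff C (n - 1) x \<oplus>\<^bsub>obj C n\<^esub> diff C (n - 1) y"
    "a \<in> carrier R \<Longrightarrow> x \<in> carrier (obj C (n - 1)) \<Longrightarrow>
      diff C (n - 1) (a \<odot>\<^bsub>obj C (n - 1)\<^esub> x) = a \<odot>\<^bsub>obj C n\<^esub> diff C (n - 1) x"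
    "diff C (n - 1) \<zero>\<^bsub>obj C (n - 1)\<^esub> = \<zero>\<^bsub>obj C n\<^esub>"
    "x \<in> carrier (obj C (n - 1)) \<Longrightarrow> diff C (n - 1) (\<ominus>\<^bsub>obj C (n - 1)\<^esub> x) = \<ominus>\<^bsub>obj C n\<^esub> diff C (n - 1) x"
  using diffD[OF assms, where n = "n - 1"] by simp_all

lemma chain_mapD:
  assumes "chain_map R C D f" "is_complex R C" "is_complex R D"
  shows "x \<in> carrier (obj C n) \<Longrightarrow> f n x \<in> carrier (obj D n)"
    "x \<in> carrier (obj C n) \<Longrightarrow> y \<in> carrier (obj C n) \<Longrightarrow>
      f n (x \<oplus>\<^bsub>obj C n\<^esub> y) = f n x \<oplus>\<^bsub>obj D n\<^esub> f n y"
    "a \<in> carrier R \<Longrightarrow> x \<in> carrier (obj C n) \<Longrightarrow>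
      f n (a \<odot>\<^bsub>obj C n\<^esub> x) = a \<odot>\<^bsub>obj D n\<^esub> f n x"
    "f n \<zero>\<^bsub>obj C n\<^esub> = \<zero>\<^bsub>obj D n\<^esub>"
    "x \<in> carrier (obj C n) \<Longrightarrow> f n (\<ominus>\<^bsub>obj C n\<^esub> x) = \<ominus>\<^bsub>obj D n\<^esub> f n x"
    "x \<in> carrier (obj C n) \<Longrightarrow> f (n + 1) (diff C n x) = diff D n (f n x)"
    "x \<in> carrier (obj C (n - 1)) \<Longrightarrow> f n (diff C (n - 1) x) = diff D (n - 1) (f (n - 1) x)"
proof -
  have h: "f n \<in> module_hom R (obj C n) (obj D n)" for n using assms(1) by (simp add: chain_map_def)
  note module_homD[OF h complexD(1)[OF assms(2)] complexD(1)[OF assms(3)]]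
  then show "x \<in> carrier (obj C n) \<Longrightarrow> f n x \<in> carrier (obj D n)"
    "x \<in> carrier (obj C n) \<Longrightarrow> y \<in> carrier (obj C n) \<Longrightarrow>
      f n (x \<oplus>\<^bsub>obj C n\<^esub> y) = f n x \<oplus>\<^bsub>obj D n\<^esub> f n y"
    "a \<in> carrier R \<Longrightarrow> x \<in> carrier (obj C n) \<Longrightarrow>
      f n (a \<odot>\<^bsub>obj C n\<^esub> x) = a \<odot>\<^bsub>obj D n\<^esub> f n x"
    "f n \<zero>\<^bsub>obj C n\<^esub> = \<zero>\<^bsub>obj D n\<^esub>"
    "x \<in> carrier (obj C n) \<Longrightarrow> f n (\<ominus>\<^bsub>obj C n\<^esub> x) = \<ominus>\<^bsub>obj D n\<^esub> f n x" by auto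
  show d: "f (n + 1) (diff C n x) = diff D n (f n x)" if "x \<in> carrier (obj C n)" for x n
    using assms(1) that by (auto simp: chain_map_def)
  show "x \<in> carrier (obj C (n - 1)) \<Longrightarrow> f n (diff C (n - 1) x) = diff D (n - 1) (f (n - 1) x)"
    using d[of x "n - 1"] by simp
qed

lemma cocycles_submodule:
  assumes "is_complex R C"
  shows "submodule (cocycles C n) R (obj C n)"
  using complexD(1)[OF assms]
  by (intro submodule_criterion) (auto simp: cocycles_def diffD[OF assms])

lemma coboundaries_submodule:
  assumes "is_complex R C"
  shows "submodule (coboundaries C n) R (obj C n)"
proof (rule submodule_criterion[OF complexD(1)[OF assms]])
  show "\<zero>\<^bsub>obj C n\<^esub> \<in> coboundaries C n"
    unfolding coboundaries_def
    by (rule image_eqI[of _ _ "\<zero>\<^bsub>obj C (n - 1)\<^esub>"]) (simp_all add: diff_intoD[OF assms] complexD(1)[OF assms])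
qed (auto simp: coboundaries_def diff_intoD(1)[OF assms] complexD(1)[OF assms]
    simp flip: diff_intoD(2,3)[OF assms])

lemma coboundaries_cocycles: "is_complex R C \<Longrightarrow> x \<in> coboundaries C n \<Longrightarrow> x \<in> cocycles C n"
  by (auto simp: coboundaries_def cocycles_def diff_diff diff_intoD)

lemma cohomology_submodules:
  assumes C: "is_complex R C"
  shows "module R ((obj C n)\<lparr>carrier := cocycles C n\<rparr>)"
    "submodule (coboundaries C n) R ((obj C n)\<lparr>carrier := cocycles C n\<rparr>)"
proof -
  show Z: "module R ((obj C n)\<lparr>carrier := cocycles C n\<rparr>)"
    by (rule submodule_module[OF cocycles_submodule[OF C] complexD(1)[OF C]])
  show "submodule (coboundaries C n) R ((obj C n)\<lparr>carrier := cocycles C n\<rparr>)"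
    using submoduleD[OF coboundaries_submodule[OF C] complexD(1)[OF C]] coboundaries_cocycles[OF C]
    by (intro submodule_criterion[OF Z]) auto
qed

text \<open>Bijectivity of the map induced on cohomology, in terms of cocycles and coboundaries.\<close>

definition cohomology_iso_at where
  "cohomology_iso_at C D f n \<longleftrightarrow>
    (\<forall>x\<in>cocycles C n. f n x \<in> coboundaries D n \<longrightarrow> x \<in> coboundaries C n) \<and>
    (\<forall>y\<in>cocycles D n. \<exists>x\<in>cocycles C n. \<exists>b\<in>coboundaries D n. y = f n x \<oplus>\<^bsub>obj D n\<^esub> b)"

lemma cohomology_map_iso:
  assumes C: "is_complex R C" and D: "is_complex R D" and f: "chain_map R C D f"
  shows "bij_betw (cohomology_map D f n) (carrier (cohomology C n)) (carrier (cohomology D n))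
      \<longleftrightarrow> cohomology_iso_at C D f n"
    and "cohomology_iso_at C D f n \<Longrightarrow> isomorphic_modules R (cohomology C n) (cohomology D n)"
proof -
  note fD = chain_mapD[OF f C D]
  have fZ: "f n \<in> module_hom R ((obj C n)\<lparr>carrier := cocycles C n\<rparr>) ((obj D n)\<lparr>carrier := cocycles D n\<rparr>)"
    by (intro module_homI) (auto simp: cocycles_def fD simp flip: fD(6))
  have fB: "f n x \<in> coboundaries D n" if "x \<in> coboundaries C n" for x
    using that fD(1,7) by (auto simp: coboundaries_def)
  note * = induced_quotient_hom[OF cohomology_submodules[OF C] cohomology_submodules[OF D] fZ fB]
  show eq: "bij_betw (cohomology_map D f n) (carrier (cohomology C n)) (carrier (cohomology D n))
      \<longleftrightarrow> cohomology_iso_at C D f n"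
    using *(2) by (simp add: cohomology_def cohomology_map_def[abs_def] cohomology_iso_at_def)
  have "cohomology_map D f n \<in> module_hom R (cohomology C n) (cohomology D n)"
    using *(1) by (simp add: cohomology_def cohomology_map_def[abs_def])
  with eq show "cohomology_iso_at C D f n \<Longrightarrow> isomorphic_modules R (cohomology C n) (cohomology D n)"
    by (auto simp: isomorphic_modules_def)
qed

lemma cohomology_module: "is_complex R C \<Longrightarrow> module R (cohomology C n)"
  unfolding cohomology_def by (rule quotient_is_module[OF cohomology_submodules])

end

section \<open>Functors on a poset\<close>

locale poset_diagrams = cring_base R for R :: "('r, 'x) ring_scheme" (structure) +
  fixes S :: "'p set" and leq :: "'p \<Rightarrow> 'p \<Rightarrow> bool"
  assumes leq_refl: "p \<in> S \<Longrightarrow> leq p p"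
    and leq_trans: "p \<in> S \<Longrightarrow> q \<in> S \<Longrightarrow> s \<in> S \<Longrightarrow> leq p q \<Longrightarrow> leq q s \<Longrightarrow> leq p s"

lemma degree_part_simps [simp]:
  "Mob (degree_part G n) p = obj (Cob G p) n" "Mar (degree_part G n) p q = Car G p q n"
  by (simp_all add: degree_part_def)

context cring_base
begin

lemma mod_functorD:
  assumes "is_mod_functor R S leq F"
  shows "p \<in> S \<Longrightarrow> module R (Mob F p)"
    "p \<in> S \<Longrightarrow> q \<in> S \<Longrightarrow> leq p q \<Longrightarrow> x \<in> carrier (Mob F p) \<Longrightarrow> Mar F p q x \<in> carrier (Mob F q)"
    "p \<in> S \<Longrightarrow> q \<in> S \<Longrightarrow> leq p q \<Longrightarrow> x \<in> carrier (Mob F p) \<Longrightarrow> y \<in> carrier (Mob F p) \<Longrightarrow>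
      Mar F p q (x \<oplus>\<^bsub>Mob F p\<^esub> y) = Mar F p q x \<oplus>\<^bsub>Mob F q\<^esub> Mar F p q y"
    "p \<in> S \<Longrightarrow> q \<in> S \<Longrightarrow> leq p q \<Longrightarrow> a \<in> carrier R \<Longrightarrow> x \<in> carrier (Mob F p) \<Longrightarrow>
      Mar F p q (a \<odot>\<^bsub>Mob F p\<^esub> x) = a \<odot>\<^bsub>Mob F q\<^esub> Mar F p q x"
    "p \<in> S \<Longrightarrow> q \<in> S \<Longrightarrow> leq p q \<Longrightarrow> Mar F p q \<zero>\<^bsub>Mob F p\<^esub> = \<zero>\<^bsub>Mob F q\<^esub>"
    "p \<in> S \<Longrightarrow> q \<in> S \<Longrightarrow> leq p q \<Longrightarrow> x \<in> carrier (Mob F p) \<Longrightarrow>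
      Mar F p q (\<ominus>\<^bsub>Mob F p\<^esub> x) = \<ominus>\<^bsub>Mob F q\<^esub> Mar F p q x"
    "p \<in> S \<Longrightarrow> x \<in> carrier (Mob F p) \<Longrightarrow> Mar F p p x = x"
    "p \<in> S \<Longrightarrow> q \<in> S \<Longrightarrow> s \<in> S \<Longrightarrow> leq p q \<Longrightarrow> leq q s \<Longrightarrow> x \<in> carrier (Mob F p) \<Longrightarrow>
      Mar F q s (Mar F p q x) = Mar F p s x"
proof -
  show M: "module R (Mob F p)" if "p \<in> S" for p using assms that by (simp add: is_mod_functor_def)
  fix p q assume pq: "p \<in> S" "q \<in> S" "leq p q"
  then have "Mar F p q \<in> module_hom R (Mob F p) (Mob F q)" using assms by (simp add: is_mod_functor_def)
  note h = module_homD[OF this M[OF pq(1)] M[OF pq(2)]]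
  show "x \<in> carrier (Mob F p) \<Longrightarrow> Mar F p q x \<in> carrier (Mob F q)"
    "x \<in> carrier (Mob F p) \<Longrightarrow> y \<in> carrier (Mob F p) \<Longrightarrow>
      Mar F p q (x \<oplus>\<^bsub>Mob F p\<^esub> y) = Mar F p q x \<oplus>\<^bsub>Mob F q\<^esub> Mar F p q y"
    "a \<in> carrier R \<Longrightarrow> x \<in> carrier (Mob F p) \<Longrightarrow>
      Mar F p q (a \<odot>\<^bsub>Mob F p\<^esub> x) = a \<odot>\<^bsub>Mob F q\<^esub> Mar F p q x"
    "Mar F p q \<zero>\<^bsub>Mob F p\<^esub> = \<zero>\<^bsub>Mob F q\<^esub>"
    "x \<in> carrier (Mob F p) \<Longrightarrow> Mar F p q (\<ominus>\<^bsub>Mob F p\<^esub> x) = \<ominus>\<^bsub>Mob F q\<^esub> Mar F p q x"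
    by (fact h)+
qed (use assms in \<open>auto simp: is_mod_functor_def\<close>)

lemma mod_natD:
  assumes "mod_nat R S leq F G \<eta>" "is_mod_functor R S leq F" "is_mod_functor R S leq G"
  shows "p \<in> S \<Longrightarrow> x \<in> carrier (Mob F p) \<Longrightarrow> \<eta> p x \<in> carrier (Mob G p)"
    "p \<in> S \<Longrightarrow> x \<in> carrier (Mob F p) \<Longrightarrow> y \<in> carrier (Mob F p) \<Longrightarrow>
      \<eta> p (x \<oplus>\<^bsub>Mob F p\<^esub> y) = \<eta> p x \<oplus>\<^bsub>Mob G p\<^esub> \<eta> p y"
    "p \<in> S \<Longrightarrow> a \<in> carrier R \<Longrightarrow> x \<in> carrier (Mob F p) \<Longrightarrow>
      \<eta> p (a \<odot>\<^bsub>Mob F p\<^esub> x) = a \<odot>\<^bsub>Mob G p\<^esub> \<eta> p x"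
    "p \<in> S \<Longrightarrow> \<eta> p \<zero>\<^bsub>Mob F p\<^esub> = \<zero>\<^bsub>Mob G p\<^esub>"
    "p \<in> S \<Longrightarrow> x \<in> carrier (Mob F p) \<Longrightarrow> \<eta> p (\<ominus>\<^bsub>Mob F p\<^esub> x) = \<ominus>\<^bsub>Mob G p\<^esub> \<eta> p x"
    "p \<in> S \<Longrightarrow> q \<in> S \<Longrightarrow> leq p q \<Longrightarrow> x \<in> carrier (Mob F p) \<Longrightarrow>
      \<eta> q (Mar F p q x) = Mar G p q (\<eta> p x)"
proof -
  fix p assume p: "p \<in> S"
  then have "\<eta> p \<in> module_hom R (Mob F p) (Mob G p)" using assms(1) by (simp add: mod_nat_def)
  note h = module_homD[OF this mod_functorD(1)[OF assms(2) p] mod_functorD(1)[OF assms(3) p]]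
  show "x \<in> carrier (Mob F p) \<Longrightarrow> \<eta> p x \<in> carrier (Mob G p)"
    "x \<in> carrier (Mob F p) \<Longrightarrow> y \<in> carrier (Mob F p) \<Longrightarrow>
      \<eta> p (x \<oplus>\<^bsub>Mob F p\<^esub> y) = \<eta> p x \<oplus>\<^bsub>Mob G p\<^esub> \<eta> p y"
    "a \<in> carrier R \<Longrightarrow> x \<in> carrier (Mob F p) \<Longrightarrow>
      \<eta> p (a \<odot>\<^bsub>Mob F p\<^esub> x) = a \<odot>\<^bsub>Mob G p\<^esub> \<eta> p x"
    "\<eta> p \<zero>\<^bsub>Mob F p\<^esub> = \<zero>\<^bsub>Mob G p\<^esub>"
    "x \<in> carrier (Mob F p) \<Longrightarrow> \<eta> p (\<ominus>\<^bsub>Mob F p\<^esub> x) = \<ominus>\<^bsub>Mob G p\<^esub> \<eta> p x" by (fact h)+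
qed (use assms(1) in \<open>auto simp: mod_nat_def\<close>)

lemma mod_functorI:
  assumes "\<And>p. p \<in> S \<Longrightarrow> module R (Mob F p)"
    "\<And>p q x. p \<in> S \<Longrightarrow> q \<in> S \<Longrightarrow> leq p q \<Longrightarrow> x \<in> carrier (Mob F p) \<Longrightarrow> Mar F p q x \<in> carrier (Mob F q)"
    "\<And>p q x y. p \<in> S \<Longrightarrow> q \<in> S \<Longrightarrow> leq p q \<Longrightarrow> x \<in> carrier (Mob F p) \<Longrightarrow> y \<in> carrier (Mob F p) \<Longrightarrow>
      Mar F p q (x \<oplus>\<^bsub>Mob F p\<^esub> y) = Mar F p q x \<oplus>\<^bsub>Mob F q\<^esub> Mar F p q y"
    "\<And>p q a x. p \<in> S \<Longrightarrow> q \<in> S \<Longrightarrow> leq p q \<Longrightarrow> a \<in> carrier R \<Longrightarrow> x \<in> carrier (Mob F p) \<Longrightarrow>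
      Mar F p q (a \<odot>\<^bsub>Mob F p\<^esub> x) = a \<odot>\<^bsub>Mob F q\<^esub> Mar F p q x"
    "\<And>p x. p \<in> S \<Longrightarrow> x \<in> carrier (Mob F p) \<Longrightarrow> Mar F p p x = x"
    "\<And>p q s x. p \<in> S \<Longrightarrow> q \<in> S \<Longrightarrow> s \<in> S \<Longrightarrow> leq p q \<Longrightarrow> leq q s \<Longrightarrow> x \<in> carrier (Mob F p) \<Longrightarrow>
      Mar F q s (Mar F p q x) = Mar F p s x"
  shows "is_mod_functor R S leq F"
  using assms unfolding is_mod_functor_def by (auto intro!: module_homI)

lemma mod_natI:
  assumes "\<And>p x. p \<in> S \<Longrightarrow> x \<in> carrier (Mob F p) \<Longrightarrow> \<eta> p x \<in> carrier (Mob G p)"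
    "\<And>p x y. p \<in> S \<Longrightarrow> x \<in> carrier (Mob F p) \<Longrightarrow> y \<in> carrier (Mob F p) \<Longrightarrow>
      \<eta> p (x \<oplus>\<^bsub>Mob F p\<^esub> y) = \<eta> p x \<oplus>\<^bsub>Mob G p\<^esub> \<eta> p y"
    "\<And>p a x. p \<in> S \<Longrightarrow> a \<in> carrier R \<Longrightarrow> x \<in> carrier (Mob F p) \<Longrightarrow>
      \<eta> p (a \<odot>\<^bsub>Mob F p\<^esub> x) = a \<odot>\<^bsub>Mob G p\<^esub> \<eta> p x"
    "\<And>p q x. p \<in> S \<Longrightarrow> q \<in> S \<Longrightarrow> leq p q \<Longrightarrow> x \<in> carrier (Mob F p) \<Longrightarrow>
      \<eta> q (Mar F p q x) = Mar G p q (\<eta> p x)"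
  shows "mod_nat R S leq F G \<eta>"
  using assms unfolding mod_nat_def by (auto intro!: module_homI)

lemma mod_functor_subset: "is_mod_functor R S leq F \<Longrightarrow> T \<subseteq> S \<Longrightarrow> is_mod_functor R T leq F"
  unfolding is_mod_functor_def by (meson subsetD)

lemma cx_functorD:
  assumes "is_cx_functor R S leq G"
  shows "is_mod_functor R S leq (degree_part G n)"
    "p \<in> S \<Longrightarrow> is_complex R (Cob G p)"
    "p \<in> S \<Longrightarrow> module R (obj (Cob G p) n)"
    "p \<in> S \<Longrightarrow> q \<in> S \<Longrightarrow> leq p q \<Longrightarrow> chain_map R (Cob G p) (Cob G q) (Car G p q)"
    "p \<in> S \<Longrightarrow> x \<in> carrier (obj (Cob G p) n) \<Longrightarrow> Car G p p n x = x"
    "p \<in> S \<Longrightarrow> q \<in> S \<Longrightarrow> s \<in> S \<Longrightarrow> leq p q \<Longrightarrow> leq q s \<Longrightarrow> x \<in> carrier (obj (Cob G p) n) \<Longrightarrow>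
      Car G q s n (Car G p q n x) = Car G p s n x"
proof -
  show f: "is_mod_functor R S leq (degree_part G n)" for n using assms by (simp add: is_cx_functor_def)
  show c: "p \<in> S \<Longrightarrow> is_complex R (Cob G p)" for p using assms by (simp add: is_cx_functor_def)
  show "p \<in> S \<Longrightarrow> module R (obj (Cob G p) n)" by (rule complexD(1)[OF c])
  show "p \<in> S \<Longrightarrow> q \<in> S \<Longrightarrow> leq p q \<Longrightarrow> chain_map R (Cob G p) (Cob G q) (Car G p q)"
    using assms by (simp add: is_cx_functor_def)
  show "p \<in> S \<Longrightarrow> x \<in> carrier (obj (Cob G p) n) \<Longrightarrow> Car G p p n x = x"
    using mod_functorD(7)[OF f[of n]] by simp
  show "p \<in> S \<Longrightarrow> q \<in> S \<Longrightarrow> s \<in> S \<Longrightarrow> leq p q \<Longrightarrow> leq q s \<Longrightarrow> x \<in> carrier (obj (Cob G p) n) \<Longrightarrow>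
      Car G q s n (Car G p q n x) = Car G p s n x"
    using mod_functorD(8)[OF f[of n]] by simp
qed

lemma Car_simps:
  assumes "is_cx_functor R S leq G" "p \<in> S" "q \<in> S" "leq p q"
  shows "x \<in> carrier (obj (Cob G p) n) \<Longrightarrow> Car G p q n x \<in> carrier (obj (Cob G q) n)"
    "x \<in> carrier (obj (Cob G p) n) \<Longrightarrow> y \<in> carrier (obj (Cob G p) n) \<Longrightarrow>
      Car G p q n (x \<oplus>\<^bsub>obj (Cob G p) n\<^esub> y) = Car G p q n x \<oplus>\<^bsub>obj (Cob G q) n\<^esub> Car G p q n y"
    "a \<in> carrier R \<Longrightarrow> x \<in> carrier (obj (Cob G p) n) \<Longrightarrow>
      Car G p q n (a \<odot>\<^bsub>obj (Cob G p) n\<^esub> x) = a \<odot>\<^bsub>obj (Cob G q) n\<^esub> Car G p q n x"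
    "Car G p q n \<zero>\<^bsub>obj (Cob G p) n\<^esub> = \<zero>\<^bsub>obj (Cob G q) n\<^esub>"
    "x \<in> carrier (obj (Cob G p) n) \<Longrightarrow> Car G p q n (\<ominus>\<^bsub>obj (Cob G p) n\<^esub> x) = \<ominus>\<^bsub>obj (Cob G q) n\<^esub> Car G p q n x"
    "x \<in> carrier (obj (Cob G p) n) \<Longrightarrow> Car G p q (n + 1) (diff (Cob G p) n x) = diff (Cob G q) n (Car G p q n x)"
    "x \<in> carrier (obj (Cob G p) (n - 1)) \<Longrightarrow> Car G p q n (diff (Cob G p) (n - 1) x) = diff (Cob G q) (n - 1) (Car G p q (n - 1) x)"
  using chain_mapD[OF cx_functorD(4)[OF assms] cx_functorD(2)[OF assms(1,2)] cx_functorD(2)[OF assms(1,3)]]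
  by - assumption+

lemma cx_natD:
  assumes "cx_nat R S leq F G \<phi>" "is_cx_functor R S leq F" "is_cx_functor R S leq G" "p \<in> S"
  shows "x \<in> carrier (obj (Cob F p) n) \<Longrightarrow> \<phi> p n x \<in> carrier (obj (Cob G p) n)"
    "x \<in> carrier (obj (Cob F p) n) \<Longrightarrow> y \<in> carrier (obj (Cob F p) n) \<Longrightarrow>
      \<phi> p n (x \<oplus>\<^bsub>obj (Cob F p) n\<^esub> y) = \<phi> p n x \<oplus>\<^bsub>obj (Cob G p) n\<^esub> \<phi> p n y"
    "a \<in> carrier R \<Longrightarrow> x \<in> carrier (obj (Cob F p) n) \<Longrightarrow>
      \<phi> p n (a \<odot>\<^bsub>obj (Cob F p) n\<^esub> x) = a \<odot>\<^bsub>obj (Cob G p) n\<^esub> \<phi> p n x"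
    "\<phi> p n \<zero>\<^bsub>obj (Cob F p) n\<^esub> = \<zero>\<^bsub>obj (Cob G p) n\<^esub>"
    "x \<in> carrier (obj (Cob F p) n) \<Longrightarrow> \<phi> p n (\<ominus>\<^bsub>obj (Cob F p) n\<^esub> x) = \<ominus>\<^bsub>obj (Cob G p) n\<^esub> \<phi> p n x"
    "x \<in> carrier (obj (Cob F p) n) \<Longrightarrow> \<phi> p (n + 1) (diff (Cob F p) n x) = diff (Cob G p) n (\<phi> p n x)"
    "x \<in> carrier (obj (Cob F p) (n - 1)) \<Longrightarrow> \<phi> p n (diff (Cob F p) (n - 1) x) = diff (Cob G p) (n - 1) (\<phi> p (n - 1) x)"
    "q \<in> S \<Longrightarrow> leq p q \<Longrightarrow> x \<in> carrier (obj (Cob F p) n) \<Longrightarrow> \<phi> q n (Car F p q n x) = Car G p q n (\<phi> p n x)"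
proof -
  have "chain_map R (Cob F p) (Cob G p) (\<phi> p)" using assms by (simp add: cx_nat_def)
  note h = chain_mapD[OF this cx_functorD(2)[OF assms(2,4)] cx_functorD(2)[OF assms(3,4)]]
  show "x \<in> carrier (obj (Cob F p) n) \<Longrightarrow> \<phi> p n x \<in> carrier (obj (Cob G p) n)"
    "x \<in> carrier (obj (Cob F p) n) \<Longrightarrow> y \<in> carrier (obj (Cob F p) n) \<Longrightarrow>
      \<phi> p n (x \<oplus>\<^bsub>obj (Cob F p) n\<^esub> y) = \<phi> p n x \<oplus>\<^bsub>obj (Cob G p) n\<^esub> \<phi> p n y"
    "a \<in> carrier R \<Longrightarrow> x \<in> carrier (obj (Cob F p) n) \<Longrightarrow>
      \<phi> p n (a \<odot>\<^bsub>obj (Cob F p) n\<^esub> x) = a \<odot>\<^bsub>obj (Cob G p) n\<^esub> \<phi> p n x"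
    "\<phi> p n \<zero>\<^bsub>obj (Cob F p) n\<^esub> = \<zero>\<^bsub>obj (Cob G p) n\<^esub>"
    "x \<in> carrier (obj (Cob F p) n) \<Longrightarrow> \<phi> p n (\<ominus>\<^bsub>obj (Cob F p) n\<^esub> x) = \<ominus>\<^bsub>obj (Cob G p) n\<^esub> \<phi> p n x"
    "x \<in> carrier (obj (Cob F p) n) \<Longrightarrow> \<phi> p (n + 1) (diff (Cob F p) n x) = diff (Cob G p) n (\<phi> p n x)"
    "x \<in> carrier (obj (Cob F p) (n - 1)) \<Longrightarrow> \<phi> p n (diff (Cob F p) (n - 1) x) = diff (Cob G p) (n - 1) (\<phi> p (n - 1) x)"
    by (fact h)+
  have "mod_nat R S leq (degree_part F n) (degree_part G n) (\<lambda>p. \<phi> p n)" using assms by (simp add: cx_nat_def)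
  then show "q \<in> S \<Longrightarrow> leq p q \<Longrightarrow> x \<in> carrier (obj (Cob F p) n) \<Longrightarrow> \<phi> q n (Car F p q n x) = Car G p q n (\<phi> p n x)"
    using assms(4) by (auto simp: mod_nat_def)
qed

end

section \<open>Mapping cones\<close>

definition prod_module :: "('r, 'a) module \<Rightarrow> ('r, 'b) module \<Rightarrow> ('r, 'a \<times> 'b) module" where
  "prod_module M N = \<lparr>carrier = carrier M \<times> carrier N, mult = undefined, one = undefined,
     zero = (\<zero>\<^bsub>M\<^esub>, \<zero>\<^bsub>N\<^esub>), add = (\<lambda>x y. (fst x \<oplus>\<^bsub>M\<^esub> fst y, snd x \<oplus>\<^bsub>N\<^esub> snd y)),
     smult = (\<lambda>a x. (a \<odot>\<^bsub>M\<^esub> fst x, a \<odot>\<^bsub>N\<^esub> snd x))\<rparr>"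

lemma prod_module_simps [simp]:
  "carrier (prod_module M N) = carrier M \<times> carrier N"
  "\<zero>\<^bsub>prod_module M N\<^esub> = (\<zero>\<^bsub>M\<^esub>, \<zero>\<^bsub>N\<^esub>)"
  "x \<oplus>\<^bsub>prod_module M N\<^esub> y = (fst x \<oplus>\<^bsub>M\<^esub> fst y, snd x \<oplus>\<^bsub>N\<^esub> snd y)"
  "a \<odot>\<^bsub>prod_module M N\<^esub> x = (a \<odot>\<^bsub>M\<^esub> fst x, a \<odot>\<^bsub>N\<^esub> snd x)"
  by (simp_all add: prod_module_def)

text \<open>The cone is shifted so that its degree \<open>n\<close> part is \<open>C\<^sup>n \<oplus> D\<^sup>n\<^sup>-\<^sup>1\<close>.\<close>

definition cone :: "('r, 'a) cochain_complex \<Rightarrow> ('r, 'b) cochain_complex \<Rightarrow> (int \<Rightarrow> 'a \<Rightarrow> 'b) \<Rightarrow>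
    ('r, 'a \<times> 'b) cochain_complex" where
  "cone C D f = \<lparr>obj = (\<lambda>n. prod_module (obj C n) (obj D (n - 1))),
     diff = (\<lambda>n x. (\<ominus>\<^bsub>obj C (n + 1)\<^esub> diff C n (fst x), f n (fst x) \<oplus>\<^bsub>obj D n\<^esub> diff D (n - 1) (snd x)))\<rparr>"

lemma cone_simps [simp]:
  "obj (cone C D f) n = prod_module (obj C n) (obj D (n - 1))"
  "diff (cone C D f) n x = (\<ominus>\<^bsub>obj C (n + 1)\<^esub> diff C n (fst x), f n (fst x) \<oplus>\<^bsub>obj D n\<^esub> diff D (n - 1) (snd x))"
  by (simp_all add: cone_def)

definition acyclic_complex :: "('r, 'a) cochain_complex \<Rightarrow> bool" where
  "acyclic_complex C \<longleftrightarrow> (\<forall>n. cocycles C n \<subseteq> coboundaries C n)"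

definition cone_functor :: "('r, 'p, 'a) cx_functor \<Rightarrow> ('r, 'p, 'b) cx_functor \<Rightarrow> ('p \<Rightarrow> int \<Rightarrow> 'a \<Rightarrow> 'b) \<Rightarrow>
    ('r, 'p, 'a \<times> 'b) cx_functor" where
  "cone_functor X Y \<phi> = \<lparr>Cob = (\<lambda>p. cone (Cob X p) (Cob Y p) (\<phi> p)),
     Car = (\<lambda>p q n x. (Car X p q n (fst x), Car Y p q (n - 1) (snd x)))\<rparr>"

lemma cone_functor_simps [simp]:
  "Cob (cone_functor X Y \<phi>) p = cone (Cob X p) (Cob Y p) (\<phi> p)"
  "Car (cone_functor X Y \<phi>) p q n x = (Car X p q n (fst x), Car Y p q (n - 1) (snd x))"
  by (simp_all add: cone_functor_def)

context cring_base
begin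

lemma prod_is_module:
  assumes M: "module R M" and N: "module R N"
  shows "module R (prod_module M N)"
proof (intro moduleI abelian_groupI is_cring)
  fix x assume "x \<in> carrier (prod_module M N)"
  then show "\<exists>y\<in>carrier (prod_module M N). y \<oplus>\<^bsub>prod_module M N\<^esub> x = \<zero>\<^bsub>prod_module M N\<^esub>"
    using M N by (intro bexI[of _ "(\<ominus>\<^bsub>M\<^esub> fst x, \<ominus>\<^bsub>N\<^esub> snd x)"]) auto
qed (use M N in \<open>auto simp: module_ac module_smult\<close>)

lemma complexI:
  assumes "\<And>n. module R (obj C n)"
    "\<And>n x. x \<in> carrier (obj C n) \<Longrightarrow> diff C n x \<in> carrier (obj C (n + 1))"
    "\<And>n x y. x \<in> carrier (obj C n) \<Longrightarrow> y \<in> carrier (obj C n) \<Longrightarrow>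
      diff C n (x \<oplus>\<^bsub>obj C n\<^esub> y) = diff C n x \<oplus>\<^bsub>obj C (n + 1)\<^esub> diff C n y"
    "\<And>n a x. a \<in> carrier R \<Longrightarrow> x \<in> carrier (obj C n) \<Longrightarrow>
      diff C n (a \<odot>\<^bsub>obj C n\<^esub> x) = a \<odot>\<^bsub>obj C (n + 1)\<^esub> diff C n x"
    "\<And>n x. x \<in> carrier (obj C n) \<Longrightarrow> diff C (n + 1) (diff C n x) = \<zero>\<^bsub>obj C (n + 2)\<^esub>"
  shows "is_complex R C"
  using assms unfolding is_complex_def by (auto intro!: module_homI)

lemma cone_complex:
  assumes C: "is_complex R C" and D: "is_complex R D" and f: "chain_map R C D f"
  shows "is_complex R (cone C D f)"
proof (rule complexI)
  note C' = complexD(1,3)[OF C] diffD[OF C] and D' = complexD(1)[OF D] diff_intoD[OF D] diff_diff[OF D]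
    and f' = chain_mapD[OF f C D]
  fix n
  show "module R (obj (cone C D f) n)" by (simp add: prod_is_module C' D')
  fix x assume x: "x \<in> carrier (obj (cone C D f) n)"
  then show "diff (cone C D f) n x \<in> carrier (obj (cone C D f) (n + 1))"
    by (auto simp: C' D' f')
  show "diff (cone C D f) n (x \<oplus>\<^bsub>obj (cone C D f) n\<^esub> y) =
      diff (cone C D f) n x \<oplus>\<^bsub>obj (cone C D f) (n + 1)\<^esub> diff (cone C D f) n y"
    if "y \<in> carrier (obj (cone C D f) n)" for y
    using x that by (auto simp: C' D' f' module_ac)
  show "diff (cone C D f) n (a \<odot>\<^bsub>obj (cone C D f) n\<^esub> x) =
      a \<odot>\<^bsub>obj (cone C D f) (n + 1)\<^esub> diff (cone C D f) n x" if "a \<in> carrier R" for a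
    using x that by (auto simp: C' D' f' module_smult)
  note Dn = diffD[OF D, where n = n]
  note i = add.commute[of 1 n] add.commute[of 2 n]
  show "diff (cone C D f) (n + 1) (diff (cone C D f) n x) = \<zero>\<^bsub>obj (cone C D f) (n + 2)\<^esub>"
    using x by (auto simp: C' D' f' Dn module_ac i)
qed

text \<open>A cocycle \<open>(x, y)\<close> of the cone is a cocycle \<open>x\<close> together with a reason why \<open>f x\<close> is a coboundary. That it
  is itself a coboundary combines injectivity of \<open>f\<close> on cohomology, which makes \<open>x\<close> a coboundary, with
  surjectivity one degree lower, which accounts for \<open>y\<close>. Conversely both properties are read off from
  suitable cocycles.\<close>

lemma cone_acyclic_iff:
  assumes C: "is_complex R C" and D: "is_complex R D" and f: "chain_map R C D f"
  shows "acyclic_complex (cone C D f) \<longleftrightarrow> (\<forall>n. cohomology_iso_at C D f n)"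
proof
  note C' = complexD(1)[OF C] diff_intoD[OF C] and D' = complexD(1)[OF D] diff_intoD[OF D] diff_diff[OF D]
    and f' = chain_mapD[OF f C D]
  {
    assume a: "acyclic_complex (cone C D f)"
    show "\<forall>n. cohomology_iso_at C D f n"
      unfolding cohomology_iso_at_def
    proof (intro allI conjI ballI impI)
      fix n x assume x: "x \<in> cocycles C n" "f n x \<in> coboundaries D n"
      then obtain y where y: "y \<in> carrier (obj D (n - 1))" "f n x = diff D (n - 1) y"
        by (auto simp: coboundaries_def)
      with x have "(x, \<ominus>\<^bsub>obj D (n - 1)\<^esub> y) \<in> cocycles (cone C D f) n"
        by (auto simp: cocycles_def C' D')
      with a have "(x, \<ominus>\<^bsub>obj D (n - 1)\<^esub> y) \<in> coboundaries (cone C D f) n"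
        by (auto simp: acyclic_complex_def)
      then obtain u where u: "u \<in> carrier (obj C (n - 1))" "x = \<ominus>\<^bsub>obj C n\<^esub> diff C (n - 1) u"
        by (auto simp: coboundaries_def)
      then have "x = diff C (n - 1) (\<ominus>\<^bsub>obj C (n - 1)\<^esub> u)" by (simp add: C')
      from image_eqI[where f = "diff C (n - 1)", OF this] u show "x \<in> coboundaries C n"
        by (simp add: coboundaries_def C')
    next
      fix n y assume y: "y \<in> cocycles D n"
      then have "(\<zero>\<^bsub>obj C (n + 1)\<^esub>, y) \<in> cocycles (cone C D f) (n + 1)"
        using f'(4) by (auto simp: cocycles_def C' D' diffD[OF C] diffD[OF D] add.commute[of 1 n])
      with a have "(\<zero>\<^bsub>obj C (n + 1)\<^esub>, y) \<in> coboundaries (cone C D f) (n + 1)"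
        by (auto simp: acyclic_complex_def)
      then obtain u v where uv: "u \<in> carrier (obj C n)" "v \<in> carrier (obj D (n - 1))"
        "\<zero>\<^bsub>obj C (n + 1)\<^esub> = \<ominus>\<^bsub>obj C (n + 1)\<^esub> diff C n u" "y = f n u \<oplus>\<^bsub>obj D n\<^esub> diff D (n - 1) v"
        by (auto simp: coboundaries_def)
      have "diff C n u = \<ominus>\<^bsub>obj C (n + 1)\<^esub> (\<ominus>\<^bsub>obj C (n + 1)\<^esub> diff C n u)"
        using uv(1) by (simp add: C' diffD[OF C])
      also have "\<dots> = \<zero>\<^bsub>obj C (n + 1)\<^esub>" using C' by (simp add: uv(3)[symmetric])
      finally show "\<exists>x\<in>cocycles C n. \<exists>b\<in>coboundaries D n. y = f n x \<oplus>\<^bsub>obj D n\<^esub> b"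
        using uv(1,2,4) by (auto simp: cocycles_def coboundaries_def)
    qed
  }
  assume i: "\<forall>n. cohomology_iso_at C D f n"
  show "acyclic_complex (cone C D f)"
    unfolding acyclic_complex_def
  proof (intro allI subsetI)
    fix n c assume "c \<in> cocycles (cone C D f) n"
    then obtain x y where c: "c = (x, y)" and x: "x \<in> carrier (obj C n)" and y: "y \<in> carrier (obj D (n - 1))"
      and dx: "\<ominus>\<^bsub>obj C (n + 1)\<^esub> diff C n x = \<zero>\<^bsub>obj C (n + 1)\<^esub>"
      and fx: "f n x \<oplus>\<^bsub>obj D n\<^esub> diff D (n - 1) y = \<zero>\<^bsub>obj D n\<^esub>"
      by (cases c) (auto simp: cocycles_def)
    have "diff C n x = \<ominus>\<^bsub>obj C (n + 1)\<^esub> (\<ominus>\<^bsub>obj C (n + 1)\<^esub> diff C n x)"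
      using x by (simp add: C' diffD[OF C])
    then have xZ: "x \<in> cocycles C n" using dx x C' by (simp add: cocycles_def)
    have "f n x = \<ominus>\<^bsub>obj D n\<^esub> diff D (n - 1) y"
      using fx x y by (intro module_minus_unique) (auto simp: D' f' module_ac)
    also have "\<dots> = diff D (n - 1) (\<ominus>\<^bsub>obj D (n - 1)\<^esub> y)" using y by (simp add: D')
    finally have fx': "f n x = diff D (n - 1) (\<ominus>\<^bsub>obj D (n - 1)\<^esub> y)" .
    then have "f n x \<in> coboundaries D n" unfolding coboundaries_def
      by (rule image_eqI[where f = "diff D (n - 1)"]) (use y in \<open>simp add: D'\<close>)
    with i xZ obtain u where u: "u \<in> carrier (obj C (n - 1))" "x = diff C (n - 1) u"
      unfolding cohomology_iso_at_def coboundaries_def by blast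
    \<comment> \<open>Subtracting the differential of \<open>(- u, 0)\<close> from \<open>(x, y)\<close> leaves \<open>(0, w)\<close>.\<close>
    define w where "w = y \<oplus>\<^bsub>obj D (n - 1)\<^esub> f (n - 1) u"
    have "diff D (n - 1) w = diff D (n - 1) y \<oplus>\<^bsub>obj D n\<^esub> f n x"
      unfolding w_def using u y by (simp add: D' f')
    also have "\<dots> = \<zero>\<^bsub>obj D n\<^esub>" using fx x y by (simp add: module_ac D' f')
    finally have "w \<in> cocycles D (n - 1)" using y u by (simp add: cocycles_def w_def D' f')
    with i obtain z b where z: "z \<in> cocycles C (n - 1)" and b: "b \<in> carrier (obj D (n - 1 - 1))"
      and w: "w = f (n - 1) z \<oplus>\<^bsub>obj D (n - 1)\<^esub> diff D (n - 1 - 1) b"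
      unfolding cohomology_iso_at_def coboundaries_def by blast
    have zc: "z \<in> carrier (obj C (n - 1))" "diff C (n - 1) z = \<zero>\<^bsub>obj C n\<^esub>" using z by (auto simp: cocycles_def)
    have db: "diff D (n - 1 - 1) b \<in> carrier (obj D (n - 1))" using b by (rule D'(2))
    let ?a = "z \<oplus>\<^bsub>obj C (n - 1)\<^esub> \<ominus>\<^bsub>obj C (n - 1)\<^esub> u"
    have "\<ominus>\<^bsub>obj C n\<^esub> diff C (n - 1) ?a = x" using zc u x by (simp add: C')
    moreover have "f (n - 1) ?a \<oplus>\<^bsub>obj D (n - 1)\<^esub> diff D (n - 1 - 1) b = w \<oplus>\<^bsub>obj D (n - 1)\<^esub> \<ominus>\<^bsub>obj D (n - 1)\<^esub> f (n - 1) u"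
      unfolding w using zc u db by (simp add: f' C' D' module_ac del: diff_diff_eq)
    moreover have "\<dots> = y" unfolding w_def using y u by (simp add: f' D' module_ac)
    ultimately have "c = diff (cone C D f) (n - 1) (?a, b)" by (simp add: c)
    moreover have "(?a, b) \<in> carrier (obj (cone C D f) (n - 1))" using zc u b C' by simp
    ultimately show "c \<in> coboundaries (cone C D f) n" unfolding coboundaries_def by blast
  qed
qed

lemma cone_cx_functor:
  assumes X: "is_cx_functor R S leq X" and Y: "is_cx_functor R S leq Y" and \<phi>: "cx_nat R S leq X Y \<phi>"
  shows "is_cx_functor R S leq (cone_functor X Y \<phi>)"
  unfolding is_cx_functor_def
proof (intro conjI ballI allI impI)
  note X' = cx_functorD[OF X] Car_simps[OF X] and Y' = cx_functorD[OF Y] Car_simps[OF Y]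
    and \<phi>' = cx_natD[OF \<phi> X Y]
  have ch: "chain_map R (Cob X p) (Cob Y p) (\<phi> p)" if "p \<in> S" for p
    using \<phi> that by (simp add: cx_nat_def)
  show "is_complex R (Cob (cone_functor X Y \<phi>) p)" if "p \<in> S" for p
    using that by (simp add: cone_complex X' Y' ch)
  show "is_mod_functor R S leq (degree_part (cone_functor X Y \<phi>) n)" for n
    by (rule mod_functorI) (auto simp: X' Y' prod_is_module)
  fix p q assume pq: "p \<in> S" "q \<in> S" "leq p q"
  note Xp = diffD[OF X'(2)[OF pq(1)]] and Yp = diff_intoD[OF Y'(2)[OF pq(1)]] Y'(3)[OF pq(1)]
  note Xq = X'(3)[OF pq(2)] and Yq = diff_intoD[OF Y'(2)[OF pq(2)]] Y'(3)[OF pq(2)]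
  show "chain_map R (Cob (cone_functor X Y \<phi>) p) (Cob (cone_functor X Y \<phi>) q) (Car (cone_functor X Y \<phi>) p q)"
    unfolding chain_map_def
    using pq by (auto intro!: module_homI simp: X' Y' \<phi>' Xp Yp Xq Yq)
qed

end

lemma coboundariesI:
  "y \<in> carrier (obj C (n - 1)) \<Longrightarrow> x = diff C (n - 1) y \<Longrightarrow> x \<in> coboundaries C n"
  by (auto simp: coboundaries_def)

section \<open>Limits of fibrant functors\<close>

lemma lim_mod_simps [simp]:
  "\<zero>\<^bsub>lim_mod S leq F\<^esub> = (\<lambda>p\<in>S. \<zero>\<^bsub>Mob F p\<^esub>)"
  "x \<oplus>\<^bsub>lim_mod S leq F\<^esub> y = (\<lambda>p\<in>S. x p \<oplus>\<^bsub>Mob F p\<^esub> y p)"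
  "a \<odot>\<^bsub>lim_mod S leq F\<^esub> x = (\<lambda>p\<in>S. a \<odot>\<^bsub>Mob F p\<^esub> x p)"
  "obj (lim_cx S leq G) n = lim_mod S leq (degree_part G n)"
  "diff (lim_cx S leq G) n x = (\<lambda>p\<in>S. diff (Cob G p) n (x p))"
  by (simp_all add: lim_mod_def lim_cx_def)

lemma lim_mod_carrier:
  "x \<in> carrier (lim_mod S leq F) \<longleftrightarrow> x \<in> extensional S \<and> (\<forall>p\<in>S. x p \<in> carrier (Mob F p)) \<and>
    (\<forall>p\<in>S. \<forall>q\<in>S. leq p q \<longrightarrow> Mar F p q (x p) = x q)"
  by (auto simp: lim_mod_def PiE_iff)

definition lim_map :: "'p set \<Rightarrow> ('p \<Rightarrow> int \<Rightarrow> 'a \<Rightarrow> 'b) \<Rightarrow> int \<Rightarrow> ('p \<Rightarrow> 'a) \<Rightarrow> 'p \<Rightarrow> 'b" where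
  "lim_map S \<phi> n x = (\<lambda>p\<in>S. \<phi> p n (x p))"

context cring_base
begin

lemma lim_is_module:
  assumes F: "is_mod_functor R S leq F"
  shows "module R (lim_mod S leq F)"
proof (intro moduleI abelian_groupI is_cring)
  note F' = mod_functorD[OF F]
  fix x assume x: "x \<in> carrier (lim_mod S leq F)"
  have "(\<lambda>p\<in>S. \<ominus>\<^bsub>Mob F p\<^esub> x p) \<in> carrier (lim_mod S leq F)"
    using x by (auto simp: lim_mod_carrier F')
  moreover have "(\<lambda>p\<in>S. \<ominus>\<^bsub>Mob F p\<^esub> x p) \<oplus>\<^bsub>lim_mod S leq F\<^esub> x = \<zero>\<^bsub>lim_mod S leq F\<^esub>"
    using x by (auto simp: lim_mod_carrier F' intro!: restrict_ext)
  ultimately show "\<exists>y\<in>carrier (lim_mod S leq F). y \<oplus>\<^bsub>lim_mod S leq F\<^esub> x = \<zero>\<^bsub>lim_mod S leq F\<^esub>" by blast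
next
  note F' = mod_functorD[OF F]
  fix x assume "x \<in> carrier (lim_mod S leq F)"
  then show "\<zero>\<^bsub>lim_mod S leq F\<^esub> \<oplus>\<^bsub>lim_mod S leq F\<^esub> x = x" "\<one> \<odot>\<^bsub>lim_mod S leq F\<^esub> x = x"
    by (auto simp: lim_mod_carrier F' extensional_def restrict_def)
qed (use mod_functorD[OF F] in \<open>auto simp: lim_mod_carrier module_smult intro!: restrict_ext simp: module_ac\<close>)

lemma lim_complex:
  assumes G: "is_cx_functor R S leq G"
  shows "is_complex R (lim_cx S leq G)"
proof (rule complexI)
  note G' = cx_functorD[OF G] Car_simps[OF G]
  note Gd = diffD[OF G'(2)] complexD(3)[OF G'(2)]
  fix n show "module R (obj (lim_cx S leq G) n)" by (simp add: lim_is_module[OF G'(1)])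
  fix x assume x: "x \<in> carrier (obj (lim_cx S leq G) n)"
  then show "diff (lim_cx S leq G) n x \<in> carrier (obj (lim_cx S leq G) (n + 1))"
    by (auto simp: lim_mod_carrier Gd G'(1-5) simp: Car_simps(6)[OF G])
  show "diff (lim_cx S leq G) (n + 1) (diff (lim_cx S leq G) n x) = \<zero>\<^bsub>obj (lim_cx S leq G) (n + 2)\<^esub>"
    using x by (auto simp: lim_mod_carrier Gd intro!: restrict_ext)
  show "diff (lim_cx S leq G) n (x \<oplus>\<^bsub>obj (lim_cx S leq G) n\<^esub> y) =
      diff (lim_cx S leq G) n x \<oplus>\<^bsub>obj (lim_cx S leq G) (n + 1)\<^esub> diff (lim_cx S leq G) n y"
    if "y \<in> carrier (obj (lim_cx S leq G) n)" for y
    using x that by (auto simp: lim_mod_carrier Gd intro!: restrict_ext)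
  show "diff (lim_cx S leq G) n (a \<odot>\<^bsub>obj (lim_cx S leq G) n\<^esub> x) =
      a \<odot>\<^bsub>obj (lim_cx S leq G) (n + 1)\<^esub> diff (lim_cx S leq G) n x" if "a \<in> carrier R" for a
    using x that by (auto simp: lim_mod_carrier Gd intro!: restrict_ext)
qed

lemma fibrantD:
  assumes "fibrant R P G" "p \<in> P" "w \<in> carrier (lim_mod (below P p) (\<ge>) (degree_part G n))"
  obtains x where "x \<in> carrier (obj (Cob G p) n)" "\<And>q. q \<in> P \<Longrightarrow> q < p \<Longrightarrow> Car G p q n x = w q"
proof -
  from assms have "w \<in> matching_map P G p n ` carrier (obj (Cob G p) n)" by (simp add: fibrant_def)
  then obtain x where "x \<in> carrier (obj (Cob G p) n)" "w = matching_map P G p n x" by blast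
  then show ?thesis by (intro that[of x]) (auto simp: matching_map_def below_def)
qed

text \<open>A cocycle of the limit over a lower set is bounded by choosing primitives along the order: the
  matching condition extends the choices made below \<open>p\<close>, and the error is a cocycle in the kernel of
  the matching map.\<close>

lemma lim_primitive_if_kernels_acyclic:
  fixes P :: "'p::order set" and d :: "'p \<Rightarrow> nat"
  assumes d: "strict_mono_on P d" and fib: "fibrant R P G"
    and T: "T \<subseteq> P" "\<And>p q. p \<in> T \<Longrightarrow> q \<in> P \<Longrightarrow> q < p \<Longrightarrow> q \<in> T"
    and K: "\<And>p k. p \<in> T \<Longrightarrow> k \<in> cocycles (Cob G p) n \<Longrightarrow>
      (\<And>q. q \<in> P \<Longrightarrow> q < p \<Longrightarrow> Car G p q n k = \<zero>\<^bsub>obj (Cob G q) n\<^esub>) \<Longrightarrow>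
      \<exists>z\<in>carrier (obj (Cob G p) (n - 1)). diff (Cob G p) (n - 1) z = k \<and>
        (\<forall>q\<in>P. q < p \<longrightarrow> Car G p q (n - 1) z = \<zero>\<^bsub>obj (Cob G q) (n - 1)\<^esub>)"
    and x: "x \<in> cocycles (lim_cx T (\<ge>) G) n"
  shows "x \<in> coboundaries (lim_cx T (\<ge>) G) n"
proof -
  have G: "is_cx_functor R P (\<ge>) G" using fib by (simp add: fibrant_def)
  note G' = cx_functorD[OF G]
  note Gd = diff_intoD[OF G'(2)]
  note C = Car_simps[OF G]
  have xT: "x p \<in> carrier (obj (Cob G p) n)" "diff (Cob G p) n (x p) = \<zero>\<^bsub>obj (Cob G p) (n + 1)\<^esub>" if "p \<in> T" for p
  proof -
    from x that show "x p \<in> carrier (obj (Cob G p) n)" by (simp add: cocycles_def lim_mod_carrier)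
    from x have "diff (lim_cx T (\<ge>) G) n x = \<zero>\<^bsub>obj (lim_cx T (\<ge>) G) (n + 1)\<^esub>" by (simp add: cocycles_def)
    from fun_cong[OF this, of p] that show "diff (Cob G p) n (x p) = \<zero>\<^bsub>obj (Cob G p) (n + 1)\<^esub>" by simp
  qed
  have xc: "Car G p q n (x p) = x q" if "p \<in> T" "q \<in> T" "q \<le> p" for p q
    using x that by (auto simp: cocycles_def lim_mod_carrier)
  define Q where "Q f p y \<longleftrightarrow> (p \<in> T \<longrightarrow> y \<in> carrier (obj (Cob G p) (n - 1)) \<and>
      diff (Cob G p) (n - 1) y = x p \<and> (\<forall>q\<in>T. q < p \<longrightarrow> Car G p q (n - 1) y = f q))" for f p y
  have dT: "d q < d p" if "q \<in> T" "p \<in> T" "q < p" for p q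
    using d T(1) that unfolding strict_mono_on_def by blast
  have wf: "wf {(q, p). q \<in> T \<and> p \<in> T \<and> q < p}"
    by (rule wf_subset[of "measure d"]) (auto intro: dT)
  have adm: "Q f p y = Q g p y" if "\<And>z. (z, p) \<in> {(q, p). q \<in> T \<and> p \<in> T \<and> q < p} \<Longrightarrow> f z = g z" for f g p y
    using that by (auto simp: Q_def)
  have step: "\<exists>y. Q f p y" if f: "\<And>q. (q, p) \<in> {(q, p). q \<in> T \<and> p \<in> T \<and> q < p} \<Longrightarrow> Q f q (f q)" for p f
  proof (cases "p \<in> T")
    case True
    with T have p: "p \<in> P" by blast
    have below: "q \<in> T" if "q \<in> below P p" for q using T(2)[OF True] that by (auto simp: below_def)
    have f: "f q \<in> carrier (obj (Cob G q) (n - 1))" "diff (Cob G q) (n - 1) (f q) = x q"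
      "\<And>s. s \<in> T \<Longrightarrow> s < q \<Longrightarrow> Car G q s (n - 1) (f q) = f s" if "q \<in> T" "q < p" for q
      using f[of q] that True by (auto simp: Q_def)
    have "(\<lambda>q\<in>below P p. f q) \<in> carrier (lim_mod (below P p) (\<ge>) (degree_part G (n - 1)))"
      unfolding lim_mod_carrier
    proof (intro conjI ballI impI)
      fix q s assume qs: "q \<in> below P p" "s \<in> below P p" "q \<ge> s"
      then have "q \<in> T" "s \<in> T" "q < p" "q \<in> P" using below by (auto simp: below_def)
      then have "Car G q s (n - 1) (f q) = f s" using f qs(3) G'(5) by (cases "q = s") auto
      then show "Mar (degree_part G (n - 1)) q s ((\<lambda>q\<in>below P p. f q) q) = (\<lambda>q\<in>below P p. f q) s"
        using qs by simp
    qed (use below f in \<open>auto simp: below_def\<close>)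
    from fibrantD[OF fib p this] obtain y where y: "y \<in> carrier (obj (Cob G p) (n - 1))"
      "\<And>q. q \<in> P \<Longrightarrow> q < p \<Longrightarrow> Car G p q (n - 1) y = (\<lambda>q\<in>below P p. f q) q" by blast
    have yf: "Car G p q (n - 1) y = f q" if "q \<in> P" "q < p" for q
      using y(2)[OF that] that by (simp add: below_def)
    let ?k = "x p \<oplus>\<^bsub>obj (Cob G p) n\<^esub> \<ominus>\<^bsub>obj (Cob G p) n\<^esub> diff (Cob G p) (n - 1) y"
    have "?k \<in> cocycles (Cob G p) n"
      using p y(1) xT[OF True] by (simp add: cocycles_def Gd diffD[OF G'(2)] diff_diff[OF G'(2)] G'(3))
    moreover have "Car G p q n ?k = \<zero>\<^bsub>obj (Cob G q) n\<^esub>" if "q \<in> P" "q < p" for q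
    proof -
      have qT: "q \<in> T" using T(2)[OF True] that by blast
      then show ?thesis using p that y(1) xT[OF True] xT[OF qT] f[OF qT that(2)] xc[OF True qT] yf[OF that]
        by (simp add: C Gd G'(3))
    qed
    ultimately obtain z where z: "z \<in> carrier (obj (Cob G p) (n - 1))" "diff (Cob G p) (n - 1) z = ?k"
      "\<And>q. q \<in> P \<Longrightarrow> q < p \<Longrightarrow> Car G p q (n - 1) z = \<zero>\<^bsub>obj (Cob G q) (n - 1)\<^esub>"
      using K[OF True] by blast
    have "Q f p (y \<oplus>\<^bsub>obj (Cob G p) (n - 1)\<^esub> z)"
      unfolding Q_def
    proof (intro impI conjI ballI)
      show "diff (Cob G p) (n - 1) (y \<oplus>\<^bsub>obj (Cob G p) (n - 1)\<^esub> z) = x p"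
        using p y(1) z(1,2) xT[OF True] by (simp add: Gd G'(3) module_ac)
      fix q assume "q \<in> T" "q < p"
      then show "Car G p q (n - 1) (y \<oplus>\<^bsub>obj (Cob G p) (n - 1)\<^esub> z) = f q"
        using p y(1) z(1,3) T(1) yf[of q] f[of q] C(2)[of p q y "n - 1" z] G'(3)[of q] by auto
    qed (use p y z in \<open>simp add: G'(3)\<close>)
    then show ?thesis ..
  qed (simp add: Q_def)
  obtain y where y: "\<And>p. Q y p (y p)"
    using dependent_wf_choice[of _ Q, OF wf adm step] by blast
  have "(\<lambda>p\<in>T. y p) \<in> carrier (lim_mod T (\<ge>) (degree_part G (n - 1)))"
    unfolding lim_mod_carrier
  proof (intro conjI ballI impI)
    fix q s assume qs: "q \<in> T" "s \<in> T" "q \<ge> s"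
    then have "Car G q s (n - 1) (y q) = y s" using y[of q] G'(5)[of q] T by (cases "q = s") (auto simp: Q_def)
    then show "Mar (degree_part G (n - 1)) q s ((\<lambda>p\<in>T. y p) q) = (\<lambda>p\<in>T. y p) s" using qs by simp
  qed (use y in \<open>auto simp: Q_def\<close>)
  then have "(\<lambda>p\<in>T. y p) \<in> carrier (obj (lim_cx T (\<ge>) G) (n - 1))" by simp
  moreover have "x = diff (lim_cx T (\<ge>) G) (n - 1) (\<lambda>p\<in>T. y p)"
  proof (rule extensionalityI[of _ T])
    show "x \<in> extensional T" using x by (simp add: cocycles_def lim_mod_carrier)
  qed (use y in \<open>auto simp: Q_def\<close>)
  ultimately show ?thesis by (rule coboundariesI)
qed

text \<open>A primitive \<open>w\<close> of \<open>k\<close> in \<open>G p\<close> need not vanish below \<open>p\<close>, but it restricts to a cocycle of the limit over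
  the elements below \<open>p\<close>. By hypothesis this is the differential of some \<open>u\<close>; lifting \<open>u\<close> to \<open>p\<close> gives the
  correction of \<open>w\<close>.\<close>

lemma matching_kernel_acyclic:
  fixes P :: "'p::order set"
  assumes fib: "fibrant R P G" and p: "p \<in> P" and ac: "acyclic_complex (Cob G p)"
    and below: "acyclic_complex (lim_cx (below P p) (\<ge>) G)"
    and k: "k \<in> cocycles (Cob G p) n" and k0: "\<And>q. q \<in> P \<Longrightarrow> q < p \<Longrightarrow> Car G p q n k = \<zero>\<^bsub>obj (Cob G q) n\<^esub>"
  shows "\<exists>z\<in>carrier (obj (Cob G p) (n - 1)). diff (Cob G p) (n - 1) z = k \<and>
    (\<forall>q\<in>P. q < p \<longrightarrow> Car G p q (n - 1) z = \<zero>\<^bsub>obj (Cob G q) (n - 1)\<^esub>)"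
proof -
  have G: "is_cx_functor R P (\<ge>) G" using fib by (simp add: fibrant_def)
  note G' = cx_functorD[OF G]
  note C = Car_simps[OF G]
  obtain w where w: "w \<in> carrier (obj (Cob G p) (n - 1))" "k = diff (Cob G p) (n - 1) w"
    using ac k by (auto simp: acyclic_complex_def coboundaries_def)
  let ?v = "\<lambda>q\<in>below P p. Car G p q (n - 1) w"
  have "?v \<in> cocycles (lim_cx (below P p) (\<ge>) G) (n - 1)"
    unfolding cocycles_def
  proof (intro CollectI conjI)
    show "?v \<in> carrier (obj (lim_cx (below P p) (\<ge>) G) (n - 1))"
      using p w(1) by (auto simp: lim_mod_carrier below_def C G')
    have "diff (Cob G q) (n - 1) (Car G p q (n - 1) w) = \<zero>\<^bsub>obj (Cob G q) n\<^esub>" if "q \<in> P" "q < p" for q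
      using k0[OF that] C(7)[of p q w n] p that w by simp
    then show "diff (lim_cx (below P p) (\<ge>) G) (n - 1) ?v = \<zero>\<^bsub>obj (lim_cx (below P p) (\<ge>) G) (n - 1 + 1)\<^esub>"
      by (auto simp: below_def intro!: restrict_ext)
  qed
  with below have "?v \<in> coboundaries (lim_cx (below P p) (\<ge>) G) (n - 1)" by (auto simp: acyclic_complex_def)
  then obtain u where u: "u \<in> carrier (lim_mod (below P p) (\<ge>) (degree_part G (n - 1 - 1)))"
    "?v = (\<lambda>q\<in>below P p. diff (Cob G q) (n - 1 - 1) (u q))" by (auto simp: coboundaries_def simp del: diff_diff_eq)
  from fibrantD[OF fib p u(1)] obtain u' where u': "u' \<in> carrier (obj (Cob G p) (n - 1 - 1))"
    "\<And>q. q \<in> P \<Longrightarrow> q < p \<Longrightarrow> Car G p q (n - 1 - 1) u' = u q" by blast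
  let ?du = "diff (Cob G p) (n - 1 - 1) u'"
  have du: "?du \<in> carrier (obj (Cob G p) (n - 1))" "diff (Cob G p) (n - 1) ?du = \<zero>\<^bsub>obj (Cob G p) n\<^esub>"
    using diff_intoD(1)[OF G'(2)[OF p] u'(1)] diff_diff[OF G'(2)[OF p] u'(1)] by simp_all
  have duq: "Car G p q (n - 1) ?du = Car G p q (n - 1) w" if "q \<in> P" "q < p" for q
  proof -
    have "Car G p q (n - 1) ?du = diff (Cob G q) (n - 1 - 1) (u q)"
      using C(7)[of p q u' "n - 1"] p that u' by simp
    then show ?thesis using fun_cong[OF u(2), of q] that by (simp add: below_def)
  qed
  let ?z = "w \<oplus>\<^bsub>obj (Cob G p) (n - 1)\<^esub> \<ominus>\<^bsub>obj (Cob G p) (n - 1)\<^esub> ?du"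
  have "diff (Cob G p) (n - 1) ?z = k"
    using diff_intoD[OF G'(2)[OF p]] w du G'(3)[OF p] by simp
  moreover have "Car G p q (n - 1) ?z = \<zero>\<^bsub>obj (Cob G q) (n - 1)\<^esub>" if "q \<in> P" "q < p" for q
    using C[of p q] p that w(1) du(1) duq[OF that] G'(3) by simp
  ultimately show ?thesis using w(1) du(1) G'(3)[OF p] by (intro bexI[of _ ?z]) auto
qed

text \<open>The two lemmas feed each other: acyclic kernels at the elements below \<open>p\<close> give an acyclic limit over
  these elements, which gives an acyclic kernel at \<open>p\<close>. The induction is on the rank \<open>d p\<close>.\<close>

theorem lim_fibrant_acyclic:
  fixes P :: "'p::order set"
  assumes P: "filtered_poset P" and fib: "fibrant R P G" and ac: "\<And>p. p \<in> P \<Longrightarrow> acyclic_complex (Cob G p)"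
  shows "acyclic_complex (lim_cx P (\<ge>) G)"
proof -
  from P obtain d :: "'p \<Rightarrow> nat" where d: "strict_mono_on P d" by (auto simp: filtered_poset_def)
  have below: "acyclic_complex (lim_cx (below P p) (\<ge>) G)" if "p \<in> P" for p
    using that
  proof (induction "d p" arbitrary: p rule: less_induct)
    case less
    show ?case
      unfolding acyclic_complex_def
    proof (intro allI subsetI)
      fix n x assume "x \<in> cocycles (lim_cx (below P p) (\<ge>) G) n"
      then show "x \<in> coboundaries (lim_cx (below P p) (\<ge>) G) n"
      proof (rule lim_primitive_if_kernels_acyclic[OF d fib, rotated 3])
        fix q k assume q: "q \<in> below P p"
          and k: "k \<in> cocycles (Cob G q) n" "\<And>s. s \<in> P \<Longrightarrow> s < q \<Longrightarrow> Car G q s n k = \<zero>\<^bsub>obj (Cob G s) n\<^esub>"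
        then have "d q < d p" "q \<in> P" using d less.prems by (auto simp: below_def strict_mono_on_def)
        with k show "\<exists>z\<in>carrier (obj (Cob G q) (n - 1)). diff (Cob G q) (n - 1) z = k \<and>
            (\<forall>s\<in>P. s < q \<longrightarrow> Car G q s (n - 1) z = \<zero>\<^bsub>obj (Cob G s) (n - 1)\<^esub>)"
          by (intro matching_kernel_acyclic[OF fib _ ac less.hyps]) auto
      qed (auto simp: below_def)
    qed
  qed
  show ?thesis
    unfolding acyclic_complex_def
  proof (intro allI subsetI)
    fix n x assume "x \<in> cocycles (lim_cx P (\<ge>) G) n"
    then show "x \<in> coboundaries (lim_cx P (\<ge>) G) n"
      by (rule lim_primitive_if_kernels_acyclic[OF d fib, rotated 3])
        (auto intro!: matching_kernel_acyclic[OF fib _ ac below])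
  qed
qed

lemma lim_map_chain_map:
  assumes X: "is_cx_functor R S leq X" and Y: "is_cx_functor R S leq Y" and \<phi>: "cx_nat R S leq X Y \<phi>"
  shows "chain_map R (lim_cx S leq X) (lim_cx S leq Y) (lim_map S \<phi>)"
proof -
  note \<phi>' = cx_natD[OF \<phi> X Y]
  have "\<phi> p (n + 1) (diff (Cob X p) n x) = diff (Cob Y p) n (\<phi> p n x)" if "p \<in> S" "x \<in> carrier (obj (Cob X p) n)" for p n x
    using \<phi>'(6) that by blast
  then show ?thesis
    unfolding chain_map_def
    by (auto simp: lim_map_def lim_mod_carrier \<phi>'(1-5) \<phi>'(8)[symmetric] intro!: module_homI restrict_ext)
qed

text \<open>The matching map of a cone is the product of the two matching maps.\<close>

lemma cone_fibrant:
  fixes P :: "'p::order set"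
  assumes X: "fibrant R P X" and Y: "fibrant R P Y" and \<phi>: "cx_nat R P (\<ge>) X Y \<phi>"
  shows "fibrant R P (cone_functor X Y \<phi>)"
proof -
  have X': "is_cx_functor R P (\<ge>) X" and Y': "is_cx_functor R P (\<ge>) Y" using X Y by (auto simp: fibrant_def)
  note XX = Car_simps[OF X'] cx_functorD[OF X'] and YY = Car_simps[OF Y'] cx_functorD[OF Y']
  let ?C = "cone_functor X Y \<phi>"
  have C: "is_cx_functor R P (\<ge>) ?C" by (rule cone_cx_functor[OF X' Y' \<phi>])
  have "matching_map P ?C p n ` carrier (obj (Cob ?C p) n) = carrier (obj (lim_cx (below P p) (\<ge>) ?C) n)"
    if p: "p \<in> P" for p n
  proof (intro subset_antisym subsetI)
    fix w assume "w \<in> matching_map P ?C p n ` carrier (obj (Cob ?C p) n)"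
    then obtain c where "c \<in> carrier (obj (Cob ?C p) n)" "w = matching_map P ?C p n c" by blast
    then show "w \<in> carrier (obj (lim_cx (below P p) (\<ge>) ?C) n)"
      using p by (auto simp: lim_mod_carrier matching_map_def below_def XX YY)
  next
    fix w assume w: "w \<in> carrier (obj (lim_cx (below P p) (\<ge>) ?C) n)"
    then have "(\<lambda>q\<in>below P p. fst (w q)) \<in> carrier (lim_mod (below P p) (\<ge>) (degree_part X n))"
      "(\<lambda>q\<in>below P p. snd (w q)) \<in> carrier (lim_mod (below P p) (\<ge>) (degree_part Y (n - 1)))"
      by (auto simp: lim_mod_carrier mem_Times_iff) (metis fst_conv snd_conv)+
    from fibrantD[OF X p this(1)] fibrantD[OF Y p this(2)] obtain x y where
      xy: "x \<in> carrier (obj (Cob X p) n)" "\<And>q. q \<in> P \<Longrightarrow> q < p \<Longrightarrow> Car X p q n x = (\<lambda>q\<in>below P p. fst (w q)) q"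
      "y \<in> carrier (obj (Cob Y p) (n - 1))" "\<And>q. q \<in> P \<Longrightarrow> q < p \<Longrightarrow> Car Y p q (n - 1) y = (\<lambda>q\<in>below P p. snd (w q)) q"
      by metis
    have "w = matching_map P ?C p n (x, y)"
    proof (rule extensionalityI[of _ "below P p"])
      show "w \<in> extensional (below P p)" using w by (simp add: lim_mod_carrier)
    qed (use xy in \<open>auto simp: matching_map_def below_def\<close>)
    with xy show "w \<in> matching_map P ?C p n ` carrier (obj (Cob ?C p) n)" by auto
  qed
  with C show ?thesis by (simp add: fibrant_def)
qed

text \<open>The limit of a cone is the cone of the limits, up to exchanging families of pairs and pairs of families.\<close>

lemma acyclic_cone_lim:
  assumes X: "is_cx_functor R S leq X" and Y: "is_cx_functor R S leq Y"
    and ac: "acyclic_complex (lim_cx S leq (cone_functor X Y \<phi>))"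
  shows "acyclic_complex (cone (lim_cx S leq X) (lim_cx S leq Y) (lim_map S \<phi>))"
  unfolding acyclic_complex_def
proof (intro allI subsetI)
  let ?C = "cone_functor X Y \<phi>" and ?D = "cone (lim_cx S leq X) (lim_cx S leq Y) (lim_map S \<phi>)"
  fix n c0 assume c: "c0 \<in> cocycles ?D n"
  obtain x y where xy: "c0 = (x, y)" by (cases c0)
  from c have x: "x \<in> carrier (lim_mod S leq (degree_part X n))"
    and y: "y \<in> carrier (lim_mod S leq (degree_part Y (n - 1)))"
    by (auto simp: cocycles_def xy)
  have m: "module R (lim_mod S leq (degree_part X m))" "module R (lim_mod S leq (degree_part Y m))" for m
    by (intro lim_is_module cx_functorD(1)[OF X] cx_functorD(1)[OF Y])+
  have neg: "(\<ominus>\<^bsub>lim_mod S leq (degree_part X m)\<^esub> u) p = \<ominus>\<^bsub>obj (Cob X p) m\<^esub> u p"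
    if "u \<in> carrier (lim_mod S leq (degree_part X m))" "p \<in> S" for m u p
  proof -
    let ?M = "lim_mod S leq (degree_part X m)"
    have "u \<oplus>\<^bsub>?M\<^esub> \<ominus>\<^bsub>?M\<^esub> u = \<zero>\<^bsub>?M\<^esub>" by (rule module_simps(9)[OF m(1) that(1)])
    from fun_cong[OF this, of p] that
    have "u p \<oplus>\<^bsub>obj (Cob X p) m\<^esub> (\<ominus>\<^bsub>?M\<^esub> u) p = \<zero>\<^bsub>obj (Cob X p) m\<^esub>" by simp
    moreover have "\<ominus>\<^bsub>?M\<^esub> u \<in> carrier ?M" using that m by simp
    ultimately show ?thesis
      using that cx_functorD(3)[OF X, of p m] by (intro module_minus_unique) (auto simp: lim_mod_carrier)
  qed
  have dx: "diff (lim_cx S leq X) n x \<in> carrier (lim_mod S leq (degree_part X (n + 1)))"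
    using diffD(1)[OF lim_complex[OF X], of x n] x by simp
  have "(\<lambda>p\<in>S. (x p, y p)) \<in> cocycles (lim_cx S leq ?C) n"
    unfolding cocycles_def
  proof (intro CollectI conjI)
    show "(\<lambda>p\<in>S. (x p, y p)) \<in> carrier (obj (lim_cx S leq ?C) n)"
      using x y by (auto simp: lim_mod_carrier)
    from c have e: "\<ominus>\<^bsub>lim_mod S leq (degree_part X (n + 1))\<^esub> diff (lim_cx S leq X) n x = (\<lambda>p\<in>S. \<zero>\<^bsub>obj (Cob X p) (n + 1)\<^esub>)"
      "(\<lambda>p\<in>S. lim_map S \<phi> n x p \<oplus>\<^bsub>obj (Cob Y p) n\<^esub> diff (lim_cx S leq Y) (n - 1) y p) = (\<lambda>p\<in>S. \<zero>\<^bsub>obj (Cob Y p) n\<^esub>)"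
      by (auto simp: cocycles_def xy cong: if_cong)
    have "\<ominus>\<^bsub>obj (Cob X p) (n + 1)\<^esub> diff (Cob X p) n (x p) = \<zero>\<^bsub>obj (Cob X p) (n + 1)\<^esub>" if "p \<in> S" for p
      using fun_cong[OF e(1), of p] neg[OF dx that] that by simp
    moreover have "\<phi> p n (x p) \<oplus>\<^bsub>obj (Cob Y p) n\<^esub> diff (Cob Y p) (n - 1) (y p) = \<zero>\<^bsub>obj (Cob Y p) n\<^esub>" if "p \<in> S" for p
      using fun_cong[OF e(2), of p] that by (simp add: lim_map_def)
    ultimately show "diff (lim_cx S leq ?C) n (\<lambda>p\<in>S. (x p, y p)) = \<zero>\<^bsub>obj (lim_cx S leq ?C) (n + 1)\<^esub>"
      by (auto intro!: restrict_ext)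
  qed
  with ac have "(\<lambda>p\<in>S. (x p, y p)) \<in> coboundaries (lim_cx S leq ?C) n" by (auto simp: acyclic_complex_def)
  then obtain c where c: "c \<in> carrier (lim_mod S leq (degree_part ?C (n - 1)))"
    "(\<lambda>p\<in>S. (x p, y p)) = diff (lim_cx S leq ?C) (n - 1) c" by (auto simp: coboundaries_def simp del: diff_diff_eq)
  let ?u = "\<lambda>p\<in>S. fst (c p)" and ?v = "\<lambda>p\<in>S. snd (c p)"
  have uv: "?u \<in> carrier (lim_mod S leq (degree_part X (n - 1)))"
    "?v \<in> carrier (lim_mod S leq (degree_part Y (n - 1 - 1)))"
    using c(1) by (auto simp: lim_mod_carrier mem_Times_iff simp del: diff_diff_eq) (metis fst_conv snd_conv)+
  have du: "diff (lim_cx S leq X) (n - 1) ?u \<in> carrier (lim_mod S leq (degree_part X n))"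
    using diff_intoD(1)[OF lim_complex[OF X], of ?u n] uv by simp
  have e: "x p = \<ominus>\<^bsub>obj (Cob X p) n\<^esub> diff (Cob X p) (n - 1) (fst (c p))"
    "y p = \<phi> p (n - 1) (fst (c p)) \<oplus>\<^bsub>obj (Cob Y p) (n - 1)\<^esub> diff (Cob Y p) (n - 1 - 1) (snd (c p))" if "p \<in> S" for p
    using fun_cong[OF c(2), of p] that by auto
  have "x = \<ominus>\<^bsub>lim_mod S leq (degree_part X n)\<^esub> diff (lim_cx S leq X) (n - 1) ?u"
  proof (rule extensionalityI[of _ S])
    have "\<ominus>\<^bsub>lim_mod S leq (degree_part X n)\<^esub> diff (lim_cx S leq X) (n - 1) ?u \<in> carrier (lim_mod S leq (degree_part X n))"
      using du m by simp
    then show "\<ominus>\<^bsub>lim_mod S leq (degree_part X n)\<^esub> diff (lim_cx S leq X) (n - 1) ?u \<in> extensional S"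
      unfolding lim_mod_carrier by blast
  qed (use x neg[OF du] e in \<open>auto simp: lim_mod_carrier\<close>)
  moreover have "y = lim_map S \<phi> (n - 1) ?u \<oplus>\<^bsub>lim_mod S leq (degree_part Y (n - 1))\<^esub> diff (lim_cx S leq Y) (n - 1 - 1) ?v"
    by (rule extensionalityI[of _ S]) (use y e in \<open>auto simp: lim_mod_carrier lim_map_def\<close>)
  ultimately have "(x, y) = diff ?D (n - 1) (?u, ?v)" by simp
  moreover have "(?u, ?v) \<in> carrier (obj ?D (n - 1))" using uv by simp
  ultimately show "c0 \<in> coboundaries ?D n"
    unfolding coboundaries_def xy by blast
qed

theorem lim_weak_equivalence:
  fixes P :: "'p::order set"
  assumes P: "filtered_poset P" and X: "fibrant R P X" and Y: "fibrant R P Y" and \<phi>: "cx_nat R P (\<ge>) X Y \<phi>"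
    and iso: "\<And>p n. p \<in> P \<Longrightarrow> cohomology_iso_at (Cob X p) (Cob Y p) (\<phi> p) n"
  shows "isomorphic_modules R (cohomology (lim_cx P (\<ge>) X) n) (cohomology (lim_cx P (\<ge>) Y) n)"
proof -
  have X': "is_cx_functor R P (\<ge>) X" and Y': "is_cx_functor R P (\<ge>) Y" using X Y by (auto simp: fibrant_def)
  have "acyclic_complex (Cob (cone_functor X Y \<phi>) p)" if "p \<in> P" for p
    using that \<phi> by (simp add: cone_acyclic_iff[OF cx_functorD(2)[OF X'] cx_functorD(2)[OF Y']] cx_nat_def iso)
  then have "acyclic_complex (lim_cx P (\<ge>) (cone_functor X Y \<phi>))"
    by (intro lim_fibrant_acyclic[OF P cone_fibrant[OF X Y \<phi>]])
  then have "acyclic_complex (cone (lim_cx P (\<ge>) X) (lim_cx P (\<ge>) Y) (lim_map P \<phi>))"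
    by (rule acyclic_cone_lim[OF X' Y'])
  then show ?thesis
    using cone_acyclic_iff cohomology_map_iso(2) lim_complex[OF X'] lim_complex[OF Y'] lim_map_chain_map[OF X' Y' \<phi>]
    by metis
qed

end

section \<open>Linear relations between functors\<close>

context poset_diagrams
begin

text \<open>A linear relation is a subfunctor of \<open>F \<times> G\<close>. Extension problems along monomorphisms are
  single-valued relations, lifting problems along epimorphisms are total ones.\<close>

definition linear_relation ::
  "('r, 'p, 'f) mod_functor \<Rightarrow> ('r, 'p, 'g) mod_functor \<Rightarrow> ('p \<Rightarrow> ('f \<times> 'g) set) \<Rightarrow> bool" where
  "linear_relation F G \<Gamma> \<longleftrightarrow>
    (\<forall>p\<in>S. \<Gamma> p \<subseteq> carrier (Mob F p) \<times> carrier (Mob G p) \<and> (\<zero>\<^bsub>Mob F p\<^esub>, \<zero>\<^bsub>Mob G p\<^esub>) \<in> \<Gamma> p \<and>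
      (\<forall>(x, y)\<in>\<Gamma> p. \<forall>(x', y')\<in>\<Gamma> p. (x \<oplus>\<^bsub>Mob F p\<^esub> x', y \<oplus>\<^bsub>Mob G p\<^esub> y') \<in> \<Gamma> p) \<and>
      (\<forall>a\<in>carrier R. \<forall>(x, y)\<in>\<Gamma> p. (a \<odot>\<^bsub>Mob F p\<^esub> x, a \<odot>\<^bsub>Mob G p\<^esub> y) \<in> \<Gamma> p)) \<and>
    (\<forall>p\<in>S. \<forall>q\<in>S. leq p q \<longrightarrow> (\<forall>(x, y)\<in>\<Gamma> p. (Mar F p q x, Mar G p q y) \<in> \<Gamma> q))"

lemma linear_relationI:
  assumes "\<And>p x y. p \<in> S \<Longrightarrow> (x, y) \<in> \<Gamma> p \<Longrightarrow> x \<in> carrier (Mob F p)"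
    "\<And>p x y. p \<in> S \<Longrightarrow> (x, y) \<in> \<Gamma> p \<Longrightarrow> y \<in> carrier (Mob G p)"
    "\<And>p. p \<in> S \<Longrightarrow> (\<zero>\<^bsub>Mob F p\<^esub>, \<zero>\<^bsub>Mob G p\<^esub>) \<in> \<Gamma> p"
    "\<And>p x y x' y'. p \<in> S \<Longrightarrow> (x, y) \<in> \<Gamma> p \<Longrightarrow> (x', y') \<in> \<Gamma> p \<Longrightarrow>
      (x \<oplus>\<^bsub>Mob F p\<^esub> x', y \<oplus>\<^bsub>Mob G p\<^esub> y') \<in> \<Gamma> p"
    "\<And>p a x y. p \<in> S \<Longrightarrow> a \<in> carrier R \<Longrightarrow> (x, y) \<in> \<Gamma> p \<Longrightarrow> (a \<odot>\<^bsub>Mob F p\<^esub> x, a \<odot>\<^bsub>Mob G p\<^esub> y) \<in> \<Gamma> p"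
    "\<And>p q x y. p \<in> S \<Longrightarrow> q \<in> S \<Longrightarrow> leq p q \<Longrightarrow> (x, y) \<in> \<Gamma> p \<Longrightarrow> (Mar F p q x, Mar G p q y) \<in> \<Gamma> q"
  shows "linear_relation F G \<Gamma>"
  unfolding linear_relation_def by (auto dest: assms(1,2) intro: assms(3-6))

lemma linear_relationD:
  assumes "linear_relation F G \<Gamma>"
  shows "p \<in> S \<Longrightarrow> (x, y) \<in> \<Gamma> p \<Longrightarrow> x \<in> carrier (Mob F p)"
    "p \<in> S \<Longrightarrow> (x, y) \<in> \<Gamma> p \<Longrightarrow> y \<in> carrier (Mob G p)"
    "p \<in> S \<Longrightarrow> (\<zero>\<^bsub>Mob F p\<^esub>, \<zero>\<^bsub>Mob G p\<^esub>) \<in> \<Gamma> p"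
    "p \<in> S \<Longrightarrow> (x, y) \<in> \<Gamma> p \<Longrightarrow> (x', y') \<in> \<Gamma> p \<Longrightarrow> (x \<oplus>\<^bsub>Mob F p\<^esub> x', y \<oplus>\<^bsub>Mob G p\<^esub> y') \<in> \<Gamma> p"
    "p \<in> S \<Longrightarrow> a \<in> carrier R \<Longrightarrow> (x, y) \<in> \<Gamma> p \<Longrightarrow> (a \<odot>\<^bsub>Mob F p\<^esub> x, a \<odot>\<^bsub>Mob G p\<^esub> y) \<in> \<Gamma> p"
    "p \<in> S \<Longrightarrow> q \<in> S \<Longrightarrow> leq p q \<Longrightarrow> (x, y) \<in> \<Gamma> p \<Longrightarrow> (Mar F p q x, Mar G p q y) \<in> \<Gamma> q"
  using assms unfolding linear_relation_def by blast+

lemma linear_relation_minus: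
  assumes "linear_relation F G \<Gamma>" "is_mod_functor R S leq F" "is_mod_functor R S leq G"
    and p: "p \<in> S" "(x, y) \<in> \<Gamma> p"
  shows "(\<ominus>\<^bsub>Mob F p\<^esub> x, \<ominus>\<^bsub>Mob G p\<^esub> y) \<in> \<Gamma> p"
proof -
  have "((\<ominus> \<one>) \<odot>\<^bsub>Mob F p\<^esub> x, (\<ominus> \<one>) \<odot>\<^bsub>Mob G p\<^esub> y) \<in> \<Gamma> p"
    by (rule linear_relationD(5)[OF assms(1) p(1) _ p(2)]) simp
  then show ?thesis
    using linear_relationD(1,2)[OF assms(1) p] mod_functorD(1)[OF assms(2) p(1)] mod_functorD(1)[OF assms(3) p(1)]
    by (simp add: module_smult)
qed

lemma single_valued_unique:
  assumes \<Gamma>: "linear_relation F G \<Gamma>" and F: "is_mod_functor R S leq F" and G: "is_mod_functor R S leq G"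
    and p: "p \<in> S" and single: "\<And>y. (\<zero>\<^bsub>Mob F p\<^esub>, y) \<in> \<Gamma> p \<Longrightarrow> y = \<zero>\<^bsub>Mob G p\<^esub>"
    and xy: "(x, y) \<in> \<Gamma> p" "(x, y') \<in> \<Gamma> p"
  shows "y = y'"
proof -
  note m = mod_functorD(1)[OF F p] mod_functorD(1)[OF G p] and c = linear_relationD(1,2)[OF \<Gamma> p]
  have "(x \<oplus>\<^bsub>Mob F p\<^esub> \<ominus>\<^bsub>Mob F p\<^esub> x, y \<oplus>\<^bsub>Mob G p\<^esub> \<ominus>\<^bsub>Mob G p\<^esub> y') \<in> \<Gamma> p"
    by (intro linear_relationD(4)[OF \<Gamma> p] xy linear_relation_minus[OF \<Gamma> F G p])
  then have "y \<oplus>\<^bsub>Mob G p\<^esub> \<ominus>\<^bsub>Mob G p\<^esub> y' = \<zero>\<^bsub>Mob G p\<^esub>"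
    using m c[OF xy(1)] by (intro single) simp
  then show ?thesis using m c[OF xy(1)] c[OF xy(2)] by (simp add: module_eq_iff)
qed

definition relation_functor ::
  "('r, 'p, 'f) mod_functor \<Rightarrow> ('r, 'p, 'g) mod_functor \<Rightarrow> ('p \<Rightarrow> ('f \<times> 'g) set) \<Rightarrow> ('r, 'p, 'f \<times> 'g) mod_functor" where
  "relation_functor F G \<Gamma> = \<lparr>Mob = (\<lambda>p. (prod_module (Mob F p) (Mob G p))\<lparr>carrier := \<Gamma> p\<rparr>),
     Mar = (\<lambda>p q x. (Mar F p q (fst x), Mar G p q (snd x)))\<rparr>"

lemma relation_functor_simps [simp]:
  "Mob (relation_functor F G \<Gamma>) p = (prod_module (Mob F p) (Mob G p))\<lparr>carrier := \<Gamma> p\<rparr>"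
  "Mar (relation_functor F G \<Gamma>) p q x = (Mar F p q (fst x), Mar G p q (snd x))"
  by (simp_all add: relation_functor_def)

lemma relation_functor_functor:
  assumes \<Gamma>: "linear_relation F G \<Gamma>" and F: "is_mod_functor R S leq F" and G: "is_mod_functor R S leq G"
  shows "is_mod_functor R S leq (relation_functor F G \<Gamma>)"
proof (rule mod_functorI)
  note \<Gamma>' = linear_relationD[OF \<Gamma>] and F' = mod_functorD[OF F] and G' = mod_functorD[OF G]
  fix p assume p: "p \<in> S"
  have sub: "submodule (\<Gamma> p) R (prod_module (Mob F p) (Mob G p))"
    by (rule submodule_criterion[OF prod_is_module[OF F'(1)[OF p] G'(1)[OF p]]])
      (use p \<Gamma>' in auto)
  show "module R (Mob (relation_functor F G \<Gamma>) p)"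
    using submodule_module[OF sub prod_is_module[OF F'(1)[OF p] G'(1)[OF p]]] by simp
qed (use linear_relationD[OF \<Gamma>] mod_functorD[OF F] mod_functorD[OF G] in \<open>auto\<close>)

text \<open>The isomorphic copy of \<open>F\<close> on the images of injections \<open>e p\<close>; it moves small functors into a universe.\<close>

definition transport :: "('r, 'p, 'f) mod_functor \<Rightarrow> ('p \<Rightarrow> 'f \<Rightarrow> 'u) \<Rightarrow> ('r, 'p, 'u) mod_functor" where
  "transport F e =
    \<lparr>Mob = (\<lambda>p. let g = inv_into (carrier (Mob F p)) (e p) in
       \<lparr>carrier = e p ` carrier (Mob F p), mult = undefined, one = undefined, zero = e p \<zero>\<^bsub>Mob F p\<^esub>,
        add = (\<lambda>x y. e p (g x \<oplus>\<^bsub>Mob F p\<^esub> g y)), smult = (\<lambda>a x. e p (a \<odot>\<^bsub>Mob F p\<^esub> g x))\<rparr>),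
     Mar = (\<lambda>p q x. e q (Mar F p q (inv_into (carrier (Mob F p)) (e p) x)))\<rparr>"

lemma transport_iso:
  assumes F: "is_mod_functor R S leq F" and e: "\<forall>p\<in>S. inj_on (e p) (carrier (Mob F p))"
  shows "is_mod_functor R S leq (transport F e)"
    and "mod_nat R S leq F (transport F e) e"
    and "mod_nat R S leq (transport F e) F (\<lambda>p. inv_into (carrier (Mob F p)) (e p))"
    and "p \<in> S \<Longrightarrow> x \<in> carrier (Mob F p) \<Longrightarrow> inv_into (carrier (Mob F p)) (e p) (e p x) = x"
    and "p \<in> S \<Longrightarrow> carrier (Mob (transport F e) p) = e p ` carrier (Mob F p)"
proof -
  note F' = mod_functorD[OF F]
  show inv: "inv_into (carrier (Mob F p)) (e p) (e p x) = x" if "p \<in> S" "x \<in> carrier (Mob F p)" for p x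
    using e that by simp
  show car: "carrier (Mob (transport F e) p) = e p ` carrier (Mob F p)" for p by (simp add: transport_def Let_def)
  note t = transport_def Let_def
  show "is_mod_functor R S leq (transport F e)"
  proof (rule mod_functorI)
    fix p assume p: "p \<in> S"
    note m = F'(1)[OF p]
    show "module R (Mob (transport F e) p)"
    proof (intro moduleI abelian_groupI is_cring)
      fix x assume "x \<in> carrier (Mob (transport F e) p)"
      then obtain u where u: "u \<in> carrier (Mob F p)" "x = e p u" by (auto simp: car)
      then show "\<exists>y\<in>carrier (Mob (transport F e) p). y \<oplus>\<^bsub>Mob (transport F e) p\<^esub> x = \<zero>\<^bsub>Mob (transport F e) p\<^esub>"
        using m p by (intro bexI[of _ "e p (\<ominus>\<^bsub>Mob F p\<^esub> u)"]) (auto simp: t inv)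
    qed (use m p in \<open>auto simp: t inv module_ac module_smult\<close>)
  qed (auto simp: t inv F')
  show "mod_nat R S leq F (transport F e) e"
    by (rule mod_natI) (auto simp: t inv F')
  show "mod_nat R S leq (transport F e) F (\<lambda>p. inv_into (carrier (Mob F p)) (e p))"
    by (rule mod_natI) (auto simp: t inv F')
qed

lemma mod_nat_comp:
  assumes "mod_nat R S leq F G \<eta>" "mod_nat R S leq G H \<theta>"
  shows "mod_nat R S leq F H (\<lambda>p x. \<theta> p (\<eta> p x))"
  using assms unfolding mod_nat_def module_hom_def by (auto simp: Pi_iff)

lemma relation_projections:
  assumes "linear_relation F G \<Gamma>"
  shows "mod_nat R S leq (relation_functor F G \<Gamma>) F (\<lambda>p. fst)"
    and "mod_nat R S leq (relation_functor F G \<Gamma>) G (\<lambda>p. snd)"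
  by (rule mod_natI; use linear_relationD[OF assms] in auto)+

section \<open>Injective functors\<close>

text \<open>A single-valued relation is a functor whose first projection is a monomorphism to \<open>B\<close>; extending the
  second projection along it, after transport to the universe of \<open>J\<close>, gives \<open>\<psi>\<close>.\<close>

lemma injective_extension_small:
  assumes J: "injective_functor R S leq (J :: ('r, 'p, 'u) mod_functor)"
    and B: "is_mod_functor R S leq (B :: ('r, 'p, 'f) mod_functor)"
    and small: "\<And>p. p \<in> S \<Longrightarrow> carrier (Mob B p) \<lesssim> (UNIV :: 'u set)"
    and \<Gamma>: "linear_relation B J \<Gamma>" and single: "\<And>p y. p \<in> S \<Longrightarrow> (\<zero>\<^bsub>Mob B p\<^esub>, y) \<in> \<Gamma> p \<Longrightarrow> y = \<zero>\<^bsub>Mob J p\<^esub>"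
  shows "\<exists>\<psi>. mod_nat R S leq B J \<psi> \<and> (\<forall>p\<in>S. \<forall>b j. (b, j) \<in> \<Gamma> p \<longrightarrow> \<psi> p b = j)"
proof -
  have Jf: "is_mod_functor R S leq J" using J by (simp add: injective_functor_def)
  from small have "\<forall>p\<in>S. \<exists>e :: 'f \<Rightarrow> 'u. inj_on e (carrier (Mob B p))" by (auto simp: lepoll_def)
  then obtain e :: "'p \<Rightarrow> 'f \<Rightarrow> 'u" where e: "\<forall>p\<in>S. inj_on (e p) (carrier (Mob B p))" by metis
  let ?A = "relation_functor B J \<Gamma>"
  have A: "is_mod_functor R S leq ?A" by (rule relation_functor_functor[OF \<Gamma> B Jf])
  have inj: "inj_on fst (\<Gamma> p)" if p: "p \<in> S" for p
    using single_valued_unique[OF \<Gamma> B Jf p single[OF p]] by (auto intro!: inj_onI)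
  let ?eA = "\<lambda>p c. e p (fst c)"
  have eA: "\<forall>p\<in>S. inj_on (?eA p) (carrier (Mob ?A p))"
  proof
    fix p assume p: "p \<in> S"
    then have "fst ` \<Gamma> p \<subseteq> carrier (Mob B p)" using linear_relationD(1)[OF \<Gamma> p] by auto
    with comp_inj_on[OF inj[OF p] inj_on_subset[OF bspec[OF e p]]] show "inj_on (?eA p) (carrier (Mob ?A p))"
      by (simp add: comp_def)
  qed
  note TA = transport_iso[where F = ?A and e = ?eA, OF A eA] and TB = transport_iso[where F = B and e = e, OF B e]
  let ?\<iota> = "\<lambda>p x. e p (fst (inv_into (carrier (Mob ?A p)) (?eA p) x))"
  let ?\<phi> = "\<lambda>p x. snd (inv_into (carrier (Mob ?A p)) (?eA p) x)"
  have "mod_nat R S leq (transport ?A ?eA) (transport B e) ?\<iota>"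
    by (rule mod_nat_comp[OF mod_nat_comp[OF TA(3) relation_projections(1)[OF \<Gamma>]] TB(2)])
  moreover have "mod_nat R S leq (transport ?A ?eA) J ?\<phi>"
    by (rule mod_nat_comp[OF TA(3) relation_projections(2)[OF \<Gamma>]])
  moreover have "\<forall>p\<in>S. inj_on (?\<iota> p) (carrier (Mob (transport ?A ?eA) p))"
  proof (intro ballI inj_onI)
    have id: "?\<iota> p x = x" if "p \<in> S" "x \<in> carrier (Mob (transport ?A ?eA) p)" for p x
    proof -
      from that obtain c where "c \<in> carrier (Mob ?A p)" "x = ?eA p c" using TA(5) by blast
      then show ?thesis using TA(4)[OF that(1)] by simp
    qed
    fix p x y assume "p \<in> S" "x \<in> carrier (Mob (transport ?A ?eA) p)" "y \<in> carrier (Mob (transport ?A ?eA) p)"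
      "?\<iota> p x = ?\<iota> p y"
    then show "x = y" using id[of p x] id[of p y] by simp
  qed
  ultimately obtain \<psi> where \<psi>: "mod_nat R S leq (transport B e) J \<psi>"
    "\<And>p x. p \<in> S \<Longrightarrow> x \<in> carrier (Mob (transport ?A ?eA) p) \<Longrightarrow> \<psi> p (?\<iota> p x) = ?\<phi> p x"
    using J TA(1) TB(1) unfolding injective_functor_def by blast
  have "\<psi> p (e p b) = j" if "p \<in> S" "(b, j) \<in> \<Gamma> p" for p b j
  proof -
    have c: "(b, j) \<in> carrier (Mob ?A p)" using that by simp
    then have "?eA p (b, j) \<in> carrier (Mob (transport ?A ?eA) p)" using TA(5)[OF that(1)] by blast
    from \<psi>(2)[OF that(1) this] TA(4)[OF that(1) c] show ?thesis by simp
  qed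
  with mod_nat_comp[OF TB(2) \<psi>(1)] show ?thesis by (intro exI[of _ "\<lambda>p x. \<psi> p (e p x)"]) auto
qed

text \<open>The functor \<open>Hom(p, -)\<close> with coefficients in \<open>R\<close>.\<close>

definition representable :: "'p \<Rightarrow> ('r, 'p, 'r) mod_functor" where
  "representable p = \<lparr>Mob = (\<lambda>q. \<lparr>carrier = (if leq p q then carrier R else {\<zero>}), mult = undefined,
     one = undefined, zero = \<zero>, add = (\<oplus>), smult = (\<otimes>)\<rparr>), Mar = (\<lambda>q s r. r)\<rparr>"

lemma representable_simps [simp]:
  "carrier (Mob (representable p) q) = (if leq p q then carrier R else {\<zero>})"
  "\<zero>\<^bsub>Mob (representable p) q\<^esub> = \<zero>" "x \<oplus>\<^bsub>Mob (representable p) q\<^esub> y = x \<oplus> y"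
  "a \<odot>\<^bsub>Mob (representable p) q\<^esub> x = a \<otimes> x" "Mar (representable p) q s x = x"
  by (simp_all add: representable_def)

lemma representable_functor:
  assumes "p \<in> S"
  shows "is_mod_functor R S leq (representable p)"
proof (rule mod_functorI)
  fix q assume "q \<in> S"
  show "module R (Mob (representable p) q)"
  proof (intro moduleI abelian_groupI is_cring)
    fix x assume "x \<in> carrier (Mob (representable p) q)"
    then show "\<exists>y\<in>carrier (Mob (representable p) q). y \<oplus>\<^bsub>Mob (representable p) q\<^esub> x = \<zero>\<^bsub>Mob (representable p) q\<^esub>"
      by (intro bexI[of _ "\<ominus> x"]) (auto simp: l_neg split: if_splits)
  qed (auto simp: a_ac l_distr r_distr m_assoc split: if_splits)
qed (auto split: if_splits dest: leq_trans[OF assms])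

text \<open>Baer's condition: extension from subfunctors of representable functors. Single-valued linear
  relations between the functor represented by \<open>p\<close> and \<open>J\<close> are the homomorphisms from subfunctors of
  the former, and the element \<open>j\<close> is the extension according to the Yoneda lemma.\<close>

definition baer :: "('r, 'p, 'u) mod_functor \<Rightarrow> bool" where
  "baer J \<longleftrightarrow> is_mod_functor R S leq J \<and>
    (\<forall>p\<in>S. \<forall>\<Lambda>. linear_relation (representable p) J \<Lambda> \<and> (\<forall>q\<in>S. \<forall>y. (\<zero>, y) \<in> \<Lambda> q \<longrightarrow> y = \<zero>\<^bsub>Mob J q\<^esub>) \<longrightarrow>
      (\<exists>j\<in>carrier (Mob J p). \<forall>q\<in>S. leq p q \<longrightarrow> (\<forall>r y. (r, y) \<in> \<Lambda> q \<longrightarrow> y = r \<odot>\<^bsub>Mob J q\<^esub> Mar J p q j)))"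

text \<open>The values of a representable functor lie in \<open>R\<close>, so it is small for every large universe.\<close>

lemma injective_baer:
  assumes J: "injective_functor R S leq (J :: ('r, 'p, 'u) mod_functor)"
  shows "baer J"
  unfolding baer_def
proof (intro conjI ballI allI impI)
  show Jf: "is_mod_functor R S leq J" using J by (simp add: injective_functor_def)
  fix p \<Lambda> assume p: "p \<in> S"
    and \<Lambda>: "linear_relation (representable p) J \<Lambda> \<and> (\<forall>q\<in>S. \<forall>y. (\<zero>, y) \<in> \<Lambda> q \<longrightarrow> y = \<zero>\<^bsub>Mob J q\<^esub>)"
  have R: "carrier R \<lesssim> (UNIV :: 'u set)" using J by (simp add: injective_functor_def large_universe_def)
  moreover from R have "{\<zero>} \<lesssim> (UNIV :: 'u set)"
    by (rule lepoll_trans[OF subset_imp_lepoll, rotated]) simp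
  ultimately have "carrier (Mob (representable p) q) \<lesssim> (UNIV :: 'u set)" for q by simp
  with \<Lambda> obtain \<psi> where \<psi>: "mod_nat R S leq (representable p) J \<psi>" "\<And>q r y. q \<in> S \<Longrightarrow> (r, y) \<in> \<Lambda> q \<Longrightarrow> \<psi> q r = y"
    using injective_extension_small[OF J representable_functor[OF p], of \<Lambda>] by (auto simp del: representable_simps(1))
  note \<psi>' = mod_natD[OF \<psi>(1) representable_functor[OF p] Jf]
  have "y = r \<odot>\<^bsub>Mob J q\<^esub> Mar J p q (\<psi> p \<one>)" if q: "q \<in> S" "leq p q" "(r, y) \<in> \<Lambda> q" for q r y
  proof -
    have "r \<in> carrier R" using linear_relationD(1)[OF conjunct1[OF \<Lambda>] q(1,3)] q by simp
    then have "\<psi> q r = r \<odot>\<^bsub>Mob J q\<^esub> \<psi> q \<one>" using \<psi>'(3)[of q r \<one>] q by simp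
    also have "\<psi> q \<one> = Mar J p q (\<psi> p \<one>)" using \<psi>'(6)[of p q \<one>] p q leq_refl by simp
    finally show ?thesis using \<psi>(2)[OF q(1,3)] by simp
  qed
  moreover have "\<psi> p \<one> \<in> carrier (Mob J p)" using \<psi>'(1)[of p \<one>] p leq_refl by simp
  ultimately show "\<exists>j\<in>carrier (Mob J p). \<forall>q\<in>S. leq p q \<longrightarrow> (\<forall>r y. (r, y) \<in> \<Lambda> q \<longrightarrow> y = r \<odot>\<^bsub>Mob J q\<^esub> Mar J p q j)" by blast
qed

text \<open>One step of the extension: a single-valued relation can be enlarged so that its domain contains
  a given element \<open>b\<close>.\<close>

lemma baer_extend_one:
  assumes J: "baer J" and B: "is_mod_functor R S leq B"
    and \<Gamma>: "linear_relation B J \<Gamma>" and single: "\<And>p y. p \<in> S \<Longrightarrow> (\<zero>\<^bsub>Mob B p\<^esub>, y) \<in> \<Gamma> p \<Longrightarrow> y = \<zero>\<^bsub>Mob J p\<^esub>"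
    and p: "p \<in> S" and b: "b \<in> carrier (Mob B p)"
  obtains \<Delta> j where "linear_relation B J \<Delta>" "\<And>p y. p \<in> S \<Longrightarrow> (\<zero>\<^bsub>Mob B p\<^esub>, y) \<in> \<Delta> p \<Longrightarrow> y = \<zero>\<^bsub>Mob J p\<^esub>"
    "\<And>q. \<Gamma> q \<subseteq> \<Delta> q" "(b, j) \<in> \<Delta> p"
proof -
  have Jf: "is_mod_functor R S leq J" using J by (simp add: baer_def)
  note \<Gamma>' = linear_relationD[OF \<Gamma>] and B' = mod_functorD[OF B] and J' = mod_functorD[OF Jf]
  \<comment> \<open>The multiples of \<open>b\<close> on which the relation is already defined form a subfunctor of a representable functor.\<close>
  define \<Lambda> where "\<Lambda> q = {(r, y). if leq p q then r \<in> carrier R \<and> (r \<odot>\<^bsub>Mob B q\<^esub> Mar B p q b, y) \<in> \<Gamma> q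
    else r = \<zero> \<and> y = \<zero>\<^bsub>Mob J q\<^esub>}" for q
  have "linear_relation (representable p) J \<Lambda>"
  proof (rule linear_relationI)
    fix q s r y assume qs: "q \<in> S" "s \<in> S" "leq q s" "(r, y) \<in> \<Lambda> q"
    show "(Mar (representable p) q s r, Mar J q s y) \<in> \<Lambda> s"
    proof (cases "leq p q")
      case True
      with qs have y: "r \<in> carrier R" "(r \<odot>\<^bsub>Mob B q\<^esub> Mar B p q b, y) \<in> \<Gamma> q" "leq p s"
        using p leq_trans[of p q s] by (auto simp: \<Lambda>_def)
      have "(Mar B q s (r \<odot>\<^bsub>Mob B q\<^esub> Mar B p q b), Mar J q s y) \<in> \<Gamma> s" by (rule \<Gamma>'(6)[OF qs(1-3) y(2)])
      then show ?thesis using y True p qs b by (simp add: \<Lambda>_def B')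
    next
      case False
      then show ?thesis using qs p b \<Gamma>'(3)[of s] by (simp add: \<Lambda>_def J' B')
    qed
  qed (use p b \<Gamma>'(1-5) B' J' in \<open>auto simp: \<Lambda>_def module_smult split: if_splits\<close>)
  moreover have "y = \<zero>\<^bsub>Mob J q\<^esub>" if "q \<in> S" "(\<zero>, y) \<in> \<Lambda> q" for q y
    using that p b single B' by (auto simp: \<Lambda>_def split: if_splits)
  ultimately obtain j where j: "j \<in> carrier (Mob J p)"
    "\<And>q r y. q \<in> S \<Longrightarrow> leq p q \<Longrightarrow> (r, y) \<in> \<Lambda> q \<Longrightarrow> y = r \<odot>\<^bsub>Mob J q\<^esub> Mar J p q j"
    using J p unfolding baer_def by blast
  define \<Delta> where "\<Delta> q = \<Gamma> q \<union> {(x \<oplus>\<^bsub>Mob B q\<^esub> r \<odot>\<^bsub>Mob B q\<^esub> Mar B p q b, y \<oplus>\<^bsub>Mob J q\<^esub> r \<odot>\<^bsub>Mob J q\<^esub> Mar J p q j) | x y r.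
    leq p q \<and> (x, y) \<in> \<Gamma> q \<and> r \<in> carrier R}" for q
  have \<Delta>E: "\<exists>x y r. (x, y) \<in> \<Gamma> q \<and> r \<in> carrier R \<and> c = x \<oplus>\<^bsub>Mob B q\<^esub> r \<odot>\<^bsub>Mob B q\<^esub> Mar B p q b \<and>
      c' = y \<oplus>\<^bsub>Mob J q\<^esub> r \<odot>\<^bsub>Mob J q\<^esub> Mar J p q j"
    if "(c, c') \<in> \<Delta> q" "q \<in> S" "leq p q" for c c' q
  proof (cases "(c, c') \<in> \<Gamma> q")
    case True
    then show ?thesis using that p b j(1) \<Gamma>'(1,2)[OF that(2) True] B' J'
      by (intro exI[of _ c] exI[of _ c'] exI[of _ \<zero>]) simp
  qed (use that in \<open>auto simp: \<Delta>_def\<close>)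
  have \<Delta>I: "(x \<oplus>\<^bsub>Mob B q\<^esub> r \<odot>\<^bsub>Mob B q\<^esub> Mar B p q b, y \<oplus>\<^bsub>Mob J q\<^esub> r \<odot>\<^bsub>Mob J q\<^esub> Mar J p q j) \<in> \<Delta> q"
    if "(x, y) \<in> \<Gamma> q" "r \<in> carrier R" "leq p q" for x y r q
    using that unfolding \<Delta>_def by blast
  have \<Delta>0: "\<Delta> q = \<Gamma> q" if "\<not> leq p q" for q using that by (auto simp: \<Delta>_def)
  have bq: "Mar B p q b \<in> carrier (Mob B q)" "Mar J p q j \<in> carrier (Mob J q)" if "q \<in> S" "leq p q" for q
    using that p b j(1) B' J' by auto
  have lin: "linear_relation B J \<Delta>"
  proof (rule linear_relationI)
    fix q c c' assume q: "q \<in> S" and c: "(c, c') \<in> \<Delta> q"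
    show "c \<in> carrier (Mob B q)" "c' \<in> carrier (Mob J q)"
      using c q \<Gamma>'(1,2)[OF q] bq[OF q] B'(1)[OF q] J'(1)[OF q] by (auto simp: \<Delta>_def)
    show "(a \<odot>\<^bsub>Mob B q\<^esub> c, a \<odot>\<^bsub>Mob J q\<^esub> c') \<in> \<Delta> q" if a: "a \<in> carrier R" for a
    proof (cases "leq p q")
      case True
      from \<Delta>E[OF c q True] obtain x y r where x: "(x, y) \<in> \<Gamma> q" "r \<in> carrier R"
        "c = x \<oplus>\<^bsub>Mob B q\<^esub> r \<odot>\<^bsub>Mob B q\<^esub> Mar B p q b" "c' = y \<oplus>\<^bsub>Mob J q\<^esub> r \<odot>\<^bsub>Mob J q\<^esub> Mar J p q j" by blast
      from \<Delta>I[OF \<Gamma>'(5)[OF q a x(1)], of "a \<otimes> r"] show ?thesis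
        using x a bq[OF q True] B'(1)[OF q] J'(1)[OF q] \<Gamma>'(1,2)[OF q x(1)] True by (simp add: module_smult)
    qed (use c q a \<Gamma>'(5) in \<open>simp add: \<Delta>0\<close>)
    show "(c \<oplus>\<^bsub>Mob B q\<^esub> d, c' \<oplus>\<^bsub>Mob J q\<^esub> d') \<in> \<Delta> q" if d: "(d, d') \<in> \<Delta> q" for d d'
    proof (cases "leq p q")
      case True
      from \<Delta>E[OF c q True] obtain x y r where x: "(x, y) \<in> \<Gamma> q" "r \<in> carrier R"
        "c = x \<oplus>\<^bsub>Mob B q\<^esub> r \<odot>\<^bsub>Mob B q\<^esub> Mar B p q b" "c' = y \<oplus>\<^bsub>Mob J q\<^esub> r \<odot>\<^bsub>Mob J q\<^esub> Mar J p q j" by blast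
      from \<Delta>E[OF d q True] obtain x' y' r' where x': "(x', y') \<in> \<Gamma> q" "r' \<in> carrier R"
        "d = x' \<oplus>\<^bsub>Mob B q\<^esub> r' \<odot>\<^bsub>Mob B q\<^esub> Mar B p q b" "d' = y' \<oplus>\<^bsub>Mob J q\<^esub> r' \<odot>\<^bsub>Mob J q\<^esub> Mar J p q j" by blast
      from \<Delta>I[OF \<Gamma>'(4)[OF q x(1) x'(1)], of "r \<oplus> r'"] show ?thesis
        using x x' bq[OF q True] B'(1)[OF q] J'(1)[OF q] \<Gamma>'(1,2)[OF q x(1)] \<Gamma>'(1,2)[OF q x'(1)] True
        by (simp add: module_smult module_ac)
    qed (use c d q \<Gamma>'(4) in \<open>simp add: \<Delta>0\<close>)
    fix s assume s: "s \<in> S" "leq q s"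
    show "(Mar B q s c, Mar J q s c') \<in> \<Delta> s"
    proof (cases "leq p q")
      case True
      then have ps: "leq p s" using p q s leq_trans[of p q s] by blast
      from \<Delta>E[OF c q True] obtain x y r where x: "(x, y) \<in> \<Gamma> q" "r \<in> carrier R"
        "c = x \<oplus>\<^bsub>Mob B q\<^esub> r \<odot>\<^bsub>Mob B q\<^esub> Mar B p q b" "c' = y \<oplus>\<^bsub>Mob J q\<^esub> r \<odot>\<^bsub>Mob J q\<^esub> Mar J p q j" by blast
      from \<Delta>I[OF \<Gamma>'(6)[OF q s x(1)] x(2) ps] show ?thesis
        using x bq[OF q True] B' J' \<Gamma>'(1,2)[OF q x(1)] True p q s b j(1) by simp
    qed (use c q s \<Gamma>'(6)[of q s c c'] in \<open>auto simp: \<Delta>0 \<Delta>_def\<close>)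
  qed (use \<Gamma>'(3) in \<open>auto simp: \<Delta>_def\<close>)
  moreover have "c' = \<zero>\<^bsub>Mob J q\<^esub>" if q: "q \<in> S" and c: "(\<zero>\<^bsub>Mob B q\<^esub>, c') \<in> \<Delta> q" for q c'
  proof (cases "leq p q")
    case True
    from \<Delta>E[OF c q True] obtain x y r where x: "(x, y) \<in> \<Gamma> q" "r \<in> carrier R"
      "\<zero>\<^bsub>Mob B q\<^esub> = x \<oplus>\<^bsub>Mob B q\<^esub> r \<odot>\<^bsub>Mob B q\<^esub> Mar B p q b" "c' = y \<oplus>\<^bsub>Mob J q\<^esub> r \<odot>\<^bsub>Mob J q\<^esub> Mar J p q j" by blast
    note xy = \<Gamma>'(1,2)[OF q x(1)] bq[OF q True] and m = B'(1)[OF q] J'(1)[OF q]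
    have "r \<odot>\<^bsub>Mob B q\<^esub> Mar B p q b = \<ominus>\<^bsub>Mob B q\<^esub> x"
      using module_minus_unique[OF m(1) xy(1) _ x(3)[symmetric]] x(2) xy m by simp
    then have "(r \<odot>\<^bsub>Mob B q\<^esub> Mar B p q b, \<ominus>\<^bsub>Mob J q\<^esub> y) \<in> \<Gamma> q"
      using linear_relation_minus[OF \<Gamma> B Jf q x(1)] by simp
    then have "(r, \<ominus>\<^bsub>Mob J q\<^esub> y) \<in> \<Lambda> q" using True x(2) by (simp add: \<Lambda>_def)
    from j(2)[OF q True this] show ?thesis using x(2,4) xy m by (simp flip: \<open>\<ominus>\<^bsub>Mob J q\<^esub> y = _\<close>)
  qed (use c q single in \<open>auto simp: \<Delta>0\<close>)
  moreover have "(b, j) \<in> \<Delta> p"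
    using \<Delta>I[OF \<Gamma>'(3)[OF p] one_closed leq_refl[OF p]] p b j(1) B' J' by simp
  ultimately show ?thesis using that[of \<Delta> j] by (auto simp: \<Delta>_def)
qed

text \<open>By Zorn's lemma there is a maximal single-valued relation containing \<open>\<Gamma>\<close>; the previous step shows that it
  is total.\<close>

theorem baer_extension:
  assumes J: "baer (J :: ('r, 'p, 'u) mod_functor)" and B: "is_mod_functor R S leq (B :: ('r, 'p, 'f) mod_functor)"
    and \<Gamma>: "linear_relation B J \<Gamma>" and single: "\<And>p y. p \<in> S \<Longrightarrow> (\<zero>\<^bsub>Mob B p\<^esub>, y) \<in> \<Gamma> p \<Longrightarrow> y = \<zero>\<^bsub>Mob J p\<^esub>"
  shows "\<exists>\<psi>. mod_nat R S leq B J \<psi> \<and> (\<forall>p\<in>S. \<forall>b j. (b, j) \<in> \<Gamma> p \<longrightarrow> \<psi> p b = j)"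
proof -
  have Jf: "is_mod_functor R S leq J" using J by (simp add: baer_def)
  \<comment> \<open>Families of sets are encoded as sets of pairs, so that the order is inclusion.\<close>
  define rel :: "('p \<times> 'f \<times> 'u) set \<Rightarrow> 'p \<Rightarrow> ('f \<times> 'u) set" where "rel G p = {c. (p, c) \<in> G}" for G p
  define A where "A = {G. linear_relation B J (rel G) \<and> (\<forall>p\<in>S. \<forall>y. (\<zero>\<^bsub>Mob B p\<^esub>, y) \<in> rel G p \<longrightarrow> y = \<zero>\<^bsub>Mob J p\<^esub>) \<and>
    (\<forall>p. \<Gamma> p \<subseteq> rel G p)}"
  have relI: "rel {(p, c). c \<in> \<Delta> p} = \<Delta>" for \<Delta> by (auto simp: rel_def)
  have "{(p, c). c \<in> \<Gamma> p} \<in> A" using \<Gamma> single by (auto simp: A_def relI)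
  then have "A \<noteq> {}" by blast
  moreover have "\<Union>C \<in> A" if C: "C \<noteq> {}" "subset.chain A C" for C
  proof -
    have CA: "G \<in> A" if "G \<in> C" for G using C(2) that by (auto simp: subset.chain_def)
    have two: "\<exists>G\<in>C. c \<in> rel G p \<and> c' \<in> rel G p" if "c \<in> rel (\<Union>C) p" "c' \<in> rel (\<Union>C) p" for c c' p
    proof -
      from that obtain G G' where G: "G \<in> C" "(p, c) \<in> G" "G' \<in> C" "(p, c') \<in> G'" by (auto simp: rel_def)
      then have "G \<subseteq> G' \<or> G' \<subseteq> G" using C(2) by (auto simp: subset_chain_def)
      with G show ?thesis by (auto simp: rel_def)
    qed
    have one: "\<exists>G\<in>C. c \<in> rel G p" if "c \<in> rel (\<Union>C) p" for c p using that by (auto simp: rel_def)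
    have up: "c \<in> rel (\<Union>C) p" if "G \<in> C" "c \<in> rel G p" for c p G using that by (auto simp: rel_def)
    have lin: "linear_relation B J (rel G)" if "G \<in> C" for G using CA[OF that] by (simp add: A_def)
    obtain G0 where G0: "G0 \<in> C" using C(1) by blast
    have "linear_relation B J (rel (\<Union>C))"
    proof (rule linear_relationI)
      fix p x y assume p: "p \<in> S" and xy: "(x, y) \<in> rel (\<Union>C) p"
      from one[OF xy] obtain G where G: "G \<in> C" "(x, y) \<in> rel G p" by blast
      note D = linear_relationD[OF lin[OF G(1)]]
      show "x \<in> carrier (Mob B p)" "y \<in> carrier (Mob J p)" by (fact D(1,2)[OF p G(2)])+
      show "(a \<odot>\<^bsub>Mob B p\<^esub> x, a \<odot>\<^bsub>Mob J p\<^esub> y) \<in> rel (\<Union>C) p" if "a \<in> carrier R" for a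
        by (rule up[OF G(1) D(5)[OF p that G(2)]])
      show "(Mar B p q x, Mar J p q y) \<in> rel (\<Union>C) q" if "q \<in> S" "leq p q" for q
        by (rule up[OF G(1) D(6)[OF p that G(2)]])
      show "(x \<oplus>\<^bsub>Mob B p\<^esub> x', y \<oplus>\<^bsub>Mob J p\<^esub> y') \<in> rel (\<Union>C) p" if xy': "(x', y') \<in> rel (\<Union>C) p" for x' y'
      proof -
        from two[OF xy xy'] obtain H where H: "H \<in> C" "(x, y) \<in> rel H p" "(x', y') \<in> rel H p" by blast
        show ?thesis by (rule up[OF H(1) linear_relationD(4)[OF lin[OF H(1)] p H(2,3)]])
      qed
    qed (rule up[OF G0 linear_relationD(3)[OF lin[OF G0]]])
    moreover have "\<forall>p\<in>S. \<forall>y. (\<zero>\<^bsub>Mob B p\<^esub>, y) \<in> rel (\<Union>C) p \<longrightarrow> y = \<zero>\<^bsub>Mob J p\<^esub>"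
      using one CA unfolding A_def by blast
    moreover have "\<forall>p. \<Gamma> p \<subseteq> rel (\<Union>C) p" using up[OF G0] CA[OF G0] unfolding A_def by blast
    ultimately show ?thesis by (simp add: A_def)
  qed
  ultimately obtain M where M: "M \<in> A" "\<And>X. X \<in> A \<Longrightarrow> M \<subseteq> X \<Longrightarrow> X = M"
    using subset_Zorn_nonempty[of A] by blast
  have lin: "linear_relation B J (rel M)" and sv: "\<And>p y. p \<in> S \<Longrightarrow> (\<zero>\<^bsub>Mob B p\<^esub>, y) \<in> rel M p \<Longrightarrow> y = \<zero>\<^bsub>Mob J p\<^esub>"
    and ge: "\<And>p. \<Gamma> p \<subseteq> rel M p" using M(1) by (auto simp: A_def)
  have total: "\<exists>j. (b, j) \<in> rel M p" if p: "p \<in> S" "b \<in> carrier (Mob B p)" for p b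
  proof -
    obtain \<Delta> j where \<Delta>: "linear_relation B J \<Delta>" "\<And>p y. p \<in> S \<Longrightarrow> (\<zero>\<^bsub>Mob B p\<^esub>, y) \<in> \<Delta> p \<Longrightarrow> y = \<zero>\<^bsub>Mob J p\<^esub>"
      "\<And>q. rel M q \<subseteq> \<Delta> q" "(b, j) \<in> \<Delta> p"
      using baer_extend_one[OF J B lin sv p] by blast
    then have "{(p, c). c \<in> \<Delta> p} \<in> A" using ge by (fastforce simp: A_def relI)
    moreover have "M \<subseteq> {(p, c). c \<in> \<Delta> p}" using \<Delta>(3) by (auto simp: rel_def)
    ultimately have "{(p, c). c \<in> \<Delta> p} = M" by (rule M(2))
    with \<Delta>(4) show ?thesis by (auto simp: rel_def)
  qed
  have uniq: "y = y'" if "p \<in> S" "(x, y) \<in> rel M p" "(x, y') \<in> rel M p" for p x y y'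
    by (rule single_valued_unique[OF lin B Jf that(1) sv[OF that(1)] that(2,3)])
  obtain \<psi> where \<psi>: "\<And>p b. p \<in> S \<Longrightarrow> b \<in> carrier (Mob B p) \<Longrightarrow> (b, \<psi> p b) \<in> rel M p"
    using total by metis
  note D = linear_relationD[OF lin] and B' = mod_functorD[OF B]
  have "mod_nat R S leq B J \<psi>"
  proof (rule mod_natI)
    show "\<And>p x. p \<in> S \<Longrightarrow> x \<in> carrier (Mob B p) \<Longrightarrow> \<psi> p x \<in> carrier (Mob J p)" using \<psi> D(2) by blast
    show "\<psi> p (x \<oplus>\<^bsub>Mob B p\<^esub> y) = \<psi> p x \<oplus>\<^bsub>Mob J p\<^esub> \<psi> p y"
      if "p \<in> S" "x \<in> carrier (Mob B p)" "y \<in> carrier (Mob B p)" for p x y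
      by (rule uniq[OF that(1) \<psi> D(4)]) (use that \<psi> B' in auto)
    show "\<psi> p (a \<odot>\<^bsub>Mob B p\<^esub> x) = a \<odot>\<^bsub>Mob J p\<^esub> \<psi> p x"
      if "p \<in> S" "a \<in> carrier R" "x \<in> carrier (Mob B p)" for p a x
      by (rule uniq[OF that(1) \<psi> D(5)]) (use that \<psi> B' in auto)
    show "\<psi> q (Mar B p q x) = Mar J p q (\<psi> p x)"
      if "p \<in> S" "q \<in> S" "leq p q" "x \<in> carrier (Mob B p)" for p q x
      by (rule uniq[OF that(2) \<psi> D(6)]) (use that \<psi> B' in auto)
  qed
  moreover have "\<psi> p b = j" if "p \<in> S" "(b, j) \<in> \<Gamma> p" for p b j
    using uniq[OF that(1) \<psi>, of b j] that ge linear_relationD(1)[OF \<Gamma> that] by blast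
  ultimately show ?thesis by blast
qed

end

section \<open>Comparison with an injective resolution\<close>

lemma concentrated_simps [simp]:
  "obj (Cob (concentrated F) p) n = (if n = 0 then Mob F p else (Mob F p)\<lparr>carrier := {\<zero>\<^bsub>Mob F p\<^esub>}\<rparr>)"
  "diff (Cob (concentrated F) p) n x = \<zero>\<^bsub>Mob F p\<^esub>"
  "Car (concentrated F) p q n x = Mar F p q x"
  by (simp_all add: concentrated_def)

context cring_base
begin

lemma concentrated_functor:
  assumes F: "is_mod_functor R S leq F"
  shows "is_cx_functor R S leq (concentrated F)"
proof -
  note F' = mod_functorD[OF F]
  have m: "module R (obj (Cob (concentrated F) p) n)" if "p \<in> S" for p n
  proof (cases "n = 0")
    case False
    have "submodule {\<zero>\<^bsub>Mob F p\<^esub>} R (Mob F p)" by (rule submodule_criterion[OF F'(1)[OF that]]) (use F'(1)[OF that] in auto)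
    from submodule_module[OF this F'(1)[OF that]] False show ?thesis by simp
  qed (use F'(1) that in simp)
  have "is_complex R (Cob (concentrated F) p)" if p: "p \<in> S" for p
    by (rule complexI[OF m[OF p]]) (use F'(1)[OF p] in \<open>auto split: if_splits\<close>)
  moreover have "is_mod_functor R S leq (degree_part (concentrated F) n)" for n
  proof (rule mod_functorI)
    fix p q s x assume p: "p \<in> S" "q \<in> S" "s \<in> S" "leq p q" "leq q s"
      and "x \<in> carrier (Mob (degree_part (concentrated F) n) p)"
    then have "x \<in> carrier (Mob F p)" using F'(1)[OF p(1)] by (auto split: if_splits)
    then show "Mar (degree_part (concentrated F) n) q s (Mar (degree_part (concentrated F) n) p q x) =
        Mar (degree_part (concentrated F) n) p s x" using F'(8)[OF p] by simp
  qed (use m F'(1-7) in \<open>auto split: if_splits\<close>)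
  moreover have "chain_map R (Cob (concentrated F) p) (Cob (concentrated F) q) (Car (concentrated F) p q)"
    if "p \<in> S" "q \<in> S" "leq p q" for p q
    unfolding chain_map_def using that F' by (auto intro!: module_homI split: if_splits)
  ultimately show ?thesis by (auto simp: is_cx_functor_def)
qed

lemma weak_equivalence_iso:
  assumes "weak_equivalence R S leq X Y \<eta>" "is_cx_functor R S leq X" "is_cx_functor R S leq Y"
  shows "cx_nat R S leq X Y \<eta>" and "p \<in> S \<Longrightarrow> cohomology_iso_at (Cob X p) (Cob Y p) (\<eta> p) n"
proof -
  show n: "cx_nat R S leq X Y \<eta>" using assms(1) by (simp add: weak_equivalence_def)
  assume p: "p \<in> S"
  with assms(1) have "quasi_iso R (Cob X p) (Cob Y p) (\<eta> p)" by (simp add: weak_equivalence_def)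
  then have ch: "chain_map R (Cob X p) (Cob Y p) (\<eta> p)" and
    "bij_betw (cohomology_map (Cob Y p) (\<eta> p) n) (carrier (cohomology (Cob X p) n)) (carrier (cohomology (Cob Y p) n))"
    by (simp_all add: quasi_iso_def)
  then show "cohomology_iso_at (Cob X p) (Cob Y p) (\<eta> p) n"
    using cohomology_map_iso(1)[OF cx_functorD(2)[OF assms(2) p] cx_functorD(2)[OF assms(3) p] ch] by blast
qed

text \<open>A weak equivalence from a functor \<open>F\<close> in degree \<open>0\<close> says that the target has cohomology \<open>F\<close> in
  degree \<open>0\<close> and none elsewhere.\<close>

lemma coaugmentationD:
  assumes \<eta>: "weak_equivalence R S leq (concentrated F) X \<eta>" and F: "is_mod_functor R S leq F"
    and X: "is_cx_functor R S leq X"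
  shows "p \<in> S \<Longrightarrow> x \<in> carrier (Mob F p) \<Longrightarrow> \<eta> p 0 x \<in> cocycles (Cob X p) 0"
    and "mod_nat R S leq F (degree_part X 0) (\<lambda>p. \<eta> p 0)"
    and "p \<in> S \<Longrightarrow> z \<in> cocycles (Cob X p) 0 \<Longrightarrow>
      \<exists>x\<in>carrier (Mob F p). \<exists>b\<in>coboundaries (Cob X p) 0. z = \<eta> p 0 x \<oplus>\<^bsub>obj (Cob X p) 0\<^esub> b"
    and "p \<in> S \<Longrightarrow> x \<in> carrier (Mob F p) \<Longrightarrow> \<eta> p 0 x \<in> coboundaries (Cob X p) 0 \<Longrightarrow> x = \<zero>\<^bsub>Mob F p\<^esub>"
    and "p \<in> S \<Longrightarrow> n \<noteq> 0 \<Longrightarrow> z \<in> cocycles (Cob X p) n \<Longrightarrow> z \<in> coboundaries (Cob X p) n"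
proof -
  note w = weak_equivalence_iso[OF \<eta> concentrated_functor[OF F] X]
  note n = cx_natD[OF w(1) concentrated_functor[OF F] X]
  have Z: "cocycles (Cob (concentrated F) p) 0 = carrier (Mob F p)" for p
    by (auto simp: cocycles_def)
  have B: "coboundaries (Cob (concentrated F) p) m = {\<zero>\<^bsub>Mob F p\<^esub>}" if "p \<in> S" for p m
  proof -
    have "\<zero>\<^bsub>Mob F p\<^esub> \<in> carrier (obj (Cob (concentrated F) p) (m - 1))"
      using mod_functorD(1)[OF F that] by simp
    then show ?thesis unfolding coboundaries_def concentrated_simps(2) by blast
  qed
  have F0: "degree_part (concentrated F) 0 = \<lparr>Mob = Mob F, Mar = Mar F\<rparr>"
    by (simp add: degree_part_def concentrated_def)
  have "mod_nat R S leq (degree_part (concentrated F) 0) (degree_part X 0) (\<lambda>p. \<eta> p 0)"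
    using w(1) by (simp add: cx_nat_def)
  then show "mod_nat R S leq F (degree_part X 0) (\<lambda>p. \<eta> p 0)" by (simp add: mod_nat_def)
  show "\<eta> p 0 x \<in> cocycles (Cob X p) 0" if "p \<in> S" "x \<in> carrier (Mob F p)" for p x
    using n(1)[of p x 0] n(6)[of p x 0] n(4)[of p 1] that by (simp add: cocycles_def)
  show "\<exists>x\<in>carrier (Mob F p). \<exists>b\<in>coboundaries (Cob X p) 0. z = \<eta> p 0 x \<oplus>\<^bsub>obj (Cob X p) 0\<^esub> b"
    if "p \<in> S" "z \<in> cocycles (Cob X p) 0" for p z
    using w(2)[of p 0] that unfolding cohomology_iso_at_def Z by blast
  show "x = \<zero>\<^bsub>Mob F p\<^esub>" if "p \<in> S" "x \<in> carrier (Mob F p)" "\<eta> p 0 x \<in> coboundaries (Cob X p) 0" for p x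
    using w(2)[of p 0] that B[of p 0] unfolding cohomology_iso_at_def Z by blast
  show "z \<in> coboundaries (Cob X p) n" if p: "p \<in> S" and n0: "n \<noteq> 0" and z: "z \<in> cocycles (Cob X p) n" for p z n
  proof -
    obtain x b where x: "x \<in> cocycles (Cob (concentrated F) p) n" and b: "b \<in> coboundaries (Cob X p) n"
      and zb: "z = \<eta> p n x \<oplus>\<^bsub>obj (Cob X p) n\<^esub> b"
      using w(2)[OF p, of n] z unfolding cohomology_iso_at_def by blast
    have "x = \<zero>\<^bsub>obj (Cob (concentrated F) p) n\<^esub>" using x n0 by (simp add: cocycles_def)
    then have "z = b" using zb n(4)[OF p, of n] cx_functorD(3)[OF X p, of n]
        submoduleD(1)[OF coboundaries_submodule[OF cx_functorD(2)[OF X p]] cx_functorD(3)[OF X p] b] by simp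
    with b show ?thesis by simp
  qed
qed

end

context poset_diagrams
begin

text \<open>The comparison map is built degree by degree: on cocycles it is prescribed by the map in the
  previous degree, and Baer's condition extends it to all elements.\<close>

lemma map_into_injective_complex:
  assumes F: "is_mod_functor R S leq F" and X: "is_cx_functor R S leq X" and I: "is_cx_functor R S leq I"
    and \<eta>: "weak_equivalence R S leq (concentrated F) X \<eta>"
    and \<epsilon>: "weak_equivalence R S leq (concentrated F) I \<epsilon>"
    and baer: "\<And>n. baer (degree_part I n)"
    and neg: "\<And>n p. n < 0 \<Longrightarrow> p \<in> S \<Longrightarrow> carrier (obj (Cob I p) n) = {\<zero>\<^bsub>obj (Cob I p) n\<^esub>}"
  obtains \<phi> where "cx_nat R S leq X I \<phi>" "\<And>p n. p \<in> S \<Longrightarrow> cohomology_iso_at (Cob X p) (Cob I p) (\<phi> p) n"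
proof -
  note X' = cx_functorD[OF X] and I' = cx_functorD[OF I] and XC = Car_simps[OF X] and IC = Car_simps[OF I]
  note Xd = diffD[OF X'(2)] and Id = diffD[OF I'(2)] and Xd' = diff_intoD[OF X'(2)] and Id' = diff_intoD[OF I'(2)]
  note e\<eta> = coaugmentationD[OF \<eta> F X] and e\<epsilon> = coaugmentationD[OF \<epsilon> F I]
  note n\<eta> = mod_natD[OF e\<eta>(2) F X'(1), simplified] and n\<epsilon> = mod_natD[OF e\<epsilon>(2) F I'(1), simplified]
  note F' = mod_functorD[OF F]
  have subB: "submodule (coboundaries (Cob X p) n) R (obj (Cob X p) n)" if "p \<in> S" for p n
    by (rule coboundaries_submodule[OF X'(2)[OF that]])
  note BD = submoduleD[OF subB X'(3)]
  \<comment> \<open>Partial chain maps: \<open>Ok\<close> says that the map in degree \<open>n\<close> admits a successor, \<open>Comp\<close> that \<open>g\<close> is one.\<close>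
  define Ok where "Ok n f \<longleftrightarrow> mod_nat R S leq (degree_part X (int n)) (degree_part I (int n)) f \<and>
      (\<forall>p\<in>S. \<forall>z\<in>cocycles (Cob X p) (int n). diff (Cob I p) (int n) (f p z) = \<zero>\<^bsub>obj (Cob I p) (int n + 1)\<^esub>) \<and>
      (n = 0 \<longrightarrow> (\<forall>p\<in>S. \<forall>x\<in>carrier (Mob F p). \<forall>b\<in>coboundaries (Cob X p) 0.
         f p (\<eta> p 0 x \<oplus>\<^bsub>obj (Cob X p) 0\<^esub> b) = \<epsilon> p 0 x))" for n f
  define Comp where "Comp n f g \<longleftrightarrow> (\<forall>p\<in>S. \<forall>x\<in>carrier (obj (Cob X p) (int n)).
      g p (diff (Cob X p) (int n) x) = diff (Cob I p) (int n) (f p x))" for n f g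
  have "\<exists>f. Ok 0 f"
  proof -
    define \<Gamma> where "\<Gamma> p = {(\<eta> p 0 x \<oplus>\<^bsub>obj (Cob X p) 0\<^esub> b, \<epsilon> p 0 x) | x b.
      x \<in> carrier (Mob F p) \<and> b \<in> coboundaries (Cob X p) 0}" for p
    have \<Gamma>I: "(\<eta> p 0 x \<oplus>\<^bsub>obj (Cob X p) 0\<^esub> b, \<epsilon> p 0 x) \<in> \<Gamma> p"
      if "x \<in> carrier (Mob F p)" "b \<in> coboundaries (Cob X p) 0" for p x b using that unfolding \<Gamma>_def by blast
    have \<Gamma>E: "\<exists>x b. x \<in> carrier (Mob F p) \<and> b \<in> coboundaries (Cob X p) 0 \<and>
        u = \<eta> p 0 x \<oplus>\<^bsub>obj (Cob X p) 0\<^esub> b \<and> v = \<epsilon> p 0 x" if "(u, v) \<in> \<Gamma> p" for p u v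
      using that unfolding \<Gamma>_def by blast
    have "linear_relation (degree_part X 0) (degree_part I 0) \<Gamma>"
    proof (rule linear_relationI)
      fix p u v assume p: "p \<in> S" and "(u, v) \<in> \<Gamma> p"
      then obtain x b where xb: "x \<in> carrier (Mob F p)" "b \<in> coboundaries (Cob X p) 0"
        "u = \<eta> p 0 x \<oplus>\<^bsub>obj (Cob X p) 0\<^esub> b" "v = \<epsilon> p 0 x" using \<Gamma>E by blast
      note bc = BD(1)[OF p p xb(2)]
      show "u \<in> carrier (Mob (degree_part X 0) p)" "v \<in> carrier (Mob (degree_part I 0) p)"
        using xb bc p n\<eta>(1) n\<epsilon>(1) X'(3) by auto
      show "(u \<oplus>\<^bsub>Mob (degree_part X 0) p\<^esub> u', v \<oplus>\<^bsub>Mob (degree_part I 0) p\<^esub> v') \<in> \<Gamma> p"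
        if "(u', v') \<in> \<Gamma> p" for u' v'
      proof -
        from that obtain x' b' where xb': "x' \<in> carrier (Mob F p)" "b' \<in> coboundaries (Cob X p) 0"
          "u' = \<eta> p 0 x' \<oplus>\<^bsub>obj (Cob X p) 0\<^esub> b'" "v' = \<epsilon> p 0 x'" using \<Gamma>E by blast
        note bc' = BD(1)[OF p p xb'(2)]
        have "(\<eta> p 0 (x \<oplus>\<^bsub>Mob F p\<^esub> x') \<oplus>\<^bsub>obj (Cob X p) 0\<^esub> (b \<oplus>\<^bsub>obj (Cob X p) 0\<^esub> b'), \<epsilon> p 0 (x \<oplus>\<^bsub>Mob F p\<^esub> x')) \<in> \<Gamma> p"
          using F'(1)[OF p] xb xb' BD(3)[OF p p] by (intro \<Gamma>I) auto
        then show ?thesis using xb xb' bc bc' p n\<eta>(1,2) n\<epsilon>(1,2) X'(3)[OF p, of 0] by (simp add: module_ac)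
      qed
      show "(a \<odot>\<^bsub>Mob (degree_part X 0) p\<^esub> u, a \<odot>\<^bsub>Mob (degree_part I 0) p\<^esub> v) \<in> \<Gamma> p" if "a \<in> carrier R" for a
        using \<Gamma>I[of "a \<odot>\<^bsub>Mob F p\<^esub> x" p "a \<odot>\<^bsub>obj (Cob X p) 0\<^esub> b"] that F'(1)[OF p] xb bc BD(5)[OF p p that xb(2)] p
          n\<eta>(1,3) n\<epsilon>(1,3) X'(3)[OF p, of 0] by (simp add: module_smult)
      show "(Mar (degree_part X 0) p q u, Mar (degree_part I 0) p q v) \<in> \<Gamma> q" if q: "q \<in> S" "leq p q" for q
      proof -
        have "Car X p q 0 b \<in> coboundaries (Cob X q) 0"
          using xb(2) p q XC(7)[of p q _ 0] XC(1)[of p q] by (auto simp: coboundaries_def)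
        with \<Gamma>I[of "Mar F p q x" q "Car X p q 0 b"] show ?thesis
          using F'(2) p q xb bc n\<eta>(1,6) n\<epsilon>(6) XC(2) by simp
      qed
    next
      fix p assume p: "p \<in> S"
      show "(\<zero>\<^bsub>Mob (degree_part X 0) p\<^esub>, \<zero>\<^bsub>Mob (degree_part I 0) p\<^esub>) \<in> \<Gamma> p"
        using \<Gamma>I[of "\<zero>\<^bsub>Mob F p\<^esub>" p "\<zero>\<^bsub>obj (Cob X p) 0\<^esub>"] F'(1)[OF p] BD(2)[OF p p] n\<eta>(4) n\<epsilon>(4) p X'(3)[OF p, of 0] by simp
    qed
    moreover have "v = \<zero>\<^bsub>Mob (degree_part I 0) p\<^esub>" if p: "p \<in> S" and v: "(\<zero>\<^bsub>Mob (degree_part X 0) p\<^esub>, v) \<in> \<Gamma> p" for p v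
    proof -
      from \<Gamma>E[OF v] obtain x b where xb: "x \<in> carrier (Mob F p)" "b \<in> coboundaries (Cob X p) 0"
        "\<zero>\<^bsub>obj (Cob X p) 0\<^esub> = \<eta> p 0 x \<oplus>\<^bsub>obj (Cob X p) 0\<^esub> b" "v = \<epsilon> p 0 x" by auto
      note bc = BD(1)[OF p p xb(2)] and m = X'(3)[OF p, of 0]
      have "b \<oplus>\<^bsub>obj (Cob X p) 0\<^esub> \<eta> p 0 x = \<zero>\<^bsub>obj (Cob X p) 0\<^esub>"
        using xb(3) bc n\<eta>(1)[OF p xb(1)] m by (simp add: module_ac)
      then have "\<eta> p 0 x = \<ominus>\<^bsub>obj (Cob X p) 0\<^esub> b"
        using bc n\<eta>(1)[OF p xb(1)] m by (intro module_minus_unique) auto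
      then have "x = \<zero>\<^bsub>Mob F p\<^esub>" using e\<eta>(4)[OF p xb(1)] BD(4)[OF p p xb(2)] by simp
      then show ?thesis using xb(4) n\<epsilon>(4)[OF p] by simp
    qed
    ultimately obtain f where f: "mod_nat R S leq (degree_part X 0) (degree_part I 0) f"
      "\<forall>p\<in>S. \<forall>u v. (u, v) \<in> \<Gamma> p \<longrightarrow> f p u = v"
      using baer_extension[OF baer X'(1), of 0 0 \<Gamma>] by blast
    have f\<eta>: "f p (\<eta> p 0 x \<oplus>\<^bsub>obj (Cob X p) 0\<^esub> b) = \<epsilon> p 0 x"
      if "p \<in> S" "x \<in> carrier (Mob F p)" "b \<in> coboundaries (Cob X p) 0" for p x b
      using f(2) \<Gamma>I that by blast
    moreover have "diff (Cob I p) 0 (f p z) = \<zero>\<^bsub>obj (Cob I p) (0 + 1)\<^esub>"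
      if p: "p \<in> S" and z: "z \<in> cocycles (Cob X p) 0" for p z
    proof -
      from e\<eta>(3)[OF p z] obtain x where "x \<in> carrier (Mob F p)" "f p z = \<epsilon> p 0 x" using f\<eta>[OF p] by blast
      with e\<epsilon>(1)[OF p] show ?thesis by (auto simp: cocycles_def)
    qed
    ultimately have "Ok 0 f" using f(1) by (auto simp: Ok_def)
    then show ?thesis by blast
  qed
  moreover have "\<exists>g. Ok (Suc n) g \<and> Comp n f g" if f: "Ok n f" for n f
  proof -
    have fn: "mod_nat R S leq (degree_part X (int n)) (degree_part I (int n)) f"
      and fZ: "\<And>p z. p \<in> S \<Longrightarrow> z \<in> cocycles (Cob X p) (int n) \<Longrightarrow>
        diff (Cob I p) (int n) (f p z) = \<zero>\<^bsub>obj (Cob I p) (int n + 1)\<^esub>"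
      using f by (auto simp: Ok_def)
    note f' = mod_natD[OF fn X'(1) I'(1), simplified]
    let ?m = "int n + 1"
    define \<Gamma> where "\<Gamma> p = (\<lambda>x. (diff (Cob X p) (int n) x, diff (Cob I p) (int n) (f p x))) ` carrier (obj (Cob X p) (int n))" for p
    have \<Gamma>I: "(diff (Cob X p) (int n) x, diff (Cob I p) (int n) (f p x)) \<in> \<Gamma> p"
      if "x \<in> carrier (obj (Cob X p) (int n))" for p x using that unfolding \<Gamma>_def by blast
    have "linear_relation (degree_part X ?m) (degree_part I ?m) \<Gamma>"
    proof (rule linear_relationI)
      fix p u v assume p: "p \<in> S" and "(u, v) \<in> \<Gamma> p"
      then obtain x where x: "x \<in> carrier (obj (Cob X p) (int n))"
        "u = diff (Cob X p) (int n) x" "v = diff (Cob I p) (int n) (f p x)" unfolding \<Gamma>_def by blast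
      show "u \<in> carrier (Mob (degree_part X ?m) p)" "v \<in> carrier (Mob (degree_part I ?m) p)"
        using x p f'(1) Xd(1) Id(1) by auto
      show "(u \<oplus>\<^bsub>Mob (degree_part X ?m) p\<^esub> u', v \<oplus>\<^bsub>Mob (degree_part I ?m) p\<^esub> v') \<in> \<Gamma> p"
        if "(u', v') \<in> \<Gamma> p" for u' v'
      proof -
        from that obtain x' where x': "x' \<in> carrier (obj (Cob X p) (int n))"
          "u' = diff (Cob X p) (int n) x'" "v' = diff (Cob I p) (int n) (f p x')" unfolding \<Gamma>_def by blast
        from \<Gamma>I[of "x \<oplus>\<^bsub>obj (Cob X p) (int n)\<^esub> x'" p] show ?thesis
          using x x' p f'(1,2) Xd(2) Id(2) X'(3)[OF p] by simp
      qed
      show "(a \<odot>\<^bsub>Mob (degree_part X ?m) p\<^esub> u, a \<odot>\<^bsub>Mob (degree_part I ?m) p\<^esub> v) \<in> \<Gamma> p" if "a \<in> carrier R" for a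
        using \<Gamma>I[of "a \<odot>\<^bsub>obj (Cob X p) (int n)\<^esub> x" p] x p that f'(1,3) Xd(3) Id(3) X'(3)[OF p] by simp
      show "(Mar (degree_part X ?m) p q u, Mar (degree_part I ?m) p q v) \<in> \<Gamma> q" if q: "q \<in> S" "leq p q" for q
        using \<Gamma>I[of "Car X p q (int n) x" q] x p q f'(1,6) XC(1,6) IC(6) by simp
    next
      fix p assume p: "p \<in> S"
      show "(\<zero>\<^bsub>Mob (degree_part X ?m) p\<^esub>, \<zero>\<^bsub>Mob (degree_part I ?m) p\<^esub>) \<in> \<Gamma> p"
        using \<Gamma>I[of "\<zero>\<^bsub>obj (Cob X p) (int n)\<^esub>" p] p X'(3)[OF p] Xd(4) Id(4) f'(4) by simp
    qed
    moreover have "v = \<zero>\<^bsub>Mob (degree_part I ?m) p\<^esub>"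
      if p: "p \<in> S" and v: "(\<zero>\<^bsub>Mob (degree_part X ?m) p\<^esub>, v) \<in> \<Gamma> p" for p v
      using v fZ[OF p] by (auto simp: \<Gamma>_def cocycles_def)
    ultimately obtain g where g: "mod_nat R S leq (degree_part X ?m) (degree_part I ?m) g"
      "\<forall>p\<in>S. \<forall>u v. (u, v) \<in> \<Gamma> p \<longrightarrow> g p u = v"
      using baer_extension[OF baer X'(1), of ?m ?m \<Gamma>] by blast
    have gd: "g p (diff (Cob X p) (int n) x) = diff (Cob I p) (int n) (f p x)"
      if "p \<in> S" "x \<in> carrier (obj (Cob X p) (int n))" for p x
      using g(2) \<Gamma>I that by blast
    have "diff (Cob I p) ?m (g p z) = \<zero>\<^bsub>obj (Cob I p) (?m + 1)\<^esub>" if p: "p \<in> S" and z: "z \<in> cocycles (Cob X p) ?m" for p z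
    proof -
      have "z \<in> coboundaries (Cob X p) ?m" by (rule e\<eta>(5)[OF p _ z]) simp
      then obtain x where "x \<in> carrier (obj (Cob X p) (int n))" "z = diff (Cob X p) (int n) x"
        by (auto simp: coboundaries_def)
      moreover have "diff (Cob I p) ?m (diff (Cob I p) (int n) w) = \<zero>\<^bsub>obj (Cob I p) (?m + 1)\<^esub>"
        if "w \<in> carrier (obj (Cob I p) (int n))" for w
        using diff_diff[OF I'(2)[OF p], of w ?m] that by simp
      ultimately show ?thesis using gd[OF p] f'(1)[OF p] by simp
    qed
    then have "Ok (Suc n) g" using g(1) by (simp add: Ok_def add.commute[of 1])
    moreover have "Comp n f g" using gd by (simp add: Comp_def)
    ultimately show ?thesis by blast
  qed
  ultimately obtain f where f: "\<And>n. Ok n (f n)" "\<And>n. Comp n (f n) (f (Suc n))"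
    using dependent_nat_choice[of Ok Comp] by metis
  \<comment> \<open>In negative degrees the target is zero.\<close>
  define \<phi> where "\<phi> p n = (if n \<ge> 0 then f (nat n) p else (\<lambda>_. \<zero>\<^bsub>obj (Cob I p) n\<^esub>))" for p n
  have \<phi>n: "mod_nat R S leq (degree_part X n) (degree_part I n) (\<lambda>p. \<phi> p n)" for n
  proof (cases "n \<ge> 0")
    case True
    with f(1)[of "nat n"] show ?thesis by (simp add: Ok_def \<phi>_def)
  qed (rule mod_natI, use I'(3)[of _ n] IC(4) in \<open>auto simp: \<phi>_def\<close>)
  note \<phi>' = mod_natD[OF \<phi>n X'(1) I'(1), simplified]
  have \<phi>0: "\<phi> p 0 (\<eta> p 0 x \<oplus>\<^bsub>obj (Cob X p) 0\<^esub> b) = \<epsilon> p 0 x"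
    if "p \<in> S" "x \<in> carrier (Mob F p)" "b \<in> coboundaries (Cob X p) 0" for p x b
    using f(1)[of 0] that by (simp add: Ok_def \<phi>_def)
  have \<phi>d: "\<phi> p (n + 1) (diff (Cob X p) n x) = diff (Cob I p) n (\<phi> p n x)"
    if p: "p \<in> S" and x: "x \<in> carrier (obj (Cob X p) n)" for p n x
  proof -
    \<comment> \<open>In degree \<open>-1\<close> commutation uses that coboundaries of \<open>X\<close> in degree \<open>0\<close> represent the zero of \<open>F\<close>.\<close>
    consider "n \<ge> 0" | "n = -1" | "n < -1" by linarith
    then show ?thesis
    proof cases
      case 1
      then have "nat (n + 1) = Suc (nat n)" by simp
      with f(2)[of "nat n"] 1 p x show ?thesis by (simp add: \<phi>_def Comp_def)
    next
      case 2
      have b: "diff (Cob X p) n x \<in> coboundaries (Cob X p) 0" using x 2 by (auto simp: coboundaries_def)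
      note bc = BD(1)[OF p p b]
      have z: "\<zero>\<^bsub>Mob F p\<^esub> \<in> carrier (Mob F p)" using F'(1)[OF p] by simp
      have "\<phi> p 0 (\<eta> p 0 \<zero>\<^bsub>Mob F p\<^esub> \<oplus>\<^bsub>obj (Cob X p) 0\<^esub> diff (Cob X p) n x) = \<epsilon> p 0 \<zero>\<^bsub>Mob F p\<^esub>"
        by (rule \<phi>0[OF p z b])
      then show ?thesis using 2 bc n\<eta>(4)[OF p] n\<epsilon>(4)[OF p] X'(3)[OF p, of 0] Id(4)[OF p, of "-1"] p by (simp add: \<phi>_def)
    next
      case 3
      then show ?thesis using Id(4)[OF p, of n] p by (simp add: \<phi>_def)
    qed
  qed
  have "cx_nat R S leq X I \<phi>"
    unfolding cx_nat_def chain_map_def using \<phi>n \<phi>d by (auto simp: mod_nat_def)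
  moreover have "cohomology_iso_at (Cob X p) (Cob I p) (\<phi> p) n" if p: "p \<in> S" for p n
  proof (cases "n = 0")
    case False
    show ?thesis
      unfolding cohomology_iso_at_def
    proof (intro conjI ballI impI)
      fix y assume "y \<in> cocycles (Cob I p) n"
      then have y: "y \<in> coboundaries (Cob I p) n" by (rule e\<epsilon>(5)[OF p False])
      have "\<zero>\<^bsub>obj (Cob X p) n\<^esub> \<in> cocycles (Cob X p) n"
        using X'(3)[OF p] Xd(4)[OF p] by (simp add: cocycles_def)
      moreover have "y = \<phi> p n \<zero>\<^bsub>obj (Cob X p) n\<^esub> \<oplus>\<^bsub>obj (Cob I p) n\<^esub> y"
        using \<phi>'(4)[OF p] I'(3)[OF p] submoduleD(1)[OF coboundaries_submodule[OF I'(2)[OF p]] I'(3)[OF p] y] by simp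
      ultimately show "\<exists>x\<in>cocycles (Cob X p) n. \<exists>b\<in>coboundaries (Cob I p) n. y = \<phi> p n x \<oplus>\<^bsub>obj (Cob I p) n\<^esub> b"
        using y by blast
    qed (use e\<eta>(5)[OF p False] in blast)
  next
    case True
    have B0: "coboundaries (Cob I p) 0 = {\<zero>\<^bsub>obj (Cob I p) 0\<^esub>}"
      using neg[of "-1" p] p Id(4)[OF p, of "-1"] by (simp add: coboundaries_def)
    show ?thesis
      unfolding cohomology_iso_at_def True
    proof (intro conjI ballI impI)
      fix z assume z: "z \<in> cocycles (Cob X p) 0" "\<phi> p 0 z \<in> coboundaries (Cob I p) 0"
      from e\<eta>(3)[OF p z(1)] obtain x b where xb: "x \<in> carrier (Mob F p)" "b \<in> coboundaries (Cob X p) 0"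
        "z = \<eta> p 0 x \<oplus>\<^bsub>obj (Cob X p) 0\<^esub> b" by blast
      then have "\<epsilon> p 0 x \<in> coboundaries (Cob I p) 0" using z(2) \<phi>0[OF p] by simp
      then have "x = \<zero>\<^bsub>Mob F p\<^esub>" by (rule e\<epsilon>(4)[OF p xb(1)])
      then have "z = b" using xb(3) n\<eta>(4)[OF p] BD(1)[OF p p xb(2)] X'(3)[OF p, of 0] by simp
      with xb(2) show "z \<in> coboundaries (Cob X p) 0" by simp
    next
      fix y assume y: "y \<in> cocycles (Cob I p) 0"
      from e\<epsilon>(3)[OF p y] obtain x where x: "x \<in> carrier (Mob F p)" "y = \<epsilon> p 0 x"
        using B0 n\<epsilon>(1)[OF p] I'(3)[OF p, of 0] by auto
      have z: "\<zero>\<^bsub>obj (Cob X p) 0\<^esub> \<in> coboundaries (Cob X p) 0" by (rule BD(2)[OF p p])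
      have "y = \<phi> p 0 (\<eta> p 0 x)" using \<phi>0[OF p x(1) z] x n\<eta>(1)[OF p x(1)] X'(3)[OF p, of 0] by simp
      moreover have "\<phi> p 0 (\<eta> p 0 x) \<in> carrier (obj (Cob I p) 0)" using \<phi>'(1) p n\<eta>(1)[OF p x(1)] by simp
      ultimately show "\<exists>x\<in>cocycles (Cob X p) 0. \<exists>b\<in>coboundaries (Cob I p) 0. y = \<phi> p 0 x \<oplus>\<^bsub>obj (Cob I p) 0\<^esub> b"
        using e\<eta>(1)[OF p x(1)] B0 I'(3)[OF p, of 0] by (intro bexI[of _ "\<eta> p 0 x"] bexI[of _ "\<zero>\<^bsub>obj (Cob I p) 0\<^esub>"]) auto
    qed
  qed
  ultimately show ?thesis by (rule that)
qed

end

text \<open>Extending the homomorphism that sends \<open>r\<close> to the family \<open>r w\<close>, from the part of a representable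
  functor strictly below \<open>p\<close>, solves the matching problem for \<open>w\<close>.\<close>

lemma baer_fibrant:
  fixes P :: "'p::order set"
  assumes R: "cring R" and I: "is_cx_functor R P (\<ge>) I"
    and baer: "\<And>n. poset_diagrams.baer R P (\<ge>) (degree_part I n)"
  shows "fibrant R P I"
proof -
  interpret poset_diagrams R P "(\<ge>)"
    using R by (intro poset_diagrams.intro cring_base.intro poset_diagrams_axioms.intro) auto
  note I' = cx_functorD[OF I] and IC = Car_simps[OF I]
  have "matching_map P I p n ` carrier (obj (Cob I p) n) = carrier (obj (lim_cx (below P p) (\<ge>) I) n)"
    if p: "p \<in> P" for p n
  proof (intro subset_antisym subsetI)
    fix w assume "w \<in> matching_map P I p n ` carrier (obj (Cob I p) n)"
    then show "w \<in> carrier (obj (lim_cx (below P p) (\<ge>) I) n)"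
      using p by (auto simp: lim_mod_carrier matching_map_def below_def IC(1) I'(6))
  next
    fix w assume "w \<in> carrier (obj (lim_cx (below P p) (\<ge>) I) n)"
    then have w: "w \<in> extensional (below P p)" "\<And>q. q \<in> P \<Longrightarrow> q < p \<Longrightarrow> w q \<in> carrier (obj (Cob I q) n)"
      "\<And>q s. q \<in> P \<Longrightarrow> s \<in> P \<Longrightarrow> q < p \<Longrightarrow> s \<le> q \<Longrightarrow> Car I q s n (w q) = w s"
      by (auto simp: lim_mod_carrier below_def)
    define \<Lambda> where "\<Lambda> q = (if q < p then {(r, r \<odot>\<^bsub>obj (Cob I q) n\<^esub> w q) | r. r \<in> carrier R}
      else {(\<zero>\<^bsub>R\<^esub>, \<zero>\<^bsub>obj (Cob I q) n\<^esub>)})" for q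
    have "linear_relation (representable p) (degree_part I n) \<Lambda>"
    proof (rule linear_relationI)
      fix q s r y assume q: "q \<in> P" "s \<in> P" "q \<ge> s" "(r, y) \<in> \<Lambda> q"
      show "(Mar (representable p) q s r, Mar (degree_part I n) q s y) \<in> \<Lambda> s"
      proof (cases "q < p")
        case True
        with q(3) have "s < p" by simp
        with True q w show ?thesis by (auto simp: \<Lambda>_def IC(3))
      next
        case False
        with q have "r = \<zero>\<^bsub>R\<^esub>" "y = \<zero>\<^bsub>obj (Cob I q) n\<^esub>" by (auto simp: \<Lambda>_def)
        then show ?thesis using q w(2)[of s] I'(3)[of s n] by (auto simp: \<Lambda>_def IC(4) intro!: exI[of _ "\<zero>\<^bsub>R\<^esub>"])
      qed
    qed (auto simp: \<Lambda>_def w I'(3) module_smult l_distr r_distr split: if_splits intro!: exI[of _ "\<zero>\<^bsub>R\<^esub>"])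
    moreover have "\<forall>q\<in>P. \<forall>y. (\<zero>\<^bsub>R\<^esub>, y) \<in> \<Lambda> q \<longrightarrow> y = \<zero>\<^bsub>Mob (degree_part I n) q\<^esub>"
      by (auto simp: \<Lambda>_def w I'(3) split: if_splits)
    ultimately have "\<exists>j\<in>carrier (Mob (degree_part I n) p). \<forall>q\<in>P. q \<le> p \<longrightarrow>
        (\<forall>r y. (r, y) \<in> \<Lambda> q \<longrightarrow> y = r \<odot>\<^bsub>Mob (degree_part I n) q\<^esub> Mar (degree_part I n) p q j)"
      using conjunct2[OF baer[of n, unfolded baer_def]] p by blast
    then obtain j where j: "j \<in> carrier (obj (Cob I p) n)"
      "\<And>q r y. q \<in> P \<Longrightarrow> q \<le> p \<Longrightarrow> (r, y) \<in> \<Lambda> q \<Longrightarrow> y = r \<odot>\<^bsub>obj (Cob I q) n\<^esub> Car I p q n j"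
      by auto
    have "w q = Car I p q n j" if "q \<in> P" "q < p" for q
    proof -
      have "(\<one>\<^bsub>R\<^esub>, w q) \<in> \<Lambda> q" using that w(2)[OF that] I'(3)[OF that(1), of n] by (auto simp: \<Lambda>_def intro!: exI[of _ "\<one>\<^bsub>R\<^esub>"])
      from j(2)[OF that(1) _ this] show ?thesis using that p j(1) IC(1)[of p q j n] I'(3)[OF that(1), of n] by simp
    qed
    then have "w = matching_map P I p n j"
      by (intro extensionalityI[OF w(1)]) (auto simp: matching_map_def below_def)
    with j(1) show "w \<in> matching_map P I p n ` carrier (obj (Cob I p) n)" by blast
  qed
  with I show ?thesis by (simp add: fibrant_def)
qed

theorem right_derived_lim_fibrant_replacement:
  fixes R :: "('r, 'x) ring_scheme" and P :: "'p::order set" and F :: "('r, 'p, 'a) mod_functor"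
    and H :: "('r, ('p \<Rightarrow> 'u) set) module"
  assumes R: "cring R" and P: "filtered_poset P" and F: "is_mod_functor R P (\<ge>) F"
    and RF: "fibrant_replacement R P F RF \<eta>" and H: "is_right_derived_lim R P (\<ge>) F k H"
  shows "isomorphic_modules R H (cohomology (lim_cx P (\<ge>) RF) k)"
proof -
  interpret poset_diagrams R P "(\<ge>)"
    using R by (intro poset_diagrams.intro cring_base.intro poset_diagrams_axioms.intro) auto
  obtain I \<epsilon> where I: "injective_resolution R P (\<ge>) F I \<epsilon>" and Heq: "H = cohomology (lim_cx P (\<ge>) I) k"
    using H by (auto simp: is_right_derived_lim_def)
  have fib: "fibrant R P RF" and \<eta>: "weak_equivalence R P (\<ge>) (concentrated F) RF \<eta>"
    using RF by (auto simp: fibrant_replacement_def)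
  then have RFc: "is_cx_functor R P (\<ge>) RF" by (simp add: fibrant_def)
  have Ic: "is_cx_functor R P (\<ge>) I" and \<epsilon>: "weak_equivalence R P (\<ge>) (concentrated F) I \<epsilon>"
    and neg: "\<And>n p. n < 0 \<Longrightarrow> p \<in> P \<Longrightarrow> carrier (obj (Cob I p) n) = {\<zero>\<^bsub>obj (Cob I p) n\<^esub>}"
    and baer: "baer (degree_part I n)" for n
    using I by (auto simp: injective_resolution_def injective_baer)
  obtain \<phi> where \<phi>: "cx_nat R P (\<ge>) RF I \<phi>" "\<And>p n. p \<in> P \<Longrightarrow> cohomology_iso_at (Cob RF p) (Cob I p) (\<phi> p) n"
    using map_into_injective_complex[OF F RFc Ic \<eta> \<epsilon> baer neg] by blast
  have "isomorphic_modules R (cohomology (lim_cx P (\<ge>) RF) k) (cohomology (lim_cx P (\<ge>) I) k)"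
    by (rule lim_weak_equivalence[OF P fib baer_fibrant[OF R Ic baer] \<phi>])
  then show ?thesis
    unfolding Heq by (rule isomorphic_modules_sym) (rule cohomology_module[OF lim_complex[OF RFc]])
qed

section \<open>Projective functors\<close>

text \<open>A list is coded by its length and by an iterated pairing of its entries; the pairing exists because an
  infinite set is equipotent to its square.\<close>

lemma lists_lepoll:
  fixes A :: "'c set"
  assumes inf: "infinite (UNIV :: 'v set)" and A: "A \<lesssim> (UNIV :: 'v set)"
  shows "lists A \<lesssim> (UNIV :: 'v set)"
proof -
  obtain a :: "'c \<Rightarrow> 'v" where a: "inj_on a A" using A by (auto simp: lepoll_def)
  obtain t :: "nat \<Rightarrow> 'v" where t: "inj t" using inf by (auto simp: infinite_iff_countable_subset)
  obtain h :: "'v \<times> 'v \<Rightarrow> 'v" where h: "inj h"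
    using iffD2[OF card_of_ordIso card_of_Times_same_infinite[OF inf]] by (auto simp: bij_betw_def)
  define enc where "enc l = foldr (\<lambda>x c. h (a x, c)) l (t 0)" for l
  have "l = l'" if "length l = length l'" "set l \<subseteq> A" "set l' \<subseteq> A" "enc l = enc l'" for l l'
    using that
  proof (induction l l' rule: list_induct2)
    case (Cons x l x' l')
    then have "h (a x, enc l) = h (a x', enc l')" by (simp add: enc_def)
    then have "a x = a x'" "enc l = enc l'" using injD[OF h] by blast+
    with Cons a show ?case by (auto simp: inj_on_def)
  qed simp
  then have "inj_on (\<lambda>l. h (t (length l), enc l)) (lists A)"
    by (intro inj_onI) (auto simp: inj_eq[OF h] inj_eq[OF t] in_lists_conv_set subset_iff)
  then show ?thesis by (auto simp: lepoll_def)
qed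

lemma times_lepoll:
  assumes inf: "infinite (UNIV :: 'v set)" and A: "A \<lesssim> (UNIV :: 'v set)" and B: "B \<lesssim> (UNIV :: 'v set)"
  shows "A \<times> B \<lesssim> (UNIV :: 'v set)"
proof -
  have "A \<times> B \<lesssim> (UNIV :: 'v set) \<times> (UNIV :: 'v set)" by (rule times_lepoll_mono[OF A B])
  also have "\<dots> \<lesssim> (UNIV :: 'v set)"
    using iffD2[OF card_of_ordIso card_of_Times_same_infinite[OF inf]]
    by (auto simp: bij_betw_def lepoll_def)
  finally show ?thesis .
qed

context poset_diagrams
begin

text \<open>A total relation is a functor whose first projection to \<open>Q\<close> is an epimorphism. The second projection of a
  section is the required transformation.\<close>

lemma projective_lifting_small:
  assumes Q: "projective_functor R S leq (Q :: ('r, 'p, 'v) mod_functor)"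
    and A: "is_mod_functor R S leq (A :: ('r, 'p, 'f) mod_functor)"
    and \<Gamma>: "linear_relation Q A \<Gamma>" and total: "\<And>p x. p \<in> S \<Longrightarrow> x \<in> carrier (Mob Q p) \<Longrightarrow> \<exists>a. (x, a) \<in> \<Gamma> p"
    and small: "\<And>p. p \<in> S \<Longrightarrow> \<Gamma> p \<lesssim> (UNIV :: 'v set)"
  shows "\<exists>\<psi>. mod_nat R S leq Q A \<psi> \<and> (\<forall>p\<in>S. \<forall>x\<in>carrier (Mob Q p). (x, \<psi> p x) \<in> \<Gamma> p)"
proof -
  have Qf: "is_mod_functor R S leq Q" using Q by (simp add: projective_functor_def)
  let ?E = "relation_functor Q A \<Gamma>"
  have E: "is_mod_functor R S leq ?E" by (rule relation_functor_functor[OF \<Gamma> Qf A])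
  from small have "\<forall>p\<in>S. \<exists>e :: 'v \<times> 'f \<Rightarrow> 'v. inj_on e (carrier (Mob ?E p))" by (auto simp: lepoll_def)
  then obtain e :: "'p \<Rightarrow> 'v \<times> 'f \<Rightarrow> 'v" where e: "\<forall>p\<in>S. inj_on (e p) (carrier (Mob ?E p))" by metis
  note T = transport_iso[where F = ?E and e = e, OF E e]
  let ?T = "transport ?E e" and ?i = "\<lambda>p. inv_into (carrier (Mob ?E p)) (e p)"
  have "mod_nat R S leq ?T Q (\<lambda>p x. fst (?i p x))"
    by (rule mod_nat_comp[OF T(3) relation_projections(1)[OF \<Gamma>]])
  moreover have "\<forall>p\<in>S. (\<lambda>x. fst (?i p x)) ` carrier (Mob ?T p) = carrier (Mob Q p)"
  proof (intro ballI subset_antisym subsetI)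
    fix p x assume p: "p \<in> S" and "x \<in> (\<lambda>x. fst (?i p x)) ` carrier (Mob ?T p)"
    then show "x \<in> carrier (Mob Q p)" using T(4,5)[OF p] linear_relationD(1)[OF \<Gamma> p] by auto
  next
    fix p x assume p: "p \<in> S" and "x \<in> carrier (Mob Q p)"
    then obtain a where a: "(x, a) \<in> carrier (Mob ?E p)" using total by auto
    then have "e p (x, a) \<in> carrier (Mob ?T p)" using T(5)[OF p] by blast
    moreover have "x = fst (?i p (e p (x, a)))" using T(4)[OF p a] by simp
    ultimately show "x \<in> (\<lambda>x. fst (?i p x)) ` carrier (Mob ?T p)" by blast
  qed
  moreover have "mod_nat R S leq Q Q (\<lambda>p x. x)"
    by (rule mod_natI) auto
  ultimately obtain \<psi> where \<psi>: "mod_nat R S leq Q ?T \<psi>"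
    "\<forall>p\<in>S. \<forall>x\<in>carrier (Mob Q p). fst (?i p (\<psi> p x)) = x"
    using Q T(1) Qf unfolding projective_functor_def by blast
  have "mod_nat R S leq Q A (\<lambda>p x. snd (?i p (\<psi> p x)))"
    by (rule mod_nat_comp[OF mod_nat_comp[OF \<psi>(1) T(3)] relation_projections(2)[OF \<Gamma>]])
  moreover have "(x, snd (?i p (\<psi> p x))) \<in> \<Gamma> p" if p: "p \<in> S" and x: "x \<in> carrier (Mob Q p)" for p x
  proof -
    have "\<psi> p x \<in> carrier (Mob ?T p)" using mod_natD(1)[OF \<psi>(1) Qf T(1) p x] .
    then obtain c where "c \<in> carrier (Mob ?E p)" "\<psi> p x = e p c" using T(5)[OF p] by blast
    then have "?i p (\<psi> p x) \<in> \<Gamma> p" using T(4)[OF p] by simp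
    then show ?thesis using \<psi>(2) p x by (metis prod.collapse)
  qed
  ultimately show ?thesis by blast
qed

text \<open>A lifting problem may have values of arbitrary size. It restricts to one in the universe of \<open>Q\<close>
  by a downward Loewenheim-Skolem argument: choose a lift of every element and pass to the subfunctor
  generated by these choices. Its elements are values of formal linear combinations, that is, of lists.\<close>

lemma small_total_subrelation:
  assumes large: "large_universe R S TYPE('v)" and Qf: "is_mod_functor R S leq (Q :: ('r, 'p, 'v) mod_functor)"
    and A: "is_mod_functor R S leq (A :: ('r, 'p, 'f) mod_functor)"
    and \<Gamma>: "linear_relation Q A \<Gamma>" and total: "\<And>p x. p \<in> S \<Longrightarrow> x \<in> carrier (Mob Q p) \<Longrightarrow> \<exists>a. (x, a) \<in> \<Gamma> p"
  obtains \<Delta> where "linear_relation Q A \<Delta>" "\<And>p x. p \<in> S \<Longrightarrow> x \<in> carrier (Mob Q p) \<Longrightarrow> \<exists>a. (x, a) \<in> \<Delta> p"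
    "\<And>p. p \<in> S \<Longrightarrow> \<Delta> p \<subseteq> \<Gamma> p" "\<And>p. p \<in> S \<Longrightarrow> \<Delta> p \<lesssim> (UNIV :: 'v set)"
proof -
  note Q' = mod_functorD[OF Qf] and A' = mod_functorD[OF A] and G = linear_relationD[OF \<Gamma>]
  obtain s where s: "\<And>p x. p \<in> S \<Longrightarrow> x \<in> carrier (Mob Q p) \<Longrightarrow> (x, s p x) \<in> \<Gamma> p" using total by metis
  have sA: "s p x \<in> carrier (Mob A p)" if "p \<in> S" "x \<in> carrier (Mob Q p)" for p x
    using G(2) s that by blast
  \<comment> \<open>Formal terms \<open>r \<cdot> Mar p q x\<close>, evaluated in both components of the relation at once by \<open>ev\<close>.\<close>
  define gen where "gen q = {(r, p, x). r \<in> carrier R \<and> p \<in> S \<and> leq p q \<and> x \<in> carrier (Mob Q p)}" for q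
  define ev where "ev q = (\<lambda>l. foldr (\<lambda>(r, p, x) c. (r \<odot>\<^bsub>Mob Q q\<^esub> Mar Q p q x \<oplus>\<^bsub>Mob Q q\<^esub> fst c,
    r \<odot>\<^bsub>Mob A q\<^esub> Mar A p q (s p x) \<oplus>\<^bsub>Mob A q\<^esub> snd c)) l (\<zero>\<^bsub>Mob Q q\<^esub>, \<zero>\<^bsub>Mob A q\<^esub>))" for q
  have ev0: "ev q [] = (\<zero>\<^bsub>Mob Q q\<^esub>, \<zero>\<^bsub>Mob A q\<^esub>)" for q by (simp add: ev_def)
  have ev1: "ev q ((r, p, x) # l) = (r \<odot>\<^bsub>Mob Q q\<^esub> Mar Q p q x \<oplus>\<^bsub>Mob Q q\<^esub> fst (ev q l),
    r \<odot>\<^bsub>Mob A q\<^esub> Mar A p q (s p x) \<oplus>\<^bsub>Mob A q\<^esub> snd (ev q l))" for q r p x l by (simp add: ev_def)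
  have ev\<Gamma>: "ev q l \<in> \<Gamma> q" if q: "q \<in> S" and l: "l \<in> lists (gen q)" for q l
    using l
  proof induction
    case (Cons c l)
    obtain r p x where c: "c = (r, p, x)" by (cases c)
    with Cons have h: "r \<in> carrier R" "p \<in> S" "leq p q" "x \<in> carrier (Mob Q p)" by (auto simp: gen_def)
    have "(r \<odot>\<^bsub>Mob Q q\<^esub> Mar Q p q x, r \<odot>\<^bsub>Mob A q\<^esub> Mar A p q (s p x)) \<in> \<Gamma> q"
      by (rule G(5)[OF q h(1) G(6)[OF h(2) q h(3) s[OF h(2,4)]]])
    from G(4)[OF q this, of "fst (ev q l)" "snd (ev q l)"] Cons show ?case by (simp add: c ev1)
  qed (use G(3)[OF q] in \<open>simp add: ev0\<close>)
  have evc: "fst (ev q l) \<in> carrier (Mob Q q)" "snd (ev q l) \<in> carrier (Mob A q)"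
    if "q \<in> S" "l \<in> lists (gen q)" for q l
    using G(1,2)[OF that(1), of "fst (ev q l)" "snd (ev q l)"] ev\<Gamma>[OF that] by simp_all
  have term_c: "Mar Q p q x \<in> carrier (Mob Q q)" "Mar A p q (s p x) \<in> carrier (Mob A q)"
    if "q \<in> S" "(r, p, x) \<in> gen q" for q r p x
    using that Q'(2) A'(2) sA by (auto simp: gen_def)
  have ev_add: "ev q (l @ l') = (fst (ev q l) \<oplus>\<^bsub>Mob Q q\<^esub> fst (ev q l'), snd (ev q l) \<oplus>\<^bsub>Mob A q\<^esub> snd (ev q l'))"
    if q: "q \<in> S" and l: "l \<in> lists (gen q)" "l' \<in> lists (gen q)" for q l l'
    using l(1)
  proof induction
    case (Cons c l)
    obtain r p x where c: "c = (r, p, x)" by (cases c)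
    note tc = term_c[OF q Cons(1)[unfolded c]]
    have r: "r \<in> carrier R" using Cons(1) by (simp add: c gen_def)
    show ?case using Cons(3) tc r evc[OF q Cons(2)] evc[OF q l(2)] Q'(1)[OF q] A'(1)[OF q]
      by (simp add: c ev1 module_ac)
  qed (use evc[OF q l(2)] Q'(1)[OF q] A'(1)[OF q] in \<open>simp add: ev0\<close>)
  have ev_smult: "ev q (map (\<lambda>(r, p, x). (a \<otimes> r, p, x)) l) = (a \<odot>\<^bsub>Mob Q q\<^esub> fst (ev q l), a \<odot>\<^bsub>Mob A q\<^esub> snd (ev q l))"
    if q: "q \<in> S" and a: "a \<in> carrier R" and l: "l \<in> lists (gen q)" for q a l
    using l
  proof induction
    case (Cons c l)
    obtain r p x where c: "c = (r, p, x)" by (cases c)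
    note tc = term_c[OF q Cons(1)[unfolded c]]
    have r: "r \<in> carrier R" using Cons(1) by (simp add: c gen_def)
    show ?case using Cons(3) tc r a evc[OF q Cons(2)] Q'(1)[OF q] A'(1)[OF q]
      by (simp add: c ev1 module_smult)
  qed (use a Q'(1)[OF q] A'(1)[OF q] in \<open>simp add: ev0\<close>)
  have ev_Mar: "ev q' l = (Mar Q q q' (fst (ev q l)), Mar A q q' (snd (ev q l)))"
    if q: "q \<in> S" "q' \<in> S" "leq q q'" and l: "l \<in> lists (gen q)" for q q' l
    using l
  proof induction
    case (Cons c l)
    obtain r p x where c: "c = (r, p, x)" by (cases c)
    note tc = term_c[OF q(1) Cons(1)[unfolded c]]
    have h: "r \<in> carrier R" "p \<in> S" "leq p q" "x \<in> carrier (Mob Q p)" using Cons(1) by (auto simp: c gen_def)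
    show ?case using Cons(3) tc h q evc[OF q(1) Cons(2)] Q' A' sA[OF h(2,4)]
      by (simp add: c ev1)
  qed (use q Q'(5) A'(5) in \<open>simp add: ev0\<close>)
  define \<Delta> where "\<Delta> q = ev q ` lists (gen q)" for q
  have "linear_relation Q A \<Delta>"
  proof (rule linear_relationI)
    fix q x y assume q: "q \<in> S" and "(x, y) \<in> \<Delta> q"
    then obtain l where l: "l \<in> lists (gen q)" "ev q l = (x, y)" by (force simp: \<Delta>_def)
    show "x \<in> carrier (Mob Q q)" "y \<in> carrier (Mob A q)" using evc[OF q l(1)] l(2) by auto
    show "(x \<oplus>\<^bsub>Mob Q q\<^esub> x', y \<oplus>\<^bsub>Mob A q\<^esub> y') \<in> \<Delta> q" if "(x', y') \<in> \<Delta> q" for x' y'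
    proof -
      from that obtain l' where l': "l' \<in> lists (gen q)" "ev q l' = (x', y')" by (force simp: \<Delta>_def)
      have "ev q (l @ l') \<in> \<Delta> q" unfolding \<Delta>_def using l l' by (intro imageI) auto
      then show ?thesis using ev_add[OF q l(1) l'(1)] l l' by simp
    qed
    show "(a \<odot>\<^bsub>Mob Q q\<^esub> x, a \<odot>\<^bsub>Mob A q\<^esub> y) \<in> \<Delta> q" if a: "a \<in> carrier R" for a
    proof -
      have "ev q (map (\<lambda>(r, p, x). (a \<otimes> r, p, x)) l) \<in> \<Delta> q"
        unfolding \<Delta>_def using l a by (intro imageI) (auto simp: gen_def in_lists_conv_set)
      then show ?thesis using ev_smult[OF q a l(1)] l by simp
    qed
    show "(Mar Q q q' x, Mar A q q' y) \<in> \<Delta> q'" if q': "q' \<in> S" "leq q q'" for q'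
    proof -
      have "l \<in> lists (gen q')" using l(1) q q' leq_trans[OF _ q q'(1) _ q'(2)] by (auto simp: gen_def in_lists_conv_set)
      then have "ev q' l \<in> \<Delta> q'" unfolding \<Delta>_def by (rule imageI)
      then show ?thesis using ev_Mar[OF q q' l(1)] l by simp
    qed
  next
    fix q assume "q \<in> S"
    have "ev q [] \<in> \<Delta> q" unfolding \<Delta>_def by (rule imageI) simp
    then show "(\<zero>\<^bsub>Mob Q q\<^esub>, \<zero>\<^bsub>Mob A q\<^esub>) \<in> \<Delta> q" by (simp add: ev0)
  qed
  moreover have "\<exists>a. (x, a) \<in> \<Delta> q" if q: "q \<in> S" and x: "x \<in> carrier (Mob Q q)" for q x
  proof -
    have "ev q [(\<one>, q, x)] \<in> \<Delta> q"
      unfolding \<Delta>_def by (rule imageI) (use q x leq_refl in \<open>auto simp: gen_def\<close>)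
    then show ?thesis using q x Q' by (auto simp: ev0 ev1)
  qed
  moreover have "\<Delta> q \<subseteq> \<Gamma> q" if "q \<in> S" for q using ev\<Gamma>[OF that] unfolding \<Delta>_def by blast
  moreover have "\<Delta> q \<lesssim> (UNIV :: 'v set)" for q
  proof -
    have inf: "infinite (UNIV :: 'v set)" and R: "carrier R \<lesssim> (UNIV :: 'v set)" and S: "S \<lesssim> (UNIV :: 'v set)"
      using large by (auto simp: large_universe_def)
    have "gen q \<subseteq> carrier R \<times> (S \<times> (UNIV :: 'v set))" by (auto simp: gen_def)
    then have "gen q \<lesssim> carrier R \<times> (S \<times> (UNIV :: 'v set))" by (rule subset_imp_lepoll)
    also have "\<dots> \<lesssim> (UNIV :: 'v set)"
      by (rule times_lepoll[OF inf R times_lepoll[OF inf S lepoll_refl]])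
    finally have "lists (gen q) \<lesssim> (UNIV :: 'v set)" by (rule lists_lepoll[OF inf])
    then show ?thesis unfolding \<Delta>_def by (rule lepoll_trans[OF image_lepoll])
  qed
  ultimately show ?thesis by (intro that[of \<Delta>])
qed

theorem projective_lifting:
  assumes Q: "projective_functor R S leq (Q :: ('r, 'p, 'v) mod_functor)"
    and A: "is_mod_functor R S leq (A :: ('r, 'p, 'f) mod_functor)"
    and \<Gamma>: "linear_relation Q A \<Gamma>" and total: "\<And>p x. p \<in> S \<Longrightarrow> x \<in> carrier (Mob Q p) \<Longrightarrow> \<exists>a. (x, a) \<in> \<Gamma> p"
  shows "\<exists>\<psi>. mod_nat R S leq Q A \<psi> \<and> (\<forall>p\<in>S. \<forall>x\<in>carrier (Mob Q p). (x, \<psi> p x) \<in> \<Gamma> p)"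
proof -
  have large: "large_universe R S TYPE('v)" and Qf: "is_mod_functor R S leq Q"
    using Q by (auto simp: projective_functor_def)
  obtain \<Delta> where \<Delta>: "linear_relation Q A \<Delta>" "\<And>p x. p \<in> S \<Longrightarrow> x \<in> carrier (Mob Q p) \<Longrightarrow> \<exists>a. (x, a) \<in> \<Delta> p"
    "\<And>p. p \<in> S \<Longrightarrow> \<Delta> p \<subseteq> \<Gamma> p" "\<And>p. p \<in> S \<Longrightarrow> \<Delta> p \<lesssim> (UNIV :: 'v set)"
    using small_total_subrelation[OF large Qf A \<Gamma> total] by blast
  from projective_lifting_small[OF Q A \<Delta>(1,2,4)] obtain \<psi> where
    "mod_nat R S leq Q A \<psi>" "\<forall>p\<in>S. \<forall>x\<in>carrier (Mob Q p). (x, \<psi> p x) \<in> \<Delta> p" by blast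
  with \<Delta>(3) show ?thesis by blast
qed

end

section \<open>Comparison with a projective resolution\<close>

context cring_base
begin

text \<open>The counterpart of \<open>coaugmentationD\<close> for a weak equivalence to a functor in degree \<open>0\<close>.\<close>

lemma augmentationD:
  assumes \<eta>: "weak_equivalence R S leq X (concentrated F) \<eta>" and F: "is_mod_functor R S leq F"
    and X: "is_cx_functor R S leq X"
  shows "mod_nat R S leq (degree_part X 0) F (\<lambda>p. \<eta> p 0)"
    and "p \<in> S \<Longrightarrow> x \<in> carrier (obj (Cob X p) (- 1)) \<Longrightarrow> \<eta> p 0 (diff (Cob X p) (- 1) x) = \<zero>\<^bsub>Mob F p\<^esub>"
    and "p \<in> S \<Longrightarrow> y \<in> carrier (Mob F p) \<Longrightarrow> \<exists>z\<in>cocycles (Cob X p) 0. \<eta> p 0 z = y"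
    and "p \<in> S \<Longrightarrow> z \<in> cocycles (Cob X p) 0 \<Longrightarrow> \<eta> p 0 z = \<zero>\<^bsub>Mob F p\<^esub> \<Longrightarrow> z \<in> coboundaries (Cob X p) 0"
    and "p \<in> S \<Longrightarrow> n \<noteq> 0 \<Longrightarrow> z \<in> cocycles (Cob X p) n \<Longrightarrow> z \<in> coboundaries (Cob X p) n"
proof -
  note w = weak_equivalence_iso[OF \<eta> X concentrated_functor[OF F]]
  note n = cx_natD[OF w(1) X concentrated_functor[OF F]]
  note F' = mod_functorD[OF F]
  have Z: "cocycles (Cob (concentrated F) p) 0 = carrier (Mob F p)" for p
    by (auto simp: cocycles_def)
  have B: "coboundaries (Cob (concentrated F) p) m = {\<zero>\<^bsub>Mob F p\<^esub>}" if "p \<in> S" for p m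
  proof -
    have "\<zero>\<^bsub>Mob F p\<^esub> \<in> carrier (obj (Cob (concentrated F) p) (m - 1))" using F'(1)[OF that] by simp
    then show ?thesis unfolding coboundaries_def concentrated_simps(2) by blast
  qed
  have "mod_nat R S leq (degree_part X 0) (degree_part (concentrated F) 0) (\<lambda>p. \<eta> p 0)"
    using w(1) by (simp add: cx_nat_def)
  then show "mod_nat R S leq (degree_part X 0) F (\<lambda>p. \<eta> p 0)" by (simp add: mod_nat_def)
  show "\<eta> p 0 (diff (Cob X p) (- 1) x) = \<zero>\<^bsub>Mob F p\<^esub>" if "p \<in> S" "x \<in> carrier (obj (Cob X p) (- 1))" for p x
    using n(6)[of p x "-1"] that by simp
  show "\<exists>z\<in>cocycles (Cob X p) 0. \<eta> p 0 z = y" if p: "p \<in> S" and y: "y \<in> carrier (Mob F p)" for p y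
  proof -
    obtain z where z: "z \<in> cocycles (Cob X p) 0" "y = \<eta> p 0 z \<oplus>\<^bsub>Mob F p\<^esub> \<zero>\<^bsub>Mob F p\<^esub>"
      using w(2)[OF p, of 0] y B[OF p, of 0] unfolding cohomology_iso_at_def Z by auto
    then have "\<eta> p 0 z \<in> carrier (Mob F p)" using n(1)[OF p, of z 0] by (simp add: cocycles_def)
    with z F'(1)[OF p] show ?thesis by auto
  qed
  show "z \<in> coboundaries (Cob X p) 0" if "p \<in> S" "z \<in> cocycles (Cob X p) 0" "\<eta> p 0 z = \<zero>\<^bsub>Mob F p\<^esub>" for p z
    using w(2)[OF that(1), of 0] that B[of p 0] unfolding cohomology_iso_at_def by blast
  show "z \<in> coboundaries (Cob X p) n" if p: "p \<in> S" and n0: "n \<noteq> 0" and z: "z \<in> cocycles (Cob X p) n" for p n z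
  proof -
    have "\<eta> p n z = \<zero>\<^bsub>Mob F p\<^esub>" using n(1)[OF p, of z n] z n0 by (simp add: cocycles_def)
    then show ?thesis using w(2)[OF p, of n] z B[OF p, of n] unfolding cohomology_iso_at_def by blast
  qed
qed

end

context poset_diagrams
begin

text \<open>The components are lifts against the differentials of \<open>X\<close>, going down from degree \<open>0\<close>. A lift exists since
  the composite with the differential consists of coboundaries: in degree \<open>0\<close> this follows from the
  augmentations, in lower degrees from the exactness of \<open>X\<close>. In degree \<open>0\<close> the values are taken in the
  cocycles, so that the map is zero in positive degrees.\<close>

lemma map_from_projective_complex:
  assumes F: "is_mod_functor R S leq F" and X: "is_cx_functor R S leq X" and Q: "is_cx_functor R S leq Q"
    and \<eta>: "weak_equivalence R S leq X (concentrated F) \<eta>"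
    and \<epsilon>: "weak_equivalence R S leq Q (concentrated F) \<epsilon>"
    and proj: "\<And>n. projective_functor R S leq (degree_part Q n)"
    and pos: "\<And>n p. n > 0 \<Longrightarrow> p \<in> S \<Longrightarrow> carrier (obj (Cob Q p) n) = {\<zero>\<^bsub>obj (Cob Q p) n\<^esub>}"
  obtains \<phi> where "cx_nat R S leq Q X \<phi>" "\<And>p n. p \<in> S \<Longrightarrow> cohomology_iso_at (Cob Q p) (Cob X p) (\<phi> p) n"
proof -
  note X' = cx_functorD[OF X] and Q' = cx_functorD[OF Q] and XC = Car_simps[OF X] and QC = Car_simps[OF Q]
  note Xd = diffD[OF X'(2)] and Qd = diffD[OF Q'(2)] and Xd' = diff_intoD[OF X'(2)] and Qd' = diff_intoD[OF Q'(2)]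
  note e\<eta> = augmentationD[OF \<eta> F X] and e\<epsilon> = augmentationD[OF \<epsilon> F Q]
  note n\<eta> = mod_natD[OF e\<eta>(1) X'(1) F, simplified] and n\<epsilon> = mod_natD[OF e\<epsilon>(1) Q'(1) F, simplified]
  note F' = mod_functorD[OF F]
  have subB: "submodule (coboundaries (Cob X p) n) R (obj (Cob X p) n)" if "p \<in> S" for p n
    by (rule coboundaries_submodule[OF X'(2)[OF that]])
  have subZ: "submodule (cocycles (Cob X p) n) R (obj (Cob X p) n)" if "p \<in> S" for p n
    by (rule cocycles_submodule[OF X'(2)[OF that]])
  note BD = submoduleD[OF subB X'(3)] and ZD = submoduleD[OF subZ X'(3)]
  \<comment> \<open>\<open>Ok\<close> says that the map in degree \<open>- n\<close> admits a successor, \<open>Comp\<close> that \<open>g\<close> is one.\<close>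
  define Ok where "Ok n f \<longleftrightarrow> mod_nat R S leq (degree_part Q (- int n)) (degree_part X (- int n)) f \<and>
      (\<forall>p\<in>S. \<forall>x\<in>carrier (obj (Cob Q p) (- int n - 1)).
         f p (diff (Cob Q p) (- int n - 1) x) \<in> coboundaries (Cob X p) (- int n)) \<and>
      (n = 0 \<longrightarrow> (\<forall>p\<in>S. \<forall>x\<in>carrier (obj (Cob Q p) 0). f p x \<in> cocycles (Cob X p) 0 \<and> \<eta> p 0 (f p x) = \<epsilon> p 0 x))" for n f
  define Comp where "Comp n f g \<longleftrightarrow> (\<forall>p\<in>S. \<forall>x\<in>carrier (obj (Cob Q p) (- int n - 1)).
      diff (Cob X p) (- int n - 1) (g p x) = f p (diff (Cob Q p) (- int n - 1) x))" for n f g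
  have "\<exists>f. Ok 0 f"
  proof -
    define \<Gamma> where "\<Gamma> p = {(x, z). x \<in> carrier (obj (Cob Q p) 0) \<and> z \<in> cocycles (Cob X p) 0 \<and> \<eta> p 0 z = \<epsilon> p 0 x}" for p
    have "linear_relation (degree_part Q 0) (degree_part X 0) \<Gamma>"
    proof (rule linear_relationI)
      fix p q x z assume pq: "p \<in> S" "q \<in> S" "leq p q" "(x, z) \<in> \<Gamma> p"
      then have "Car X p q 0 z \<in> cocycles (Cob X q) 0"
        using XC(6)[of p q z 0] XC(1,4)[of p q] by (auto simp: \<Gamma>_def cocycles_def)
      with pq show "(Mar (degree_part Q 0) p q x, Mar (degree_part X 0) p q z) \<in> \<Gamma> q"
        using n\<eta>(6) n\<epsilon>(6) QC(1) ZD(1) by (auto simp: \<Gamma>_def)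
    next
      fix p x y x' y' assume p: "p \<in> S" and "(x, y) \<in> \<Gamma> p" "(x', y') \<in> \<Gamma> p"
      then show "(x \<oplus>\<^bsub>Mob (degree_part Q 0) p\<^esub> x', y \<oplus>\<^bsub>Mob (degree_part X 0) p\<^esub> y') \<in> \<Gamma> p"
        using Q'(3)[OF p] ZD(1,3)[OF p p] n\<eta>(2)[OF p] n\<epsilon>(2)[OF p] by (auto simp: \<Gamma>_def)
    next
      fix p a x y assume p: "p \<in> S" and a: "a \<in> carrier R" and "(x, y) \<in> \<Gamma> p"
      then show "(a \<odot>\<^bsub>Mob (degree_part Q 0) p\<^esub> x, a \<odot>\<^bsub>Mob (degree_part X 0) p\<^esub> y) \<in> \<Gamma> p"
        using Q'(3)[OF p] ZD(1)[OF p p] ZD(5)[OF p p a] n\<eta>(3)[OF p a] n\<epsilon>(3)[OF p a] by (auto simp: \<Gamma>_def)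
    next
      fix p assume p: "p \<in> S"
      then show "(\<zero>\<^bsub>Mob (degree_part Q 0) p\<^esub>, \<zero>\<^bsub>Mob (degree_part X 0) p\<^esub>) \<in> \<Gamma> p"
        using Q'(3)[OF p] ZD(2)[OF p p] n\<eta>(4)[OF p] n\<epsilon>(4)[OF p] by (auto simp: \<Gamma>_def)
    qed (auto simp: \<Gamma>_def cocycles_def)
    moreover have "\<exists>z. (x, z) \<in> \<Gamma> p" if "p \<in> S" "x \<in> carrier (Mob (degree_part Q 0) p)" for p x
      using e\<eta>(3)[OF that(1) n\<epsilon>(1)[OF that(1)]] that(2) by (auto simp: \<Gamma>_def)
    ultimately obtain f where f: "mod_nat R S leq (degree_part Q 0) (degree_part X 0) f"
      "\<forall>p\<in>S. \<forall>x\<in>carrier (Mob (degree_part Q 0) p). (x, f p x) \<in> \<Gamma> p"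
      using projective_lifting[OF proj X'(1), of 0 0 \<Gamma>] by blast
    have "f p (diff (Cob Q p) (- 1) x) \<in> coboundaries (Cob X p) 0" if p: "p \<in> S" and x: "x \<in> carrier (obj (Cob Q p) (- 1))" for p x
    proof -
      have "diff (Cob Q p) (- 1) x \<in> carrier (obj (Cob Q p) 0)" using Qd(1)[OF p x] by simp
      with f(2) p have "f p (diff (Cob Q p) (- 1) x) \<in> cocycles (Cob X p) 0"
        "\<eta> p 0 (f p (diff (Cob Q p) (- 1) x)) = \<epsilon> p 0 (diff (Cob Q p) (- 1) x)" by (auto simp: \<Gamma>_def)
      with e\<eta>(4)[OF p] e\<epsilon>(2)[OF p x] show ?thesis by simp
    qed
    with f have "Ok 0 f" by (auto simp: Ok_def \<Gamma>_def)
    then show ?thesis by blast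
  qed
  moreover have "\<exists>g. Ok (Suc n) g \<and> Comp n f g" if f: "Ok n f" for n f
  proof -
    have fn: "mod_nat R S leq (degree_part Q (- int n)) (degree_part X (- int n)) f"
      using f by (auto simp: Ok_def)
    note f' = mod_natD[OF fn Q'(1) X'(1), simplified]
    define m where "m = - int n"
    have m: "- int n = m" "- int (Suc n) = m - 1" by (simp_all add: m_def)
    have fB: "f p (diff (Cob Q p) (m - 1) x) \<in> coboundaries (Cob X p) m"
      if "p \<in> S" "x \<in> carrier (obj (Cob Q p) (m - 1))" for p x
      using f that by (simp add: Ok_def m)
    note f' = f'[unfolded m]
    define \<Gamma> where "\<Gamma> p = {(x, a). x \<in> carrier (obj (Cob Q p) (m - 1)) \<and> a \<in> carrier (obj (Cob X p) (m - 1)) \<and>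
      diff (Cob X p) (m - 1) a = f p (diff (Cob Q p) (m - 1) x)}" for p
    have "linear_relation (degree_part Q (m - 1)) (degree_part X (m - 1)) \<Gamma>"
    proof (rule linear_relationI)
      fix p q x a assume pq: "p \<in> S" "q \<in> S" "leq p q" "(x, a) \<in> \<Gamma> p"
      then have "diff (Cob X q) (m - 1) (Car X p q (m - 1) a) = Car X p q m (f p (diff (Cob Q p) (m - 1) x))"
        using XC(7)[of p q a m] by (auto simp: \<Gamma>_def)
      also have "\<dots> = f q (Car Q p q m (diff (Cob Q p) (m - 1) x))"
        using pq f'(6)[OF pq(1-3)] Qd'(1)[of p x m] by (auto simp: \<Gamma>_def)
      also have "\<dots> = f q (diff (Cob Q q) (m - 1) (Car Q p q (m - 1) x))"
        using pq QC(7)[of p q x m] by (auto simp: \<Gamma>_def)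
      finally show "(Mar (degree_part Q (m - 1)) p q x, Mar (degree_part X (m - 1)) p q a) \<in> \<Gamma> q"
        using pq XC(1) QC(1) by (auto simp: \<Gamma>_def)
    next
      fix p x y x' y' assume p: "p \<in> S" and "(x, y) \<in> \<Gamma> p" "(x', y') \<in> \<Gamma> p"
      then show "(x \<oplus>\<^bsub>Mob (degree_part Q (m - 1)) p\<^esub> x', y \<oplus>\<^bsub>Mob (degree_part X (m - 1)) p\<^esub> y') \<in> \<Gamma> p"
        using Q'(3)[OF p] X'(3)[OF p] Xd'(2)[OF p] Qd'(1,2)[OF p] f'(2)[OF p] by (auto simp: \<Gamma>_def)
    next
      fix p a x y assume p: "p \<in> S" and a: "a \<in> carrier R" and "(x, y) \<in> \<Gamma> p"
      then show "(a \<odot>\<^bsub>Mob (degree_part Q (m - 1)) p\<^esub> x, a \<odot>\<^bsub>Mob (degree_part X (m - 1)) p\<^esub> y) \<in> \<Gamma> p"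
        using Q'(3)[OF p] X'(3)[OF p] Xd'(3)[OF p a] Qd'(1)[OF p] Qd'(3)[OF p a] f'(3)[OF p a] by (auto simp: \<Gamma>_def)
    next
      fix p assume p: "p \<in> S"
      then show "(\<zero>\<^bsub>Mob (degree_part Q (m - 1)) p\<^esub>, \<zero>\<^bsub>Mob (degree_part X (m - 1)) p\<^esub>) \<in> \<Gamma> p"
        using Q'(3)[OF p] X'(3)[OF p] Xd'(4)[OF p] Qd'(4)[OF p] f'(4)[OF p] by (auto simp: \<Gamma>_def)
    qed (auto simp: \<Gamma>_def)
    moreover have "\<exists>a. (x, a) \<in> \<Gamma> p" if "p \<in> S" "x \<in> carrier (Mob (degree_part Q (m - 1)) p)" for p x
      using fB[of p x] that by (auto simp: \<Gamma>_def coboundaries_def)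
    ultimately obtain g where g: "mod_nat R S leq (degree_part Q (m - 1)) (degree_part X (m - 1)) g"
      "\<forall>p\<in>S. \<forall>x\<in>carrier (Mob (degree_part Q (m - 1)) p). (x, g p x) \<in> \<Gamma> p"
      using projective_lifting[OF proj X'(1), of "m - 1" "m - 1" \<Gamma>] by blast
    have gd: "g p x \<in> carrier (obj (Cob X p) (m - 1))" "diff (Cob X p) (m - 1) (g p x) = f p (diff (Cob Q p) (m - 1) x)"
      if "p \<in> S" "x \<in> carrier (obj (Cob Q p) (m - 1))" for p x
      using g(2) that by (auto simp: \<Gamma>_def)
    have "g p (diff (Cob Q p) (m - 1 - 1) x) \<in> coboundaries (Cob X p) (m - 1)"
      if p: "p \<in> S" and x: "x \<in> carrier (obj (Cob Q p) (m - 1 - 1))" for p x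
    proof (rule e\<eta>(5)[OF p])
      show "m - 1 \<noteq> 0" by (simp add: m_def)
      have dx: "diff (Cob Q p) (m - 1 - 1) x \<in> carrier (obj (Cob Q p) (m - 1))" by (rule Qd'(1)[OF p x])
      show "g p (diff (Cob Q p) (m - 1 - 1) x) \<in> cocycles (Cob X p) (m - 1)"
        using gd[OF p dx] diff_diff[OF Q'(2)[OF p] x] f'(4)[OF p] by (simp add: cocycles_def)
    qed
    then have "Ok (Suc n) g" using g(1) unfolding Ok_def m by simp
    moreover have "Comp n f g" using gd(2) unfolding Comp_def m by simp
    ultimately show ?thesis by blast
  qed
  ultimately obtain f where f: "\<And>n. Ok n (f n)" "\<And>n. Comp n (f n) (f (Suc n))"
    using dependent_nat_choice[of Ok Comp] by metis
  define \<phi> where "\<phi> p n = (if n \<le> 0 then f (nat (- n)) p else (\<lambda>_. \<zero>\<^bsub>obj (Cob X p) n\<^esub>))" for p n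
  have \<phi>n: "mod_nat R S leq (degree_part Q n) (degree_part X n) (\<lambda>p. \<phi> p n)" for n
  proof (cases "n \<le> 0")
    case True
    with f(1)[of "nat (- n)"] show ?thesis by (simp add: Ok_def \<phi>_def)
  qed (rule mod_natI, use X'(3)[of _ n] XC(4) in \<open>auto simp: \<phi>_def\<close>)
  note \<phi>' = mod_natD[OF \<phi>n Q'(1) X'(1), simplified]
  have \<phi>0: "\<phi> p 0 x \<in> cocycles (Cob X p) 0" "\<eta> p 0 (\<phi> p 0 x) = \<epsilon> p 0 x"
    if "p \<in> S" "x \<in> carrier (obj (Cob Q p) 0)" for p x
    using f(1)[of 0] that by (auto simp: Ok_def \<phi>_def)
  have \<phi>d: "\<phi> p (n + 1) (diff (Cob Q p) n x) = diff (Cob X p) n (\<phi> p n x)"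
    if p: "p \<in> S" and x: "x \<in> carrier (obj (Cob Q p) n)" for p n x
  proof -
    consider "n < 0" | "n = 0" | "n > 0" by linarith
    then show ?thesis
    proof cases
      case 1
      define k where "k = nat (- n - 1)"
      have k: "- int k - 1 = n" "nat (- n) = Suc k" "nat (- (n + 1)) = k" using 1 by (simp_all add: k_def)
      with f(2)[of k] 1 p x show ?thesis by (simp add: \<phi>_def Comp_def)
    next
      case 2
      then show ?thesis using \<phi>0(1)[OF p] x by (simp add: \<phi>_def cocycles_def)
    next
      case 3
      then show ?thesis using Xd(4)[OF p, of n] by (simp add: \<phi>_def)
    qed
  qed
  have "cx_nat R S leq Q X \<phi>"
    unfolding cx_nat_def chain_map_def using \<phi>n \<phi>d by (auto simp: mod_nat_def)
  moreover have "cohomology_iso_at (Cob Q p) (Cob X p) (\<phi> p) n" if p: "p \<in> S" for p n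
  proof (cases "n = 0")
    case False
    show ?thesis
      unfolding cohomology_iso_at_def
    proof (intro conjI ballI impI)
      fix y assume "y \<in> cocycles (Cob X p) n"
      then have y: "y \<in> coboundaries (Cob X p) n" by (rule e\<eta>(5)[OF p False])
      have "\<zero>\<^bsub>obj (Cob Q p) n\<^esub> \<in> cocycles (Cob Q p) n"
        using Q'(3)[OF p] Qd(4)[OF p] by (simp add: cocycles_def)
      moreover have "y = \<phi> p n \<zero>\<^bsub>obj (Cob Q p) n\<^esub> \<oplus>\<^bsub>obj (Cob X p) n\<^esub> y"
        using \<phi>'(4)[OF p] X'(3)[OF p] BD(1)[OF p p y] by simp
      ultimately show "\<exists>x\<in>cocycles (Cob Q p) n. \<exists>b\<in>coboundaries (Cob X p) n. y = \<phi> p n x \<oplus>\<^bsub>obj (Cob X p) n\<^esub> b"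
        using y by blast
    qed (use e\<epsilon>(5)[OF p False] in blast)
  next
    case True
    show ?thesis
      unfolding cohomology_iso_at_def True
    proof (intro conjI ballI impI)
      fix x assume x: "x \<in> cocycles (Cob Q p) 0" "\<phi> p 0 x \<in> coboundaries (Cob X p) 0"
      then have xc: "x \<in> carrier (obj (Cob Q p) 0)" by (simp add: cocycles_def)
      from x(2) obtain w where w: "w \<in> carrier (obj (Cob X p) (- 1))" "\<phi> p 0 x = diff (Cob X p) (- 1) w"
        by (auto simp: coboundaries_def)
      have "\<epsilon> p 0 x = \<zero>\<^bsub>Mob F p\<^esub>" using \<phi>0(2)[OF p xc] e\<eta>(2)[OF p w(1)] w(2) by simp
      then show "x \<in> coboundaries (Cob Q p) 0" by (rule e\<epsilon>(4)[OF p x(1)])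
    next
      fix y assume y: "y \<in> cocycles (Cob X p) 0"
      note yc = ZD(1)[OF p p y]
      from e\<epsilon>(3)[OF p] n\<eta>(1)[OF p yc] obtain x where x: "x \<in> cocycles (Cob Q p) 0" "\<epsilon> p 0 x = \<eta> p 0 y" by blast
      then have xc: "x \<in> carrier (obj (Cob Q p) 0)" by (simp add: cocycles_def)
      note fx = \<phi>0[OF p xc] and fxc = ZD(1)[OF p p \<phi>0(1)[OF p xc]]
      let ?b = "\<ominus>\<^bsub>obj (Cob X p) 0\<^esub> \<phi> p 0 x \<oplus>\<^bsub>obj (Cob X p) 0\<^esub> y"
      have "?b \<in> cocycles (Cob X p) 0" using ZD(3)[OF p p ZD(4)[OF p p fx(1)] y] .
      moreover have "\<eta> p 0 ?b = \<zero>\<^bsub>Mob F p\<^esub>"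
        using n\<eta>(1,2,5)[OF p] yc fxc fx(2) x(2) X'(3)[OF p, of 0] F'(1)[OF p] by simp
      ultimately have "?b \<in> coboundaries (Cob X p) 0" by (rule e\<eta>(4)[OF p])
      moreover have "y = \<phi> p 0 x \<oplus>\<^bsub>obj (Cob X p) 0\<^esub> ?b" using yc fxc X'(3)[OF p, of 0] by (simp add: module_ac)
      ultimately show "\<exists>x\<in>cocycles (Cob Q p) 0. \<exists>b\<in>coboundaries (Cob X p) 0. y = \<phi> p 0 x \<oplus>\<^bsub>obj (Cob X p) 0\<^esub> b"
        using x(1) by blast
    qed
  qed
  ultimately show ?thesis by (rule that)
qed

end

section \<open>Characters\<close>

text \<open>Homomorphisms of the underlying groups, between modules over possibly different rings: characters are not
  linear.\<close>

definition additive_map :: "('r, 'a) module \<Rightarrow> ('s, 'b) module \<Rightarrow> ('a \<Rightarrow> 'b) \<Rightarrow> bool" where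
  "additive_map M N f \<longleftrightarrow> (\<forall>x\<in>carrier M. f x \<in> carrier N) \<and>
     (\<forall>x\<in>carrier M. \<forall>y\<in>carrier M. f (x \<oplus>\<^bsub>M\<^esub> y) = f x \<oplus>\<^bsub>N\<^esub> f y)"

definition int_ring :: "int ring" where
  "int_ring = \<lparr>carrier = UNIV, mult = (*), one = 1, zero = 0, add = (+)\<rparr>"

lemma int_ring_simps [simp]:
  "carrier int_ring = UNIV" "x \<otimes>\<^bsub>int_ring\<^esub> y = x * y" "\<one>\<^bsub>int_ring\<^esub> = 1" "\<zero>\<^bsub>int_ring\<^esub> = 0" "x \<oplus>\<^bsub>int_ring\<^esub> y = x + y"
  by (simp_all add: int_ring_def)

lemma int_ring_cring: "cring int_ring"
proof (rule cringI)
  show "abelian_group int_ring"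
    by (rule abelian_groupI) (auto intro: exI[of _ "- x" for x])
  show "Group.comm_monoid int_ring" by (rule comm_monoidI) auto
qed (auto simp: algebra_simps)

text \<open>The divisible group that characters take values in: the nonzero complex numbers.\<close>

definition cstar :: "(int, complex) module" where
  "cstar = \<lparr>carrier = - {0}, mult = undefined, one = undefined, zero = 1, add = (*), smult = (\<lambda>k z. z powi k)\<rparr>"

lemma cstar_simps [simp]:
  "carrier cstar = - {0}" "\<zero>\<^bsub>cstar\<^esub> = 1" "x \<oplus>\<^bsub>cstar\<^esub> y = x * y" "k \<odot>\<^bsub>cstar\<^esub> z = z powi k"
  by (simp_all add: cstar_def)

lemma cstar_module: "module int_ring cstar"
proof (intro moduleI abelian_groupI int_ring_cring)
  fix x assume "x \<in> carrier cstar"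
  then show "\<exists>y\<in>carrier cstar. y \<oplus>\<^bsub>cstar\<^esub> x = \<zero>\<^bsub>cstar\<^esub>" by (intro bexI[of _ "inverse x"]) auto
qed (auto simp: power_int_add power_int_mult_distrib power_int_mult[symmetric] mult.commute)

lemma cstar_abelian_group: "abelian_group cstar"
  by (rule module.axioms(2)[OF cstar_module])

abbreviation character :: "('r, 'a) module \<Rightarrow> ('a \<Rightarrow> complex) \<Rightarrow> bool" where
  "character M \<equiv> additive_map M cstar"

lemma additive_mapD:
  assumes "additive_map M N f"
  shows "x \<in> carrier M \<Longrightarrow> f x \<in> carrier N"
    "x \<in> carrier M \<Longrightarrow> y \<in> carrier M \<Longrightarrow> f (x \<oplus>\<^bsub>M\<^esub> y) = f x \<oplus>\<^bsub>N\<^esub> f y"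
  using assms by (auto simp: additive_map_def)

lemma additive_map_zero:
  assumes "additive_map M N f" "abelian_group M" "abelian_group N"
  shows "f \<zero>\<^bsub>M\<^esub> = \<zero>\<^bsub>N\<^esub>"
proof -
  interpret M: abelian_group M by fact
  interpret N: abelian_group N by fact
  note f = additive_mapD[OF assms(1)]
  have "f \<zero>\<^bsub>M\<^esub> = f \<zero>\<^bsub>M\<^esub> \<oplus>\<^bsub>N\<^esub> f \<zero>\<^bsub>M\<^esub>" using f(2)[of "\<zero>\<^bsub>M\<^esub>" "\<zero>\<^bsub>M\<^esub>"] by simp
  with f(1)[of "\<zero>\<^bsub>M\<^esub>"] show ?thesis by (metis M.zero_closed N.add.r_cancel_one')
qed

lemma characterD:
  assumes "character M f" "abelian_group M"
  shows "x \<in> carrier M \<Longrightarrow> f x \<noteq> 0"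
    "x \<in> carrier M \<Longrightarrow> y \<in> carrier M \<Longrightarrow> f (x \<oplus>\<^bsub>M\<^esub> y) = f x * f y"
    "f \<zero>\<^bsub>M\<^esub> = 1"
    "x \<in> carrier M \<Longrightarrow> f (\<ominus>\<^bsub>M\<^esub> x) = inverse (f x)"
proof -
  interpret M: abelian_group M by fact
  note f = additive_mapD[OF assms(1)]
  show f0: "x \<in> carrier M \<Longrightarrow> f x \<noteq> 0" for x using f(1) by simp
  show fa: "x \<in> carrier M \<Longrightarrow> y \<in> carrier M \<Longrightarrow> f (x \<oplus>\<^bsub>M\<^esub> y) = f x * f y" for x y using f(2) by simp
  show f1: "f \<zero>\<^bsub>M\<^esub> = 1" using additive_map_zero[OF assms cstar_abelian_group] by simp
  show "x \<in> carrier M \<Longrightarrow> f (\<ominus>\<^bsub>M\<^esub> x) = inverse (f x)"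
    using fa[of x "\<ominus>\<^bsub>M\<^esub> x"] f1 f0[of x] by (simp add: M.r_neg field_simps)
qed

text \<open>An abelian group as a module over the integers. Such modules are functors on the poset with one element,
  so that \<open>baer_extension\<close> applies to group homomorphisms.\<close>

definition zmod :: "('r, 'a) module \<Rightarrow> (int, 'a) module" where
  "zmod M = \<lparr>carrier = carrier M, mult = undefined, one = undefined, zero = zero M, add = add M,
     smult = (\<lambda>k x. [k] \<cdot>\<^bsub>M\<^esub> x)\<rparr>"

lemma zmod_simps [simp]:
  "carrier (zmod M) = carrier M" "\<zero>\<^bsub>zmod M\<^esub> = \<zero>\<^bsub>M\<^esub>" "x \<oplus>\<^bsub>zmod M\<^esub> y = x \<oplus>\<^bsub>M\<^esub> y"
  "k \<odot>\<^bsub>zmod M\<^esub> x = [k] \<cdot>\<^bsub>M\<^esub> x"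
  by (simp_all add: zmod_def)

lemma add_pow_int_0 [simp]: "[(0 :: int)] \<cdot>\<^bsub>M\<^esub> x = \<zero>\<^bsub>M\<^esub>"
  by (simp add: add_pow_def)

lemma zmod_module:
  assumes "abelian_group M"
  shows "module int_ring (zmod M)"
proof -
  interpret M: abelian_group M by fact
  show ?thesis
  proof (intro moduleI abelian_groupI int_ring_cring)
    fix x assume "x \<in> carrier (zmod M)"
    then show "\<exists>y\<in>carrier (zmod M). y \<oplus>\<^bsub>zmod M\<^esub> x = \<zero>\<^bsub>zmod M\<^esub>"
      by (intro bexI[of _ "\<ominus>\<^bsub>M\<^esub> x"]) (auto simp: M.l_neg)
  next
    fix a b x assume "x \<in> carrier (zmod M)"
    then show "(a \<otimes>\<^bsub>int_ring\<^esub> b) \<odot>\<^bsub>zmod M\<^esub> x = a \<odot>\<^bsub>zmod M\<^esub> (b \<odot>\<^bsub>zmod M\<^esub> x)"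
      using M.add.int_pow_pow[of x a b] by (simp add: mult.commute)
  qed (auto simp: M.a_ac M.add.int_pow_mult M.add.int_pow_distrib)
qed

definition constant_functor :: "('s, 'a) module \<Rightarrow> ('s, unit, 'a) mod_functor" where
  "constant_functor M = \<lparr>Mob = (\<lambda>_. M), Mar = (\<lambda>_ _ x. x)\<rparr>"

lemma constant_functor_simps [simp]:
  "Mob (constant_functor M) u = M" "Mar (constant_functor M) u v x = x"
  by (simp_all add: constant_functor_def)

interpretation abelian: poset_diagrams int_ring "UNIV :: unit set" "(=)"
  by (intro poset_diagrams.intro cring_base.intro poset_diagrams_axioms.intro int_ring_cring) auto

lemma constant_functor_functor: "module int_ring M \<Longrightarrow> is_mod_functor int_ring (UNIV :: unit set) (=) (constant_functor M)"
  by (rule abelian.mod_functorI) auto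

lemma complex_root_exists:
  assumes "z \<noteq> 0" "m > 0"
  shows "\<exists>w :: complex. w \<noteq> 0 \<and> w ^ m = z"
proof -
  have "rcis (root m (cmod z)) (Arg z / real m) ^ m = rcis (root m (cmod z) ^ m) (real m * (Arg z / real m))"
    by (rule DeMoivre2)
  also have "\<dots> = z" using assms by (simp add: rcis_cmod_Arg)
  finally have "rcis (root m (cmod z)) (Arg z / real m) ^ m = z" .
  moreover from this have "rcis (root m (cmod z)) (Arg z / real m) \<noteq> 0" using assms by (metis power_eq_0_iff)
  ultimately show ?thesis by blast
qed

text \<open>Over the integers Baer's condition only concerns the ideals \<open>m\<int>\<close>, for which it is divisibility.\<close>

lemma cstar_baer: "abelian.baer (constant_functor cstar)"
  unfolding abelian.baer_def
proof (intro conjI ballI allI impI)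
  show "is_mod_functor int_ring UNIV (=) (constant_functor cstar)"
    by (rule constant_functor_functor[OF cstar_module])
  fix p :: unit and \<Lambda>
  assume \<Lambda>: "abelian.linear_relation (abelian.representable p) (constant_functor cstar) \<Lambda> \<and>
    (\<forall>q\<in>UNIV. \<forall>y. (\<zero>\<^bsub>int_ring\<^esub>, y) \<in> \<Lambda> q \<longrightarrow> y = \<zero>\<^bsub>Mob (constant_functor cstar) q\<^esub>)"
  define L where "L = \<Lambda> ()"
  note D = abelian.linear_relationD[OF conjunct1[OF \<Lambda>], of "()", folded L_def, simplified]
  have L0: "y = 1" if "(0, y) \<in> L" for y using \<Lambda> that by (simp add: L_def)
  have key: "\<exists>j. j \<noteq> 0 \<and> (\<forall>r y. (r, y) \<in> L \<longrightarrow> y = j powi r)"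
  proof (cases "\<exists>n y. n > 0 \<and> (int n, y) \<in> L")
    case True
    define m where "m = (LEAST n. n > 0 \<and> (\<exists>y. (int n, y) \<in> L))"
    have m: "m > 0 \<and> (\<exists>y. (int m, y) \<in> L)" unfolding m_def by (rule LeastI_ex) (use True in blast)
    then obtain z where z: "(int m, z) \<in> L" by blast
    obtain j where j: "j \<noteq> 0" "j ^ m = z" using complex_root_exists[of z m] D(2)[OF z] m by auto
    have "y = j powi r" if ry: "(r, y) \<in> L" for r y
    proof -
      define k where "k = r div int m"
      have "(- k * int m, z powi (- k)) \<in> L" by (rule D(5)[OF z])
      from D(4)[OF ry this] have e: "(r - k * int m, y * z powi (- k)) \<in> L" by simp
      have rm: "r - k * int m = r mod int m" by (simp add: k_def minus_div_mult_eq_mod)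
      have "r mod int m = 0"
      proof (rule ccontr)
        assume "r mod int m \<noteq> 0"
        moreover have bounds: "0 \<le> r mod int m" "r mod int m < int m" using m by simp_all
        ultimately have "nat (r mod int m) > 0" by linarith
        moreover have "(int (nat (r mod int m)), y * z powi (- k)) \<in> L"
          using e bounds(1) by (simp only: rm nat_0_le)
        ultimately have "m \<le> nat (r mod int m)" unfolding m_def by (intro Least_le) blast
        with bounds show False by linarith
      qed
      then have "y * z powi (- k) = 1" "r = int m * k" using L0 e rm by (auto simp: mult.commute)
      then have "y = z powi k" using j by (auto simp: power_int_minus field_simps)
      also have "\<dots> = j powi r" using \<open>r = int m * k\<close> j(2) by (simp add: power_int_mult)
      finally show ?thesis .
    qed
    with j(1) show ?thesis by blast
  next
    case False
    have "y = 1 powi r" if ry: "(r, y) \<in> L" for r y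
    proof -
      have "(\<bar>r\<bar>, y powi sgn r) \<in> L" using D(5)[OF ry, of "sgn r"] by (simp add: abs_sgn mult.commute)
      then have "r = 0" using False by (metis nat_0_le zero_less_nat_eq zero_less_abs_iff abs_ge_zero)
      with ry L0 show ?thesis by auto
    qed
    then show ?thesis by (intro exI[of _ 1]) auto
  qed
  then obtain j where "j \<noteq> 0" "\<forall>r y. (r, y) \<in> L \<longrightarrow> y = j powi r" by blast
  then show "\<exists>j\<in>carrier (Mob (constant_functor cstar) p). \<forall>q\<in>UNIV. p = q \<longrightarrow> (\<forall>r y. (r, y) \<in> \<Lambda> q \<longrightarrow>
      y = r \<odot>\<^bsub>Mob (constant_functor cstar) q\<^esub> Mar (constant_functor cstar) p q j)"
    by (intro bexI[of _ j]) (auto simp: L_def)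
qed

text \<open>A single-valued subgroup of \<open>M \<times> \<complex>\<^sup>*\<close> is a character of a subgroup of \<open>M\<close>.\<close>

lemma character_extension:
  assumes M: "abelian_group M"
    and sub: "\<And>x c. (x, c) \<in> \<Gamma> \<Longrightarrow> x \<in> carrier M" "\<And>x c. (x, c) \<in> \<Gamma> \<Longrightarrow> c \<noteq> (0 :: complex)"
    and zero: "(\<zero>\<^bsub>M\<^esub>, 1) \<in> \<Gamma>"
    and add: "\<And>x c y d. (x, c) \<in> \<Gamma> \<Longrightarrow> (y, d) \<in> \<Gamma> \<Longrightarrow> (x \<oplus>\<^bsub>M\<^esub> y, c * d) \<in> \<Gamma>"
    and neg: "\<And>x c. (x, c) \<in> \<Gamma> \<Longrightarrow> (\<ominus>\<^bsub>M\<^esub> x, inverse c) \<in> \<Gamma>"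
    and single: "\<And>c. (\<zero>\<^bsub>M\<^esub>, c) \<in> \<Gamma> \<Longrightarrow> c = 1"
  shows "\<exists>\<chi>. character M \<chi> \<and> (\<forall>x c. (x, c) \<in> \<Gamma> \<longrightarrow> \<chi> x = c)"
proof -
  interpret M: abelian_group M by fact
  have mult: "([k] \<cdot>\<^bsub>M\<^esub> x, c powi k) \<in> \<Gamma>" if xc: "(x, c) \<in> \<Gamma>" for k x c
  proof (induction k rule: int_induct[where k = 0])
    case base
    show ?case using zero sub[OF xc] by simp
  next
    case (step1 i)
    from add[OF step1(2) xc] show ?case using sub[OF xc] by (simp add: M.add.int_pow_mult power_int_add)
  next
    case (step2 i)
    from add[OF step2(2) neg[OF xc]] show ?case
      using sub[OF xc] by (simp add: M.add.int_pow_diff power_int_diff M.add.int_pow_1 divide_inverse)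
  qed
  have "abelian.linear_relation (constant_functor (zmod M)) (constant_functor cstar) (\<lambda>_. \<Gamma>)"
    by (rule abelian.linear_relationI) (use sub zero add mult in auto)
  from abelian.baer_extension[OF cstar_baer constant_functor_functor[OF zmod_module[OF M]] this]
  obtain \<psi> where \<psi>: "mod_nat int_ring (UNIV :: unit set) (=) (constant_functor (zmod M)) (constant_functor cstar) \<psi>"
    "\<forall>b j. (b, j) \<in> \<Gamma> \<longrightarrow> \<psi> () b = j" using single by auto
  then have "\<psi> () \<in> module_hom int_ring (zmod M) cstar" by (simp add: mod_nat_def)
  then have "character M (\<psi> ())" by (auto simp: module_hom_def additive_map_def)
  with \<psi>(2) show ?thesis by blast
qed

lemma nontrivial_root_of_unity:
  assumes "m > 1"
  shows "\<exists>c :: complex. c ^ m = 1 \<and> c \<noteq> 1"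
proof -
  let ?f = "\<lambda>k. cis (2 * pi * real k / real m)"
  have b: "bij_betw ?f {..<m} {z. z ^ m = 1}" using assms by (intro bij_betw_roots_unity) simp
  then have "?f 1 \<noteq> ?f 0" using assms unfolding bij_betw_def inj_on_def by (metis lessThan_iff zero_neq_one zero_less_one less_trans)
  moreover have "?f 1 \<in> {z. z ^ m = 1}" using b assms unfolding bij_betw_def by blast
  ultimately show ?thesis by auto
qed

text \<open>Characters separate points from subgroups: the subgroup generated by \<open>x\<close> and \<open>N\<close> has a character that is
  trivial on \<open>N\<close> and sends \<open>x\<close> to some \<open>c \<noteq> 1\<close>. Here \<open>c\<close> is an \<open>m\<close>-th root of unity if \<open>x\<close> has order \<open>m\<close>
  modulo \<open>N\<close>, and arbitrary if this order is infinite.\<close>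

lemma character_separation:
  assumes M: "abelian_group M" and N: "N \<subseteq> carrier M" "\<zero>\<^bsub>M\<^esub> \<in> N"
    "\<And>x y. x \<in> N \<Longrightarrow> y \<in> N \<Longrightarrow> x \<oplus>\<^bsub>M\<^esub> y \<in> N" "\<And>x. x \<in> N \<Longrightarrow> \<ominus>\<^bsub>M\<^esub> x \<in> N"
    and x: "x \<in> carrier M" "x \<notin> N"
  obtains \<chi> where "character M \<chi>" "\<And>y. y \<in> N \<Longrightarrow> \<chi> y = 1" "\<chi> x \<noteq> 1"
proof -
  interpret M: abelian_group M by fact
  have "\<exists>c :: complex. c \<noteq> 0 \<and> c \<noteq> 1 \<and> (\<forall>k :: int. [k] \<cdot>\<^bsub>M\<^esub> x \<in> N \<longrightarrow> c powi k = 1)"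
  proof (cases "\<exists>n :: nat. n > 0 \<and> [int n] \<cdot>\<^bsub>M\<^esub> x \<in> N")
    case True
    define m where "m = (LEAST n :: nat. n > 0 \<and> [int n] \<cdot>\<^bsub>M\<^esub> x \<in> N)"
    have m: "m > 0" "[int m] \<cdot>\<^bsub>M\<^esub> x \<in> N"
      using LeastI_ex[OF True] unfolding m_def by auto
    have "m \<noteq> 1" using m(2) x by (auto simp: M.add.int_pow_1)
    with m obtain c :: complex where c: "c ^ m = 1" "c \<noteq> 1" using nontrivial_root_of_unity[of m] by auto
    have Nm: "[(int j * int m)] \<cdot>\<^bsub>M\<^esub> x \<in> N" for j
    proof (induction j)
      case (Suc j)
      from N(3)[OF m(2) Suc] show ?case using x(1)
        by (simp add: M.add.int_pow_mult[symmetric] algebra_simps)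
    qed (use N(2) x in simp)
    have Nmk: "[(k * int m)] \<cdot>\<^bsub>M\<^esub> x \<in> N" for k
    proof (cases "k \<ge> 0")
      case True
      then show ?thesis using Nm[of "nat k"] by simp
    next
      case False
      then have "[(- (k * int m))] \<cdot>\<^bsub>M\<^esub> x \<in> N" using Nm[of "nat (- k)"] by simp
      from N(4)[OF this] show ?thesis using x(1) by (simp add: M.add.int_pow_neg)
    qed
    have "c powi k = 1" if k: "[k] \<cdot>\<^bsub>M\<^esub> x \<in> N" for k :: int
    proof -
      define q where "q = k div int m"
      have e: "k + (- q) * int m = k mod int m" by (simp add: q_def minus_div_mult_eq_mod)
      have "[(k + (- q) * int m)] \<cdot>\<^bsub>M\<^esub> x \<in> N"
        using N(3)[OF k Nmk[of "- q"]] x(1) by (simp add: M.add.int_pow_mult[symmetric])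
      then have kN: "[(k mod int m)] \<cdot>\<^bsub>M\<^esub> x \<in> N" using e by simp
      have "k mod int m = 0"
      proof (rule ccontr)
        assume "k mod int m \<noteq> 0"
        moreover have bounds: "0 \<le> k mod int m" "k mod int m < int m" using m(1) by simp_all
        ultimately have "nat (k mod int m) > 0" by linarith
        moreover have "[int (nat (k mod int m))] \<cdot>\<^bsub>M\<^esub> x \<in> N"
          using kN bounds(1) by (simp only: nat_0_le)
        ultimately have "m \<le> nat (k mod int m)" unfolding m_def by (intro Least_le) blast
        with bounds show False by linarith
      qed
      then have "k = int m * q" by (auto simp: q_def)
      then show ?thesis using c(1) by (simp add: power_int_mult)
    qed
    moreover have "c \<noteq> 0" using c(1) m(1) by (auto simp: zero_power)
    ultimately show ?thesis using c(2) by blast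
  next
    case False
    have "k = 0" if k: "[k] \<cdot>\<^bsub>M\<^esub> x \<in> N" for k :: int
    proof (rule ccontr)
      assume "k \<noteq> 0"
      then have "nat \<bar>k\<bar> > 0" by simp
      moreover have "[\<bar>k\<bar>] \<cdot>\<^bsub>M\<^esub> x \<in> N" using k N(4)[OF k] x(1) by (cases "k \<ge> 0") (auto simp: M.add.int_pow_neg)
      ultimately show False using False by (metis abs_ge_zero nat_0_le)
    qed
    then have "\<forall>k :: int. [k] \<cdot>\<^bsub>M\<^esub> x \<in> N \<longrightarrow> (2 :: complex) powi k = 1" by (metis power_int_0_right)
    then show ?thesis by (intro exI[of _ 2]) simp
  qed
  then obtain c :: complex where c: "c \<noteq> 0" "c \<noteq> 1" "\<And>k :: int. [k] \<cdot>\<^bsub>M\<^esub> x \<in> N \<Longrightarrow> c powi k = 1" by blast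
  define \<Gamma> where "\<Gamma> = {(n \<oplus>\<^bsub>M\<^esub> [k] \<cdot>\<^bsub>M\<^esub> x, c powi k) | n k. n \<in> N}"
  have \<Gamma>I: "(n \<oplus>\<^bsub>M\<^esub> [k] \<cdot>\<^bsub>M\<^esub> x, c powi k) \<in> \<Gamma>" if "n \<in> N" for n k using that unfolding \<Gamma>_def by blast
  have N1: "n \<in> carrier M" if "n \<in> N" for n using N(1) that by blast
  have "\<exists>\<chi>. character M \<chi> \<and> (\<forall>x c. (x, c) \<in> \<Gamma> \<longrightarrow> \<chi> x = c)"
  proof (rule character_extension[OF M])
    show "\<And>y d. (y, d) \<in> \<Gamma> \<Longrightarrow> y \<in> carrier M" "\<And>y d. (y, d) \<in> \<Gamma> \<Longrightarrow> d \<noteq> 0"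
      using N1 x(1) c(1) by (auto simp: \<Gamma>_def)
    show "(\<zero>\<^bsub>M\<^esub>, 1) \<in> \<Gamma>" using \<Gamma>I[OF N(2), of 0] x(1) by simp
    show "(y \<oplus>\<^bsub>M\<^esub> y', d * d') \<in> \<Gamma>" if yd: "(y, d) \<in> \<Gamma>" "(y', d') \<in> \<Gamma>" for y d y' d'
    proof -
      from yd(1) obtain n k where n: "n \<in> N" "y = n \<oplus>\<^bsub>M\<^esub> [k] \<cdot>\<^bsub>M\<^esub> x" "d = c powi k" unfolding \<Gamma>_def by blast
      from yd(2) obtain n' k' where n': "n' \<in> N" "y' = n' \<oplus>\<^bsub>M\<^esub> [k'] \<cdot>\<^bsub>M\<^esub> x" "d' = c powi k'" unfolding \<Gamma>_def by blast
      from \<Gamma>I[OF N(3)[OF n(1) n'(1)], of "k + k'"] show ?thesis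
        using n n' N1 x(1) c(1) by (simp add: M.add.int_pow_mult power_int_add M.a_ac)
    qed
    show "(\<ominus>\<^bsub>M\<^esub> y, inverse d) \<in> \<Gamma>" if "(y, d) \<in> \<Gamma>" for y d
    proof -
      from that obtain n k where n: "n \<in> N" "y = n \<oplus>\<^bsub>M\<^esub> [k] \<cdot>\<^bsub>M\<^esub> x" "d = c powi k" unfolding \<Gamma>_def by blast
      from \<Gamma>I[OF N(4)[OF n(1)], of "- k"] show ?thesis
        using n N1 x(1) by (simp add: M.add.int_pow_neg power_int_minus M.minus_add)
    qed
    show "d = 1" if "(\<zero>\<^bsub>M\<^esub>, d) \<in> \<Gamma>" for d
    proof -
      from that obtain n k where n: "n \<in> N" "\<zero>\<^bsub>M\<^esub> = n \<oplus>\<^bsub>M\<^esub> [k] \<cdot>\<^bsub>M\<^esub> x" "d = c powi k" unfolding \<Gamma>_def by blast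
      then have "[k] \<cdot>\<^bsub>M\<^esub> x = \<ominus>\<^bsub>M\<^esub> n"
        using N1 x(1) by (metis M.minus_equality M.a_comm M.add.int_pow_closed)
      then show ?thesis using c(3) N(4)[OF n(1)] n(3) by simp
    qed
  qed
  then obtain \<chi> where \<chi>: "character M \<chi>" "\<And>y d. (y, d) \<in> \<Gamma> \<Longrightarrow> \<chi> y = d" by blast
  show ?thesis
  proof (rule that[OF \<chi>(1)])
    show "\<chi> y = 1" if "y \<in> N" for y using \<chi>(2) \<Gamma>I[OF that, of 0] N1[OF that] x(1) by simp
    show "\<chi> x \<noteq> 1" using \<chi>(2)[OF \<Gamma>I[OF N(2), of 1]] x(1) c(2) by (simp add: M.add.int_pow_1)
  qed
qed

section \<open>Dual functors\<close>

definition dual :: "('r, 'a) module \<Rightarrow> ('r, 'a \<Rightarrow> complex) module" where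
  "dual M = \<lparr>carrier = {f \<in> extensional (carrier M). character M f}, mult = undefined, one = undefined,
     zero = (\<lambda>x\<in>carrier M. 1), add = (\<lambda>f g. \<lambda>x\<in>carrier M. f x * g x),
     smult = (\<lambda>a f. \<lambda>x\<in>carrier M. f (a \<odot>\<^bsub>M\<^esub> x))\<rparr>"

lemma dual_simps [simp]:
  "\<zero>\<^bsub>dual M\<^esub> = (\<lambda>x\<in>carrier M. 1)" "f \<oplus>\<^bsub>dual M\<^esub> g = (\<lambda>x\<in>carrier M. f x * g x)"
  "a \<odot>\<^bsub>dual M\<^esub> f = (\<lambda>x\<in>carrier M. f (a \<odot>\<^bsub>M\<^esub> x))"
  "f \<in> carrier (dual M) \<longleftrightarrow> f \<in> extensional (carrier M) \<and> character M f"
  by (simp_all add: dual_def)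

definition dual_complex :: "('r, 'a) cochain_complex \<Rightarrow> ('r, 'a \<Rightarrow> complex) cochain_complex" where
  "dual_complex C = \<lparr>obj = (\<lambda>n. dual (obj C (- n))),
     diff = (\<lambda>n f. \<lambda>x\<in>carrier (obj C (- n - 1)). f (diff C (- n - 1) x))\<rparr>"

lemma dual_complex_simps [simp]:
  "obj (dual_complex C) n = dual (obj C (- n))"
  "diff (dual_complex C) n f = (\<lambda>x\<in>carrier (obj C (- n - 1)). f (diff C (- n - 1) x))"
  by (simp_all add: dual_complex_def)

definition dual_functor :: "('r, 'p, 'a) cx_functor \<Rightarrow> ('r, 'p, 'a \<Rightarrow> complex) cx_functor" where
  "dual_functor G = \<lparr>Cob = (\<lambda>p. dual_complex (Cob G p)),
     Car = (\<lambda>p q n f. \<lambda>x\<in>carrier (obj (Cob G q) (- n)). f (Car G q p (- n) x))\<rparr>"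

lemma dual_functor_simps [simp]:
  "Cob (dual_functor G) p = dual_complex (Cob G p)"
  "Car (dual_functor G) p q n f = (\<lambda>x\<in>carrier (obj (Cob G q) (- n)). f (Car G q p (- n) x))"
  by (simp_all add: dual_functor_def)

context cring_base
begin

lemma module_characterD:
  assumes "character M f" "module R M"
  shows "x \<in> carrier M \<Longrightarrow> f x \<noteq> 0"
    "x \<in> carrier M \<Longrightarrow> y \<in> carrier M \<Longrightarrow> f (x \<oplus>\<^bsub>M\<^esub> y) = f x * f y"
    "f \<zero>\<^bsub>M\<^esub> = 1"
    "x \<in> carrier M \<Longrightarrow> f (\<ominus>\<^bsub>M\<^esub> x) = inverse (f x)"
  using characterD[OF assms(1) module_abelian_group[OF assms(2)]] by auto

lemma characterI:
  assumes "\<And>x. x \<in> carrier M \<Longrightarrow> f x \<noteq> 0"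
    "\<And>x y. x \<in> carrier M \<Longrightarrow> y \<in> carrier M \<Longrightarrow> f (x \<oplus>\<^bsub>M\<^esub> y) = f x * f y"
  shows "character M f"
  using assms by (auto simp: additive_map_def)

lemma dual_module:
  assumes M: "module R M"
  shows "module R (dual M)"
proof (intro moduleI abelian_groupI is_cring)
  fix f assume f: "f \<in> carrier (dual M)"
  then have "character M f" by simp
  note c = module_characterD[OF this M]
  show "\<exists>g\<in>carrier (dual M). g \<oplus>\<^bsub>dual M\<^esub> f = \<zero>\<^bsub>dual M\<^esub>"
  proof (rule bexI)
    show "(\<lambda>x\<in>carrier M. inverse (f x)) \<in> carrier (dual M)"
      using f M c(1,2) by (auto intro!: characterI)
    show "(\<lambda>x\<in>carrier M. inverse (f x)) \<oplus>\<^bsub>dual M\<^esub> f = \<zero>\<^bsub>dual M\<^esub>"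
      using f c(1) by (auto intro!: restrict_ext)
  qed
  show "\<zero>\<^bsub>dual M\<^esub> \<oplus>\<^bsub>dual M\<^esub> f = f"
    by (rule extensionalityI[of _ "carrier M"]) (use f in auto)
  show "\<one> \<odot>\<^bsub>dual M\<^esub> f = f"
    by (rule extensionalityI[of _ "carrier M"]) (use f M in auto)
  show "a \<odot>\<^bsub>dual M\<^esub> f \<in> carrier (dual M)" if "a \<in> carrier R" for a
    using f M c(1,2) that by (auto intro!: characterI simp: module_smult)
  show "(a \<oplus> b) \<odot>\<^bsub>dual M\<^esub> f = a \<odot>\<^bsub>dual M\<^esub> f \<oplus>\<^bsub>dual M\<^esub> b \<odot>\<^bsub>dual M\<^esub> f" if "a \<in> carrier R" "b \<in> carrier R" for a b
    using f M c(2) that by (auto intro!: restrict_ext simp: module_smult)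
  show "(a \<otimes> b) \<odot>\<^bsub>dual M\<^esub> f = a \<odot>\<^bsub>dual M\<^esub> (b \<odot>\<^bsub>dual M\<^esub> f)" if "a \<in> carrier R" "b \<in> carrier R" for a b
    using f M that by (auto intro!: restrict_ext simp: m_comm[of a b] module_smult)
  show "f \<oplus>\<^bsub>dual M\<^esub> g \<in> carrier (dual M)" if "g \<in> carrier (dual M)" for g
  proof -
    from that have "character M g" by simp
    from f M c(1,2) module_characterD(1,2)[OF this M] show ?thesis by (auto intro!: characterI)
  qed
next
  show "\<zero>\<^bsub>dual M\<^esub> \<in> carrier (dual M)" using M by (auto intro!: characterI)
qed (use M in \<open>auto intro!: restrict_ext simp: mult_ac\<close>)

lemma character_comp:
  assumes "character N f" "module R M" "module R N" "g \<in> module_hom R M N"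
  shows "character M (\<lambda>x\<in>carrier M. f (g x))"
  using module_homD[OF assms(4,2,3)] module_characterD[OF assms(1,3)] assms(2) by (auto intro!: characterI)

lemma dual_complex_complex:
  assumes C: "is_complex R C"
  shows "is_complex R (dual_complex C)"
proof (rule complexI)
  note C' = complexD[OF C]
  fix n :: int
  have e: "- (n + 1) = - n - 1" "- n - 1 + 1 = - n" "- (n + 2) = - n - 2" "- n - 1 - 1 = - n - 2" by simp_all
  have h: "diff C (- n - 1) \<in> module_hom R (obj C (- n - 1)) (obj C (- n))"
    using C'(2)[of "- n - 1"] by (simp only: e)
  note d = module_homD[OF h C'(1) C'(1)]
  show "module R (obj (dual_complex C) n)" by (simp add: dual_module C')
  fix f assume f: "f \<in> carrier (obj (dual_complex C) n)"
  then show "diff (dual_complex C) n f \<in> carrier (obj (dual_complex C) (n + 1))"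
    unfolding dual_complex_simps e using character_comp[OF _ C'(1) C'(1) h] by simp
  show "diff (dual_complex C) n (f \<oplus>\<^bsub>obj (dual_complex C) n\<^esub> g) =
      diff (dual_complex C) n f \<oplus>\<^bsub>obj (dual_complex C) (n + 1)\<^esub> diff (dual_complex C) n g" for g
    unfolding dual_complex_simps e using d(1) by (auto intro!: restrict_ext)
  show "diff (dual_complex C) n (a \<odot>\<^bsub>obj (dual_complex C) n\<^esub> f) =
      a \<odot>\<^bsub>obj (dual_complex C) (n + 1)\<^esub> diff (dual_complex C) n f" if "a \<in> carrier R" for a
    unfolding dual_complex_simps e using d(1,3) that C'(1) by (auto intro!: restrict_ext)
  have "f (diff C (- n - 1) (diff C (- n - 2) x)) = 1" if x: "x \<in> carrier (obj C (- n - 2))" for x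
  proof -
    have "diff C (- n - 1) (diff C (- n - 1 - 1) x) = \<zero>\<^bsub>obj C (- n - 1 + 1)\<^esub>"
      using diff_diff[OF C, of x "- n - 1"] x unfolding e .
    then show ?thesis using f module_characterD(3)[of "obj C (- n)" f] C'(1) unfolding e by simp
  qed
  moreover have "diff C (- n - 2) x \<in> carrier (obj C (- n - 1))" if "x \<in> carrier (obj C (- n - 2))" for x
    using diff_intoD(1)[OF C, of x "- n - 1"] that unfolding e .
  ultimately show "diff (dual_complex C) (n + 1) (diff (dual_complex C) n f) = \<zero>\<^bsub>obj (dual_complex C) (n + 2)\<^esub>"
    unfolding dual_complex_simps e by (auto intro!: restrict_ext)
qed

text \<open>Duality is exact since the target group of characters is divisible.\<close>

lemma dual_acyclic:
  assumes C: "is_complex R C" and ac: "acyclic_complex C"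
  shows "acyclic_complex (dual_complex C)"
  unfolding acyclic_complex_def
proof (intro allI subsetI)
  note C' = complexD[OF C]
  fix n f assume f: "f \<in> cocycles (dual_complex C) n"
  define m where "m = - n"
  have e: "- (n - 1) = m + 1" "- n = m" "- (n - 1) - 1 = m" by (simp_all add: m_def)
  have fc: "f \<in> extensional (carrier (obj C m))" "character (obj C m) f"
    using f by (auto simp: cocycles_def m_def)
  note f' = module_characterD[OF fc(2) C'(1)]
  have fB: "f (diff C (m - 1) x) = 1" if "x \<in> carrier (obj C (m - 1))" for x
  proof -
    from f have "diff (dual_complex C) n f = \<zero>\<^bsub>obj (dual_complex C) (n + 1)\<^esub>" by (simp add: cocycles_def)
    from fun_cong[OF this, of x] that show ?thesis by (simp add: m_def)
  qed
  let ?\<Gamma> = "(\<lambda>y. (diff C m y, f y)) ` carrier (obj C m)"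
  have "\<exists>\<chi>. character (obj C (m + 1)) \<chi> \<and> (\<forall>x c. (x, c) \<in> ?\<Gamma> \<longrightarrow> \<chi> x = c)"
  proof (rule character_extension[OF module_abelian_group[OF C'(1)]])
    show "x \<in> carrier (obj C (m + 1))" "c \<noteq> 0" if "(x, c) \<in> ?\<Gamma>" for x c
      using that diffD(1)[OF C] f'(1) by auto
    show "(\<zero>\<^bsub>obj C (m + 1)\<^esub>, 1) \<in> ?\<Gamma>"
      by (rule image_eqI[of _ _ "\<zero>\<^bsub>obj C m\<^esub>"]) (use C'(1) in \<open>simp_all add: diffD(4)[OF C] f'(3)\<close>)
    show "(x \<oplus>\<^bsub>obj C (m + 1)\<^esub> y, c * d) \<in> ?\<Gamma>" if xy: "(x, c) \<in> ?\<Gamma>" "(y, d) \<in> ?\<Gamma>" for x c y d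
    proof -
      from xy obtain u v where "u \<in> carrier (obj C m)" "v \<in> carrier (obj C m)" "x = diff C m u" "c = f u"
        "y = diff C m v" "d = f v" by blast
      then show ?thesis using C'(1)
        by (intro image_eqI[of _ _ "u \<oplus>\<^bsub>obj C m\<^esub> v"]) (simp_all add: diffD(2)[OF C] f'(2))
    qed
    show "(\<ominus>\<^bsub>obj C (m + 1)\<^esub> x, inverse c) \<in> ?\<Gamma>" if "(x, c) \<in> ?\<Gamma>" for x c
    proof -
      from that obtain u where "u \<in> carrier (obj C m)" "x = diff C m u" "c = f u" by blast
      then show ?thesis using C'(1)
        by (intro image_eqI[of _ _ "\<ominus>\<^bsub>obj C m\<^esub> u"]) (simp_all add: diffD(5)[OF C] f'(4))
    qed
    show "c = 1" if c: "(\<zero>\<^bsub>obj C (m + 1)\<^esub>, c) \<in> ?\<Gamma>" for c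
    proof -
      from c obtain y where y: "y \<in> carrier (obj C m)" "diff C m y = \<zero>\<^bsub>obj C (m + 1)\<^esub>" "c = f y" by force
      then have "y \<in> coboundaries C m" using ac by (auto simp: acyclic_complex_def cocycles_def)
      then show ?thesis using y(3) fB by (auto simp: coboundaries_def)
    qed
  qed
  then obtain \<chi> where \<chi>: "character (obj C (m + 1)) \<chi>" "\<And>y. y \<in> carrier (obj C m) \<Longrightarrow> \<chi> (diff C m y) = f y" by blast
  let ?g = "\<lambda>x\<in>carrier (obj C (m + 1)). \<chi> x"
  show "f \<in> coboundaries (dual_complex C) n"
  proof (rule coboundariesI)
    have "character (obj C (m + 1)) ?g" using module_characterD(1,2)[OF \<chi>(1) C'(1)] C'(1) by (auto intro!: characterI)
    then show "?g \<in> carrier (obj (dual_complex C) (n - 1))" unfolding dual_complex_simps e by simp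
    show "f = diff (dual_complex C) (n - 1) ?g" unfolding dual_complex_simps e
      by (rule extensionalityI[of _ "carrier (obj C m)"]) (use fc \<chi>(2) diffD(1)[OF C] in auto)
  qed
qed

lemma dual_functor_functor:
  assumes G: "is_cx_functor R S leq G"
  shows "is_cx_functor R S (\<lambda>p q. leq q p) (dual_functor G)"
  unfolding is_cx_functor_def
proof (intro conjI ballI allI impI)
  note G' = cx_functorD[OF G] and C = Car_simps[OF G]
  have hom: "Car G q p n \<in> module_hom R (obj (Cob G q) n) (obj (Cob G p) n)" if "p \<in> S" "q \<in> S" "leq q p" for p q n
    using C(1-3)[OF that(2,1,3)] by (intro module_homI)
  show "is_complex R (Cob (dual_functor G) p)" if "p \<in> S" for p
    using that by (simp add: dual_complex_complex G'(2))
  show "is_mod_functor R S (\<lambda>p q. leq q p) (degree_part (dual_functor G) n)" for n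
  proof (rule mod_functorI)
    fix p q f assume pq: "p \<in> S" "q \<in> S" "leq q p" and f: "f \<in> carrier (Mob (degree_part (dual_functor G) n) p)"
    note m = G'(3)[OF pq(1)] G'(3)[OF pq(2)]
    show "Mar (degree_part (dual_functor G) n) p q f \<in> carrier (Mob (degree_part (dual_functor G) n) q)"
      using character_comp[OF _ m(2) m(1) hom[OF pq]] f by simp
    show "Mar (degree_part (dual_functor G) n) p q (a \<odot>\<^bsub>Mob (degree_part (dual_functor G) n) p\<^esub> f) =
      a \<odot>\<^bsub>Mob (degree_part (dual_functor G) n) q\<^esub> Mar (degree_part (dual_functor G) n) p q f" if "a \<in> carrier R" for a
      using C(1,3)[OF pq(2,1,3)] that m by (auto intro!: restrict_ext)
  qed (auto intro!: restrict_ext simp: dual_module G' C elim: extensionalityI[OF restrict_extensional])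
  fix p q assume pq: "p \<in> S" "q \<in> S" "leq q p"
  note m = G'(3)[OF pq(1)] G'(3)[OF pq(2)]
  have d: "Car G q p (- n) (diff (Cob G q) (- n - 1) x) = diff (Cob G p) (- n - 1) (Car G q p (- n - 1) x)"
    "diff (Cob G q) (- n - 1) x \<in> carrier (obj (Cob G q) (- n))" if "x \<in> carrier (obj (Cob G q) (- n - 1))" for n x
    using C(7)[OF pq(2,1,3), of x "- n"] diff_intoD(1)[OF G'(2)[OF pq(2)], of x "- n"] that by auto
  show "chain_map R (Cob (dual_functor G) p) (Cob (dual_functor G) q) (Car (dual_functor G) p q)"
    unfolding chain_map_def
  proof (intro conjI allI ballI)
    show "Car (dual_functor G) p q n \<in> module_hom R (obj (Cob (dual_functor G) p) n) (obj (Cob (dual_functor G) q) n)" for n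
      using character_comp[OF _ m(2) m(1) hom[OF pq]] C(1,3)[OF pq(2,1,3)] m
      by (intro module_homI) (auto intro!: restrict_ext)
    fix n f assume "f \<in> carrier (obj (Cob (dual_functor G) p) n)"
    show "Car (dual_functor G) p q (n + 1) (diff (Cob (dual_functor G) p) n f) =
        diff (Cob (dual_functor G) q) n (Car (dual_functor G) p q n f)"
      using d C(1)[OF pq(2,1,3)] by (auto intro!: restrict_ext)
  qed
qed

end

text \<open>The condition on a functor under which its dual is fibrant.\<close>

definition characters_extend :: "'p::order set \<Rightarrow> ('r, 'p, 'a) cx_functor \<Rightarrow> bool" where
  "characters_extend P G \<longleftrightarrow> (\<forall>p\<in>P. \<forall>n w.
    (\<forall>q\<in>below P p. character (obj (Cob G q) n) (w q)) \<longrightarrow>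
    (\<forall>q\<in>below P p. \<forall>s\<in>below P p. q \<le> s \<longrightarrow> (\<forall>x\<in>carrier (obj (Cob G q) n). w s (Car G q s n x) = w q x)) \<longrightarrow>
    (\<exists>\<chi>. character (obj (Cob G p) n) \<chi> \<and> (\<forall>q\<in>below P p. \<forall>x\<in>carrier (obj (Cob G q) n). \<chi> (Car G q p n x) = w q x)))"

lemma characters_extendD:
  assumes "characters_extend P G" "p \<in> P" "\<And>q. q \<in> P \<Longrightarrow> q < p \<Longrightarrow> character (obj (Cob G q) n) (w q)"
    "\<And>q s x. q \<in> P \<Longrightarrow> s \<in> P \<Longrightarrow> q \<le> s \<Longrightarrow> s < p \<Longrightarrow> x \<in> carrier (obj (Cob G q) n) \<Longrightarrow> w s (Car G q s n x) = w q x"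
  obtains \<chi> where "character (obj (Cob G p) n) \<chi>"
    "\<And>q x. q \<in> P \<Longrightarrow> q < p \<Longrightarrow> x \<in> carrier (obj (Cob G q) n) \<Longrightarrow> \<chi> (Car G q p n x) = w q x"
proof -
  have "\<forall>q\<in>below P p. character (obj (Cob G q) n) (w q)" using assms(3) by (auto simp: below_def)
  moreover have "\<forall>q\<in>below P p. \<forall>s\<in>below P p. q \<le> s \<longrightarrow> (\<forall>x\<in>carrier (obj (Cob G q) n). w s (Car G q s n x) = w q x)"
    using assms(4) by (auto simp: below_def)
  ultimately obtain \<chi> where "character (obj (Cob G p) n) \<chi>"
    "\<forall>q\<in>below P p. \<forall>x\<in>carrier (obj (Cob G q) n). \<chi> (Car G q p n x) = w q x"
    using assms(1)[unfolded characters_extend_def, THEN bspec, OF assms(2), THEN spec[of _ n], THEN spec[of _ w]]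
    by blast
  then show ?thesis by (intro that[of \<chi>]) (auto simp: below_def)
qed

lemma characters_extendI:
  assumes "\<And>p n w. p \<in> P \<Longrightarrow> (\<And>q. q \<in> P \<Longrightarrow> q < p \<Longrightarrow> character (obj (Cob G q) n) (w q)) \<Longrightarrow>
    (\<And>q s x. q \<in> P \<Longrightarrow> s \<in> P \<Longrightarrow> q \<le> s \<Longrightarrow> s < p \<Longrightarrow> x \<in> carrier (obj (Cob G q) n) \<Longrightarrow> w s (Car G q s n x) = w q x) \<Longrightarrow>
    \<exists>\<chi>. character (obj (Cob G p) n) \<chi> \<and>
      (\<forall>q x. q \<in> P \<longrightarrow> q < p \<longrightarrow> x \<in> carrier (obj (Cob G q) n) \<longrightarrow> \<chi> (Car G q p n x) = w q x)"
  shows "characters_extend P G"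
  unfolding characters_extend_def
proof (intro ballI allI impI)
  fix p n w assume p: "p \<in> P" and w: "\<forall>q\<in>below P p. character (obj (Cob G q) n) (w q)"
    "\<forall>q\<in>below P p. \<forall>s\<in>below P p. q \<le> s \<longrightarrow> (\<forall>x\<in>carrier (obj (Cob G q) n). w s (Car G q s n x) = w q x)"
  have "\<exists>\<chi>. character (obj (Cob G p) n) \<chi> \<and>
      (\<forall>q x. q \<in> P \<longrightarrow> q < p \<longrightarrow> x \<in> carrier (obj (Cob G q) n) \<longrightarrow> \<chi> (Car G q p n x) = w q x)"
    by (rule assms[OF p]) (use w in \<open>auto simp: below_def\<close>)
  then show "\<exists>\<chi>. character (obj (Cob G p) n) \<chi> \<and> (\<forall>q\<in>below P p. \<forall>x\<in>carrier (obj (Cob G q) n). \<chi> (Car G q p n x) = w q x)"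
    by (auto simp: below_def)
qed

context cring_base
begin

text \<open>Families in the limit of the dual below \<open>p\<close> are compatible families of characters.\<close>

lemma dual_fibrant:
  fixes P :: "'p::order set"
  assumes G: "is_cx_functor R P (\<le>) G" and ext: "characters_extend P G"
  shows "fibrant R P (dual_functor G)"
proof -
  let ?D = "dual_functor G"
  have D: "is_cx_functor R P (\<ge>) ?D" using dual_functor_functor[OF G] .
  note G' = cx_functorD[OF G] and C = Car_simps[OF G] and D' = cx_functorD[OF D] and DC = Car_simps[OF D]
  have "matching_map P ?D p n ` carrier (obj (Cob ?D p) n) = carrier (obj (lim_cx (below P p) (\<ge>) ?D) n)"
    if p: "p \<in> P" for p n
  proof (intro subset_antisym subsetI)
    fix w assume "w \<in> matching_map P ?D p n ` carrier (obj (Cob ?D p) n)"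
    then show "w \<in> carrier (obj (lim_cx (below P p) (\<ge>) ?D) n)"
      using p DC(1) D'(6) by (auto simp: lim_mod_carrier matching_map_def below_def simp del: dual_functor_simps dual_complex_simps)
  next
    fix w assume "w \<in> carrier (obj (lim_cx (below P p) (\<ge>) ?D) n)"
    then have w: "w \<in> extensional (below P p)"
      "\<And>q. q \<in> P \<Longrightarrow> q < p \<Longrightarrow> w q \<in> carrier (dual (obj (Cob G q) (- n)))"
      "\<And>q s. q \<in> P \<Longrightarrow> s \<in> P \<Longrightarrow> s < p \<Longrightarrow> q \<le> s \<Longrightarrow> q < p \<Longrightarrow> Car ?D s q n (w s) = w q"
      by (auto simp: lim_mod_carrier below_def simp del: dual_functor_simps(2) dual_simps)
    have compat: "w s (Car G q s (- n) x) = w q x"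
      if "q \<in> P" "s \<in> P" "q \<le> s" "s < p" "x \<in> carrier (obj (Cob G q) (- n))" for q s x
      using fun_cong[OF w(3)[of q s], of x] that by auto
    obtain \<chi> where \<chi>: "character (obj (Cob G p) (- n)) \<chi>"
      "\<And>q x. q \<in> P \<Longrightarrow> q < p \<Longrightarrow> x \<in> carrier (obj (Cob G q) (- n)) \<Longrightarrow> \<chi> (Car G q p (- n) x) = w q x"
      by (rule characters_extendD[OF ext p, of "- n" w]) (use w(2) compat in auto)
    let ?f = "\<lambda>x\<in>carrier (obj (Cob G p) (- n)). \<chi> x"
    have "?f \<in> carrier (obj (Cob ?D p) n)"
      using module_characterD(1,2)[OF \<chi>(1) G'(3)[OF p]] G'(3)[OF p] by (auto intro!: characterI)
    moreover have "w = matching_map P ?D p n ?f"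
    proof (rule extensionalityI[OF w(1)])
      fix q assume q: "q \<in> below P p"
      then have "q \<in> P" "q < p" "w q \<in> extensional (carrier (obj (Cob G q) (- n)))" using w(2) by (auto simp: below_def)
      then show "w q = matching_map P ?D p n ?f q"
        using q p \<chi>(2) C(1)[of q p] by (intro extensionalityI[of "w q"]) (auto simp: matching_map_def)
    qed (simp add: matching_map_def)
    ultimately show "w \<in> matching_map P ?D p n ` carrier (obj (Cob ?D p) n)" by blast
  qed
  with D show ?thesis by (simp add: fibrant_def)
qed

text \<open>The dual of a cone is built from the duals of its two parts, so the extension property is inherited.\<close>

lemma cone_characters_extend:
  fixes P :: "'p::order set"
  assumes X: "is_cx_functor R P (\<le>) X" and Y: "is_cx_functor R P (\<le>) Y"
    and eX: "characters_extend P X" and eY: "characters_extend P Y"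
  shows "characters_extend P (cone_functor X Y \<phi>)"
proof (rule characters_extendI)
  let ?C = "cone_functor X Y \<phi>"
  note X' = cx_functorD[OF X] Car_simps[OF X] and Y' = cx_functorD[OF Y] Car_simps[OF Y]
  fix p n w assume p: "p \<in> P" and w: "\<And>q. q \<in> P \<Longrightarrow> q < p \<Longrightarrow> character (obj (Cob ?C q) n) (w q)"
    and compat: "\<And>q s x. q \<in> P \<Longrightarrow> s \<in> P \<Longrightarrow> q \<le> s \<Longrightarrow> s < p \<Longrightarrow> x \<in> carrier (obj (Cob ?C q) n) \<Longrightarrow>
      w s (Car ?C q s n x) = w q x"
  have w': "w q c \<noteq> 0" "w q (fst c \<oplus>\<^bsub>obj (Cob X q) n\<^esub> fst c', snd c \<oplus>\<^bsub>obj (Cob Y q) (n - 1)\<^esub> snd c') = w q c * w q c'"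
    if "q \<in> P" "q < p" "fst c \<in> carrier (obj (Cob X q) n)" "snd c \<in> carrier (obj (Cob Y q) (n - 1))"
      "fst c' \<in> carrier (obj (Cob X q) n)" "snd c' \<in> carrier (obj (Cob Y q) (n - 1))" for q c c'
    using additive_mapD[OF w[OF that(1,2)]] that(3-) by (auto simp: mem_Times_iff)
  obtain \<chi> where \<chi>: "character (obj (Cob X p) n) \<chi>"
    "\<And>q x. q \<in> P \<Longrightarrow> q < p \<Longrightarrow> x \<in> carrier (obj (Cob X q) n) \<Longrightarrow> \<chi> (Car X q p n x) = w q (x, \<zero>\<^bsub>obj (Cob Y q) (n - 1)\<^esub>)"
  proof (rule characters_extendD[OF eX p, of n "\<lambda>q x. w q (x, \<zero>\<^bsub>obj (Cob Y q) (n - 1)\<^esub>)"])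
    fix q assume q: "q \<in> P" "q < p"
    show "character (obj (Cob X q) n) (\<lambda>x. w q (x, \<zero>\<^bsub>obj (Cob Y q) (n - 1)\<^esub>))"
    proof (rule characterI)
      fix x y assume "x \<in> carrier (obj (Cob X q) n)" "y \<in> carrier (obj (Cob X q) n)"
      then show "w q (x, \<zero>\<^bsub>obj (Cob Y q) (n - 1)\<^esub>) \<noteq> 0"
        "w q (x \<oplus>\<^bsub>obj (Cob X q) n\<^esub> y, \<zero>\<^bsub>obj (Cob Y q) (n - 1)\<^esub>) = w q (x, \<zero>\<^bsub>obj (Cob Y q) (n - 1)\<^esub>) * w q (y, \<zero>\<^bsub>obj (Cob Y q) (n - 1)\<^esub>)"
        using w'(1)[OF q, of "(x, \<zero>\<^bsub>obj (Cob Y q) (n - 1)\<^esub>)" "(x, \<zero>\<^bsub>obj (Cob Y q) (n - 1)\<^esub>)"]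
          w'(2)[OF q, of "(x, \<zero>\<^bsub>obj (Cob Y q) (n - 1)\<^esub>)" "(y, \<zero>\<^bsub>obj (Cob Y q) (n - 1)\<^esub>)"] q Y'(3) by auto
    qed
  next
    fix q s x assume qs: "q \<in> P" "s \<in> P" "q \<le> s" "s < p" and x: "x \<in> carrier (obj (Cob X q) n)"
    show "w s (Car X q s n x, \<zero>\<^bsub>obj (Cob Y s) (n - 1)\<^esub>) = w q (x, \<zero>\<^bsub>obj (Cob Y q) (n - 1)\<^esub>)"
      using compat[OF qs, of "(x, \<zero>\<^bsub>obj (Cob Y q) (n - 1)\<^esub>)"] x qs Y' by simp
  qed blast
  obtain \<chi>' where \<chi>': "character (obj (Cob Y p) (n - 1)) \<chi>'"
    "\<And>q x. q \<in> P \<Longrightarrow> q < p \<Longrightarrow> x \<in> carrier (obj (Cob Y q) (n - 1)) \<Longrightarrow> \<chi>' (Car Y q p (n - 1) x) = w q (\<zero>\<^bsub>obj (Cob X q) n\<^esub>, x)"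
  proof (rule characters_extendD[OF eY p, of "n - 1" "\<lambda>q x. w q (\<zero>\<^bsub>obj (Cob X q) n\<^esub>, x)"])
    fix q assume q: "q \<in> P" "q < p"
    show "character (obj (Cob Y q) (n - 1)) (\<lambda>x. w q (\<zero>\<^bsub>obj (Cob X q) n\<^esub>, x))"
    proof (rule characterI)
      fix x y assume "x \<in> carrier (obj (Cob Y q) (n - 1))" "y \<in> carrier (obj (Cob Y q) (n - 1))"
      then show "w q (\<zero>\<^bsub>obj (Cob X q) n\<^esub>, x) \<noteq> 0"
        "w q (\<zero>\<^bsub>obj (Cob X q) n\<^esub>, x \<oplus>\<^bsub>obj (Cob Y q) (n - 1)\<^esub> y) = w q (\<zero>\<^bsub>obj (Cob X q) n\<^esub>, x) * w q (\<zero>\<^bsub>obj (Cob X q) n\<^esub>, y)"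
        using w'(1)[OF q, of "(\<zero>\<^bsub>obj (Cob X q) n\<^esub>, x)" "(\<zero>\<^bsub>obj (Cob X q) n\<^esub>, x)"]
          w'(2)[OF q, of "(\<zero>\<^bsub>obj (Cob X q) n\<^esub>, x)" "(\<zero>\<^bsub>obj (Cob X q) n\<^esub>, y)"] q X'(3) by auto
    qed
  next
    fix q s x assume qs: "q \<in> P" "s \<in> P" "q \<le> s" "s < p" and x: "x \<in> carrier (obj (Cob Y q) (n - 1))"
    show "w s (\<zero>\<^bsub>obj (Cob X s) n\<^esub>, Car Y q s (n - 1) x) = w q (\<zero>\<^bsub>obj (Cob X q) n\<^esub>, x)"
      using compat[OF qs, of "(\<zero>\<^bsub>obj (Cob X q) n\<^esub>, x)"] x qs X' by simp
  qed blast
  have "character (obj (Cob ?C p) n) (\<lambda>c. \<chi> (fst c) * \<chi>' (snd c))"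
    using module_characterD(1,2)[OF \<chi>(1) X'(3)[OF p]] module_characterD(1,2)[OF \<chi>'(1) Y'(3)[OF p]]
    by (intro characterI) auto
  moreover have "\<chi> (fst (Car ?C q p n c)) * \<chi>' (snd (Car ?C q p n c)) = w q c"
    if q: "q \<in> P" "q < p" and c: "c \<in> carrier (obj (Cob ?C q) n)" for q c
  proof -
    have "w q (fst c, \<zero>\<^bsub>obj (Cob Y q) (n - 1)\<^esub>) * w q (\<zero>\<^bsub>obj (Cob X q) n\<^esub>, snd c) = w q c"
      using w'(2)[OF q, of "(fst c, \<zero>\<^bsub>obj (Cob Y q) (n - 1)\<^esub>)" "(\<zero>\<^bsub>obj (Cob X q) n\<^esub>, snd c)"] c q X'(3) Y'(3)
      by (auto simp: mem_Times_iff)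
    then show ?thesis using \<chi>(2)[OF q, of "fst c"] \<chi>'(2)[OF q, of "snd c"] c by (auto simp: mem_Times_iff)
  qed
  ultimately show "\<exists>\<chi>. character (obj (Cob ?C p) n) \<chi> \<and>
      (\<forall>q c. q \<in> P \<longrightarrow> q < p \<longrightarrow> c \<in> carrier (obj (Cob ?C q) n) \<longrightarrow> \<chi> (Car ?C q p n c) = w q c)"
    by (intro exI[of _ "\<lambda>c. \<chi> (fst c) * \<chi>' (snd c)"]) blast
qed

end

text \<open>For projective functors, compatible characters are extended by lifting against a functor that is
  constant below \<open>p\<close> with value the characters of \<open>R\<close>: homomorphisms into the module of characters of \<open>R\<close>
  are the same as characters.\<close>

lemma projective_characters_extend:
  fixes P :: "'p::order set"
  assumes R: "cring R" and Q: "is_cx_functor R P (\<le>) Q"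
    and proj: "\<And>n. projective_functor R P (\<le>) (degree_part Q n)"
  shows "characters_extend P Q"
proof (rule characters_extendI)
  interpret poset_diagrams R P "(\<le>)"
    using R by (intro poset_diagrams.intro cring_base.intro poset_diagrams_axioms.intro) auto
  note Q' = cx_functorD[OF Q] and C = Car_simps[OF Q]
  fix p n w assume p: "p \<in> P" and w: "\<And>q. q \<in> P \<Longrightarrow> q < p \<Longrightarrow> character (obj (Cob Q q) n) (w q)"
    and compat: "\<And>q s x. q \<in> P \<Longrightarrow> s \<in> P \<Longrightarrow> q \<le> s \<Longrightarrow> s < p \<Longrightarrow> x \<in> carrier (obj (Cob Q q) n) \<Longrightarrow>
      w s (Car Q q s n x) = w q x"
  note w' = module_characterD[OF w Q'(3)]
  \<comment> \<open>The functor \<open>A\<close> is \<open>E\<close> at the elements \<open>q \<le> p\<close> and zero elsewhere.\<close>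
  define E where "E = dual (Mob (representable p) p)"
  have RM: "module R (Mob (representable p) p)" by (rule mod_functorD(1)[OF representable_functor[OF p] p])
  have E: "module R E" unfolding E_def by (rule dual_module[OF RM])
  define A where "A = \<lparr>Mob = (\<lambda>q. if q \<le> p then E else E\<lparr>carrier := {\<zero>\<^bsub>E\<^esub>}\<rparr>),
    Mar = (\<lambda>q s f. if s \<le> p then f else \<zero>\<^bsub>E\<^esub>)\<rparr>"
  have A_simps: "Mob A q = (if q \<le> p then E else E\<lparr>carrier := {\<zero>\<^bsub>E\<^esub>}\<rparr>)" "Mar A q s f = (if s \<le> p then f else \<zero>\<^bsub>E\<^esub>)" for q s f
    by (simp_all add: A_def)
  have "submodule {\<zero>\<^bsub>E\<^esub>} R E" by (rule submodule_criterion[OF E]) (use E in auto)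
  then have E0: "module R (E\<lparr>carrier := {\<zero>\<^bsub>E\<^esub>}\<rparr>)" by (rule submodule_module[OF _ E])
  have A: "is_mod_functor R P (\<le>) A"
    by (rule mod_functorI) (use E E0 in \<open>auto simp: A_simps split: if_splits\<close>)
  define \<Gamma> where "\<Gamma> q = {(x, f). x \<in> carrier (obj (Cob Q q) n) \<and> f \<in> carrier (Mob A q) \<and>
    (q < p \<longrightarrow> f = (\<lambda>r\<in>carrier R. w q (r \<odot>\<^bsub>obj (Cob Q q) n\<^esub> x)))}" for q
  have E_simps: "\<zero>\<^bsub>E\<^esub> = (\<lambda>r\<in>carrier R. 1)" "f \<oplus>\<^bsub>E\<^esub> g = (\<lambda>r\<in>carrier R. f r * g r)"
    "a \<odot>\<^bsub>E\<^esub> f = (\<lambda>r\<in>carrier R. f (a \<otimes>\<^bsub>R\<^esub> r))" for f g a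
    by (simp_all add: E_def)
  have wE: "(\<lambda>r\<in>carrier R. w q (r \<odot>\<^bsub>obj (Cob Q q) n\<^esub> x)) \<in> carrier E" if "q \<in> P" "q < p" "x \<in> carrier (obj (Cob Q q) n)" for q x
    using that w'(1,2)[OF that(1,2,1)] Q'(3)[OF that(1), of n] unfolding E_def
    by (auto intro!: characterI simp: module_smult)
  have "linear_relation (degree_part Q n) A \<Gamma>"
  proof (rule linear_relationI)
    fix q assume q: "q \<in> P"
    have Aq: "module R (Mob A q)" by (rule mod_functorD(1)[OF A q])
    note Qq = Q'(3)[OF q, of n]
    have A_ops: "\<zero>\<^bsub>Mob A q\<^esub> = \<zero>\<^bsub>E\<^esub>" "f \<oplus>\<^bsub>Mob A q\<^esub> g = f \<oplus>\<^bsub>E\<^esub> g" "a \<odot>\<^bsub>Mob A q\<^esub> f = a \<odot>\<^bsub>E\<^esub> f" for f g a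
      by (auto simp: A_simps)
    show "(\<zero>\<^bsub>Mob (degree_part Q n) q\<^esub>, \<zero>\<^bsub>Mob A q\<^esub>) \<in> \<Gamma> q"
      using Aq Qq w'(3)[OF q _ q] module_simps(2)[OF Aq] by (auto simp: \<Gamma>_def A_ops E_simps intro!: restrict_ext)
    fix x f assume xf: "(x, f) \<in> \<Gamma> q"
    show "x \<in> carrier (Mob (degree_part Q n) q)" "f \<in> carrier (Mob A q)" using xf by (auto simp: \<Gamma>_def)
    show "(x \<oplus>\<^bsub>Mob (degree_part Q n) q\<^esub> x', f \<oplus>\<^bsub>Mob A q\<^esub> f') \<in> \<Gamma> q" if "(x', f') \<in> \<Gamma> q" for x' f'
    proof -
      have "f \<oplus>\<^bsub>Mob A q\<^esub> f' \<in> carrier (Mob A q)" using xf that Aq by (auto simp: \<Gamma>_def)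
      then show ?thesis using xf that Qq w'(2)[OF q _ q]
        by (auto simp: \<Gamma>_def A_ops E_simps module_smult intro!: restrict_ext)
    qed
    show "(a \<odot>\<^bsub>Mob (degree_part Q n) q\<^esub> x, a \<odot>\<^bsub>Mob A q\<^esub> f) \<in> \<Gamma> q" if a: "a \<in> carrier R" for a
    proof -
      have "a \<odot>\<^bsub>Mob A q\<^esub> f \<in> carrier (Mob A q)" using xf a Aq by (auto simp: \<Gamma>_def)
      then show ?thesis using xf a Qq m_comm[OF a]
        by (auto simp: \<Gamma>_def A_ops E_simps module_smult intro!: restrict_ext)
    qed
    show "(Mar (degree_part Q n) q s x, Mar A q s f) \<in> \<Gamma> s" if s: "s \<in> P" "q \<le> s" for s
    proof -
      have "Mar A q s f \<in> carrier (Mob A s)" using mod_functorD(2)[OF A q s] xf by (auto simp: \<Gamma>_def)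
      moreover have "Mar A q s f = (\<lambda>r\<in>carrier R. w s (r \<odot>\<^bsub>obj (Cob Q s) n\<^esub> Car Q q s n x))" if "s < p"
      proof -
        have "q < p" using s(2) that by simp
        then have f: "f = (\<lambda>r\<in>carrier R. w q (r \<odot>\<^bsub>obj (Cob Q q) n\<^esub> x))" using xf by (auto simp: \<Gamma>_def)
        have "w s (r \<odot>\<^bsub>obj (Cob Q s) n\<^esub> Car Q q s n x) = w q (r \<odot>\<^bsub>obj (Cob Q q) n\<^esub> x)" if "r \<in> carrier R" for r
          using compat[OF q s \<open>s < p\<close>, of "r \<odot>\<^bsub>obj (Cob Q q) n\<^esub> x"] C(3)[OF q s that] xf Qq that by (auto simp: \<Gamma>_def)
        then show ?thesis using that by (auto simp: A_simps f intro!: restrict_ext)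
      qed
      ultimately show ?thesis using xf C(1)[OF q s] by (auto simp: \<Gamma>_def)
    qed
  qed
  moreover have "\<exists>f. (x, f) \<in> \<Gamma> q" if q: "q \<in> P" and x: "x \<in> carrier (Mob (degree_part Q n) q)" for q x
  proof (cases "q < p")
    case True
    then show ?thesis using wE[OF q True] x by (auto simp: \<Gamma>_def A_simps)
  next
    case False
    then show ?thesis using module_simps(2)[OF mod_functorD(1)[OF A q]] x by (auto simp: \<Gamma>_def)
  qed
  ultimately obtain \<psi> where \<psi>: "mod_nat R P (\<le>) (degree_part Q n) A \<psi>"
    "\<And>q x. q \<in> P \<Longrightarrow> x \<in> carrier (obj (Cob Q q) n) \<Longrightarrow> (x, \<psi> q x) \<in> \<Gamma> q"
    using projective_lifting[OF proj A, of n \<Gamma>] by auto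
  note \<psi>' = mod_natD[OF \<psi>(1) Q'(1) A]
  have \<psi>p: "\<psi> p x \<in> carrier E" if "x \<in> carrier (obj (Cob Q p) n)" for x
    using \<psi>'(1)[OF p, of x] that by (simp add: A_simps)
  have "character (obj (Cob Q p) n) (\<lambda>x. \<psi> p x \<one>\<^bsub>R\<^esub>)"
  proof (rule characterI)
    fix x assume x: "x \<in> carrier (obj (Cob Q p) n)"
    show "\<psi> p x \<one>\<^bsub>R\<^esub> \<noteq> 0" using additive_mapD(1)[of "Mob (representable p) p" cstar "\<psi> p x" "\<one>\<^bsub>R\<^esub>"] \<psi>p[OF x]
      by (simp add: E_def)
    fix y assume y: "y \<in> carrier (obj (Cob Q p) n)"
    show "\<psi> p (x \<oplus>\<^bsub>obj (Cob Q p) n\<^esub> y) \<one>\<^bsub>R\<^esub> = \<psi> p x \<one>\<^bsub>R\<^esub> * \<psi> p y \<one>\<^bsub>R\<^esub>"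
      using \<psi>'(2)[OF p, of x y] x y by (simp add: A_simps E_simps)
  qed
  moreover have "\<psi> p (Car Q q p n x) \<one>\<^bsub>R\<^esub> = w q x" if q: "q \<in> P" "q < p" and x: "x \<in> carrier (obj (Cob Q q) n)" for q x
  proof -
    have "\<psi> p (Car Q q p n x) = \<psi> q x" using \<psi>'(6)[of q p x] q p x by (simp add: A_simps)
    moreover have "\<psi> q x = (\<lambda>r\<in>carrier R. w q (r \<odot>\<^bsub>obj (Cob Q q) n\<^esub> x))" using \<psi>(2)[OF q(1) x] q(2) by (simp add: \<Gamma>_def)
    ultimately show ?thesis using x Q'(3)[OF q(1)] by simp
  qed
  ultimately show "\<exists>\<chi>. character (obj (Cob Q p) n) \<chi> \<and>
      (\<forall>q x. q \<in> P \<longrightarrow> q < p \<longrightarrow> x \<in> carrier (obj (Cob Q q) n) \<longrightarrow> \<chi> (Car Q q p n x) = w q x)"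
    by (intro exI[of _ "\<lambda>x. \<psi> p x \<one>\<^bsub>R\<^esub>"]) blast
qed

section \<open>Direct sums and colimits\<close>

lemma direct_sum_simps [simp]:
  "\<zero>\<^bsub>direct_sum S F\<^esub> = (\<lambda>p\<in>S. \<zero>\<^bsub>Mob F p\<^esub>)"
  "x \<oplus>\<^bsub>direct_sum S F\<^esub> y = (\<lambda>p\<in>S. x p \<oplus>\<^bsub>Mob F p\<^esub> y p)"
  "a \<odot>\<^bsub>direct_sum S F\<^esub> x = (\<lambda>p\<in>S. a \<odot>\<^bsub>Mob F p\<^esub> x p)"
  by (simp_all add: direct_sum_def)

lemma direct_sum_carrier:
  "x \<in> carrier (direct_sum S F) \<longleftrightarrow> x \<in> extensional S \<and> (\<forall>p\<in>S. x p \<in> carrier (Mob F p)) \<and>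
    finite {p\<in>S. x p \<noteq> \<zero>\<^bsub>Mob F p\<^esub>}"
  by (auto simp: direct_sum_def PiE_iff)

text \<open>The homomorphism out of a direct sum given by homomorphisms \<open>h q\<close> on the summands. With the structure maps
  for \<open>h\<close> it computes \<^const>\<open>latching_map\<close>, with characters for \<open>h\<close> and \<^const>\<open>cstar\<close> for \<open>M\<close> it is a
  character of the direct sum.\<close>

definition family_sum :: "('s, 'b) module \<Rightarrow> 'p set \<Rightarrow> ('r, 'p, 'a) mod_functor \<Rightarrow> ('p \<Rightarrow> 'a \<Rightarrow> 'b) \<Rightarrow> ('p \<Rightarrow> 'a) \<Rightarrow> 'b" where
  "family_sum M S F h x = (\<Oplus>\<^bsub>M\<^esub>q\<in>{q\<in>S. x q \<noteq> \<zero>\<^bsub>Mob F q\<^esub>}. h q (x q))"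

definition sum_map :: "'p set \<Rightarrow> ('p \<Rightarrow> 'a \<Rightarrow> 'b) \<Rightarrow> ('p \<Rightarrow> 'a) \<Rightarrow> 'p \<Rightarrow> 'b" where
  "sum_map S \<alpha> x = (\<lambda>p\<in>S. \<alpha> p (x p))"

context cring_base
begin

lemma direct_sum_module:
  assumes F: "is_mod_functor R S leq F"
  shows "module R (direct_sum S F)"
proof (intro moduleI abelian_groupI is_cring)
  note F' = mod_functorD(1)[OF F]
  fix x assume x: "x \<in> carrier (direct_sum S F)"
  then have fin: "finite {p\<in>S. x p \<noteq> \<zero>\<^bsub>Mob F p\<^esub>}" by (simp add: direct_sum_carrier)
  show "x \<oplus>\<^bsub>direct_sum S F\<^esub> y \<in> carrier (direct_sum S F)" if y: "y \<in> carrier (direct_sum S F)" for y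
  proof -
    have "finite ({p\<in>S. x p \<noteq> \<zero>\<^bsub>Mob F p\<^esub>} \<union> {p\<in>S. y p \<noteq> \<zero>\<^bsub>Mob F p\<^esub>})" using fin y by (simp add: direct_sum_carrier)
    then have "finite {p\<in>S. x p \<oplus>\<^bsub>Mob F p\<^esub> y p \<noteq> \<zero>\<^bsub>Mob F p\<^esub>}"
      by (rule rev_finite_subset) (use F' in auto)
    moreover have "{p\<in>S. (x \<oplus>\<^bsub>direct_sum S F\<^esub> y) p \<noteq> \<zero>\<^bsub>Mob F p\<^esub>} = {p\<in>S. x p \<oplus>\<^bsub>Mob F p\<^esub> y p \<noteq> \<zero>\<^bsub>Mob F p\<^esub>}" by auto
    ultimately show ?thesis using x y F' by (auto simp: direct_sum_carrier)
  qed
  show "a \<odot>\<^bsub>direct_sum S F\<^esub> x \<in> carrier (direct_sum S F)" if a: "a \<in> carrier R" for a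
  proof -
    have "finite {p\<in>S. a \<odot>\<^bsub>Mob F p\<^esub> x p \<noteq> \<zero>\<^bsub>Mob F p\<^esub>}"
      by (rule rev_finite_subset[OF fin]) (use F' a in auto)
    moreover have "{p\<in>S. (a \<odot>\<^bsub>direct_sum S F\<^esub> x) p \<noteq> \<zero>\<^bsub>Mob F p\<^esub>} = {p\<in>S. a \<odot>\<^bsub>Mob F p\<^esub> x p \<noteq> \<zero>\<^bsub>Mob F p\<^esub>}" by auto
    ultimately show ?thesis using x a F' by (auto simp: direct_sum_carrier)
  qed
  show "\<exists>y\<in>carrier (direct_sum S F). y \<oplus>\<^bsub>direct_sum S F\<^esub> x = \<zero>\<^bsub>direct_sum S F\<^esub>"
  proof (rule bexI)
    have "finite {p\<in>S. \<ominus>\<^bsub>Mob F p\<^esub> x p \<noteq> \<zero>\<^bsub>Mob F p\<^esub>}"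
      by (rule rev_finite_subset[OF fin]) (use F' in auto)
    moreover have "{p\<in>S. (\<lambda>p\<in>S. \<ominus>\<^bsub>Mob F p\<^esub> x p) p \<noteq> \<zero>\<^bsub>Mob F p\<^esub>} = {p\<in>S. \<ominus>\<^bsub>Mob F p\<^esub> x p \<noteq> \<zero>\<^bsub>Mob F p\<^esub>}" by auto
    ultimately show "(\<lambda>p\<in>S. \<ominus>\<^bsub>Mob F p\<^esub> x p) \<in> carrier (direct_sum S F)" using x F' by (auto simp: direct_sum_carrier)
    show "(\<lambda>p\<in>S. \<ominus>\<^bsub>Mob F p\<^esub> x p) \<oplus>\<^bsub>direct_sum S F\<^esub> x = \<zero>\<^bsub>direct_sum S F\<^esub>"
      using x F' by (auto simp: direct_sum_carrier intro!: restrict_ext)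
  qed
  show "\<zero>\<^bsub>direct_sum S F\<^esub> \<oplus>\<^bsub>direct_sum S F\<^esub> x = x" "\<one> \<odot>\<^bsub>direct_sum S F\<^esub> x = x"
    by (rule extensionalityI[of _ S]; use x F' in \<open>auto simp: direct_sum_carrier\<close>)+
next
  have "{p\<in>S. (\<lambda>p\<in>S. \<zero>\<^bsub>Mob F p\<^esub>) p \<noteq> \<zero>\<^bsub>Mob F p\<^esub>} = {}" by auto
  then show "\<zero>\<^bsub>direct_sum S F\<^esub> \<in> carrier (direct_sum S F)"
    using mod_functorD(1)[OF F] by (simp add: direct_sum_carrier)
qed (use mod_functorD(1)[OF F] in \<open>auto simp: direct_sum_carrier module_smult module_ac intro!: restrict_ext\<close>)

lemma sum_incl_closed:
  assumes F: "is_mod_functor R S leq F" and p: "p \<in> S" "a \<in> carrier (Mob F p)"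
  shows "sum_incl S F p a \<in> carrier (direct_sum S F)"
proof -
  have "finite {q\<in>S. sum_incl S F p a q \<noteq> \<zero>\<^bsub>Mob F q\<^esub>}"
    by (rule finite_subset[of _ "{p}"]) (auto simp: sum_incl_def)
  then show ?thesis using p mod_functorD(1)[OF F] by (auto simp: direct_sum_carrier sum_incl_def)
qed

lemma direct_sum_induct [consumes 2, case_names zero incl add]:
  assumes F: "is_mod_functor R S leq F" and x: "x \<in> carrier (direct_sum S F)"
    and zero: "Pr \<zero>\<^bsub>direct_sum S F\<^esub>"
    and incl: "\<And>p a. p \<in> S \<Longrightarrow> a \<in> carrier (Mob F p) \<Longrightarrow> Pr (sum_incl S F p a)"
    and add: "\<And>x y. x \<in> carrier (direct_sum S F) \<Longrightarrow> y \<in> carrier (direct_sum S F) \<Longrightarrow> Pr x \<Longrightarrow> Pr y \<Longrightarrow>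
      Pr (x \<oplus>\<^bsub>direct_sum S F\<^esub> y)"
  shows "Pr x"
proof -
  note F' = mod_functorD(1)[OF F]
  have "finite {p\<in>S. x p \<noteq> \<zero>\<^bsub>Mob F p\<^esub>}" using x by (simp add: direct_sum_carrier)
  then show ?thesis using x
  proof (induction "{p\<in>S. x p \<noteq> \<zero>\<^bsub>Mob F p\<^esub>}" arbitrary: x rule: finite_induct)
    case empty
    then have "x = \<zero>\<^bsub>direct_sum S F\<^esub>"
      by (intro extensionalityI[of _ S]) (auto simp: direct_sum_carrier)
    with zero show ?case by (simp only:)
  next
    case (insert p T)
    then have p: "p \<in> S" "x p \<in> carrier (Mob F p)" by (auto simp: direct_sum_carrier)
    define y where "y = (\<lambda>q\<in>S. if q = p then \<zero>\<^bsub>Mob F q\<^esub> else x q)"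
    have T: "T = {q\<in>S. y q \<noteq> \<zero>\<^bsub>Mob F q\<^esub>}" using insert(2,4) by (auto simp: y_def split: if_splits)
    have y: "y \<in> carrier (direct_sum S F)"
      using insert(1,5) T F' by (auto simp: direct_sum_carrier y_def)
    have "x = sum_incl S F p (x p) \<oplus>\<^bsub>direct_sum S F\<^esub> y"
      by (rule extensionalityI[of _ S]) (use insert(5) F' p in \<open>auto simp: direct_sum_carrier sum_incl_def y_def\<close>)
    moreover have "Pr y" by (rule insert(3)[OF T y])
    ultimately show ?case using add[OF sum_incl_closed[OF F p] y incl[OF p]] by (simp only:)
  qed
qed

lemma sum_incl_ops:
  assumes F: "is_mod_functor R S leq F" and p: "p \<in> S" "a \<in> carrier (Mob F p)"
  shows "r \<in> carrier R \<Longrightarrow> r \<odot>\<^bsub>direct_sum S F\<^esub> sum_incl S F p a = sum_incl S F p (r \<odot>\<^bsub>Mob F p\<^esub> a)"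
    and "b \<in> carrier (Mob F p) \<Longrightarrow> sum_incl S F p (a \<oplus>\<^bsub>Mob F p\<^esub> b) = sum_incl S F p a \<oplus>\<^bsub>direct_sum S F\<^esub> sum_incl S F p b"
  using p mod_functorD(1)[OF F] by (auto simp: sum_incl_def intro!: restrict_ext)

lemma additive_map_minus:
  assumes f: "additive_map M N f" and M: "abelian_group M" and N: "abelian_group N" and x: "x \<in> carrier M"
  shows "f (\<ominus>\<^bsub>M\<^esub> x) = \<ominus>\<^bsub>N\<^esub> f x"
proof -
  interpret M: abelian_group M by fact
  interpret N: abelian_group N by fact
  note fD = additive_mapD[OF f]
  have "f (\<ominus>\<^bsub>M\<^esub> x) \<oplus>\<^bsub>N\<^esub> f x = \<zero>\<^bsub>N\<^esub>"
    using fD(2)[of "\<ominus>\<^bsub>M\<^esub> x" x] x additive_map_zero[OF f M N] by (simp add: M.l_neg)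
  then show ?thesis using x fD(1) by (intro N.minus_equality[symmetric]) auto
qed

lemma family_sum_eq:
  assumes N: "abelian_group N" and F: "is_mod_functor R S leq F"
    and h: "\<And>p. p \<in> S \<Longrightarrow> additive_map (Mob F p) N (h p)"
    and x: "x \<in> carrier (direct_sum S F)" and T: "finite T" "T \<subseteq> S" "{q\<in>S. x q \<noteq> \<zero>\<^bsub>Mob F q\<^esub>} \<subseteq> T"
  shows "family_sum N S F h x = (\<Oplus>\<^bsub>N\<^esub>q\<in>T. h q (x q))"
proof -
  interpret N: abelian_group N by fact
  have c: "h q (x q) \<in> carrier N" if "q \<in> S" for q
    using additive_mapD(1)[OF h[OF that]] x that by (simp add: direct_sum_carrier)
  have z: "h q (x q) = \<zero>\<^bsub>N\<^esub>" if "q \<in> T - {q\<in>S. x q \<noteq> \<zero>\<^bsub>Mob F q\<^esub>}" for q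
    using additive_map_zero[OF h module_abelian_group[OF mod_functorD(1)[OF F]] N, of q] that T by auto
  show ?thesis
    unfolding family_sum_def
    by (rule N.add.finprod_mono_neutral_cong_left[OF T(1,3)]) (use c z T in auto)
qed

lemma family_sum_additive:
  assumes N: "abelian_group N" and F: "is_mod_functor R S leq F"
    and h: "\<And>p. p \<in> S \<Longrightarrow> additive_map (Mob F p) N (h p)"
  shows "additive_map (direct_sum S F) N (family_sum N S F h)"
  unfolding additive_map_def
proof (intro conjI ballI)
  interpret N: abelian_group N by fact
  have c: "h q (x q) \<in> carrier N" if "q \<in> S" "x \<in> carrier (direct_sum S F)" for q x
    using additive_mapD(1)[OF h[OF that(1)]] that by (simp add: direct_sum_carrier)
  fix x assume x: "x \<in> carrier (direct_sum S F)"
  show "family_sum N S F h x \<in> carrier N"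
    unfolding family_sum_def by (rule N.finsum_closed) (use c x in auto)
  fix y assume y: "y \<in> carrier (direct_sum S F)"
  let ?T = "{q\<in>S. x q \<noteq> \<zero>\<^bsub>Mob F q\<^esub>} \<union> {q\<in>S. y q \<noteq> \<zero>\<^bsub>Mob F q\<^esub>}"
  have T: "finite ?T" "?T \<subseteq> S" using x y by (auto simp: direct_sum_carrier)
  have xy: "x \<oplus>\<^bsub>direct_sum S F\<^esub> y \<in> carrier (direct_sum S F)"
    using direct_sum_module[OF F] x y by (rule module_simps(1))
  have "family_sum N S F h (x \<oplus>\<^bsub>direct_sum S F\<^esub> y) = (\<Oplus>\<^bsub>N\<^esub>q\<in>?T. h q ((x \<oplus>\<^bsub>direct_sum S F\<^esub> y) q))"
    by (rule family_sum_eq[OF N F h xy T]) (use mod_functorD(1)[OF F] in auto)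
  also have "\<dots> = (\<Oplus>\<^bsub>N\<^esub>q\<in>?T. h q (x q) \<oplus>\<^bsub>N\<^esub> h q (y q))"
    by (rule N.finsum_cong') (use c x y additive_mapD(2)[OF h] in \<open>auto simp: direct_sum_carrier\<close>)
  also have "\<dots> = (\<Oplus>\<^bsub>N\<^esub>q\<in>?T. h q (x q)) \<oplus>\<^bsub>N\<^esub> (\<Oplus>\<^bsub>N\<^esub>q\<in>?T. h q (y q))"
    by (rule N.finsum_addf) (use c x y in auto)
  also have "(\<Oplus>\<^bsub>N\<^esub>q\<in>?T. h q (x q)) = family_sum N S F h x"
    by (rule family_sum_eq[OF N F h x T, symmetric]) auto
  also have "(\<Oplus>\<^bsub>N\<^esub>q\<in>?T. h q (y q)) = family_sum N S F h y"
    by (rule family_sum_eq[OF N F h y T, symmetric]) auto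
  finally show "family_sum N S F h (x \<oplus>\<^bsub>direct_sum S F\<^esub> y) = family_sum N S F h x \<oplus>\<^bsub>N\<^esub> family_sum N S F h y" .
qed

lemma family_sum_incl:
  assumes N: "abelian_group N" and F: "is_mod_functor R S leq F"
    and h: "\<And>p. p \<in> S \<Longrightarrow> additive_map (Mob F p) N (h p)"
    and p: "p \<in> S" "a \<in> carrier (Mob F p)"
  shows "family_sum N S F h (sum_incl S F p a) = h p a"
proof -
  interpret N: abelian_group N by fact
  have "family_sum N S F h (sum_incl S F p a) = (\<Oplus>\<^bsub>N\<^esub>q\<in>{p}. h q (sum_incl S F p a q))"
    by (rule family_sum_eq[OF N F h sum_incl_closed[OF F p]]) (use p in \<open>auto simp: sum_incl_def\<close>)
  also have "\<dots> = h p a" using p additive_mapD(1)[OF h[OF p(1)]] by (simp add: sum_incl_def)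
  finally show ?thesis .
qed

lemma colim_relations_submodule:
  assumes F: "is_mod_functor R S leq F"
  shows "submodule (colim_relations R S leq F) R (direct_sum S F)"
proof -
  note M = direct_sum_module[OF F]
  let ?A = "{N. submodule N R (direct_sum S F) \<and> (\<forall>p\<in>S. \<forall>q\<in>S. leq p q \<longrightarrow> (\<forall>x\<in>carrier (Mob F p).
    sum_incl S F p x \<ominus>\<^bsub>direct_sum S F\<^esub> sum_incl S F q (Mar F p q x) \<in> N))}"
  have ne: "carrier (direct_sum S F) \<in> ?A"
    using M mod_functorD(2)[OF F] sum_incl_closed[OF F] module.carrier_is_submodule[OF M] by auto
  show ?thesis
    unfolding colim_relations_def
  proof (rule submodule_criterion[OF M])
    have sub: "submodule N R (direct_sum S F)" if "N \<in> ?A" for N using that by simp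
    show "\<Inter>?A \<subseteq> carrier (direct_sum S F)" using ne by (rule Inter_lower)
    show "\<zero>\<^bsub>direct_sum S F\<^esub> \<in> \<Inter>?A" by (rule InterI) (rule submoduleD(2)[OF sub M])
    show "x \<oplus>\<^bsub>direct_sum S F\<^esub> y \<in> \<Inter>?A" if xy: "x \<in> \<Inter>?A" "y \<in> \<Inter>?A" for x y
      by (rule InterI) (rule submoduleD(3)[OF sub M InterD[OF xy(1)] InterD[OF xy(2)]])
    show "a \<odot>\<^bsub>direct_sum S F\<^esub> x \<in> \<Inter>?A" if x: "a \<in> carrier R" "x \<in> \<Inter>?A" for a x
      by (rule InterI) (rule submoduleD(5)[OF sub M x(1) InterD[OF x(2)]])
  qed
qed

lemma colim_relations_generator:
  assumes "p \<in> S" "q \<in> S" "leq p q" "x \<in> carrier (Mob F p)"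
  shows "sum_incl S F p x \<ominus>\<^bsub>direct_sum S F\<^esub> sum_incl S F q (Mar F p q x) \<in> colim_relations R S leq F"
  using assms unfolding colim_relations_def by blast

lemma colim_relations_least:
  assumes "submodule N R (direct_sum S F)"
    "\<And>p q x. p \<in> S \<Longrightarrow> q \<in> S \<Longrightarrow> leq p q \<Longrightarrow> x \<in> carrier (Mob F p) \<Longrightarrow>
      sum_incl S F p x \<ominus>\<^bsub>direct_sum S F\<^esub> sum_incl S F q (Mar F p q x) \<in> N"
    and "x \<in> colim_relations R S leq F"
  shows "x \<in> N"
  using assms unfolding colim_relations_def by blast

text \<open>The relations are generated as a submodule, while \<open>h\<close> is only additive; this is why the proof uses
  all multiples of a relation.\<close>

lemma family_sum_relations:
  assumes N: "abelian_group N" and F: "is_mod_functor R S leq F"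
    and h: "\<And>p. p \<in> S \<Longrightarrow> additive_map (Mob F p) N (h p)"
    and compat: "\<And>p q a. p \<in> S \<Longrightarrow> q \<in> S \<Longrightarrow> leq p q \<Longrightarrow> a \<in> carrier (Mob F p) \<Longrightarrow> h q (Mar F p q a) = h p a"
    and x: "x \<in> colim_relations R S leq F"
  shows "family_sum N S F h x = \<zero>\<^bsub>N\<^esub>"
proof -
  interpret N: abelian_group N by fact
  let ?M = "direct_sum S F"
  note M = direct_sum_module[OF F]
  note fs = additive_mapD[OF family_sum_additive[OF N F h]]
    and fs0 = additive_map_zero[OF family_sum_additive[OF N F h] module_abelian_group[OF M] N]
    and fsm = additive_map_minus[OF family_sum_additive[OF N F h] module_abelian_group[OF M] N]
  define K where "K = {x \<in> carrier ?M. \<forall>r\<in>carrier R. family_sum N S F h (r \<odot>\<^bsub>?M\<^esub> x) = \<zero>\<^bsub>N\<^esub>}"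
  have "submodule K R ?M"
  proof (rule submodule_criterion[OF M])
    show "\<zero>\<^bsub>?M\<^esub> \<in> K" using M fs0 module_simps(13)[OF M] unfolding K_def by (simp del: direct_sum_simps)
    show "u \<oplus>\<^bsub>?M\<^esub> v \<in> K" if "u \<in> K" "v \<in> K" for u v
      using that M fs unfolding K_def by (simp add: module_smult del: direct_sum_simps)
    show "a \<odot>\<^bsub>?M\<^esub> u \<in> K" if "a \<in> carrier R" "u \<in> K" for a u
      using that M unfolding K_def by (simp add: module_smult(3)[symmetric] del: direct_sum_simps)
  qed (auto simp: K_def)
  moreover have "sum_incl S F p a \<ominus>\<^bsub>?M\<^esub> sum_incl S F q (Mar F p q a) \<in> K"
    if p: "p \<in> S" "q \<in> S" "leq p q" and a: "a \<in> carrier (Mob F p)" for p q a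
  proof -
    let ?b = "Mar F p q a"
    have b: "?b \<in> carrier (Mob F q)" using mod_functorD(2)[OF F] p a by blast
    have i: "sum_incl S F p a \<in> carrier ?M" "sum_incl S F q ?b \<in> carrier ?M"
      using sum_incl_closed[OF F] p a b by auto
    have "family_sum N S F h (r \<odot>\<^bsub>?M\<^esub> (sum_incl S F p a \<ominus>\<^bsub>?M\<^esub> sum_incl S F q ?b)) = \<zero>\<^bsub>N\<^esub>" if r: "r \<in> carrier R" for r
    proof -
      have ra: "r \<odot>\<^bsub>Mob F p\<^esub> a \<in> carrier (Mob F p)" "r \<odot>\<^bsub>Mob F q\<^esub> ?b \<in> carrier (Mob F q)"
        using mod_functorD(1)[OF F] p a b r by auto
      have "r \<odot>\<^bsub>?M\<^esub> (sum_incl S F p a \<ominus>\<^bsub>?M\<^esub> sum_incl S F q ?b) =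
          sum_incl S F p (r \<odot>\<^bsub>Mob F p\<^esub> a) \<oplus>\<^bsub>?M\<^esub> \<ominus>\<^bsub>?M\<^esub> sum_incl S F q (r \<odot>\<^bsub>Mob F q\<^esub> ?b)"
        using M i r sum_incl_ops(1)[OF F p(1) a r] sum_incl_ops(1)[OF F p(2) b r]
        by (simp add: module_smult module_ac(9)[OF M] del: direct_sum_simps)
      then have "family_sum N S F h (r \<odot>\<^bsub>?M\<^esub> (sum_incl S F p a \<ominus>\<^bsub>?M\<^esub> sum_incl S F q ?b)) =
          h p (r \<odot>\<^bsub>Mob F p\<^esub> a) \<oplus>\<^bsub>N\<^esub> \<ominus>\<^bsub>N\<^esub> h q (r \<odot>\<^bsub>Mob F q\<^esub> ?b)"
        using fs(2) fsm sum_incl_closed[OF F] p ra M family_sum_incl[OF N F h]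
        by (simp del: direct_sum_simps)
      also have "h q (r \<odot>\<^bsub>Mob F q\<^esub> ?b) = h p (r \<odot>\<^bsub>Mob F p\<^esub> a)"
        using compat[OF p ra(1)] mod_functorD(4)[OF F p r a] by simp
      finally show ?thesis using additive_mapD(1)[OF h[OF p(1)] ra(1)] by (simp add: N.r_neg del: direct_sum_simps)
    qed
    then show ?thesis using i M unfolding K_def by simp
  qed
  ultimately have "x \<in> K" using x by (rule colim_relations_least)
  then have "family_sum N S F h (\<one> \<odot>\<^bsub>?M\<^esub> x) = \<zero>\<^bsub>N\<^esub>" by (simp add: K_def del: direct_sum_simps)
  moreover have "\<one> \<odot>\<^bsub>?M\<^esub> x = x"
    using submoduleD(1)[OF colim_relations_submodule[OF F] M x] by (rule module_simps(14)[OF M])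
  ultimately show ?thesis by simp
qed

lemma sum_map_hom:
  assumes F: "is_mod_functor R S leq F" and G: "is_mod_functor R S leq G" and \<alpha>: "mod_nat R S leq F G \<alpha>"
  shows "sum_map S \<alpha> \<in> module_hom R (direct_sum S F) (direct_sum S G)"
    and "p \<in> S \<Longrightarrow> a \<in> carrier (Mob F p) \<Longrightarrow> sum_map S \<alpha> (sum_incl S F p a) = sum_incl S G p (\<alpha> p a)"
    and "x \<in> colim_relations R S leq F \<Longrightarrow> sum_map S \<alpha> x \<in> colim_relations R S leq G"
proof -
  note a = mod_natD[OF \<alpha> F G]
  show hom: "sum_map S \<alpha> \<in> module_hom R (direct_sum S F) (direct_sum S G)"
  proof (rule module_homI)
    fix x assume x: "x \<in> carrier (direct_sum S F)"
    then have "finite {p\<in>S. x p \<noteq> \<zero>\<^bsub>Mob F p\<^esub>}" by (simp add: direct_sum_carrier)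
    then have "finite {p\<in>S. sum_map S \<alpha> x p \<noteq> \<zero>\<^bsub>Mob G p\<^esub>}"
      by (rule rev_finite_subset) (auto simp: sum_map_def a(4))
    then show "sum_map S \<alpha> x \<in> carrier (direct_sum S G)"
      using x a(1) by (auto simp: direct_sum_carrier sum_map_def)
  qed (auto simp: direct_sum_carrier sum_map_def a intro!: restrict_ext)
  show incl: "sum_map S \<alpha> (sum_incl S F p a) = sum_incl S G p (\<alpha> p a)" if "p \<in> S" "a \<in> carrier (Mob F p)" for p a
    using that a(4) by (auto simp: sum_map_def sum_incl_def intro!: restrict_ext)
  note MF = direct_sum_module[OF F] and MG = direct_sum_module[OF G]
  note h = module_homD[OF hom MF MG] and RG = submoduleD[OF colim_relations_submodule[OF G] MG]
  define K where "K = {x \<in> carrier (direct_sum S F). sum_map S \<alpha> x \<in> colim_relations R S leq G}"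
  have "submodule K R (direct_sum S F)"
    by (rule submodule_criterion[OF MF]) (use MF RG in \<open>auto simp: K_def h simp del: direct_sum_simps\<close>)
  moreover have "sum_incl S F p a \<ominus>\<^bsub>direct_sum S F\<^esub> sum_incl S F q (Mar F p q a) \<in> K"
    if p: "p \<in> S" "q \<in> S" "leq p q" and aF: "a \<in> carrier (Mob F p)" for p q a
  proof -
    have b: "Mar F p q a \<in> carrier (Mob F q)" using mod_functorD(2)[OF F] p aF by blast
    have i: "sum_incl S F p a \<in> carrier (direct_sum S F)" "sum_incl S F q (Mar F p q a) \<in> carrier (direct_sum S F)"
      using sum_incl_closed[OF F] p aF b by auto
    have "sum_incl S G p (\<alpha> p a) \<ominus>\<^bsub>direct_sum S G\<^esub> sum_incl S G q (Mar G p q (\<alpha> p a)) \<in> colim_relations R S leq G"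
      by (rule colim_relations_generator[where F = G and leq = leq and x = "\<alpha> p a", OF p(1,2,3) a(1)[OF p(1) aF]])
    then have "sum_map S \<alpha> (sum_incl S F p a \<ominus>\<^bsub>direct_sum S F\<^esub> sum_incl S F q (Mar F p q a)) \<in> colim_relations R S leq G"
      using i MF MG incl p aF b a(6)[OF p aF] by (simp add: module_ac(9) h del: direct_sum_simps)
    then show ?thesis using i MF by (simp add: K_def)
  qed
  ultimately show "x \<in> colim_relations R S leq F \<Longrightarrow> sum_map S \<alpha> x \<in> colim_relations R S leq G"
    using colim_relations_least[of K S F leq x] unfolding K_def by blast
qed

end

text \<open>The class of a finitely supported family, and the map induced by a transformation on such classes, which
  is also how the differential of \<^const>\<open>colim_cx\<close> is defined.\<close>

definition colim_class :: "('r, 'x) ring_scheme \<Rightarrow> 'p set \<Rightarrow> ('p \<Rightarrow> 'p \<Rightarrow> bool) \<Rightarrow> ('r, 'p, 'a) mod_functor \<Rightarrow>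
    ('p \<Rightarrow> 'a) \<Rightarrow> ('p \<Rightarrow> 'a) set" where
  "colim_class R S leq F x = colim_relations R S leq F +>\<^bsub>direct_sum S F\<^esub> x"

definition colim_map :: "('r, 'x) ring_scheme \<Rightarrow> 'p set \<Rightarrow> ('p \<Rightarrow> 'p \<Rightarrow> bool) \<Rightarrow> ('r, 'p, 'b) mod_functor \<Rightarrow>
    ('p \<Rightarrow> 'a \<Rightarrow> 'b) \<Rightarrow> ('p \<Rightarrow> 'a) set \<Rightarrow> ('p \<Rightarrow> 'b) set" where
  "colim_map R S leq G \<alpha> X = (\<Union>x\<in>X. colim_class R S leq G (sum_map S \<alpha> x))"

lemma colim_cx_simps [simp]:
  "obj (colim_cx R S leq G) n = colim_mod R S leq (degree_part G n)"
  "diff (colim_cx R S leq G) n = colim_map R S leq (degree_part G (n + 1)) (\<lambda>p. diff (Cob G p) n)"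
  by (simp_all add: colim_cx_def colim_map_def[abs_def] colim_class_def sum_map_def)

context cring_base
begin

lemma colim_class_hom:
  assumes F: "is_mod_functor R S leq F"
  shows "module R (colim_mod R S leq F)"
    and "colim_class R S leq F \<in> module_hom R (direct_sum S F) (colim_mod R S leq F)"
    and "carrier (colim_mod R S leq F) = colim_class R S leq F ` carrier (direct_sum S F)"
    and "x \<in> carrier (direct_sum S F) \<Longrightarrow>
      colim_class R S leq F x = \<zero>\<^bsub>colim_mod R S leq F\<^esub> \<longleftrightarrow> x \<in> colim_relations R S leq F"
proof -
  note M = direct_sum_module[OF F] and N = colim_relations_submodule[OF F]
  note q = quotient_simps[OF M N]
  show "module R (colim_mod R S leq F)" unfolding colim_mod_def by (rule quotient_is_module[OF M N])
  show "carrier (colim_mod R S leq F) = colim_class R S leq F ` carrier (direct_sum S F)"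
    unfolding colim_mod_def colim_class_def[abs_def] by (rule q(1))
  show "colim_class R S leq F \<in> module_hom R (direct_sum S F) (colim_mod R S leq F)"
    unfolding colim_mod_def colim_class_def[abs_def]
    by (rule module_homI) (simp_all add: q del: direct_sum_simps)
  assume x: "x \<in> carrier (direct_sum S F)"
  have "colim_class R S leq F x = \<zero>\<^bsub>colim_mod R S leq F\<^esub> \<longleftrightarrow>
      (\<exists>n\<in>colim_relations R S leq F. x = \<zero>\<^bsub>direct_sum S F\<^esub> \<oplus>\<^bsub>direct_sum S F\<^esub> n)"
    unfolding colim_mod_def colim_class_def q(2) by (rule coset_eq_iff[OF M N x]) (rule module_simps(2)[OF M])
  also have "\<dots> \<longleftrightarrow> x \<in> colim_relations R S leq F"
    using submoduleD(1)[OF N M] module_simps(6)[OF M] by metis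
  finally show "colim_class R S leq F x = \<zero>\<^bsub>colim_mod R S leq F\<^esub> \<longleftrightarrow> x \<in> colim_relations R S leq F" .
qed

lemma colim_map_hom:
  assumes F: "is_mod_functor R S leq F" and G: "is_mod_functor R S leq G" and \<alpha>: "mod_nat R S leq F G \<alpha>"
  shows "colim_map R S leq G \<alpha> \<in> module_hom R (colim_mod R S leq F) (colim_mod R S leq G)"
    and "x \<in> carrier (direct_sum S F) \<Longrightarrow>
      colim_map R S leq G \<alpha> (colim_class R S leq F x) = colim_class R S leq G (sum_map S \<alpha> x)"
proof -
  note s = sum_map_hom[OF F G \<alpha>]
  note MF = direct_sum_module[OF F] and MG = direct_sum_module[OF G]
    and NF = colim_relations_submodule[OF F] and NG = colim_relations_submodule[OF G]
  show "colim_map R S leq G \<alpha> \<in> module_hom R (colim_mod R S leq F) (colim_mod R S leq G)"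
    unfolding colim_mod_def colim_map_def[abs_def] colim_class_def
    by (rule induced_quotient_hom(1)[OF MF NF MG NG s(1,3)])
  show "x \<in> carrier (direct_sum S F) \<Longrightarrow>
      colim_map R S leq G \<alpha> (colim_class R S leq F x) = colim_class R S leq G (sum_map S \<alpha> x)"
    unfolding colim_map_def colim_class_def by (rule coset_UN[OF MF NF MG NG s(1,3)])
qed

lemma diff_mod_nat:
  assumes G: "is_cx_functor R S leq G"
  shows "mod_nat R S leq (degree_part G n) (degree_part G (n + 1)) (\<lambda>p. diff (Cob G p) n)"
  using Car_simps(6)[OF G] by (intro mod_natI) (simp_all add: diffD[OF cx_functorD(2)[OF G]])

lemma colim_diff_class:
  assumes G: "is_cx_functor R S leq G" and m: "m = n + 1" and x: "x \<in> carrier (direct_sum S (degree_part G n))"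
  shows "sum_map S (\<lambda>p. diff (Cob G p) n) x \<in> carrier (direct_sum S (degree_part G m))"
    and "colim_map R S leq (degree_part G m) (\<lambda>p. diff (Cob G p) n) (colim_class R S leq (degree_part G n) x) =
      colim_class R S leq (degree_part G m) (sum_map S (\<lambda>p. diff (Cob G p) n) x)"
proof -
  note f = cx_functorD(1)[OF G]
  show "sum_map S (\<lambda>p. diff (Cob G p) n) x \<in> carrier (direct_sum S (degree_part G m))"
    unfolding m
    by (rule module_homD(1)[OF sum_map_hom(1)[OF f f diff_mod_nat[OF G]] direct_sum_module[OF f] direct_sum_module[OF f] x])
  show "colim_map R S leq (degree_part G m) (\<lambda>p. diff (Cob G p) n) (colim_class R S leq (degree_part G n) x) =
      colim_class R S leq (degree_part G m) (sum_map S (\<lambda>p. diff (Cob G p) n) x)"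
    unfolding m by (rule colim_map_hom(2)[OF f f diff_mod_nat[OF G] x])
qed

lemma colim_complex:
  assumes G: "is_cx_functor R S leq G"
  shows "is_complex R (colim_cx R S leq G)"
  unfolding is_complex_def
proof (intro conjI allI ballI)
  note f = cx_functorD(1)[OF G]
  show "module R (obj (colim_cx R S leq G) n)" for n by (simp add: colim_class_hom(1)[OF f])
  show "diff (colim_cx R S leq G) n \<in> module_hom R (obj (colim_cx R S leq G) n) (obj (colim_cx R S leq G) (n + 1))" for n
    by (simp add: colim_map_hom(1)[OF f f diff_mod_nat[OF G]])
  fix n X assume "X \<in> carrier (obj (colim_cx R S leq G) n)"
  then obtain x where x: "x \<in> carrier (direct_sum S (degree_part G n))" "X = colim_class R S leq (degree_part G n) x"
    by (auto simp: colim_class_hom(3)[OF f])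
  let ?d = "\<lambda>n. sum_map S (\<lambda>p. diff (Cob G p) n)"
  have e: "n + 1 + 1 = n + 2" by simp
  have dd: "?d (n + 1) (?d n x) = \<zero>\<^bsub>direct_sum S (degree_part G (n + 2))\<^esub>"
    using x(1) complexD(3)[OF cx_functorD(2)[OF G]] by (auto simp: sum_map_def direct_sum_carrier intro!: restrict_ext)
  have "diff (colim_cx R S leq G) (n + 1) (diff (colim_cx R S leq G) n X) = colim_class R S leq (degree_part G (n + 2)) (?d (n + 1) (?d n x))"
    using colim_diff_class[OF G refl x(1)] colim_diff_class(2)[OF G refl colim_diff_class(1)[OF G refl x(1)]]
    unfolding x(2) colim_cx_simps e by simp
  also have "\<dots> = \<zero>\<^bsub>colim_mod R S leq (degree_part G (n + 2))\<^esub>"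
    unfolding dd by (rule module_homD(4)[OF colim_class_hom(2)[OF f] direct_sum_module[OF f] colim_class_hom(1)[OF f]])
  finally show "diff (colim_cx R S leq G) (n + 1) (diff (colim_cx R S leq G) n X) = \<zero>\<^bsub>obj (colim_cx R S leq G) (n + 2)\<^esub>"
    by simp
qed

lemma colim_chain_map:
  assumes X: "is_cx_functor R S leq X" and Y: "is_cx_functor R S leq Y" and \<phi>: "cx_nat R S leq X Y \<phi>"
  shows "chain_map R (colim_cx R S leq X) (colim_cx R S leq Y) (\<lambda>n. colim_map R S leq (degree_part Y n) (\<lambda>p. \<phi> p n))"
  unfolding chain_map_def
proof (intro conjI allI ballI)
  note fX = cx_functorD(1)[OF X] and fY = cx_functorD(1)[OF Y]
  have n: "mod_nat R S leq (degree_part X n) (degree_part Y n) (\<lambda>p. \<phi> p n)" for n using \<phi> by (simp add: cx_nat_def)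
  show "colim_map R S leq (degree_part Y n) (\<lambda>p. \<phi> p n) \<in> module_hom R (obj (colim_cx R S leq X) n) (obj (colim_cx R S leq Y) n)" for n
    by (simp add: colim_map_hom(1)[OF fX fY n])
  fix n c assume "c \<in> carrier (obj (colim_cx R S leq X) n)"
  then obtain x where x: "x \<in> carrier (direct_sum S (degree_part X n))" "c = colim_class R S leq (degree_part X n) x"
    by (auto simp: colim_class_hom(3)[OF fX])
  have \<phi>x: "sum_map S (\<lambda>p. \<phi> p n) x \<in> carrier (direct_sum S (degree_part Y n))"
    by (rule module_homD(1)[OF sum_map_hom(1)[OF fX fY n] direct_sum_module[OF fX] direct_sum_module[OF fY] x(1)])
  have "sum_map S (\<lambda>p. \<phi> p (n + 1)) (sum_map S (\<lambda>p. diff (Cob X p) n) x) =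
      sum_map S (\<lambda>p. diff (Cob Y p) n) (sum_map S (\<lambda>p. \<phi> p n) x)"
    using x(1) cx_natD(6)[OF \<phi> X Y] by (auto simp: sum_map_def direct_sum_carrier intro!: restrict_ext)
  then show "colim_map R S leq (degree_part Y (n + 1)) (\<lambda>p. \<phi> p (n + 1)) (diff (colim_cx R S leq X) n c) =
      diff (colim_cx R S leq Y) n (colim_map R S leq (degree_part Y n) (\<lambda>p. \<phi> p n) c)"
    using colim_diff_class[OF X refl x(1)] colim_map_hom(2)[OF fX fY n x(1)]
      colim_map_hom(2)[OF fX fY n colim_diff_class(1)[OF X refl x(1)]] colim_diff_class(2)[OF Y refl \<phi>x]
    by (simp add: x(2))
qed

lemma direct_sum_minus:
  assumes F: "is_mod_functor R S leq F" and x: "x \<in> carrier (direct_sum S F)" and p: "p \<in> S"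
  shows "(\<ominus>\<^bsub>direct_sum S F\<^esub> x) p = \<ominus>\<^bsub>Mob F p\<^esub> x p"
proof -
  note M = direct_sum_module[OF F]
  have "x \<oplus>\<^bsub>direct_sum S F\<^esub> \<ominus>\<^bsub>direct_sum S F\<^esub> x = \<zero>\<^bsub>direct_sum S F\<^esub>" by (rule module_simps(9)[OF M x])
  from fun_cong[OF this, of p] p have "x p \<oplus>\<^bsub>Mob F p\<^esub> (\<ominus>\<^bsub>direct_sum S F\<^esub> x) p = \<zero>\<^bsub>Mob F p\<^esub>" by simp
  moreover have "\<ominus>\<^bsub>direct_sum S F\<^esub> x \<in> carrier (direct_sum S F)" by (rule module_simps(3)[OF M x])
  ultimately show ?thesis
    using x p mod_functorD(1)[OF F p] by (intro module_minus_unique) (auto simp: direct_sum_carrier)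
qed

section \<open>Colimits of cofibrant functors\<close>

text \<open>Compatible characters below \<open>p\<close> define a character on the image of the latching map, because that
  map is injective, and characters extend.\<close>

lemma cofibrant_characters_extend:
  fixes P :: "'p::order set"
  assumes cof: "cofibrant R P G"
  shows "characters_extend P G"
proof (rule characters_extendI)
  have G: "is_cx_functor R P (\<le>) G" using cof by (simp add: cofibrant_def)
  note G' = cx_functorD[OF G] and C = Car_simps[OF G]
  fix p n w assume p: "p \<in> P" and w: "\<And>q. q \<in> P \<Longrightarrow> q < p \<Longrightarrow> character (obj (Cob G q) n) (w q)"
    and compat: "\<And>q s x. q \<in> P \<Longrightarrow> s \<in> P \<Longrightarrow> q \<le> s \<Longrightarrow> s < p \<Longrightarrow> x \<in> carrier (obj (Cob G q) n) \<Longrightarrow>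
      w s (Car G q s n x) = w q x"
  let ?T = "below P p" and ?F = "degree_part G n" and ?N = "obj (Cob G p) n"
  have T: "q \<in> P" "q < p" if "q \<in> ?T" for q using that by (auto simp: below_def)
  have F: "is_mod_functor R ?T (\<le>) ?F" by (rule mod_functor_subset[OF G'(1)]) (auto simp: below_def)
  note N = G'(3)[OF p, of n]
  note Na = module_abelian_group[OF N] and Ma = module_abelian_group[OF direct_sum_module[OF F]]
  note M = direct_sum_module[OF F]
  define \<sigma> where "\<sigma> = family_sum ?N ?T ?F (\<lambda>q. Car G q p n)"
  define \<tau> where "\<tau> = family_sum cstar ?T ?F w"
  have hC: "additive_map (Mob ?F q) ?N (Car G q p n)" if "q \<in> ?T" for q
    using C(1,2)[of q p] T[OF that] p by (simp add: additive_map_def)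
  have hw: "character (Mob ?F q) (w q)" if "q \<in> ?T" for q using w T[OF that] by simp
  have \<sigma>a: "additive_map (direct_sum ?T ?F) ?N \<sigma>" unfolding \<sigma>_def by (rule family_sum_additive[OF Na F hC])
  have \<tau>a: "character (direct_sum ?T ?F) \<tau>" unfolding \<tau>_def by (rule family_sum_additive[OF cstar_abelian_group F hw])
  have \<sigma>R: "\<sigma> x = \<zero>\<^bsub>?N\<^esub>" if "x \<in> colim_relations R ?T (\<le>) ?F" for x
    unfolding \<sigma>_def by (rule family_sum_relations[OF Na F hC _ that])
      (use G'(6) p T(1) less_imp_le[OF T(2)] in auto)
  have \<tau>R: "\<tau> x = 1" if "x \<in> colim_relations R ?T (\<le>) ?F" for x
  proof -
    have "\<tau> x = \<zero>\<^bsub>cstar\<^esub>"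
      unfolding \<tau>_def by (rule family_sum_relations[OF cstar_abelian_group F hw _ that]) (use compat T in auto)
    then show ?thesis by simp
  qed
  have latch: "latching_map P G p n (colim_class R ?T (\<le>) ?F x) = \<sigma> x" if x: "x \<in> carrier (direct_sum ?T ?F)" for x
  proof -
    have "\<sigma> y = \<sigma> x" if "y \<in> colim_class R ?T (\<le>) ?F x" for y
    proof -
      from that obtain r where r: "r \<in> colim_relations R ?T (\<le>) ?F" "y = r \<oplus>\<^bsub>direct_sum ?T ?F\<^esub> x"
        unfolding colim_class_def coset_mem_iff by blast
      have "r \<in> carrier (direct_sum ?T ?F)" by (rule submoduleD(1)[OF colim_relations_submodule[OF F] M r(1)])
      then show ?thesis using additive_mapD[OF \<sigma>a] r \<sigma>R x N by simp
    qed
    moreover have "x \<in> colim_class R ?T (\<le>) ?F x"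
      unfolding colim_class_def coset_mem_iff
      using submoduleD(2)[OF colim_relations_submodule[OF F] M] module_simps(6)[OF M x] by metis
    ultimately have "\<sigma> ` colim_class R ?T (\<le>) ?F x = {\<sigma> x}" by blast
    moreover have "latching_map P G p n X = the_elem (\<sigma> ` X)" for X
      by (simp add: latching_map_def \<sigma>_def family_sum_def[abs_def])
    ultimately show ?thesis by simp
  qed
  have ker: "\<tau> x = 1" if x: "x \<in> carrier (direct_sum ?T ?F)" "\<sigma> x = \<zero>\<^bsub>?N\<^esub>" for x
  proof -
    let ?z = "\<zero>\<^bsub>direct_sum ?T ?F\<^esub>"
    have z: "?z \<in> carrier (direct_sum ?T ?F)" by (rule module_simps(2)[OF M])
    have "latching_map P G p n (colim_class R ?T (\<le>) ?F x) = latching_map P G p n (colim_class R ?T (\<le>) ?F ?z)"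
      unfolding latch[OF x(1)] latch[OF z] x(2) using additive_map_zero[OF \<sigma>a Ma Na] by simp
    moreover have "inj_on (latching_map P G p n) (colim_class R ?T (\<le>) ?F ` carrier (direct_sum ?T ?F))"
      using cof p unfolding cofibrant_def colim_class_hom(3)[OF F, symmetric] colim_cx_simps by blast
    ultimately have "colim_class R ?T (\<le>) ?F x = colim_class R ?T (\<le>) ?F ?z"
      using x(1) z by (simp add: inj_on_def)
    also have "\<dots> = \<zero>\<^bsub>colim_mod R ?T (\<le>) ?F\<^esub>"
      by (rule module_homD(4)[OF colim_class_hom(2)[OF F] M colim_class_hom(1)[OF F]])
    finally show ?thesis using colim_class_hom(4)[OF F x(1)] \<tau>R by blast
  qed
  let ?\<Gamma> = "(\<lambda>x. (\<sigma> x, \<tau> x)) ` carrier (direct_sum ?T ?F)"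
  have "\<exists>\<chi>. character ?N \<chi> \<and> (\<forall>x c. (x, c) \<in> ?\<Gamma> \<longrightarrow> \<chi> x = c)"
  proof (rule character_extension[OF Na])
    note \<sigma>D = additive_mapD[OF \<sigma>a] and \<tau>D = characterD[OF \<tau>a Ma]
    show "x \<in> carrier ?N" "c \<noteq> 0" if "(x, c) \<in> ?\<Gamma>" for x c using that \<sigma>D(1) \<tau>D(1) by auto
    show "(\<zero>\<^bsub>?N\<^esub>, 1) \<in> ?\<Gamma>"
      by (rule image_eqI[OF _ module_simps(2)[OF M]]) (simp only: additive_map_zero[OF \<sigma>a Ma Na] \<tau>D(3))
    show "(x \<oplus>\<^bsub>?N\<^esub> y, c * d) \<in> ?\<Gamma>" if xy: "(x, c) \<in> ?\<Gamma>" "(y, d) \<in> ?\<Gamma>" for x c y d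
    proof -
      from xy obtain u v where uv: "u \<in> carrier (direct_sum ?T ?F)" "v \<in> carrier (direct_sum ?T ?F)"
        "x = \<sigma> u" "c = \<tau> u" "y = \<sigma> v" "d = \<tau> v" by blast
      show ?thesis by (rule image_eqI[OF _ module_simps(1)[OF M uv(1,2)]]) (simp only: uv \<sigma>D \<tau>D)
    qed
    show "(\<ominus>\<^bsub>?N\<^esub> x, inverse c) \<in> ?\<Gamma>" if "(x, c) \<in> ?\<Gamma>" for x c
    proof -
      from that obtain u where u: "u \<in> carrier (direct_sum ?T ?F)" "x = \<sigma> u" "c = \<tau> u" by blast
      show ?thesis
        by (rule image_eqI[OF _ module_simps(3)[OF M u(1)]]) (simp only: u \<tau>D additive_map_minus[OF \<sigma>a Ma Na])
    qed
    show "c = 1" if "(\<zero>\<^bsub>?N\<^esub>, c) \<in> ?\<Gamma>" for c using that ker by auto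
  qed
  then obtain \<chi> where \<chi>: "character ?N \<chi>" "\<And>x. x \<in> carrier (direct_sum ?T ?F) \<Longrightarrow> \<chi> (\<sigma> x) = \<tau> x" by blast
  have "\<chi> (Car G q p n a) = w q a" if q: "q \<in> P" "q < p" and a: "a \<in> carrier (obj (Cob G q) n)" for q a
  proof -
    have qT: "q \<in> ?T" "a \<in> carrier (Mob ?F q)" using q a by (auto simp: below_def)
    have "\<sigma> (sum_incl ?T ?F q a) = Car G q p n a" unfolding \<sigma>_def by (rule family_sum_incl[OF Na F hC qT])
    moreover have "\<tau> (sum_incl ?T ?F q a) = w q a"
      unfolding \<tau>_def by (rule family_sum_incl[OF cstar_abelian_group F hw qT])
    ultimately show ?thesis using \<chi>(2)[OF sum_incl_closed[OF F qT]] by simp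
  qed
  with \<chi>(1) show "\<exists>\<chi>. character ?N \<chi> \<and>
      (\<forall>q x. q \<in> P \<longrightarrow> q < p \<longrightarrow> x \<in> carrier (obj (Cob G q) n) \<longrightarrow> \<chi> (Car G q p n x) = w q x)" by blast
qed

text \<open>A family that is a cocycle modulo relations but not a coboundary modulo relations would be detected
  by a character; but a character that vanishes on coboundaries and relations is a cocycle in the limit
  of the dual functor, hence a coboundary there.\<close>

theorem colim_primitive:
  fixes P :: "'p::order set"
  assumes P: "filtered_poset P" and G: "is_cx_functor R P (\<le>) G" and ext: "characters_extend P G"
    and ac: "\<And>p. p \<in> P \<Longrightarrow> acyclic_complex (Cob G p)"
    and x: "x \<in> carrier (direct_sum P (degree_part G n))"
    and dx: "sum_map P (\<lambda>p. diff (Cob G p) n) x \<in> colim_relations R P (\<le>) (degree_part G (n + 1))"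
  shows "\<exists>y\<in>carrier (direct_sum P (degree_part G (n - 1))). \<exists>r\<in>colim_relations R P (\<le>) (degree_part G n).
    x = sum_map P (\<lambda>p. diff (Cob G p) (n - 1)) y \<oplus>\<^bsub>direct_sum P (degree_part G n)\<^esub> r"
proof (rule ccontr)
  note G' = cx_functorD[OF G] and C = Car_simps[OF G]
  note f = G'(1)
  let ?M = "\<lambda>n. direct_sum P (degree_part G n)" and ?Rel = "\<lambda>n. colim_relations R P (\<le>) (degree_part G n)"
    and ?d = "\<lambda>n. sum_map P (\<lambda>p. diff (Cob G p) n)"
  note M = direct_sum_module[OF f]
  have Ma: "abelian_group (?M n)" for n by (rule module_abelian_group[OF M])
  have dh: "?d (n - 1) \<in> module_hom R (?M (n - 1)) (?M n)" for n
    using sum_map_hom(1)[OF f f diff_mod_nat[OF G], of "n - 1"] by simp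
  note d' = module_homD[OF dh M M]
  have dh1: "?d n \<in> module_hom R (?M n) (?M (n + 1))" for n
    by (rule sum_map_hom(1)[OF f f diff_mod_nat[OF G]])
  note d1 = module_homD[OF dh1 M M]
  note RD = submoduleD[OF colim_relations_submodule[OF f] M]
  define B where "B = {?d (n - 1) y \<oplus>\<^bsub>?M n\<^esub> r | y r. y \<in> carrier (?M (n - 1)) \<and> r \<in> ?Rel n}"
  have BI: "?d (n - 1) y \<oplus>\<^bsub>?M n\<^esub> r \<in> B" if "y \<in> carrier (?M (n - 1))" "r \<in> ?Rel n" for y r
    using that unfolding B_def by blast
  have BE: "\<exists>y r. y \<in> carrier (?M (n - 1)) \<and> r \<in> ?Rel n \<and> u = ?d (n - 1) y \<oplus>\<^bsub>?M n\<^esub> r" if "u \<in> B" for u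
    using that unfolding B_def by blast
  have B1: "r \<in> B" if "r \<in> ?Rel n" for r
    using BI[OF module_simps(2)[OF M] that] d'(4) module_simps(6)[OF M RD(1)[OF that]] by (simp del: direct_sum_simps)
  have B2: "?d (n - 1) y \<in> B" if "y \<in> carrier (?M (n - 1))" for y
    using BI[OF that RD(2)] module_simps(7)[OF M d'(1)[OF that]] by (simp del: direct_sum_simps)
  assume contra: "\<not> (\<exists>y\<in>carrier (?M (n - 1)). \<exists>r\<in>?Rel n. x = ?d (n - 1) y \<oplus>\<^bsub>?M n\<^esub> r)"
  obtain \<chi> where \<chi>: "character (?M n) \<chi>" "\<And>u. u \<in> B \<Longrightarrow> \<chi> u = 1" "\<chi> x \<noteq> 1"
  proof (rule character_separation[OF Ma, where N = B and x = x])
    show "B \<subseteq> carrier (?M n)" using BE d'(1) RD(1) module_simps(1)[OF M] by blast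
    show "\<zero>\<^bsub>?M n\<^esub> \<in> B" by (rule B1[OF RD(2)])
    show "u \<oplus>\<^bsub>?M n\<^esub> v \<in> B" if "u \<in> B" "v \<in> B" for u v
    proof -
      from that BE obtain y r y' r' where
        y: "y \<in> carrier (?M (n - 1))" "r \<in> ?Rel n" "u = ?d (n - 1) y \<oplus>\<^bsub>?M n\<^esub> r" and
        y': "y' \<in> carrier (?M (n - 1))" "r' \<in> ?Rel n" "v = ?d (n - 1) y' \<oplus>\<^bsub>?M n\<^esub> r'" by meson
      from BI[OF module_simps(1)[OF M y(1) y'(1)] RD(3)[OF y(2) y'(2)]] show ?thesis
        using y y' d'(1,2) RD(1) by (simp add: module_ac[OF M] module_simps(1)[OF M] del: direct_sum_simps)
    qed
    show "\<ominus>\<^bsub>?M n\<^esub> u \<in> B" if "u \<in> B" for u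
    proof -
      from BE[OF that] obtain y r where y: "y \<in> carrier (?M (n - 1))" "r \<in> ?Rel n" "u = ?d (n - 1) y \<oplus>\<^bsub>?M n\<^esub> r" by blast
      from BI[OF module_simps(3)[OF M y(1)] RD(4)[OF y(2)]] show ?thesis
        using y d'(1,5) RD(1) M by (simp add: module_ac[OF M] del: direct_sum_simps)
    qed
    show "x \<in> carrier (?M n)" by (rule x)
    show "x \<notin> B" using contra BE by blast
  qed blast
  note \<chi>D = characterD[OF \<chi>(1) Ma]
  let ?D = "dual_functor G"
  \<comment> \<open>The components of \<open>\<chi>\<close> form a cocycle of the limit of the dual functor.\<close>
  define w where "w = (\<lambda>p\<in>P. \<lambda>a\<in>carrier (obj (Cob G p) n). \<chi> (sum_incl P (degree_part G n) p a))"
  have wp: "w p a = \<chi> (sum_incl P (degree_part G n) p a)" if "p \<in> P" "a \<in> carrier (obj (Cob G p) n)" for p a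
    using that by (simp add: w_def)
  have ic: "sum_incl P (degree_part G n) p a \<in> carrier (?M n)" if "p \<in> P" "a \<in> carrier (obj (Cob G p) n)" for p a n
    using sum_incl_closed[OF f, of p a] that by simp
  have wchar: "w p \<in> carrier (dual (obj (Cob G p) n))" if p: "p \<in> P" for p
  proof -
    have "character (obj (Cob G p) n) (w p)"
    proof (rule characterI)
      fix a b assume ab: "a \<in> carrier (obj (Cob G p) n)" "b \<in> carrier (obj (Cob G p) n)"
      show "w p a \<noteq> 0" using wp[OF p ab(1)] \<chi>D(1)[OF ic[OF p ab(1)]] by simp
      show "w p (a \<oplus>\<^bsub>obj (Cob G p) n\<^esub> b) = w p a * w p b"
        using wp[OF p] ab sum_incl_ops(2)[OF f p, of a n b] \<chi>D(2)[OF ic[OF p ab(1)] ic[OF p ab(2)]] G'(3)[OF p] by simp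
    qed
    moreover have "w p \<in> extensional (carrier (obj (Cob G p) n))" using p by (simp add: w_def)
    ultimately show ?thesis by simp
  qed
  have wcompat: "w q (Car G p q n a) = w p a" if p: "p \<in> P" "q \<in> P" "p \<le> q" and a: "a \<in> carrier (obj (Cob G p) n)" for p q a
  proof -
    let ?i = "sum_incl P (degree_part G n) p a" and ?j = "sum_incl P (degree_part G n) q (Car G p q n a)"
    have b: "Car G p q n a \<in> carrier (obj (Cob G q) n)" by (rule C(1)[OF p a])
    note ij = ic[OF p(1) a] ic[OF p(2) b]
    have "?i \<ominus>\<^bsub>?M n\<^esub> ?j \<in> ?Rel n"
      using colim_relations_generator[where F = "degree_part G n" and leq = "(\<le>)" and x = a, OF p(1,2,3)] a by simp
    then have "\<chi> (?i \<ominus>\<^bsub>?M n\<^esub> ?j) = 1" by (intro \<chi>(2) B1)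
    then have "\<chi> ?i * inverse (\<chi> ?j) = 1"
      using \<chi>D(2)[OF ij(1) module_simps(3)[OF M ij(2)]] \<chi>D(4)[OF ij(2)] by (simp only: module_ac(9)[OF M])
    then show ?thesis using wp p a b \<chi>D(1)[OF ij(2)] by (simp add: field_simps)
  qed
  have wd: "w p (diff (Cob G p) (n - 1) a) = 1" if p: "p \<in> P" and a: "a \<in> carrier (obj (Cob G p) (n - 1))" for p a
  proof -
    note da = diff_intoD(1)[OF G'(2)[OF p] a]
    have "?d (n - 1) (sum_incl P (degree_part G (n - 1)) p a) = sum_incl P (degree_part G n) p (diff (Cob G p) (n - 1) a)"
      using sum_map_hom(2)[OF f f diff_mod_nat[OF G] p, of a "n - 1"] a by simp
    then show ?thesis using wp[OF p da] \<chi>(2)[OF B2[OF ic[OF p a]]] by simp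
  qed
  have "w \<in> cocycles (lim_cx P (\<ge>) ?D) (- n)"
    unfolding cocycles_def
  proof (intro CollectI conjI)
    have "Car ?D p q (- n) (w p) = w q" if "p \<in> P" "q \<in> P" "q \<le> p" for p q
      by (rule extensionalityI[of _ "carrier (obj (Cob G q) n)"]) (use wchar[OF that(2)] wcompat that in auto)
    then show "w \<in> carrier (obj (lim_cx P (\<ge>) ?D) (- n))"
      using wchar by (auto simp: lim_mod_carrier w_def simp del: dual_simps(4) dual_functor_simps(2))
    show "diff (lim_cx P (\<ge>) ?D) (- n) w = \<zero>\<^bsub>obj (lim_cx P (\<ge>) ?D) (- n + 1)\<^esub>"
      using wd by (auto intro!: restrict_ext)
  qed
  moreover have "acyclic_complex (lim_cx P (\<ge>) ?D)"
    by (rule lim_fibrant_acyclic[OF P dual_fibrant[OF G ext]]) (simp add: dual_acyclic[OF G'(2)] ac)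
  ultimately have "w \<in> coboundaries (lim_cx P (\<ge>) ?D) (- n)" by (auto simp: acyclic_complex_def)
  then obtain g where g: "g \<in> carrier (obj (lim_cx P (\<ge>) ?D) (- n - 1))" "w = diff (lim_cx P (\<ge>) ?D) (- n - 1) g"
    by (auto simp: coboundaries_def)
  have e: "- (- n - 1) = n + 1" "- (- n - 1) - 1 = n" by simp_all
  from g(1) have gD: "\<And>p. p \<in> P \<Longrightarrow> g p \<in> carrier (dual (obj (Cob G p) (n + 1)))"
    "\<And>p q. p \<in> P \<Longrightarrow> q \<in> P \<Longrightarrow> q \<le> p \<Longrightarrow> Car ?D p q (- n - 1) (g p) = g q"
    unfolding lim_mod_simps lim_mod_carrier degree_part_simps dual_functor_simps(1) dual_complex_simps e by blast+
  have gchar: "character (Mob (degree_part G (n + 1)) p) (g p)" if "p \<in> P" for p using gD(1)[OF that] by simp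
  have gcompat: "g q (Mar (degree_part G (n + 1)) p q a) = g p a"
    if "p \<in> P" "q \<in> P" "p \<le> q" "a \<in> carrier (Mob (degree_part G (n + 1)) p)" for p q a
    using fun_cong[OF gD(2)[OF that(2,1,3)], of a] that(4) unfolding dual_functor_simps e by simp
  have gd: "g p (diff (Cob G p) n a) = w p a" if p: "p \<in> P" and a: "a \<in> carrier (obj (Cob G p) n)" for p a
    using fun_cong[OF fun_cong[OF g(2), of p], of a] p a unfolding lim_mod_simps dual_functor_simps dual_complex_simps e by simp
  \<comment> \<open>The primitive \<open>g\<close> of this cocycle defines a character \<open>\<tau>\<close> of the next direct sum with \<open>\<chi> = \<tau> \<circ> d\<close>.\<close>
  define \<tau> where "\<tau> = family_sum cstar P (degree_part G (n + 1)) g"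
  have \<tau>a: "character (?M (n + 1)) \<tau>" unfolding \<tau>_def by (rule family_sum_additive[OF cstar_abelian_group f gchar])
  note \<tau>D = characterD[OF \<tau>a Ma]
  have "\<chi> u = \<tau> (?d n u)" if u: "u \<in> carrier (?M n)" for u
    using f u
  proof (induction rule: direct_sum_induct)
    case zero
    show ?case by (simp only: d1(4) \<chi>D(3) \<tau>D(3))
  next
    case (incl p a)
    then have a: "a \<in> carrier (obj (Cob G p) n)" by simp
    have da: "diff (Cob G p) n a \<in> carrier (Mob (degree_part G (n + 1)) p)" using diffD(1)[OF G'(2)[OF incl(1)] a] by simp
    have "\<tau> (?d n (sum_incl P (degree_part G n) p a)) = g p (diff (Cob G p) n a)"
      unfolding sum_map_hom(2)[OF f f diff_mod_nat[OF G] incl] \<tau>_def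
      by (rule family_sum_incl[OF cstar_abelian_group f gchar incl(1) da])
    then show ?case using gd[OF incl(1) a] wp[OF incl(1) a] by simp
  next
    case (add u v)
    then show ?case by (simp only: d1(2) \<chi>D(2) \<tau>D(2) d1(1))
  qed
  moreover have "\<tau> (?d n x) = \<zero>\<^bsub>cstar\<^esub>"
    unfolding \<tau>_def by (rule family_sum_relations[OF cstar_abelian_group f gchar gcompat dx])
  ultimately show False using \<chi>(3) x by simp
qed

text \<open>Direct sums and relations of a cone split into those of its two parts, so the colimit of a cone is the cone
  of the colimits.\<close>

lemma acyclic_cone_colim:
  assumes X: "is_cx_functor R S leq X" and Y: "is_cx_functor R S leq Y" and \<phi>: "cx_nat R S leq X Y \<phi>"
    and prim: "\<And>n z. z \<in> carrier (direct_sum S (degree_part (cone_functor X Y \<phi>) n)) \<Longrightarrow>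
      sum_map S (\<lambda>p. diff (Cob (cone_functor X Y \<phi>) p) n) z \<in> colim_relations R S leq (degree_part (cone_functor X Y \<phi>) (n + 1)) \<Longrightarrow>
      \<exists>y\<in>carrier (direct_sum S (degree_part (cone_functor X Y \<phi>) (n - 1))).
        \<exists>r\<in>colim_relations R S leq (degree_part (cone_functor X Y \<phi>) n).
        z = sum_map S (\<lambda>p. diff (Cob (cone_functor X Y \<phi>) p) (n - 1)) y \<oplus>\<^bsub>direct_sum S (degree_part (cone_functor X Y \<phi>) n)\<^esub> r"
  shows "acyclic_complex (cone (colim_cx R S leq X) (colim_cx R S leq Y)
    (\<lambda>n. colim_map R S leq (degree_part Y n) (\<lambda>p. \<phi> p n)))"
  unfolding acyclic_complex_def
proof (intro allI subsetI)
  let ?C = "cone_functor X Y \<phi>"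
  let ?D = "cone (colim_cx R S leq X) (colim_cx R S leq Y) (\<lambda>n. colim_map R S leq (degree_part Y n) (\<lambda>p. \<phi> p n))"
  have Cf: "is_cx_functor R S leq ?C" by (rule cone_cx_functor[OF X Y \<phi>])
  note fX = cx_functorD(1)[OF X] and fY = cx_functorD(1)[OF Y] and fC = cx_functorD(1)[OF Cf]
  note X' = cx_functorD[OF X] and Y' = cx_functorD[OF Y] and \<phi>' = cx_natD[OF \<phi> X Y]
  note XC = Car_simps[OF X] and YC = Car_simps[OF Y]
  let ?MX = "\<lambda>n. direct_sum S (degree_part X n)" and ?MY = "\<lambda>n. direct_sum S (degree_part Y n)"
    and ?MC = "\<lambda>n. direct_sum S (degree_part ?C n)"
  let ?RX = "\<lambda>n. colim_relations R S leq (degree_part X n)" and ?RY = "\<lambda>n. colim_relations R S leq (degree_part Y n)"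
    and ?RC = "\<lambda>n. colim_relations R S leq (degree_part ?C n)"
  let ?cX = "\<lambda>n. colim_class R S leq (degree_part X n)" and ?cY = "\<lambda>n. colim_class R S leq (degree_part Y n)"
  let ?dX = "\<lambda>n. sum_map S (\<lambda>p. diff (Cob X p) n)" and ?dY = "\<lambda>n. sum_map S (\<lambda>p. diff (Cob Y p) n)"
    and ?dC = "\<lambda>n. sum_map S (\<lambda>p. diff (Cob ?C p) n)" and ?\<phi> = "\<lambda>n. sum_map S (\<lambda>p. \<phi> p n)"
  note MX = direct_sum_module[OF fX] and MY = direct_sum_module[OF fY] and MC = direct_sum_module[OF fC]
  note RXs = submoduleD[OF colim_relations_submodule[OF fX] MX] and RYs = submoduleD[OF colim_relations_submodule[OF fY] MY]
    and RCs = submoduleD[OF colim_relations_submodule[OF fC] MC]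
  note hX = module_homD[OF colim_class_hom(2)[OF fX] MX colim_class_hom(1)[OF fX]]
    and hY = module_homD[OF colim_class_hom(2)[OF fY] MY colim_class_hom(1)[OF fY]]
  have n\<phi>: "mod_nat R S leq (degree_part X n) (degree_part Y n) (\<lambda>p. \<phi> p n)" for n using \<phi> by (simp add: cx_nat_def)
  note \<phi>c = module_homD(1)[OF sum_map_hom(1)[OF fX fY n\<phi>] MX MY]
  have i1: "mod_nat R S leq (degree_part X n) (degree_part ?C n) (\<lambda>p a. (a, \<zero>\<^bsub>obj (Cob Y p) (n - 1)\<^esub>))" for n
    by (rule mod_natI) (auto simp: X'(3) Y'(3) YC(4))
  have i2: "mod_nat R S leq (degree_part Y (n - 1)) (degree_part ?C n) (\<lambda>p b. (\<zero>\<^bsub>obj (Cob X p) n\<^esub>, b))" for n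
    by (rule mod_natI) (auto simp: X'(3) Y'(3) XC(4))
  have p1: "mod_nat R S leq (degree_part ?C n) (degree_part X n) (\<lambda>p. fst)" for n
    by (rule mod_natI) auto
  have p2: "mod_nat R S leq (degree_part ?C n) (degree_part Y (n - 1)) (\<lambda>p. snd)" for n
    by (rule mod_natI) auto
  fix n c0 assume c0: "c0 \<in> cocycles ?D n"
  then obtain a b where ab: "c0 = (a, b)" "a \<in> carrier (colim_mod R S leq (degree_part X n))"
    "b \<in> carrier (colim_mod R S leq (degree_part Y (n - 1)))" by (auto simp: cocycles_def)
  obtain x where x: "x \<in> carrier (?MX n)" "a = ?cX n x" using ab(2) colim_class_hom(3)[OF fX] by blast
  obtain y where y: "y \<in> carrier (?MY (n - 1))" "b = ?cY (n - 1) y" using ab(3) colim_class_hom(3)[OF fY] by blast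
  have n1: "n = n - 1 + 1" by simp
  note dx = colim_diff_class[OF X refl x(1)] and dy = colim_diff_class[OF Y n1 y(1)]
  have e: "\<ominus>\<^bsub>colim_mod R S leq (degree_part X (n + 1))\<^esub> ?cX (n + 1) (?dX n x) = \<zero>\<^bsub>colim_mod R S leq (degree_part X (n + 1))\<^esub>"
    "?cY n (?\<phi> n x) \<oplus>\<^bsub>colim_mod R S leq (degree_part Y n)\<^esub> ?cY n (?dY (n - 1) y) = \<zero>\<^bsub>colim_mod R S leq (degree_part Y n)\<^esub>"
    using c0 dx(2) dy(2) colim_map_hom(2)[OF fX fY n\<phi> x(1)] by (auto simp: cocycles_def ab(1) x(2) y(2))
  have dxR: "\<ominus>\<^bsub>?MX (n + 1)\<^esub> ?dX n x \<in> ?RX (n + 1)"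
    using e(1) hX(5)[OF dx(1)] colim_class_hom(4)[OF fX module_simps(3)[OF MX dx(1)]] by simp
  have \<phi>dR: "?\<phi> n x \<oplus>\<^bsub>?MY n\<^esub> ?dY (n - 1) y \<in> ?RY n"
    using e(2) hY(2)[OF \<phi>c[OF x(1)] dy(1)] colim_class_hom(4)[OF fY module_simps(1)[OF MY \<phi>c[OF x(1)] dy(1)]]
    by (simp del: direct_sum_simps)
  define z where "z = (\<lambda>p\<in>S. (x p, y p))"
  have xp: "x p \<in> carrier (obj (Cob X p) n)" and yp: "y p \<in> carrier (obj (Cob Y p) (n - 1))" if "p \<in> S" for p
    using x(1) y(1) that by (auto simp: direct_sum_carrier)
  have "z = sum_map S (\<lambda>p a. (a, \<zero>\<^bsub>obj (Cob Y p) (n - 1)\<^esub>)) x \<oplus>\<^bsub>?MC n\<^esub> sum_map S (\<lambda>p b. (\<zero>\<^bsub>obj (Cob X p) n\<^esub>, b)) y"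
    using xp yp X'(3) Y'(3) by (auto simp: z_def sum_map_def intro!: restrict_ext)
  moreover have "sum_map S (\<lambda>p a. (a, \<zero>\<^bsub>obj (Cob Y p) (n - 1)\<^esub>)) x \<in> carrier (?MC n)"
    by (rule module_homD(1)[OF sum_map_hom(1)[OF fX fC i1] MX MC x(1)])
  moreover have "sum_map S (\<lambda>p b. (\<zero>\<^bsub>obj (Cob X p) n\<^esub>, b)) y \<in> carrier (?MC n)"
    by (rule module_homD(1)[OF sum_map_hom(1)[OF fY fC i2] MY MC y(1)])
  ultimately have z: "z \<in> carrier (?MC n)" using module_simps(1)[OF MC] by (simp only:)
  have dxp: "diff (Cob X p) n (x p) \<in> carrier (obj (Cob X p) (n + 1))" "\<phi> p n (x p) \<in> carrier (obj (Cob Y p) n)"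
    "diff (Cob Y p) (n - 1) (y p) \<in> carrier (obj (Cob Y p) n)" if "p \<in> S" for p
    using that xp yp diffD(1)[OF X'(2)] diff_intoD(1)[OF Y'(2)] \<phi>'(1) by auto
  have "?dC n z = sum_map S (\<lambda>p a. (a, \<zero>\<^bsub>obj (Cob Y p) (n + 1 - 1)\<^esub>)) (\<ominus>\<^bsub>?MX (n + 1)\<^esub> ?dX n x) \<oplus>\<^bsub>?MC (n + 1)\<^esub>
      sum_map S (\<lambda>p b. (\<zero>\<^bsub>obj (Cob X p) (n + 1)\<^esub>, b)) (?\<phi> n x \<oplus>\<^bsub>?MY n\<^esub> ?dY (n - 1) y)"
    using direct_sum_minus[OF fX dx(1)] dxp X'(3) Y'(3)
    by (auto simp: z_def sum_map_def intro!: restrict_ext)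
  moreover have "sum_map S (\<lambda>p a. (a, \<zero>\<^bsub>obj (Cob Y p) (n + 1 - 1)\<^esub>)) (\<ominus>\<^bsub>?MX (n + 1)\<^esub> ?dX n x) \<in> ?RC (n + 1)"
    by (rule sum_map_hom(3)[OF fX fC i1 dxR])
  moreover have "sum_map S (\<lambda>p b. (\<zero>\<^bsub>obj (Cob X p) (n + 1)\<^esub>, b)) (?\<phi> n x \<oplus>\<^bsub>?MY n\<^esub> ?dY (n - 1) y) \<in> ?RC (n + 1)"
    by (rule sum_map_hom(3)[OF fY fC i2]) (use \<phi>dR in simp)
  ultimately have "?dC n z \<in> ?RC (n + 1)" using RCs(3) by (simp only:)
  from prim[OF z this] obtain c r where c: "c \<in> carrier (?MC (n - 1))" and r: "r \<in> ?RC n"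
    and zc: "z = ?dC (n - 1) c \<oplus>\<^bsub>?MC n\<^esub> r" by blast
  note rM = RCs(1)[OF r]
  have cp: "fst (c p) \<in> carrier (obj (Cob X p) (n - 1))" "snd (c p) \<in> carrier (obj (Cob Y p) (n - 1 - 1))"
    and rp: "fst (r p) \<in> carrier (obj (Cob X p) n)" "snd (r p) \<in> carrier (obj (Cob Y p) (n - 1))" if "p \<in> S" for p
    using c rM that by (auto simp: direct_sum_carrier mem_Times_iff)
  let ?u = "sum_map S (\<lambda>p. fst) c" and ?v = "sum_map S (\<lambda>p. snd) c"
  let ?r1 = "sum_map S (\<lambda>p. fst) r" and ?r2 = "sum_map S (\<lambda>p. snd) r"
  have u: "?u \<in> carrier (?MX (n - 1))" by (rule module_homD(1)[OF sum_map_hom(1)[OF fC fX p1] MC MX c])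
  have v: "?v \<in> carrier (?MY (n - 1 - 1))" by (rule module_homD(1)[OF sum_map_hom(1)[OF fC fY p2] MC MY c])
  have r1: "?r1 \<in> ?RX n" by (rule sum_map_hom(3)[OF fC fX p1 r])
  have r2: "?r2 \<in> ?RY (n - 1)" by (rule sum_map_hom(3)[OF fC fY p2 r])
  have n2: "n - 1 = n - 1 - 1 + 1" by simp
  note du = colim_diff_class[OF X n1 u] and dv = colim_diff_class[OF Y n2 v]
  have zp: "x p = \<ominus>\<^bsub>obj (Cob X p) n\<^esub> diff (Cob X p) (n - 1) (fst (c p)) \<oplus>\<^bsub>obj (Cob X p) n\<^esub> fst (r p)"
    "y p = (\<phi> p (n - 1) (fst (c p)) \<oplus>\<^bsub>obj (Cob Y p) (n - 1)\<^esub> diff (Cob Y p) (n - 1 - 1) (snd (c p))) \<oplus>\<^bsub>obj (Cob Y p) (n - 1)\<^esub> snd (r p)"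
    if "p \<in> S" for p
    using fun_cong[OF zc, of p] that by (auto simp: z_def sum_map_def)
  have xe: "x = \<ominus>\<^bsub>?MX n\<^esub> ?dX (n - 1) ?u \<oplus>\<^bsub>?MX n\<^esub> ?r1"
    by (rule extensionalityI[of _ S])
      (use x(1) zp direct_sum_minus[OF fX du(1)] in \<open>auto simp: direct_sum_carrier sum_map_def\<close>)
  have ye: "y = (?\<phi> (n - 1) ?u \<oplus>\<^bsub>?MY (n - 1)\<^esub> ?dY (n - 1 - 1) ?v) \<oplus>\<^bsub>?MY (n - 1)\<^esub> ?r2"
    by (rule extensionalityI[of _ S]) (use y(1) zp in \<open>auto simp: direct_sum_carrier sum_map_def\<close>)
  have r1c: "?cX n ?r1 = \<zero>\<^bsub>colim_mod R S leq (degree_part X n)\<^esub>"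
    using colim_class_hom(4)[OF fX RXs(1)[OF r1]] r1 by blast
  have r2c: "?cY (n - 1) ?r2 = \<zero>\<^bsub>colim_mod R S leq (degree_part Y (n - 1))\<^esub>"
    using colim_class_hom(4)[OF fY RYs(1)[OF r2]] r2 by blast
  note mX = colim_class_hom(1)[OF fX] and mY = colim_class_hom(1)[OF fY]
  have "a = \<ominus>\<^bsub>colim_mod R S leq (degree_part X n)\<^esub> ?cX n (?dX (n - 1) ?u)"
    unfolding x(2) using arg_cong[OF xe, of "?cX n"] hX(1)[OF du(1)]
      hX(2)[OF module_simps(3)[OF MX du(1)] RXs(1)[OF r1]] hX(5)[OF du(1)] r1c mX
    by (simp del: direct_sum_simps)
  moreover have "b = ?cY (n - 1) (?\<phi> (n - 1) ?u) \<oplus>\<^bsub>colim_mod R S leq (degree_part Y (n - 1))\<^esub> ?cY (n - 1) (?dY (n - 1 - 1) ?v)"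
    unfolding y(2) using arg_cong[OF ye, of "?cY (n - 1)"] hY(1)[OF \<phi>c[OF u]] hY(1)[OF dv(1)]
      hY(2)[OF module_simps(1)[OF MY \<phi>c[OF u] dv(1)] RYs(1)[OF r2]] hY(2)[OF \<phi>c[OF u] dv(1)] r2c mY
    by (simp del: direct_sum_simps)
  ultimately have "c0 = diff ?D (n - 1) (?cX (n - 1) ?u, ?cY (n - 1 - 1) ?v)"
    using du(2) dv(2) colim_map_hom(2)[OF fX fY n\<phi> u] by (simp add: ab(1))
  moreover have "(?cX (n - 1) ?u, ?cY (n - 1 - 1) ?v) \<in> carrier (obj ?D (n - 1))"
    using hX(1)[OF u] hY(1)[OF v] by simp
  ultimately show "c0 \<in> coboundaries ?D n" by (rule coboundariesI[rotated])
qed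

theorem colim_weak_equivalence:
  fixes P :: "'p::order set"
  assumes P: "filtered_poset P" and X: "is_cx_functor R P (\<le>) X" and Y: "is_cx_functor R P (\<le>) Y"
    and eX: "characters_extend P X" and eY: "characters_extend P Y" and \<phi>: "cx_nat R P (\<le>) X Y \<phi>"
    and iso: "\<And>p n. p \<in> P \<Longrightarrow> cohomology_iso_at (Cob X p) (Cob Y p) (\<phi> p) n"
  shows "isomorphic_modules R (cohomology (colim_cx R P (\<le>) X) n) (cohomology (colim_cx R P (\<le>) Y) n)"
proof -
  have ac: "acyclic_complex (Cob (cone_functor X Y \<phi>) p)" if "p \<in> P" for p
    using that \<phi> by (simp add: cone_acyclic_iff[OF cx_functorD(2)[OF X] cx_functorD(2)[OF Y]] cx_nat_def iso)
  have "acyclic_complex (cone (colim_cx R P (\<le>) X) (colim_cx R P (\<le>) Y)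
      (\<lambda>n. colim_map R P (\<le>) (degree_part Y n) (\<lambda>p. \<phi> p n)))"
    by (rule acyclic_cone_colim[OF X Y \<phi>
          colim_primitive[OF P cone_cx_functor[OF X Y \<phi>] cone_characters_extend[OF X Y eX eY] ac]])
  then show ?thesis
    using cone_acyclic_iff cohomology_map_iso(2) colim_complex[OF X] colim_complex[OF Y] colim_chain_map[OF X Y \<phi>]
    by metis
qed

end

theorem left_derived_colim_cofibrant_replacement:
  fixes R :: "('r, 'x) ring_scheme" and P :: "'p::order set" and F :: "('r, 'p, 'c) mod_functor"
    and H :: "('r, ('p \<Rightarrow> 'v) set set) module"
  assumes R: "cring R" and P: "filtered_poset P" and F: "is_mod_functor R P (\<le>) F"
    and QF: "cofibrant_replacement R P F QF \<eta>" and H: "is_left_derived_colim R P (\<le>) F k H"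
  shows "isomorphic_modules R H (homology (colim_cx R P (\<le>) QF) k)"
proof -
  interpret poset_diagrams R P "(\<le>)"
    using R by (intro poset_diagrams.intro cring_base.intro poset_diagrams_axioms.intro) auto
  obtain Q \<epsilon> where Q: "projective_resolution R P (\<le>) F Q \<epsilon>" and Heq: "H = homology (colim_cx R P (\<le>) Q) k"
    using H by (auto simp: is_left_derived_colim_def)
  have cof: "cofibrant R P QF" and \<eta>: "weak_equivalence R P (\<le>) QF (concentrated F) \<eta>"
    using QF by (auto simp: cofibrant_replacement_def)
  then have QFc: "is_cx_functor R P (\<le>) QF" by (simp add: cofibrant_def)
  have Qc: "is_cx_functor R P (\<le>) Q" and \<epsilon>: "weak_equivalence R P (\<le>) Q (concentrated F) \<epsilon>"
    and pos: "\<And>n p. n > 0 \<Longrightarrow> p \<in> P \<Longrightarrow> carrier (obj (Cob Q p) n) = {\<zero>\<^bsub>obj (Cob Q p) n\<^esub>}"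
    and proj: "projective_functor R P (\<le>) (degree_part Q n)" for n
    using Q by (auto simp: projective_resolution_def)
  obtain \<phi> where \<phi>: "cx_nat R P (\<le>) Q QF \<phi>" "\<And>p n. p \<in> P \<Longrightarrow> cohomology_iso_at (Cob Q p) (Cob QF p) (\<phi> p) n"
    using map_from_projective_complex[OF F QFc Qc \<eta> \<epsilon> proj pos] by blast
  show ?thesis
    unfolding Heq homology_def
    by (rule colim_weak_equivalence[OF P Qc QFc projective_characters_extend[OF R Qc proj]
          cofibrant_characters_extend[OF cof] \<phi>])
qed

theorem theorem2p7:
  fixes R :: "('r, 'x) ring_scheme" and P :: "'p::order set"
  assumes "cring R" and "filtered_poset P"
  shows
    "(\<forall>(F :: ('r, 'p, 'a) mod_functor) (RF :: ('r, 'p, 'b) cx_functor) \<eta>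
        (k :: int) (H :: ('r, ('p \<Rightarrow> 'u) set) module).
        is_mod_functor R P (\<ge>) F \<longrightarrow>
        fibrant_replacement R P F RF \<eta> \<longrightarrow>
        is_right_derived_lim R P (\<ge>) F k H \<longrightarrow>
        isomorphic_modules R H (cohomology (lim_cx P (\<ge>) RF) k))
     \<and>
     (\<forall>(F :: ('r, 'p, 'c) mod_functor) (QF :: ('r, 'p, 'd) cx_functor) \<eta>
        (k :: int) (H :: ('r, ('p \<Rightarrow> 'v) set set) module).
        is_mod_functor R P (\<le>) F \<longrightarrow>
        cofibrant_replacement R P F QF \<eta> \<longrightarrow>
        is_left_derived_colim R P (\<le>) F k H \<longrightarrow>
        isomorphic_modules R H (homology (colim_cx R P (\<le>) QF) k))"
  using right_derived_lim_fibrant_replacement[OF assms] left_derived_colim_cofibrant_replacement[OF assms]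
  by blast

end
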